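(* Let $A$ be a generalized Weyl algebra $\mathbb{C}[h](\sigma,P)$, where $\sigma$ is an automorphism of $\mathbb{C}[h]$ and $P\in\mathbb{C}[h]$. Then there is a linearly split extension $$0\to\Lambda_A\overset{\iota}{\to}\mathcal{T}_A\overset{\bar p}{\to}A\to0,$$ where $\Lambda_A$ is the ideal $\bigoplus_{i,j\ge0}e_{i,j}\otimes A_{i+1}A_{-(j+1)}$ of $\mathcal{T}_A$, $\iota$ is the inclusion of $\Lambda_A$ in $\mathcal{T}_A$, and $\bar p$ is the restriction of $p$ to $\mathcal{T}_A$.
   Context: Generalized Weyl algebra: for an automorphism $\sigma$ of $\mathbb{C}[h]$ and $P\in\mathbb{C}[h]$, $\mathbb{C}[h](\sigma,P)$ is the $\mathbb{C}$-algebra generated over $\mathbb{C}[h]$ by $x,y$ with relations $xd=\sigma(d)x$, $yd=\sigma^{-1}(d)y$ ($d\in\mathbb{C}[h]$), $yx=P$, $xy=\sigma(P)$. It has a countable basis over $\mathbb{C}$ and carries the fine topology (defined by all seminorms). It is $\mathbb{Z}$-graded with $\deg y=1$, $\deg x=-1$, $\deg d=0$ for $d\in\mathbb{C}[h]$: $A_0=\mathbb{C}[h]$, $A_n=\mathbb{C}[h]y^n$ for $n>0$, $A_n=\mathbb{C}[h]x^{-n}$ for $n<0$. $A_iA_j$ denotes the linear span of products. A locally convex algebra is a complete locally convex vector space over $\mathbb{C}$ with associative, jointly continuous multiplication; $\otimes_\pi$ is the completed projective tensor product. An extension $0\to I\to E\to B\to0$ of locally convex algebras is linearly split if $E\to B$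 has a continuous linear section. $\mathcal{K}$ is the algebra of $\mathbb{N}\times\mathbb{N}$ matrices $(a_{ij})$ with $\sum_{i,j}(1+i+j)^n|a_{ij}|<\infty$ for all $n\in\mathbb{N}$, topologized by these seminorms, with matrix units $e_{i,j}$. The smooth Toeplitz algebra $\mathcal{T}$ is the algebra of $\mathbb{N}\times\mathbb{N}$ matrices of the form $a+(f_{i-j})_{i,j}$ with $a\in\mathcal{K}$ and $(f_k)_{k\in\mathbb{Z}}$ the Fourier coefficients of some $f\in C^\infty(S^1)$, with the topology of $\mathcal{K}\oplus C^\infty(S^1)$; $S\in\mathcal{T}$ is the unilateral shift (from $f=z$) and $S^*$ the backward shift (from $f=z^{-1}$), so $S^*S=1$, $SS^*=1-e_{0,0}$. There is a linearly split extension $0\to\mathcal{K}\to\mathcal{T}\to C^\infty(S^1)\to0$ sending $S\mapsto z$; tensoring its quotient map with $\mathrm{id}_A$ gives $p:\mathcal{T}\otimes_\pi A\to C^\infty(S^1)\otimes_\pi A$. $\mathcal{T}_A$ is the closed subalgebra of $\mathcal{T}\otimes_\pi A$ generated by $1\otimes A_0$, $S\otimes A_1$ and $S^*\otimes A_{-1}$. The image $p(\mathcal{T}_A)$ is generated by $1\otimes A_0$, $z\otimes A_1$, $z^{-1}\otimes A_{-1}$ and is identified with $A$ via $z^n\otimes a_n\mapsto a_n$ ($a_n\in A_n$), which is how $\bar p$ takes values in $A$.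
   Formalization: When P is a nonzero constant, the direct sum defining Λ_A is replaced by its closure in the completed tensor product, since the algebraic direct sum is then not the kernel of p̄; for P nonconstant or zero the algebraic direct sum itself is shown to be closed and is used. *)

theory Defs
  imports
    "HOL-Analysis.Analysis"
    "HOL-Library.Poly_Mapping"
    "HOL-Computational_Algebra.Polynomial"
    "HOL-Algebra.Module"
    "HOL-Algebra.QuotRing"
begin

section \<open>Locally convex algebras\<close>

definition CC :: "complex ring" where
  "CC = \<lparr>carrier = UNIV, mult = (*), one = 1, zero = 0, add = (+)\<rparr>"

text \<open>
  Locally convex spaces and algebras are carried by the module records of HOL-Algebra,
  extended by a topology. Algebras need not be unital: the field \<open>one\<close> is unconstrained
  unless a concrete record fixes it, and \<open>mult\<close> is irrelevant for mere vector spaces.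
\<close>

record 'a lc_alg = "(complex, 'a) module" +
  topo :: "'a topology"

definition with_topology :: "(complex, 'a) module \<Rightarrow> 'a topology \<Rightarrow> 'a lc_alg" where
  "with_topology M t = module.extend M (lc_alg.fields t)"

definition subobject :: "'a lc_alg \<Rightarrow> 'a set \<Rightarrow> 'a lc_alg" where
  "subobject V S = V\<lparr>carrier := S, topo := subtopology (topo V) S\<rparr>"

definition cspan :: "(complex, 'a, 'm) module_scheme \<Rightarrow> 'a set \<Rightarrow> 'a set" where
  "cspan V S = \<Inter>{H. submodule H CC V \<and> S \<subseteq> H}"

definition lin_map ::
  "(complex, 'a, 'm) module_scheme \<Rightarrow> (complex, 'b, 'n) module_scheme \<Rightarrow> ('a \<Rightarrow> 'b) \<Rightarrow> bool" where
  "lin_map V W f \<longleftrightarrow> f \<in> carrier V \<rightarrow> carrier W \<and>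
     (\<forall>x\<in>carrier V. \<forall>y\<in>carrier V. f (x \<oplus>\<^bsub>V\<^esub> y) = f x \<oplus>\<^bsub>W\<^esub> f y) \<and>
     (\<forall>c. \<forall>x\<in>carrier V. f (c \<odot>\<^bsub>V\<^esub> x) = c \<odot>\<^bsub>W\<^esub> f x)"

definition alg_hom ::
  "(complex, 'a, 'm) module_scheme \<Rightarrow> (complex, 'b, 'n) module_scheme \<Rightarrow> ('a \<Rightarrow> 'b) \<Rightarrow> bool" where
  "alg_hom A B f \<longleftrightarrow> lin_map A B f \<and>
     (\<forall>x\<in>carrier A. \<forall>y\<in>carrier A. f (x \<otimes>\<^bsub>A\<^esub> y) = f x \<otimes>\<^bsub>B\<^esub> f y)"

definition seminorm_on :: "(complex, 'a, 'm) module_scheme \<Rightarrow> ('a \<Rightarrow> real) \<Rightarrow> bool" where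
  "seminorm_on V q \<longleftrightarrow>
     (\<forall>x\<in>carrier V. 0 \<le> q x) \<and>
     (\<forall>x\<in>carrier V. \<forall>y\<in>carrier V. q (x \<oplus>\<^bsub>V\<^esub> y) \<le> q x + q y) \<and>
     (\<forall>c. \<forall>x\<in>carrier V. q (c \<odot>\<^bsub>V\<^esub> x) = cmod c * q x)"

definition seminorm_topology ::
  "(complex, 'a, 'm) module_scheme \<Rightarrow> ('a \<Rightarrow> real) set \<Rightarrow> 'a topology" where
  "seminorm_topology V Q = topology_generated_by
     (insert (carrier V)
       {{y \<in> carrier V. q (y \<ominus>\<^bsub>V\<^esub> x) < e} |q x e. q \<in> Q \<and> x \<in> carrier V \<and> 0 < e})"

definition locally_convex :: "'a lc_alg \<Rightarrow> bool" where
  "locally_convex V \<longleftrightarrow> Module.module CC V \<and>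
     (\<exists>Q. (\<forall>q\<in>Q. seminorm_on V q) \<and> topo V = seminorm_topology V Q)"

definition cont_seminorms :: "'a lc_alg \<Rightarrow> ('a \<Rightarrow> real) set" where
  "cont_seminorms V = {q. seminorm_on V q \<and> continuous_map (topo V) euclideanreal q}"

definition cauchy_filter_on :: "'a lc_alg \<Rightarrow> 'a filter \<Rightarrow> bool" where
  "cauchy_filter_on V F \<longleftrightarrow> F \<noteq> bot \<and> F \<le> principal (carrier V) \<and>
     (\<forall>q\<in>cont_seminorms V. \<forall>e>0. \<forall>\<^sub>F z in F \<times>\<^sub>F F. q (fst z \<ominus>\<^bsub>V\<^esub> snd z) < e)"

definition complete_lc :: "'a lc_alg \<Rightarrow> bool" where
  "complete_lc V \<longleftrightarrow> (\<forall>F. cauchy_filter_on V F \<longrightarrow> (\<exists>l. limitin (topo V) (\<lambda>x. x) l F))"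

definition assoc_alg :: "(complex, 'a, 'm) module_scheme \<Rightarrow> bool" where
  "assoc_alg A \<longleftrightarrow> Module.module CC A \<and>
     (\<forall>x\<in>carrier A. lin_map A A (\<lambda>y. x \<otimes>\<^bsub>A\<^esub> y)) \<and>
     (\<forall>y\<in>carrier A. lin_map A A (\<lambda>x. x \<otimes>\<^bsub>A\<^esub> y)) \<and>
     (\<forall>x\<in>carrier A. \<forall>y\<in>carrier A. \<forall>z\<in>carrier A.
        (x \<otimes>\<^bsub>A\<^esub> y) \<otimes>\<^bsub>A\<^esub> z = x \<otimes>\<^bsub>A\<^esub> (y \<otimes>\<^bsub>A\<^esub> z))"

text \<open>Complete locally convex spaces are Hausdorff by convention.\<close>

definition lc_algebra :: "'a lc_alg \<Rightarrow> bool" where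
  "lc_algebra A \<longleftrightarrow> assoc_alg A \<and> locally_convex A \<and> Hausdorff_space (topo A) \<and> complete_lc A \<and>
     continuous_map (prod_topology (topo A) (topo A)) (topo A) (\<lambda>z. fst z \<otimes>\<^bsub>A\<^esub> snd z)"

definition two_sided_ideal :: "'a set \<Rightarrow> (complex, 'a, 'm) module_scheme \<Rightarrow> bool" where
  "two_sided_ideal L E \<longleftrightarrow> submodule L CC E \<and>
     (\<forall>x\<in>L. \<forall>y\<in>carrier E. x \<otimes>\<^bsub>E\<^esub> y \<in> L \<and> y \<otimes>\<^bsub>E\<^esub> x \<in> L)"

definition closed_subalgebra_generated :: "'a lc_alg \<Rightarrow> 'a set \<Rightarrow> 'a set" where
  "closed_subalgebra_generated A S =
     \<Inter>{H. submodule H CC A \<and> (\<forall>x\<in>H. \<forall>y\<in>H. x \<otimes>\<^bsub>A\<^esub> y \<in> H) \<and> closedin (topo A) H \<and> S \<subseteq> H}"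

definition independent_subspaces ::
  "(complex, 'a, 'm) module_scheme \<Rightarrow> ('k \<Rightarrow> 'a set) \<Rightarrow> bool" where
  "independent_subspaces V U \<longleftrightarrow>
     (\<forall>F u. finite F \<longrightarrow> (\<forall>k\<in>F. u k \<in> U k) \<longrightarrow> finsum V u F = \<zero>\<^bsub>V\<^esub> \<longrightarrow> (\<forall>k\<in>F. u k = \<zero>\<^bsub>V\<^esub>))"

text \<open>Exactness is understood topologically: \<open>i\<close> is an embedding and \<open>p\<close> a quotient map.\<close>

definition lc_extension ::
  "'i lc_alg \<Rightarrow> 'e lc_alg \<Rightarrow> 'b lc_alg \<Rightarrow> ('i \<Rightarrow> 'e) \<Rightarrow> ('e \<Rightarrow> 'b) \<Rightarrow> bool" where
  "lc_extension I E B i p \<longleftrightarrow> lc_algebra I \<and> lc_algebra E \<and> lc_algebra B \<and>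
     alg_hom I E i \<and> embedding_map (topo I) (topo E) i \<and>
     alg_hom E B p \<and> quotient_map (topo E) (topo B) p \<and>
     i ` carrier I = {x \<in> carrier E. p x = \<zero>\<^bsub>B\<^esub>}"

definition linearly_split_extension ::
  "'i lc_alg \<Rightarrow> 'e lc_alg \<Rightarrow> 'b lc_alg \<Rightarrow> ('i \<Rightarrow> 'e) \<Rightarrow> ('e \<Rightarrow> 'b) \<Rightarrow> bool" where
  "linearly_split_extension I E B i p \<longleftrightarrow> lc_extension I E B i p \<and>
     (\<exists>s. lin_map B E s \<and> continuous_map (topo B) (topo E) s \<and> (\<forall>b\<in>carrier B. p (s b) = b))"


section \<open>The completed projective tensor product\<close>

definition free_space ::
  "'v lc_alg \<Rightarrow> 'w lc_alg \<Rightarrow> (complex, ('v \<times> 'w) \<Rightarrow>\<^sub>0 complex) module" where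
  "free_space V W =
     \<lparr>carrier = {f. Poly_Mapping.keys f \<subseteq> carrier V \<times> carrier W}, mult = (\<lambda>_ _. 0), one = 0,
      zero = 0, add = (+), smult = (\<lambda>c. Poly_Mapping.map ((*) c))\<rparr>"

definition bilinear_relations ::
  "'v lc_alg \<Rightarrow> 'w lc_alg \<Rightarrow> (('v \<times> 'w) \<Rightarrow>\<^sub>0 complex) set" where
  "bilinear_relations V W = cspan (free_space V W)
     ({Poly_Mapping.single (v \<oplus>\<^bsub>V\<^esub> v', w) 1 - Poly_Mapping.single (v, w) 1
         - Poly_Mapping.single (v', w) 1
         |v v' w. v \<in> carrier V \<and> v' \<in> carrier V \<and> w \<in> carrier W} \<union>
      {Poly_Mapping.single (v, w \<oplus>\<^bsub>W\<^esub> w') 1 - Poly_Mapping.single (v, w) 1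
         - Poly_Mapping.single (v, w') 1
         |v w w'. v \<in> carrier V \<and> w \<in> carrier W \<and> w' \<in> carrier W} \<union>
      {Poly_Mapping.single (c \<odot>\<^bsub>V\<^esub> v, w) 1 - Poly_Mapping.single (v, w) c
         |c v w. v \<in> carrier V \<and> w \<in> carrier W} \<union>
      {Poly_Mapping.single (v, c \<odot>\<^bsub>W\<^esub> w) 1 - Poly_Mapping.single (v, w) c
         |c v w. v \<in> carrier V \<and> w \<in> carrier W})"

definition tensor_eval ::
  "'x lc_alg \<Rightarrow> ('v \<Rightarrow> 'w \<Rightarrow> 'x) \<Rightarrow> (('v \<times> 'w) \<Rightarrow>\<^sub>0 complex) \<Rightarrow> 'x" where
  "tensor_eval X \<tau> f =
     finsum X (\<lambda>z. Poly_Mapping.lookup f z \<odot>\<^bsub>X\<^esub> \<tau> (fst z) (snd z)) (Poly_Mapping.keys f)"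

text \<open>The seminorm \<open>p \<otimes> q\<close>: the infimum of \<open>\<Sum> p v\<^sub>k * q w\<^sub>k\<close> over all ways of writing
  \<open>u = \<Sum> v\<^sub>k \<otimes> w\<^sub>k\<close>; scalar coefficients are kept outside of the \<open>v\<^sub>k\<close>.\<close>

definition projective_seminorm ::
  "'v lc_alg \<Rightarrow> 'w lc_alg \<Rightarrow> 'x lc_alg \<Rightarrow> ('v \<Rightarrow> 'w \<Rightarrow> 'x) \<Rightarrow>
   ('v \<Rightarrow> real) \<Rightarrow> ('w \<Rightarrow> real) \<Rightarrow> 'x \<Rightarrow> real" where
  "projective_seminorm V W X \<tau> p q u =
     Inf {\<Sum>z\<in>Poly_Mapping.keys f. cmod (Poly_Mapping.lookup f z) * p (fst z) * q (snd z)
          |f. f \<in> carrier (free_space V W) \<and> tensor_eval X \<tau> f = u}"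

text \<open>
  The completed projective tensor product is defined up to unique isomorphism; the predicate says
  that \<open>X\<close> with \<open>\<tau> v w = v \<otimes> w\<close> is a realization of it. The map \<open>tensor_eval X \<tau>\<close> from the free
  vector space on \<open>V \<times> W\<close> has exactly the bilinearity relations as kernel, so its image is the
  algebraic tensor product; on that image \<open>X\<close> induces the projective topology; and \<open>X\<close> is a
  (Hausdorff) completion of the image.
\<close>

definition completed_projective_tensor ::
  "'v lc_alg \<Rightarrow> 'w lc_alg \<Rightarrow> 'x lc_alg \<Rightarrow> ('v \<Rightarrow> 'w \<Rightarrow> 'x) \<Rightarrow> bool" where
  "completed_projective_tensor V W X \<tau> \<longleftrightarrow>
     locally_convex X \<and> Hausdorff_space (topo X) \<and> complete_lc X \<and>
     (\<forall>v\<in>carrier V. \<forall>w\<in>carrier W. \<tau> v w \<in> carrier X) \<and>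
     (\<forall>f\<in>carrier (free_space V W).
        tensor_eval X \<tau> f = \<zero>\<^bsub>X\<^esub> \<longleftrightarrow> f \<in> bilinear_relations V W) \<and>
     (let D = tensor_eval X \<tau> ` carrier (free_space V W) in
        topo X closure_of D = carrier X \<and>
        subtopology (topo X) D = seminorm_topology (subobject X D)
          {projective_seminorm V W X \<tau> p q |p q. p \<in> cont_seminorms V \<and> q \<in> cont_seminorms W})"

text \<open>For algebras, the product on the completion is the continuous one determined by
  \<open>(a \<otimes> b) (a' \<otimes> b') = a a' \<otimes> b b'\<close>.\<close>

definition completed_projective_tensor_algebra ::
  "'v lc_alg \<Rightarrow> 'w lc_alg \<Rightarrow> 'x lc_alg \<Rightarrow> ('v \<Rightarrow> 'w \<Rightarrow> 'x) \<Rightarrow> bool" where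
  "completed_projective_tensor_algebra A B X \<tau> \<longleftrightarrow>
     completed_projective_tensor A B X \<tau> \<and> lc_algebra X \<and>
     (\<forall>a\<in>carrier A. \<forall>a'\<in>carrier A. \<forall>b\<in>carrier B. \<forall>b'\<in>carrier B.
        \<tau> a b \<otimes>\<^bsub>X\<^esub> \<tau> a' b' = \<tau> (a \<otimes>\<^bsub>A\<^esub> a') (b \<otimes>\<^bsub>B\<^esub> b'))"

text \<open>\<open>p = \<pi> \<otimes> id\<close>; the density of the algebraic tensor product determines \<open>p\<close> on \<open>carrier X\<close>.\<close>

definition is_tensor_id ::
  "'v lc_alg \<Rightarrow> 'w lc_alg \<Rightarrow> 'x lc_alg \<Rightarrow> ('v \<Rightarrow> 'w \<Rightarrow> 'x) \<Rightarrow> 'y lc_alg \<Rightarrow> ('u \<Rightarrow> 'w \<Rightarrow> 'y) \<Rightarrow>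
   ('v \<Rightarrow> 'u) \<Rightarrow> ('x \<Rightarrow> 'y) \<Rightarrow> bool" where
  "is_tensor_id V W X \<tau> Y \<tau>' \<pi> p \<longleftrightarrow>
     lin_map X Y p \<and> continuous_map (topo X) (topo Y) p \<and>
     (\<forall>v\<in>carrier V. \<forall>w\<in>carrier W. p (\<tau> v w) = \<tau>' (\<pi> v) w)"


section \<open>Generalized Weyl algebras\<close>

datatype 'g word = Word (letters: "'g list")

instantiation word :: (type) monoid_add
begin
definition zero_word :: "'g word" where "zero_word = Word []"
definition plus_word :: "'g word \<Rightarrow> 'g word \<Rightarrow> 'g word" where
  "plus_word u v = Word (letters u @ letters v)"
instance by standard (auto simp: zero_word_def plus_word_def)
end

datatype gwa_gen = GH | GX | GY

text \<open>The monoid algebra of words in \<open>h, x, y\<close>, i.e. the free complex algebra on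
  \<open>h, x, y\<close>, which is also freely generated by \<open>x, y\<close> over the polynomials in \<open>h\<close>.\<close>

type_synonym free_alg = "gwa_gen word \<Rightarrow>\<^sub>0 complex"

type_synonym gwa_elt = "free_alg set"

definition free_ring :: "free_alg ring" where
  "free_ring = \<lparr>carrier = UNIV, mult = (*), one = 1, zero = 0, add = (+)\<rparr>"

definition gX :: free_alg where "gX = Poly_Mapping.single (Word [GX]) 1"
definition gY :: free_alg where "gY = Poly_Mapping.single (Word [GY]) 1"

definition gpoly :: "complex poly \<Rightarrow> free_alg" where
  "gpoly d = (\<Sum>i\<le>degree d. Poly_Mapping.single (Word (replicate i GH)) (coeff d i))"

definition poly_automorphism :: "(complex poly \<Rightarrow> complex poly) \<Rightarrow> bool" where
  "poly_automorphism \<sigma> \<longleftrightarrow> bij \<sigma> \<and> (\<forall>f g. \<sigma> (f + g) = \<sigma> f + \<sigma> g) \<and>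
     (\<forall>f g. \<sigma> (f * g) = \<sigma> f * \<sigma> g) \<and> (\<forall>c. \<sigma> [:c:] = [:c:])"

definition gwa_ideal :: "(complex poly \<Rightarrow> complex poly) \<Rightarrow> complex poly \<Rightarrow> free_alg set" where
  "gwa_ideal \<sigma> P = Idl\<^bsub>free_ring\<^esub>
     ({gX * gpoly d - gpoly (\<sigma> d) * gX |d. True} \<union>
      {gY * gpoly d - gpoly (inv_into UNIV \<sigma> d) * gY |d. True} \<union>
      {gY * gX - gpoly P, gX * gY - gpoly (\<sigma> P)})"

definition gwa_class ::
  "(complex poly \<Rightarrow> complex poly) \<Rightarrow> complex poly \<Rightarrow> free_alg \<Rightarrow> gwa_elt" where
  "gwa_class \<sigma> P f = gwa_ideal \<sigma> P +>\<^bsub>free_ring\<^esub> f"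

definition gwa_alg ::
  "(complex poly \<Rightarrow> complex poly) \<Rightarrow> complex poly \<Rightarrow> (complex, gwa_elt) module" where
  "gwa_alg \<sigma> P = (let R = free_ring Quot gwa_ideal \<sigma> P in
     ring.extend R
       (module.fields (\<lambda>c a. gwa_class \<sigma> P (gpoly [:c:]) \<otimes>\<^bsub>R\<^esub> a)))"

definition gwa :: "(complex poly \<Rightarrow> complex poly) \<Rightarrow> complex poly \<Rightarrow> gwa_elt lc_alg" where
  "gwa \<sigma> P = with_topology (gwa_alg \<sigma> P)
     (seminorm_topology (gwa_alg \<sigma> P) {q. seminorm_on (gwa_alg \<sigma> P) q})"

text \<open>Grading: \<open>y\<close> has degree 1 and \<open>x\<close> has degree -1.\<close>

definition gwa_comp ::
  "(complex poly \<Rightarrow> complex poly) \<Rightarrow> complex poly \<Rightarrow> int \<Rightarrow> gwa_elt set" where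
  "gwa_comp \<sigma> P n =
     (if 0 \<le> n then {gwa_class \<sigma> P (gpoly d * gY ^ nat n) |d. True}
      else {gwa_class \<sigma> P (gpoly d * gX ^ nat (- n)) |d. True})"

definition gwa_comp_prod ::
  "(complex poly \<Rightarrow> complex poly) \<Rightarrow> complex poly \<Rightarrow> int \<Rightarrow> int \<Rightarrow> gwa_elt set" where
  "gwa_comp_prod \<sigma> P m n = cspan (gwa \<sigma> P)
     {a \<otimes>\<^bsub>gwa \<sigma> P\<^esub> b |a b. a \<in> gwa_comp \<sigma> P m \<and> b \<in> gwa_comp \<sigma> P n}"


section \<open>Smooth functions on the circle and the smooth Toeplitz algebra\<close>

text \<open>A function \<open>f\<close> on the circle is represented by the \<open>2\<pi>\<close>-periodic function
  \<open>t \<mapsto> f (exp (i t))\<close>; in particular \<open>z\<^sup>n\<close> is \<open>t \<mapsto> cis (n t)\<close>.\<close>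

definition iter_deriv :: "nat \<Rightarrow> (real \<Rightarrow> complex) \<Rightarrow> real \<Rightarrow> complex" where
  "iter_deriv n = ((\<lambda>g t. vector_derivative g (at t)) ^^ n)"

definition smooth_circle_funs :: "(real \<Rightarrow> complex) set" where
  "smooth_circle_funs = {f. (\<forall>t. f (t + 2 * pi) = f t) \<and>
     (\<forall>n t. iter_deriv n f differentiable (at t))}"

definition circle_seminorm :: "nat \<Rightarrow> (real \<Rightarrow> complex) \<Rightarrow> real" where
  "circle_seminorm n f = (SUP t. cmod (iter_deriv n f t))"

definition circle_alg :: "(complex, real \<Rightarrow> complex) module" where
  "circle_alg = \<lparr>carrier = smooth_circle_funs, mult = (\<lambda>f g t. f t * g t), one = (\<lambda>t. 1),
     zero = (\<lambda>t. 0), add = (\<lambda>f g t. f t + g t), smult = (\<lambda>c f t. c * f t)\<rparr>"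

definition smooth_circle :: "(real \<Rightarrow> complex) lc_alg" where
  "smooth_circle = with_topology circle_alg (seminorm_topology circle_alg (range circle_seminorm))"

definition zpow :: "int \<Rightarrow> real \<Rightarrow> complex" where
  "zpow n = (\<lambda>t. cis (of_int n * t))"

definition fourier_coeff :: "(real \<Rightarrow> complex) \<Rightarrow> int \<Rightarrow> complex" where
  "fourier_coeff f k =
     integral {0..2 * pi} (\<lambda>t. f t * cis (- of_int k * t)) / complex_of_real (2 * pi)"

type_synonym matrix = "nat \<Rightarrow> nat \<Rightarrow> complex"

definition K_carrier :: "matrix set" where
  "K_carrier = {a. \<forall>n::nat. (\<lambda>(i, j). (1 + real i + real j) ^ n * cmod (a i j)) summable_on UNIV}"

definition K_seminorm :: "nat \<Rightarrow> matrix \<Rightarrow> real" where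
  "K_seminorm n a = (\<Sum>\<^sub>\<infinity>(i, j). (1 + real i + real j) ^ n * cmod (a i j))"

definition matrix_unit :: "nat \<Rightarrow> nat \<Rightarrow> matrix" where
  "matrix_unit i j = (\<lambda>k l. if k = i \<and> l = j then 1 else 0)"

definition toeplitz_matrix :: "(real \<Rightarrow> complex) \<Rightarrow> matrix" where
  "toeplitz_matrix f = (\<lambda>i j. fourier_coeff f (int i - int j))"

definition toeplitz_carrier :: "matrix set" where
  "toeplitz_carrier = {\<lambda>i j. a i j + toeplitz_matrix f i j |a f.
     a \<in> K_carrier \<and> f \<in> smooth_circle_funs}"

text \<open>The decomposition of an element of the Toeplitz algebra into its smooth compact part and the
  Toeplitz matrix of a smooth function, its symbol, is unique; taking the symbol is the quotient
  map onto the smooth functions on the circle.\<close>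

definition toeplitz_symbol :: "matrix \<Rightarrow> real \<Rightarrow> complex" where
  "toeplitz_symbol m = (THE f. f \<in> smooth_circle_funs \<and>
     (\<lambda>i j. m i j - toeplitz_matrix f i j) \<in> K_carrier)"

definition toeplitz_compact_part :: "matrix \<Rightarrow> matrix" where
  "toeplitz_compact_part m = (\<lambda>i j. m i j - toeplitz_matrix (toeplitz_symbol m) i j)"

definition toeplitz_alg :: "(complex, matrix) module" where
  "toeplitz_alg = \<lparr>carrier = toeplitz_carrier,
     mult = (\<lambda>a b i j. \<Sum>\<^sub>\<infinity>k. a i k * b k j), one = (\<lambda>i j. if i = j then 1 else 0),
     zero = (\<lambda>i j. 0), add = (\<lambda>a b i j. a i j + b i j), smult = (\<lambda>c a i j. c * a i j)\<rparr>"

definition smooth_toeplitz :: "matrix lc_alg" where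
  "smooth_toeplitz = with_topology toeplitz_alg (seminorm_topology toeplitz_alg
     (range (\<lambda>n m. K_seminorm n (toeplitz_compact_part m)) \<union>
      range (\<lambda>n m. circle_seminorm n (toeplitz_symbol m))))"

definition shift :: matrix where "shift = toeplitz_matrix (zpow 1)"
definition backward_shift :: matrix where "backward_shift = toeplitz_matrix (zpow (- 1))"


section \<open>The Toeplitz extension of a generalized Weyl algebra\<close>

text \<open>In the following, \<open>\<tau>\<close> and \<open>\<tau>'\<close> are the tensor maps of realizations \<open>X\<close> and \<open>Y\<close> of the
  completed projective tensor products of the generalized Weyl algebra with the smooth Toeplitz
  algebra and with the smooth functions on the circle.\<close>

definition toeplitz_gwa ::
  "(complex poly \<Rightarrow> complex poly) \<Rightarrow> complex poly \<Rightarrow> 'x lc_alg \<Rightarrow> (matrix \<Rightarrow> gwa_elt \<Rightarrow> 'x) \<Rightarrow> 'x set"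
  where
  "toeplitz_gwa \<sigma> P X \<tau> = closed_subalgebra_generated X
     (\<tau> \<one>\<^bsub>smooth_toeplitz\<^esub> ` gwa_comp \<sigma> P 0 \<union> \<tau> shift ` gwa_comp \<sigma> P 1 \<union>
      \<tau> backward_shift ` gwa_comp \<sigma> P (- 1))"

definition Lambda_summand ::
  "(complex poly \<Rightarrow> complex poly) \<Rightarrow> complex poly \<Rightarrow> (matrix \<Rightarrow> gwa_elt \<Rightarrow> 'x) \<Rightarrow> nat \<times> nat \<Rightarrow> 'x set"
  where
  "Lambda_summand \<sigma> P \<tau> k =
     \<tau> (matrix_unit (fst k) (snd k)) `
       gwa_comp_prod \<sigma> P (int (fst k) + 1) (- (int (snd k) + 1))"

definition Lambda_algebraic ::
  "(complex poly \<Rightarrow> complex poly) \<Rightarrow> complex poly \<Rightarrow> 'x lc_alg \<Rightarrow> (matrix \<Rightarrow> gwa_elt \<Rightarrow> 'x) \<Rightarrow> 'x set"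
  where
  "Lambda_algebraic \<sigma> P X \<tau> = cspan X (\<Union>k. Lambda_summand \<sigma> P \<tau> k)"

text \<open>
  The direct sum is the one of complete locally convex spaces, i.e. the closure of the algebraic
  direct sum. If \<open>P\<close> is a nonzero constant, then all the products \<open>A\<^sub>m A\<^sub>n\<close> equal
  \<open>A\<^bsub>m + n\<^esub>\<close>, and \<open>diag (2\<^sup>-\<^sup>i) \<otimes> 1\<close> lies in the kernel of the quotient
  map but not in the algebraic sum, which is not closed. For all other \<open>P\<close> it is closed.
\<close>

definition Lambda_gwa ::
  "(complex poly \<Rightarrow> complex poly) \<Rightarrow> complex poly \<Rightarrow> 'x lc_alg \<Rightarrow> (matrix \<Rightarrow> gwa_elt \<Rightarrow> 'x) \<Rightarrow> 'x set"
  where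
  "Lambda_gwa \<sigma> P X \<tau> = topo X closure_of Lambda_algebraic \<sigma> P X \<tau>"

text \<open>The identification of finite sums \<open>\<Sum> z\<^sup>n \<otimes> a\<^sub>n\<close> with \<open>\<Sum> a\<^sub>n\<close>, where \<open>a\<^sub>n\<close> is
  homogeneous of degree \<open>n\<close>.\<close>

definition loop_identified ::
  "(complex poly \<Rightarrow> complex poly) \<Rightarrow> complex poly \<Rightarrow> 'y lc_alg \<Rightarrow>
   ((real \<Rightarrow> complex) \<Rightarrow> gwa_elt \<Rightarrow> 'y) \<Rightarrow> 'y \<Rightarrow> gwa_elt \<Rightarrow> bool" where
  "loop_identified \<sigma> P Y \<tau>' y a \<longleftrightarrow>
     (\<exists>F c. finite F \<and> (\<forall>n\<in>F. c n \<in> gwa_comp \<sigma> P n) \<and>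
        y = finsum Y (\<lambda>n. \<tau>' (zpow n) (c n)) F \<and> a = finsum (gwa \<sigma> P) c F)"

definition p_bar ::
  "(complex poly \<Rightarrow> complex poly) \<Rightarrow> complex poly \<Rightarrow> 'y lc_alg \<Rightarrow>
   ((real \<Rightarrow> complex) \<Rightarrow> gwa_elt \<Rightarrow> 'y) \<Rightarrow> ('x \<Rightarrow> 'y) \<Rightarrow> 'x \<Rightarrow> gwa_elt" where
  "p_bar \<sigma> P Y \<tau>' p u = (THE a. loop_identified \<sigma> P Y \<tau>' (p u) a)"

end

theory Submission
  imports Defs "HOL-Library.Periodic_Fun"
begin

text \<open>
  No map has to be extended to a completion. The algebra \<open>A\<close> carries its finest locally convex
  topology, so that linear maps out of \<open>A\<close> are continuous, and so is the section sending
  \<open>a \<in> A\<^sub>n\<close> to \<open>S\<^sup>n \<otimes> a\<close> (to \<open>S*\<^sup>-\<^sup>n \<otimes> a\<close> if \<open>n < 0\<close>).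
  The subspace \<open>L\<close> of all \<open>\<Sum> z\<^sup>n \<otimes> a\<^sub>n\<close> is closed, as evaluation at \<open>1\<close> on the circle shows that
  it inherits the finest topology, and spaces with this topology are complete.
  The relation \<open>S S* = 1 - e\<^sub>0\<^sub>0\<close> shows that the sum \<open>W\<close> of the image of the section and of the
  algebraic sum of the \<open>e\<^sub>i\<^sub>j \<otimes> A\<^sub>i\<^sub>+\<^sub>1 A\<^sub>-\<^sub>j\<^sub>-\<^sub>1\<close> is stable under left multiplication by the
  generators. Hence the Toeplitz algebra of \<open>A\<close> is the closure of \<open>W\<close>, it is mapped into \<open>L\<close>, and
  the claims about the quotient map follow from their counterparts on \<open>W\<close> by continuity.
  If \<open>P\<close> is not constant, the elements of \<open>A\<^sub>i\<^sub>+\<^sub>1 A\<^sub>-\<^sub>j\<^sub>-\<^sub>1\<close> are divisible by a polynomial whose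
  degree grows with \<open>min i j\<close>. Seminorms of \<open>A\<close> therefore control all the matrix entries with
  arbitrary weights, the algebraic sum inherits its finest topology, and it is closed.
\<close>

section \<open>Complex vector spaces and finite linear combinations\<close>

text \<open>\<open>X\<close> and \<open>Y\<close> are arbitrary realizations of completed tensor
  products, so nothing is known about a general element; accessible is only the projective topology
  on the algebraic tensor product. Lower bounds for it come from slices \<phi> \<otimes> id with
  functionals \<phi> on the first factor: evaluation at 1 for \<open>Y\<close>, the entries of the
  compact part for \<open>X\<close>. As slices take values in \<open>A\<close>, where every seminorm
  is continuous, weights on coordinates are at free disposal. Domination for all weights makes a
  subspace closed, because a limit of finitely supported coordinates is then again finitely
  supported. For the algebraic sum, one seminorm of \<open>A\<close> has to serve infinitely many
  matrix positions. Position (i, j) lands in degree i - j of \<open>A\<close>, and the coefficients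
  that matter there sit at powers of h beyond min i j. So each basis vector of \<open>A\<close> is
  charged by finitely many positions only. For a nonzero constant P all positions of a diagonal
  compete for the same basis vectors, and the argument breaks down.\<close>

no_notation eq_closure_of (\<open>closure'_of\<index>\<close>)

lemma CC_simps [simp]:
  "carrier CC = UNIV" "x \<otimes>\<^bsub>CC\<^esub> y = x * y" "x \<oplus>\<^bsub>CC\<^esub> y = x + y"
  "\<one>\<^bsub>CC\<^esub> = 1" "\<zero>\<^bsub>CC\<^esub> = 0"
  by (simp_all add: CC_def)

lemma cring_CC: "cring CC"
proof -
  have "\<exists>y. y + x = 0 \<and> x + y = 0" for x :: complex
    by (rule exI[of _ "- x"]) simp
  then show ?thesis
    by unfold_locales (auto simp: CC_def algebra_simps Units_def)
qed

text \<open>The module laws over \<open>CC\<close> are restated with the ordinary operations on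
  complex numbers, so that simplification can use arithmetic.\<close>

locale cvec = Module.module CC V for V :: "(complex, 'a, 'm) module_scheme" (structure)
begin

lemma smul_closed [simp]: "x \<in> carrier V \<Longrightarrow> c \<odot> x \<in> carrier V"
  by (rule smult_closed) simp_all

lemma smul_add_left: "x \<in> carrier V \<Longrightarrow> (a + b) \<odot> x = a \<odot> x \<oplus> b \<odot> x"
  using smult_l_distr[of a b x] by simp

lemma smul_add_right: "x \<in> carrier V \<Longrightarrow> y \<in> carrier V \<Longrightarrow> a \<odot> (x \<oplus> y) = a \<odot> x \<oplus> a \<odot> y"
  using smult_r_distr[of a x y] by simp

lemma smul_smul: "x \<in> carrier V \<Longrightarrow> a \<odot> (b \<odot> x) = (a * b) \<odot> x"
  using smult_assoc1[of a b x] by simp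

lemma smul_one [simp]: "x \<in> carrier V \<Longrightarrow> 1 \<odot> x = x"
  using smult_one[of x] by simp

lemma smul_zero_left [simp]: "x \<in> carrier V \<Longrightarrow> 0 \<odot> x = \<zero>"
  using smult_l_null[of x] by simp

lemma smul_zero_right [simp]: "c \<odot> \<zero> = \<zero>"
  using smult_r_null[of c] by simp

lemma neg_eq: "x \<in> carrier V \<Longrightarrow> \<ominus> x = (-1) \<odot> x"
proof -
  assume x: "x \<in> carrier V"
  have "(-1) \<odot> x \<oplus> x = ((-1) + 1) \<odot> x"
    using smul_add_left[OF x, of "-1" 1] x by simp
  then have "(-1) \<odot> x \<oplus> x = \<zero>" using x by simp
  then show ?thesis using x minus_equality[of "(-1) \<odot> x" x] by simp
qed

lemma minus_eq': "x \<in> carrier V \<Longrightarrow> y \<in> carrier V \<Longrightarrow> x \<ominus> y = x \<oplus> (-1) \<odot> y"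
  by (simp add: a_minus_def neg_eq)

lemma submoduleI':
  assumes "H \<subseteq> carrier V" "\<zero> \<in> H" "\<And>a b. a \<in> H \<Longrightarrow> b \<in> H \<Longrightarrow> a \<oplus> b \<in> H"
    "\<And>c a. a \<in> H \<Longrightarrow> c \<odot> a \<in> H"
  shows "submodule H CC V"
  using assms by (intro submoduleI) (auto simp: neg_eq subset_iff)

lemma submodule_zero: "submodule H CC V \<Longrightarrow> \<zero> \<in> H"
  using submoduleE(2,4)[of H] submoduleE(1)[of H] smul_zero_left
  by (metis CC_simps(1) UNIV_I all_not_in_conv subset_iff)

lemma submoduleD:
  assumes "submodule H CC V"
  shows "H \<subseteq> carrier V" "\<zero> \<in> H" "a \<in> H \<Longrightarrow> b \<in> H \<Longrightarrow> a \<oplus> b \<in> H" "a \<in> H \<Longrightarrow> c \<odot> a \<in> H"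
    "a \<in> H \<Longrightarrow> b \<in> H \<Longrightarrow> a \<ominus> b \<in> H"
proof -
  show *: "H \<subseteq> carrier V" "\<zero> \<in> H" "a \<in> H \<Longrightarrow> b \<in> H \<Longrightarrow> a \<oplus> b \<in> H"
    "a \<in> H \<Longrightarrow> c \<odot> a \<in> H" for a b c
    using submoduleE[OF assms] submodule_zero[OF assms] by auto
  show "a \<in> H \<Longrightarrow> b \<in> H \<Longrightarrow> a \<ominus> b \<in> H"
    using *(1) by (subst minus_eq') (auto intro: *(3,4))
qed

lemma in_carrierD: "submodule S CC V \<Longrightarrow> x \<in> S \<Longrightarrow> x \<in> carrier V"
  using submoduleD(1) by blast

lemma cspan_submodule:
  assumes "S \<subseteq> carrier V" shows "submodule (cspan V S) CC V"
proof -
  have c: "submodule (carrier V) CC V" by (rule carrier_is_submodule)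
  show ?thesis
  proof (rule submoduleI')
    show "cspan V S \<subseteq> carrier V" using c assms by (auto simp: cspan_def)
  qed (auto simp: cspan_def submoduleD)
qed

lemma cspan_superset: "S \<subseteq> cspan V S"
  by (auto simp: cspan_def)

lemma cspan_least: "submodule H CC V \<Longrightarrow> S \<subseteq> H \<Longrightarrow> cspan V S \<subseteq> H"
  by (auto simp: cspan_def)

lemma add_minus_cancel: "x \<in> carrier V \<Longrightarrow> y \<in> carrier V \<Longrightarrow> y \<oplus> (x \<ominus> y) = x"
  by (simp add: a_minus_def a_lcomm r_neg)

lemma minus_self: "x \<in> carrier V \<Longrightarrow> x \<ominus> x = \<zero>"
  by (simp add: a_minus_def r_neg)

lemma minus_zero: "x \<in> carrier V \<Longrightarrow> x \<ominus> \<zero> = x"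
  by (simp add: a_minus_def)

lemma minus_closed': "x \<in> carrier V \<Longrightarrow> y \<in> carrier V \<Longrightarrow> x \<ominus> y \<in> carrier V"
  by simp

lemma minus_add_minus:
  "x \<in> carrier V \<Longrightarrow> y \<in> carrier V \<Longrightarrow> z \<in> carrier V \<Longrightarrow> (x \<ominus> y) \<oplus> (y \<ominus> z) = x \<ominus> z"
  by (simp add: a_minus_def a_ac l_neg r_neg r_neg1 r_neg2)

lemma minus_swap:
  "x \<in> carrier V \<Longrightarrow> y \<in> carrier V \<Longrightarrow> (-1) \<odot> (x \<ominus> y) = y \<ominus> x"
  by (simp add: minus_eq' smul_add_right smul_smul a_comm)

lemma add_diff_add:
  "x \<in> carrier V \<Longrightarrow> y \<in> carrier V \<Longrightarrow> z \<in> carrier V \<Longrightarrow> w \<in> carrier V \<Longrightarrow>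
   (x \<oplus> y) \<ominus> (z \<oplus> w) = (x \<ominus> z) \<oplus> (y \<ominus> w)"
  by (simp add: minus_eq' smul_add_right a_ac)

lemma smul_diff:
  "x \<in> carrier V \<Longrightarrow> y \<in> carrier V \<Longrightarrow> c \<odot> (x \<ominus> y) = c \<odot> x \<ominus> c \<odot> y"
  by (simp add: minus_eq' smul_add_right smul_smul)

lemma minus_add_self:
  assumes x: "x \<in> carrier V" and y: "y \<in> carrier V"
  shows "x \<ominus> (x \<oplus> y) = (-1) \<odot> y" "(x \<oplus> y) \<ominus> x = y"
proof -
  have z: "x \<oplus> (-1) \<odot> x = \<zero>" using minus_self[OF x] minus_eq'[OF x x] by simp
  have "x \<ominus> (x \<oplus> y) = (x \<oplus> (-1) \<odot> x) \<oplus> (-1) \<odot> y"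
    using x y by (simp add: minus_eq' smul_add_right a_assoc)
  then show "x \<ominus> (x \<oplus> y) = (-1) \<odot> y" using z y by simp
  have "(x \<oplus> y) \<ominus> x = y \<oplus> (x \<oplus> (-1) \<odot> x)"
    using x y by (simp add: minus_eq' a_ac)
  then show "(x \<oplus> y) \<ominus> x = y" using z y by simp
qed

lemma minus_eq_zeroD: "x \<in> carrier V \<Longrightarrow> y \<in> carrier V \<Longrightarrow> x \<ominus> y = \<zero> \<Longrightarrow> x = y"
  by (metis add_minus_cancel r_zero)

end

text \<open>Coefficients are finitely supported functions on an arbitrary index type, the encoding
  of \<open>tensor_eval\<close>; one family of lemmas then serves the basis of \<open>A\<close>,
  subspaces of \<open>X\<close> and \<open>Y\<close>, and formal tensors.\<close>

definition lincomb :: "(complex, 'a, 'm) module_scheme \<Rightarrow> ('i \<Rightarrow> 'a) \<Rightarrow> ('i \<Rightarrow>\<^sub>0 complex) \<Rightarrow> 'a" where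
  "lincomb V g c = finsum V (\<lambda>i. Poly_Mapping.lookup c i \<odot>\<^bsub>V\<^esub> g i) (Poly_Mapping.keys c)"

abbreviation pm_scale :: "complex \<Rightarrow> ('i \<Rightarrow>\<^sub>0 complex) \<Rightarrow> ('i \<Rightarrow>\<^sub>0 complex)" where
  "pm_scale k \<equiv> Poly_Mapping.map ((*) k)"

lemma lookup_pm_scale [simp]: "Poly_Mapping.lookup (pm_scale k c) i = k * Poly_Mapping.lookup c i"
  by (simp add: Poly_Mapping.map.rep_eq when_def)

lemma keys_pm_scale: "Poly_Mapping.keys (pm_scale k c) \<subseteq> Poly_Mapping.keys c"
  by (auto simp: in_keys_iff)

lemma tensor_eval_lincomb: "tensor_eval X \<tau> f = lincomb X (\<lambda>z. \<tau> (fst z) (snd z)) f"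
  by (simp add: tensor_eval_def lincomb_def)

context cvec
begin

lemma lincomb_superset:
  assumes "finite S" "Poly_Mapping.keys c \<subseteq> S" "\<And>i. i \<in> S \<Longrightarrow> g i \<in> carrier V"
  shows "lincomb V g c = finsum V (\<lambda>i. Poly_Mapping.lookup c i \<odot> g i) S"
  unfolding lincomb_def
  by (rule add.finprod_mono_neutral_cong_left)
     (use assms in \<open>auto simp: in_keys_iff\<close>)

lemma lincomb_closed [simp]:
  "(\<And>i. i \<in> Poly_Mapping.keys c \<Longrightarrow> g i \<in> carrier V) \<Longrightarrow> lincomb V g c \<in> carrier V"
  unfolding lincomb_def by (rule finsum_closed) auto

lemma lincomb_cong:
  assumes "\<And>i. i \<in> Poly_Mapping.keys c \<Longrightarrow> g i = h i" "\<And>i. i \<in> Poly_Mapping.keys c \<Longrightarrow> h i \<in> carrier V"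
  shows "lincomb V g c = lincomb V h c"
  unfolding lincomb_def by (rule finsum_cong') (use assms in auto)

lemma lincomb_0 [simp]: "lincomb V g 0 = \<zero>"
  by (simp add: lincomb_def)

lemma lincomb_add:
  assumes "\<And>i. i \<in> Poly_Mapping.keys c \<union> Poly_Mapping.keys d \<Longrightarrow> g i \<in> carrier V"
  shows "lincomb V g (c + d) = lincomb V g c \<oplus> lincomb V g d"
proof -
  let ?S = "Poly_Mapping.keys c \<union> Poly_Mapping.keys d"
  have "lincomb V g (c + d) = finsum V (\<lambda>i. Poly_Mapping.lookup (c + d) i \<odot> g i) ?S"
    by (rule lincomb_superset) (use assms Poly_Mapping.keys_add[of c d] in auto)
  also have "\<dots> = finsum V (\<lambda>i. Poly_Mapping.lookup c i \<odot> g i \<oplus> Poly_Mapping.lookup d i \<odot> g i) ?S"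
    by (rule finsum_cong') (use assms in \<open>auto simp: lookup_add smul_add_left\<close>)
  also have "\<dots> = lincomb V g c \<oplus> lincomb V g d"
    using assms
    by (subst finsum_addf) (auto intro!: arg_cong2[where f="(\<oplus>)"] lincomb_superset[symmetric])
  finally show ?thesis .
qed

lemma lincomb_scale:
  assumes "\<And>i. i \<in> Poly_Mapping.keys c \<Longrightarrow> g i \<in> carrier V"
  shows "lincomb V g (pm_scale k c) = k \<odot> lincomb V g c"
proof -
  have "lincomb V g (pm_scale k c)
      = finsum V (\<lambda>i. Poly_Mapping.lookup (pm_scale k c) i \<odot> g i) (Poly_Mapping.keys c)"
    by (rule lincomb_superset) (use assms keys_pm_scale[of k c] in auto)
  also have "\<dots> = finsum V (\<lambda>i. k \<odot> (Poly_Mapping.lookup c i \<odot> g i)) (Poly_Mapping.keys c)"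
    by (rule finsum_cong') (use assms in \<open>auto simp: smul_smul\<close>)
  also have "\<dots> = k \<odot> lincomb V g c"
    unfolding lincomb_def
    by (rule finsum_smult_ldistr[symmetric]) (use assms in auto)
  finally show ?thesis .
qed

lemma lincomb_diff:
  assumes "\<And>i. i \<in> Poly_Mapping.keys c \<union> Poly_Mapping.keys d \<Longrightarrow> g i \<in> carrier V"
  shows "lincomb V g (c - d) = lincomb V g c \<ominus> lincomb V g d"
proof -
  have "c - d = c + pm_scale (-1) d"
    by (rule poly_mapping_eqI) (simp add: lookup_add lookup_minus)
  moreover have "i \<in> Poly_Mapping.keys c \<union> Poly_Mapping.keys (pm_scale (-1) d) \<Longrightarrow> g i \<in> carrier V" for i
    using assms keys_pm_scale[of "-1" d] by auto
  ultimately show ?thesis using assms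
    by (simp only: minus_eq' lincomb_closed lincomb_add lincomb_scale UnI1 UnI2)
qed

lemma lincomb_single: "g i \<in> carrier V \<Longrightarrow> lincomb V g (Poly_Mapping.single i k) = k \<odot> g i"
  by (subst lincomb_superset[where S="{i}"]) auto

lemma lincomb_in_submodule:
  assumes H: "submodule H CC V" and "\<And>i. i \<in> Poly_Mapping.keys c \<Longrightarrow> g i \<in> H"
  shows "lincomb V g c \<in> H"
proof -
  have "finite S \<Longrightarrow> S \<subseteq> Poly_Mapping.keys c \<Longrightarrow>
    finsum V (\<lambda>i. Poly_Mapping.lookup c i \<odot> g i) S \<in> H" for S
  proof (induct S rule: finite_induct)
    case empty then show ?case using submoduleD[OF H] by simp
  next
    case (insert x S)
    have "g i \<in> carrier V" if "i \<in> insert x S" for i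
      using insert(4) that assms submoduleD(1)[OF H] by blast
    then show ?case using insert submoduleD[OF H] assms(2)
      by (subst finsum_insert) auto
  qed
  then show ?thesis unfolding lincomb_def by simp
qed

lemma range_lincomb_submodule:
  assumes "\<And>i. g i \<in> carrier V"
  shows "submodule (range (lincomb V g)) CC V"
proof (rule submoduleI')
  show "range (lincomb V g) \<subseteq> carrier V" using assms by auto
  show "\<zero> \<in> range (lincomb V g)" by (metis lincomb_0 rangeI)
  fix a b c assume ab: "a \<in> range (lincomb V g)"
  then obtain x where x: "a = lincomb V g x" by auto
  show "c \<odot> a \<in> range (lincomb V g)"
    using assms by (auto simp: x lincomb_scale[symmetric])
  assume "b \<in> range (lincomb V g)"
  then obtain y where "b = lincomb V g y" by auto
  then show "a \<oplus> b \<in> range (lincomb V g)"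
    using assms by (auto simp: x lincomb_add[symmetric])
qed

end

lemma lin_mapD:
  assumes "lin_map V W f"
  shows "x \<in> carrier V \<Longrightarrow> f x \<in> carrier W"
    "x \<in> carrier V \<Longrightarrow> y \<in> carrier V \<Longrightarrow> f (x \<oplus>\<^bsub>V\<^esub> y) = f x \<oplus>\<^bsub>W\<^esub> f y"
    "x \<in> carrier V \<Longrightarrow> f (c \<odot>\<^bsub>V\<^esub> x) = c \<odot>\<^bsub>W\<^esub> f x"
  using assms by (auto simp: lin_map_def)

lemma lin_mapI:
  assumes "\<And>x. x \<in> carrier V \<Longrightarrow> f x \<in> carrier W"
    "\<And>x y. x \<in> carrier V \<Longrightarrow> y \<in> carrier V \<Longrightarrow> f (x \<oplus>\<^bsub>V\<^esub> y) = f x \<oplus>\<^bsub>W\<^esub> f y"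
    "\<And>c x. x \<in> carrier V \<Longrightarrow> f (c \<odot>\<^bsub>V\<^esub> x) = c \<odot>\<^bsub>W\<^esub> f x"
  shows "lin_map V W f"
  using assms by (auto simp: lin_map_def)

locale cvec_lin = V: cvec V + W: cvec W for V :: "(complex, 'a, 'm) module_scheme" 
  and W :: "(complex, 'b, 'n) module_scheme" +
  fixes f assumes lin: "lin_map V W f"
begin

lemmas linD = lin_mapD[OF lin]

lemma map_zero: "f \<zero>\<^bsub>V\<^esub> = \<zero>\<^bsub>W\<^esub>"
  using linD(3)[of "\<zero>\<^bsub>V\<^esub>" 0] linD(1)[of "\<zero>\<^bsub>V\<^esub>"] by simp

lemma map_minus: "x \<in> carrier V \<Longrightarrow> y \<in> carrier V \<Longrightarrow> f (x \<ominus>\<^bsub>V\<^esub> y) = f x \<ominus>\<^bsub>W\<^esub> f y"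
  by (simp add: V.minus_eq' W.minus_eq' linD)

lemma map_finsum:
  "finite S \<Longrightarrow> (\<And>i. i \<in> S \<Longrightarrow> g i \<in> carrier V) \<Longrightarrow>
   f (finsum V g S) = finsum W (\<lambda>i. f (g i)) S"
proof (induct S rule: finite_induct)
  case empty then show ?case by (simp add: map_zero)
next
  case (insert x S)
  have "finsum V g S \<in> carrier V" using insert by (intro V.finsum_closed) auto
  then show ?case using insert
    by (subst V.finsum_insert; (subst W.finsum_insert)?) (auto simp: linD Pi_def)
qed

text \<open>The preimage of \<open>H\<close> is a subspace, so elements of the span never have to be
  described.\<close>

lemma image_cspan:
  assumes S: "S \<subseteq> carrier V" and H: "submodule H CC W" and f: "\<And>x. x \<in> S \<Longrightarrow> f x \<in> H" and x: "x \<in> cspan V S"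
  shows "f x \<in> H"
proof -
  have "submodule {x \<in> carrier V. f x \<in> H} CC V"
    by (rule V.submoduleI') (use W.submoduleD[OF H] in \<open>auto simp: map_zero linD\<close>)
  then have "cspan V S \<subseteq> {x \<in> carrier V. f x \<in> H}"
    by (rule V.cspan_least) (use S f in auto)
  then show ?thesis using x by blast
qed

lemma map_lincomb:
  assumes "\<And>i. i \<in> Poly_Mapping.keys c \<Longrightarrow> g i \<in> carrier V"
  shows "f (lincomb V g c) = lincomb W (\<lambda>i. f (g i)) c"
  unfolding lincomb_def using assms
  by (subst map_finsum) (auto intro!: W.finsum_cong' simp: linD)

end

section \<open>Seminorms and their topologies\<close>

lemma seminorm_onD:
  assumes "seminorm_on V q"
  shows "x \<in> carrier V \<Longrightarrow> 0 \<le> q x"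
    "x \<in> carrier V \<Longrightarrow> y \<in> carrier V \<Longrightarrow> q (x \<oplus>\<^bsub>V\<^esub> y) \<le> q x + q y"
    "x \<in> carrier V \<Longrightarrow> q (c \<odot>\<^bsub>V\<^esub> x) = cmod c * q x"
  using assms by (auto simp: seminorm_on_def)

lemma seminorm_onI:
  assumes "\<And>x. x \<in> carrier V \<Longrightarrow> 0 \<le> q x"
    "\<And>x y. x \<in> carrier V \<Longrightarrow> y \<in> carrier V \<Longrightarrow> q (x \<oplus>\<^bsub>V\<^esub> y) \<le> q x + q y"
    "\<And>c x. x \<in> carrier V \<Longrightarrow> q (c \<odot>\<^bsub>V\<^esub> x) = cmod c * q x"
  shows "seminorm_on V q"
  using assms by (auto simp: seminorm_on_def)

context cvec
begin

lemma seminorm_zero: "seminorm_on V q \<Longrightarrow> q \<zero> = 0"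
  using seminorm_onD(3)[of V q \<zero> 0] by simp

lemma seminorm_minus_commute:
  "seminorm_on V q \<Longrightarrow> x \<in> carrier V \<Longrightarrow> y \<in> carrier V \<Longrightarrow> q (x \<ominus> y) = q (y \<ominus> x)"
  using seminorm_onD(3)[of V q "y \<ominus> x" "-1"] by (simp add: minus_swap)

lemma seminorm_triangle:
  "seminorm_on V q \<Longrightarrow> x \<in> carrier V \<Longrightarrow> y \<in> carrier V \<Longrightarrow> z \<in> carrier V \<Longrightarrow>
   q (x \<ominus> z) \<le> q (x \<ominus> y) + q (y \<ominus> z)"
  by (metis seminorm_onD(2) minus_add_minus minus_closed)

lemma seminorm_le:
  "seminorm_on V q \<Longrightarrow> x \<in> carrier V \<Longrightarrow> y \<in> carrier V \<Longrightarrow> q x \<le> q y + q (x \<ominus> y)"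
  by (metis seminorm_onD(2) add_minus_cancel minus_closed)

lemma seminorm_sum:
  assumes F: "\<And>q. q \<in> F \<Longrightarrow> seminorm_on V q"
  shows "seminorm_on V (\<lambda>x. \<Sum>q\<in>F. q x)"
proof (rule seminorm_onI)
  fix x y assume xy: "x \<in> carrier V" "y \<in> carrier V"
  have "(\<Sum>q\<in>F. q (x \<oplus> y)) \<le> (\<Sum>q\<in>F. q x + q y)"
    by (rule sum_mono) (rule seminorm_onD(2)[OF F xy])
  then show "(\<Sum>q\<in>F. q (x \<oplus> y)) \<le> (\<Sum>q\<in>F. q x) + (\<Sum>q\<in>F. q y)"
    by (simp add: sum.distrib)
next
  fix x assume x: "x \<in> carrier V"
  show "0 \<le> (\<Sum>q\<in>F. q x)" by (rule sum_nonneg) (rule seminorm_onD(1)[OF F x])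
  fix c
  show "(\<Sum>q\<in>F. q (c \<odot> x)) = cmod c * (\<Sum>q\<in>F. q x)"
    unfolding sum_distrib_left by (rule sum.cong[OF refl]) (rule seminorm_onD(3)[OF F x])
qed

lemma seminorm_scale:
  assumes q: "seminorm_on V q" and C: "0 \<le> C"
  shows "seminorm_on V (\<lambda>x. C * q x)"
proof (rule seminorm_onI)
  fix x y assume xy: "x \<in> carrier V" "y \<in> carrier V"
  show "C * q (x \<oplus> y) \<le> C * q x + C * q y"
    using mult_left_mono[OF seminorm_onD(2)[OF q xy] C] by (simp add: distrib_left)
qed (use seminorm_onD(1,3)[OF q] C in auto)

lemma seminorm_lincomb:
  assumes q: "seminorm_on V q" and g: "\<And>i. i \<in> Poly_Mapping.keys c \<Longrightarrow> g i \<in> carrier V"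
  shows "q (lincomb V g c) \<le> (\<Sum>i\<in>Poly_Mapping.keys c. cmod (Poly_Mapping.lookup c i) * q (g i))"
proof -
  have "finite S \<Longrightarrow> S \<subseteq> Poly_Mapping.keys c \<Longrightarrow>
    q (finsum V (\<lambda>i. Poly_Mapping.lookup c i \<odot> g i) S)
      \<le> (\<Sum>i\<in>S. cmod (Poly_Mapping.lookup c i) * q (g i))" for S
  proof (induct S rule: finite_induct)
    case empty then show ?case using seminorm_zero[OF q] by simp
  next
    case (insert x S)
    have gc: "g i \<in> carrier V" if "i \<in> insert x S" for i
      using insert(4) that g by blast
    let ?h = "\<lambda>i. Poly_Mapping.lookup c i \<odot> g i"
    have "q (finsum V ?h (insert x S)) = q (?h x \<oplus> finsum V ?h S)"
      using insert gc by (subst finsum_insert) auto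
    also have "\<dots> \<le> q (?h x) + q (finsum V ?h S)"
      using gc by (intro seminorm_onD(2)[OF q] finsum_closed) auto
    also have "\<dots> \<le> q (?h x) + (\<Sum>i\<in>S. cmod (Poly_Mapping.lookup c i) * q (g i))"
      using insert by simp
    also have "q (?h x) = cmod (Poly_Mapping.lookup c x) * q (g x)"
      using gc by (intro seminorm_onD(3)[OF q]) auto
    finally show ?case using insert by simp
  qed
  then show ?thesis unfolding lincomb_def by simp
qed

text \<open>The generating balls have arbitrary centres; the triangle inequality shrinks them to
  balls about the point considered, and finite intersections become finite sets of seminorms with
  one radius.\<close>

lemma openin_seminorm_topology:
  assumes Q: "\<And>q. q \<in> Q \<Longrightarrow> seminorm_on V q"
  shows "openin (seminorm_topology V Q) U \<longleftrightarrow> U \<subseteq> carrier V \<and>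
    (\<forall>x\<in>U. \<exists>F e. finite F \<and> F \<subseteq> Q \<and> 0 < e \<and> {y \<in> carrier V. \<forall>q\<in>F. q (y \<ominus> x) < e} \<subseteq> U)"
proof -
  define N where "N U x \<longleftrightarrow> (\<exists>F e. finite F \<and> F \<subseteq> Q \<and> 0 < e \<and>
    {y \<in> carrier V. \<forall>q\<in>F. q (y \<ominus> x) < e} \<subseteq> U)" for U x
  have NI: "N U x" if "finite F" "F \<subseteq> Q" "0 < e" "{y \<in> carrier V. \<forall>q\<in>F. q (y \<ominus> x) < e} \<subseteq> U" for F e U x
    unfolding N_def using that by blast
  let ?B = "insert (carrier V)
       {{y \<in> carrier V. q (y \<ominus>\<^bsub>V\<^esub> x) < e} |q x e. q \<in> Q \<and> x \<in> carrier V \<and> 0 < e}"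
  have eq: "openin (seminorm_topology V Q) U \<longleftrightarrow> generate_topology_on ?B U" for U
    by (simp add: seminorm_topology_def openin_topology_generated_by_iff)
  have N: "U \<subseteq> carrier V \<and> (\<forall>x\<in>U. N U x)" if "generate_topology_on ?B U" for U
    using that
  proof (induct rule: generate_topology_on.induct)
    case Empty then show ?case by simp
  next
    case (Int a b)
    have "N (a \<inter> b) x" if x: "x \<in> a" "x \<in> b" for x
    proof -
      have "N a x" "N b x" using Int x by auto
      then obtain F e F' e' where 1: "finite F" "F \<subseteq> Q" "0 < e" "{y \<in> carrier V. \<forall>q\<in>F. q (y \<ominus> x) < e} \<subseteq> a"
        and 2: "finite F'" "F' \<subseteq> Q" "0 < e'" "{y \<in> carrier V. \<forall>q\<in>F'. q (y \<ominus> x) < e'} \<subseteq> b"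
        unfolding N_def by (elim exE conjE) blast
      show ?thesis
        by (rule NI[of "F \<union> F'" "min e e'"]) (use 1 2 in auto)
    qed
    then show ?case using Int(2) by auto
  next
    case (UN K)
    have "N (\<Union>K) x" if x: "k \<in> K" "x \<in> k" for x k
    proof -
      have "N k x" using UN x by blast
      then obtain F e where "finite F" "F \<subseteq> Q" "0 < e" "{y \<in> carrier V. \<forall>q\<in>F. q (y \<ominus> x) < e} \<subseteq> k"
        unfolding N_def by (elim exE conjE) blast
      then show ?thesis using x by (intro NI[of F e]) auto
    qed
    moreover have "\<Union>K \<subseteq> carrier V" using UN by blast
    ultimately show ?case by auto
  next
    case (Basis s)
    show ?case
    proof (cases "s = carrier V")
      case True
      have "N s x" for x
        by (rule NI[of "{}" 1]) (simp_all add: True)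
      then show ?thesis using True by simp
    next
      case False
      then obtain q x e where s: "s = {y \<in> carrier V. q (y \<ominus>\<^bsub>V\<^esub> x) < e}"
        and q: "q \<in> Q" "x \<in> carrier V" "0 < e" using Basis by auto
      have "N s z" if z: "z \<in> s" for z
      proof -
        have zc: "z \<in> carrier V" "q (z \<ominus> x) < e" using z s by auto
        have "{y \<in> carrier V. \<forall>q\<in>{q}. q (y \<ominus> z) < e - q (z \<ominus> x)} \<subseteq> s"
        proof
          fix y assume "y \<in> {y \<in> carrier V. \<forall>q\<in>{q}. q (y \<ominus> z) < e - q (z \<ominus> x)}"
          then have y: "y \<in> carrier V" "q (y \<ominus> z) < e - q (z \<ominus> x)" by auto
          then show "y \<in> s"
            using seminorm_triangle[OF Q[OF q(1)] y(1) zc(1) q(2)] by (simp add: s)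
        qed
        then show ?thesis using q zc by (intro NI[of "{q}" "e - q (z \<ominus> x)"]) auto
      qed
      then show ?thesis using s by auto
    qed
  qed
  have conv: "openin (seminorm_topology V Q) U" if U: "U \<subseteq> carrier V" "\<And>x. x \<in> U \<Longrightarrow> N U x" for U
  proof (subst openin_subopen, clarify)
    fix x assume x: "x \<in> U"
    have "N U x" using U x by blast
    then obtain F e where F: "finite F" "F \<subseteq> Q" "0 < e" "{y \<in> carrier V. \<forall>q\<in>F. q (y \<ominus> x) < e} \<subseteq> U"
      unfolding N_def by (elim exE conjE) blast
    have xc: "x \<in> carrier V" using U x by blast
    have "openin (seminorm_topology V Q) {y \<in> carrier V. \<forall>q\<in>F. q (y \<ominus> x) < e}"
      using F(1,2)
    proof (induct F rule: finite_induct)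
      case empty
      then show ?case unfolding eq by (auto intro: generate_topology_on.Basis)
    next
      case (insert p F)
      have "openin (seminorm_topology V Q) {y \<in> carrier V. p (y \<ominus> x) < e}"
        unfolding eq
        by (rule generate_topology_on.Basis, rule insertI2, rule CollectI,
            rule exI[of _ p], rule exI[of _ x], rule exI[of _ e])
           (use insert xc F in simp)
      then have "openin (seminorm_topology V Q)
        ({y \<in> carrier V. p (y \<ominus> x) < e} \<inter> {y \<in> carrier V. \<forall>q\<in>F. q (y \<ominus> x) < e})"
        using insert by auto
      then show ?case by (rule back_subst[where P="openin _"]) auto
    qed
    moreover have "q (x \<ominus> x) < e" if "q \<in> F" for q
      using xc F(2,3) that seminorm_zero[of q] Q by (auto simp: minus_self)
    then have "x \<in> {y \<in> carrier V. \<forall>q\<in>F. q (y \<ominus> x) < e}" using xc by auto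
    ultimately show "\<exists>T. openin (seminorm_topology V Q) T \<and> x \<in> T \<and> T \<subseteq> U" using F(4) by blast
  qed
  have "openin (seminorm_topology V Q) U \<longleftrightarrow> U \<subseteq> carrier V \<and> (\<forall>x\<in>U. N U x)"
    using N[of U] conv[of U] eq[of U] by blast
  then show ?thesis unfolding N_def .
qed

lemma openin_seminorm_topologyI:
  assumes "\<And>q. q \<in> Q \<Longrightarrow> seminorm_on V q" "U \<subseteq> carrier V"
    "\<And>x. x \<in> U \<Longrightarrow>
      \<exists>F e. finite F \<and> F \<subseteq> Q \<and> 0 < e \<and> {y \<in> carrier V. \<forall>q\<in>F. q (y \<ominus> x) < e} \<subseteq> U"
  shows "openin (seminorm_topology V Q) U"
  by (subst openin_seminorm_topology) (use assms in blast)+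

lemma openin_seminorm_topologyD:
  assumes "openin (seminorm_topology V Q) U" "x \<in> U" "\<And>q. q \<in> Q \<Longrightarrow> seminorm_on V q"
  obtains F e where "finite F" "F \<subseteq> Q" "0 < e" "{y \<in> carrier V. \<forall>q\<in>F. q (y \<ominus> x) < e} \<subseteq> U"
proof -
  have "\<exists>F e. finite F \<and> F \<subseteq> Q \<and> 0 < e \<and> {y \<in> carrier V. \<forall>q\<in>F. q (y \<ominus> x) < e} \<subseteq> U"
    using openin_seminorm_topology[of Q U] assms by blast
  then show ?thesis using that by blast
qed

end

section \<open>Locally convex spaces through their continuous seminorms\<close>

locale lcs = cvec V for V :: "'a lc_alg" (structure) +
  assumes lc: "\<exists>Q. (\<forall>q\<in>Q. seminorm_on V q) \<and> topo V = seminorm_topology V Q"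

lemma lcs_iff: "locally_convex V \<longleftrightarrow> lcs V"
  by (simp add: locally_convex_def lcs_def lcs_axioms_def cvec_def)

lemma topspace_seminorm_topology [simp]: "topspace (seminorm_topology V Q) = carrier V"
  by (auto simp: seminorm_topology_def topology_generated_by_topspace)

context lcs
begin

lemma topspace_topo [simp]: "topspace (topo V) = carrier V"
  using lc topspace_seminorm_topology by auto

lemma cs_seminorm: "r \<in> cont_seminorms V \<Longrightarrow> seminorm_on V r"
  by (simp add: cont_seminorms_def)

text \<open>Continuity of \<open>r\<close> makes the ball about \<zero> open; a basic neighbourhood
  of \<zero> inside it is translated to \<open>x\<close>.\<close>

lemma cs_ball_open:
  assumes r: "r \<in> cont_seminorms V" and e: "0 < e" and x: "x \<in> carrier V"
  shows "\<exists>U. openin (topo V) U \<and> x \<in> U \<and> U \<subseteq> {y \<in> carrier V. r (y \<ominus> x) < e}"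
proof -
  obtain Q where Q: "\<And>q. q\<in>Q \<Longrightarrow> seminorm_on V q" "topo V = seminorm_topology V Q" using lc by blast
  note sr = cs_seminorm[OF r]
  have "openin (topo V) {y \<in> topspace (topo V). r y \<in> {..<e}}"
    by (rule openin_continuous_map_preimage[of _ euclideanreal])
       (use r in \<open>auto simp: cont_seminorms_def\<close>)
  then have op: "openin (seminorm_topology V Q) {y \<in> carrier V. r y < e}" using Q by simp
  have "\<zero> \<in> {y \<in> carrier V. r y < e}" using e seminorm_zero[OF sr] by simp
  then obtain F d where F: "finite F" "F \<subseteq> Q" "0 < d"
    "{y \<in> carrier V. \<forall>q\<in>F. q (y \<ominus> \<zero>) < d} \<subseteq> {y \<in> carrier V. r y < e}"
    by (rule openin_seminorm_topologyD[OF op]) (use Q in auto)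
  let ?U = "{y \<in> carrier V. \<forall>q\<in>F. q (y \<ominus> x) < d}"
  have "openin (topo V) ?U" unfolding Q(2)
  proof (rule openin_seminorm_topologyI[OF Q(1)])
    fix z assume z: "z \<in> ?U"
    \<comment> \<open>The inserted \<open>d\<close> keeps the minimum defined when \<open>F\<close>
      is empty.\<close>
    define d' where "d' = Min (insert d ((\<lambda>q. d - q (z \<ominus> x)) ` F))"
    have d': "d' > 0" using F z by (auto simp: d'_def)
    have "{y \<in> carrier V. \<forall>q\<in>F. q (y \<ominus> z) < d'} \<subseteq> ?U"
    proof clarify
      fix y q assume y: "y \<in> carrier V" "\<forall>q\<in>F. q (y \<ominus> z) < d'" and q: "q \<in> F"
      have "d' \<le> d - q (z \<ominus> x)" using F(1) q by (auto simp: d'_def)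
      then have "q (y \<ominus> z) < d - q (z \<ominus> x)" using y q by fastforce
      then show "q (y \<ominus> x) < d"
        using seminorm_triangle[of q y z x] Q(1) q F(2) y z x by fastforce
    qed
    then show "\<exists>F e. finite F \<and> F \<subseteq> Q \<and> 0 < e \<and> {y \<in> carrier V. \<forall>q\<in>F. q (y \<ominus> z) < e} \<subseteq> ?U"
      using F d' by blast
  qed auto
  moreover have "q (x \<ominus> x) < d" if "q \<in> F" for q
    using x F(2,3) that seminorm_zero[of q] Q by (auto simp: minus_self)
  then have "x \<in> ?U" using x by auto
  moreover have "?U \<subseteq> {y \<in> carrier V. r (y \<ominus> x) < e}"
  proof clarify
    fix y assume y: "y \<in> carrier V" "\<forall>q\<in>F. q (y \<ominus> x) < d"
    then have "y \<ominus> x \<in> {y \<in> carrier V. \<forall>q\<in>F. q (y \<ominus> \<zero>) < d}" using x by (simp add: minus_zero)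
    then show "r (y \<ominus> x) < e" using F(4) by blast
  qed
  ultimately show ?thesis by blast
qed

lemma cs_scale: "r \<in> cont_seminorms V \<Longrightarrow> 0 \<le> C \<Longrightarrow> (\<lambda>x. C * r x) \<in> cont_seminorms V"
  by (auto simp: cont_seminorms_def seminorm_scale intro!: continuous_map_real_mult_left)

lemma cs_sum:
  assumes "\<And>q. q \<in> F \<Longrightarrow> q \<in> cont_seminorms V"
  shows "(\<lambda>x. \<Sum>q\<in>F. q x) \<in> cont_seminorms V"
proof (cases "finite F")
  case True
  show ?thesis
    using assms True by (auto simp: cont_seminorms_def seminorm_sum intro!: continuous_map_sum)
next
  case False
  then have "(\<lambda>x. \<Sum>q\<in>F. q x) = (\<lambda>x. \<Sum>q\<in>{}. q x)" by simp
  then show ?thesis by (auto simp: cont_seminorms_def seminorm_on_def)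
qed

lemma cs_add:
  assumes "r \<in> cont_seminorms V" "q \<in> cont_seminorms V" shows "(\<lambda>x. r x + q x) \<in> cont_seminorms V"
proof -
  note s = seminorm_onD[OF cs_seminorm[OF assms(1)]] seminorm_onD[OF cs_seminorm[OF assms(2)]]
  have "seminorm_on V (\<lambda>x. r x + q x)"
  proof (rule seminorm_onI)
    fix x y assume "x \<in> carrier V" "y \<in> carrier V"
    then show "r (x \<oplus> y) + q (x \<oplus> y) \<le> (r x + q x) + (r y + q y)"
      using s(2)[of x y] s(5)[of x y] by simp
  qed (use s in \<open>auto simp: distrib_left\<close>)
  then show ?thesis using assms by (auto simp: cont_seminorms_def intro!: continuous_map_add)
qed

lemma cs_generating:
  assumes "topo V = seminorm_topology V Q" "\<And>q. q \<in> Q \<Longrightarrow> seminorm_on V q" "q \<in> Q"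
  shows "q \<in> cont_seminorms V"
proof -
  note sq = assms(2)[OF assms(3)]
  have "continuous_map (topo V) euclideanreal q"
    unfolding continuous_map_def
  proof (intro conjI allI impI)
    fix T :: "real set" assume T: "openin euclideanreal T"
    show "openin (topo V) {x \<in> topspace (topo V). q x \<in> T}"
      unfolding assms(1) topspace_seminorm_topology
    proof (rule openin_seminorm_topologyI[OF assms(2)])
      fix x assume x: "x \<in> {x \<in> carrier V. q x \<in> T}"
      then obtain d where d: "d > 0" "\<And>s. \<bar>s - q x\<bar> < d \<Longrightarrow> s \<in> T"
        using T by (auto simp: open_dist dist_real_def)
      have "{y \<in> carrier V. \<forall>q\<in>{q}. q (y \<ominus> x) < d} \<subseteq> {x \<in> carrier V. q x \<in> T}"
      proof clarsimp
        fix y assume y: "y \<in> carrier V" "q (y \<ominus> x) < d"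
        have "\<bar>q y - q x\<bar> < d"
          using seminorm_le[OF sq, of y x] seminorm_le[OF sq, of x y] seminorm_minus_commute[OF sq, of x y] x y
          by auto
        then show "q y \<in> T" using d by auto
      qed
      then show "\<exists>F e. finite F \<and> F \<subseteq> Q \<and> 0 < e \<and> {y \<in> carrier V. \<forall>q\<in>F. q (y \<ominus> x) < e} \<subseteq> {x \<in> carrier V. q x \<in> T}"
        using d assms(3) by (intro exI[of _ "{q}"] exI[of _ d]) auto
    qed auto
  qed auto
  then show ?thesis using sq by (simp add: cont_seminorms_def)
qed

text \<open>Sums of finitely many generating seminorms are continuous seminorms, so a single one
  describes a neighbourhood. Later arguments speak of \<open>cont_seminorms\<close> instead of an
  unspecified generating family.\<close>

lemma openin_topo_iff:
  "openin (topo V) U \<longleftrightarrow> U \<subseteq> carrier V \<and>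
    (\<forall>x\<in>U. \<exists>r\<in>cont_seminorms V. \<exists>e>0. {y \<in> carrier V. r (y \<ominus> x) < e} \<subseteq> U)"
proof
  obtain Q where Q: "\<And>q. q\<in>Q \<Longrightarrow> seminorm_on V q" "topo V = seminorm_topology V Q" using lc by blast
  assume U: "openin (topo V) U"
  have "\<exists>r\<in>cont_seminorms V. \<exists>e>0. {y \<in> carrier V. r (y \<ominus> x) < e} \<subseteq> U" if x: "x \<in> U" for x
  proof -
    obtain F d where F: "finite F" "F \<subseteq> Q" "0 < d" "{y \<in> carrier V. \<forall>q\<in>F. q (y \<ominus> x) < d} \<subseteq> U"
      by (rule openin_seminorm_topologyD[OF U[unfolded Q(2)] x Q(1)])
    have xc: "x \<in> carrier V" using x openin_subset[OF U] by auto
    have "{y \<in> carrier V. (\<Sum>q\<in>F. q (y \<ominus> x)) < d} \<subseteq> {y \<in> carrier V. \<forall>q\<in>F. q (y \<ominus> x) < d}"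
    proof clarify
      fix y q assume y: "y \<in> carrier V" "(\<Sum>q\<in>F. q (y \<ominus> x)) < d" "q \<in> F"
      have "q (y \<ominus> x) \<le> (\<Sum>q\<in>F. q (y \<ominus> x))"
        by (rule member_le_sum) (use y F xc Q seminorm_onD(1)[of V _ "y \<ominus> x"] in auto)
      then show "q (y \<ominus> x) < d" using y by simp
    qed
    moreover have "(\<lambda>x. \<Sum>q\<in>F. q x) \<in> cont_seminorms V"
      using F Q cs_generating by (intro cs_sum) blast
    ultimately show ?thesis using F by (intro bexI[of _ "\<lambda>x. \<Sum>q\<in>F. q x"] exI[of _ d]) auto
  qed
  then show "U \<subseteq> carrier V \<and>
    (\<forall>x\<in>U. \<exists>r\<in>cont_seminorms V. \<exists>e>0. {y \<in> carrier V. r (y \<ominus> x) < e} \<subseteq> U)"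
    using openin_subset[OF U] by auto
next
  assume U: "U \<subseteq> carrier V \<and>
    (\<forall>x\<in>U. \<exists>r\<in>cont_seminorms V. \<exists>e>0. {y \<in> carrier V. r (y \<ominus> x) < e} \<subseteq> U)"
  show "openin (topo V) U"
  proof (subst openin_subopen, clarify)
    fix x assume x: "x \<in> U"
    then obtain r e where r: "r\<in>cont_seminorms V" "e>0" "{y \<in> carrier V. r (y \<ominus> x) < e} \<subseteq> U" using U by blast
    have "x \<in> carrier V" using U x by blast
    then obtain T where "openin (topo V) T" "x \<in> T" "T \<subseteq> {y \<in> carrier V. r (y \<ominus> x) < e}"
      using cs_ball_open[OF r(1,2)] by blast
    then show "\<exists>T. openin (topo V) T \<and> x \<in> T \<and> T \<subseteq> U"
      using r(3) by blast
  qed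
qed

lemma closure_of_topo_iff:
  assumes "S \<subseteq> carrier V"
  shows "x \<in> topo V closure_of S \<longleftrightarrow> x \<in> carrier V \<and>
    (\<forall>r\<in>cont_seminorms V. \<forall>e>0. \<exists>s\<in>S. r (s \<ominus> x) < e)"
proof (intro iffI conjI ballI allI impI)
  assume x: "x \<in> topo V closure_of S"
  show xc: "x \<in> carrier V" using x by (simp add: in_closure_of)
  fix r e assume r: "r\<in>cont_seminorms V" "(e::real)>0"
  obtain U where "openin (topo V) U" "x \<in> U" "U \<subseteq> {y \<in> carrier V. r (y \<ominus> x) < e}"
    using cs_ball_open[OF r xc] by blast
  moreover from this have "\<exists>y. y \<in> S \<and> y \<in> U" using x by (auto simp: in_closure_of)
  ultimately show "\<exists>s\<in>S. r (s \<ominus> x) < e" by blast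
next
  assume x: "x \<in> carrier V \<and> (\<forall>r\<in>cont_seminorms V. \<forall>e>0. \<exists>s\<in>S. r (s \<ominus> x) < e)"
  show "x \<in> topo V closure_of S" unfolding in_closure_of
  proof (intro conjI allI impI)
    fix T assume T: "x \<in> T \<and> openin (topo V) T"
    then obtain r e where r: "r\<in>cont_seminorms V" "e>0" "{y \<in> carrier V. r (y \<ominus> x) < e} \<subseteq> T"
      unfolding openin_topo_iff by meson
    then obtain s where "s \<in> S" "r (s \<ominus> x) < e" using x by blast
    then show "\<exists>y. y \<in> S \<and> y \<in> T" using r assms by blast
  qed (use x in simp)
qed

lemma closure_submodule:
  assumes S: "submodule S CC V" shows "submodule (topo V closure_of S) CC V"
proof -
  note D = submoduleD[OF S]
  note cl = closure_of_topo_iff[OF D(1)]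
  show ?thesis
  proof (rule submoduleI')
    show "topo V closure_of S \<subseteq> carrier V" using cl by blast
    have "S \<subseteq> topo V closure_of S" using D(1) by (intro closure_of_subset) simp
    then show "\<zero> \<in> topo V closure_of S" using D(2) by blast
  next
    fix a b assume a: "a \<in> topo V closure_of S" and b: "b \<in> topo V closure_of S"
    have c: "a \<in> carrier V" "b \<in> carrier V" using a b cl by auto
    show "a \<oplus> b \<in> topo V closure_of S" unfolding cl
    proof (intro conjI ballI allI impI)
      fix r e assume r: "r\<in>cont_seminorms V" "(e::real)>0"
      obtain s where s: "s \<in> S" "r (s \<ominus> a) < e/2" using a r cl by (meson half_gt_zero)
      obtain t where t: "t \<in> S" "r (t \<ominus> b) < e/2" using b r cl by (meson half_gt_zero)
      have "s \<in> carrier V" "t \<in> carrier V" using s t D by auto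
      then have "r ((s \<oplus> t) \<ominus> (a \<oplus> b)) \<le> r (s \<ominus> a) + r (t \<ominus> b)"
        using c by (simp add: add_diff_add seminorm_onD(2)[OF cs_seminorm[OF r(1)]])
      then have "r ((s \<oplus> t) \<ominus> (a \<oplus> b)) < e" using s t by simp
      then show "\<exists>s\<in>S. r (s \<ominus> (a \<oplus> b)) < e" using D s t by blast
    qed (use c in simp)
  next
    fix k a assume a: "a \<in> topo V closure_of S"
    have c: "a \<in> carrier V" using a cl by auto
    show "k \<odot> a \<in> topo V closure_of S" unfolding cl
    proof (intro conjI ballI allI impI)
      fix r e assume r: "r\<in>cont_seminorms V" "(e::real)>0"
      \<comment> \<open>The added 1 covers k = 0 without a case distinction.\<close>
      have e': "e / (cmod k + 1) > 0" using r by (simp add: add_nonneg_pos)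
      then obtain s where s: "s \<in> S" "r (s \<ominus> a) < e / (cmod k + 1)" using a r cl by meson
      have sc: "s \<in> carrier V" using s D by auto
      have "r (k \<odot> s \<ominus> k \<odot> a) = cmod k * r (s \<ominus> a)"
        using sc c by (simp add: smul_diff[symmetric] seminorm_onD(3)[OF cs_seminorm[OF r(1)]])
      also have "\<dots> \<le> (cmod k + 1) * r (s \<ominus> a)"
        using seminorm_onD(1)[OF cs_seminorm[OF r(1)], of "s \<ominus> a"] sc c by (simp add: mult_right_mono)
      also have "\<dots> < e"
        using s pos_less_divide_eq[of "cmod k + 1" "r (s \<ominus> a)" e]
        by (simp add: add_nonneg_pos mult.commute)
      finally show "\<exists>s\<in>S. r (s \<ominus> k \<odot> a) < e" using D s by blast
    qed (use c in simp)
  qed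
qed

lemma limitin_topo_iff:
  "limitin (topo V) f l F \<longleftrightarrow> l \<in> carrier V \<and>
    (\<forall>r\<in>cont_seminorms V. \<forall>e>0. \<forall>\<^sub>F x in F. f x \<in> carrier V \<and> r (f x \<ominus> l) < e)"
proof (intro iffI conjI ballI allI impI)
  assume x: "limitin (topo V) f l F"
  show lc: "l \<in> carrier V" using x by (simp add: limitin_def)
  fix r e assume r: "r\<in>cont_seminorms V" "(e::real)>0"
  obtain U where U: "openin (topo V) U" "l \<in> U" "U \<subseteq> {y \<in> carrier V. r (y \<ominus> l) < e}"
    using cs_ball_open[OF r lc] by blast
  then have "\<forall>\<^sub>F x in F. f x \<in> U" using x by (auto simp: limitin_def)
  then show "\<forall>\<^sub>F x in F. f x \<in> carrier V \<and> r (f x \<ominus> l) < e"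
    by (rule eventually_mono) (use U in blast)
next
  assume x: "l \<in> carrier V \<and>
    (\<forall>r\<in>cont_seminorms V. \<forall>e>0. \<forall>\<^sub>F x in F. f x \<in> carrier V \<and> r (f x \<ominus> l) < e)"
  show "limitin (topo V) f l F" unfolding limitin_def
  proof (intro conjI allI impI)
    fix T assume T: "openin (topo V) T \<and> l \<in> T"
    then obtain r e where r: "r\<in>cont_seminorms V" "e>0" "{y \<in> carrier V. r (y \<ominus> l) < e} \<subseteq> T"
      unfolding openin_topo_iff by meson
    then have "\<forall>\<^sub>F x in F. f x \<in> carrier V \<and> r (f x \<ominus> l) < e" using x by blast
    then show "\<forall>\<^sub>F x in F. f x \<in> T" by (rule eventually_mono) (use r in blast)
  qed (use x in simp)
qed

lemma Hausdorff_sep: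
  assumes "Hausdorff_space (topo V)" "x \<in> carrier V" "\<And>r. r \<in> cont_seminorms V \<Longrightarrow> r x = 0"
  shows "x = \<zero>"
proof (rule ccontr)
  assume "x \<noteq> \<zero>"
  then obtain U T where U: "openin (topo V) U" "openin (topo V) T" "\<zero> \<in> U" "x \<in> T" "disjnt U T"
    using assms(1,2) unfolding Hausdorff_space_def by (metis topspace_topo zero_closed)
  then obtain r e where r: "r\<in>cont_seminorms V" "e>0" "{y \<in> carrier V. r (y \<ominus> \<zero>) < e} \<subseteq> U"
    unfolding openin_topo_iff by meson
  have "x \<in> U" using r(2) assms(2) assms(3)[OF r(1)] by (intro subsetD[OF r(3)]) (simp add: minus_zero)
  then show False using U by (auto simp: disjnt_def)
qed

lemma Hausdorff_I:
  assumes "\<And>x. x \<in> carrier V \<Longrightarrow> x \<noteq> \<zero> \<Longrightarrow> \<exists>r \<in> cont_seminorms V. r x \<noteq> 0"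
  shows "Hausdorff_space (topo V)"
  unfolding Hausdorff_space_def topspace_topo
proof (intro allI impI)
  fix x y assume xy: "x \<in> carrier V \<and> y \<in> carrier V \<and> x \<noteq> y"
  then have "x \<ominus> y \<noteq> \<zero>" using minus_eq_zeroD by blast
  then obtain r where r: "r \<in> cont_seminorms V" "r (x \<ominus> y) \<noteq> 0" using assms[of "x \<ominus> y"] xy by auto
  note sr = cs_seminorm[OF r(1)]
  define e where "e = r (x \<ominus> y) / 2"
  have e: "e > 0" using r seminorm_onD(1)[OF sr, of "x \<ominus> y"] xy by (simp add: e_def)
  obtain U where U: "openin (topo V) U" "x \<in> U" "U \<subseteq> {z \<in> carrier V. r (z \<ominus> x) < e}"
    using cs_ball_open[OF r(1) e, of x] xy by auto
  obtain T where T: "openin (topo V) T" "y \<in> T" "T \<subseteq> {z \<in> carrier V. r (z \<ominus> y) < e}"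
    using cs_ball_open[OF r(1) e, of y] xy by auto
  have "disjnt U T"
  proof (unfold disjnt_iff, rule ccontr, clarsimp)
    fix z assume "z \<in> U" "z \<in> T"
    then have z: "z \<in> carrier V" "r (z \<ominus> x) < e" "r (z \<ominus> y) < e" using U T by auto
    have "r (x \<ominus> y) \<le> r (x \<ominus> z) + r (z \<ominus> y)" using seminorm_triangle[OF sr] xy z by blast
    also have "r (x \<ominus> z) = r (z \<ominus> x)" using seminorm_minus_commute[OF sr] xy z by blast
    finally show False using z by (simp add: e_def)
  qed
  then show "\<exists>U T. openin (topo V) U \<and> openin (topo V) T \<and> x \<in> U \<and> y \<in> T \<and> disjnt U T"
    using U T by blast
qed

end

text \<open>Additive inverses come from the (-1)-multiples.\<close>

lemma cvecI:
  fixes V :: "(complex, 'a, 'm) module_scheme" (structure)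
  assumes "\<And>x y. x \<in> carrier V \<Longrightarrow> y \<in> carrier V \<Longrightarrow> x \<oplus> y \<in> carrier V"
    and "\<zero> \<in> carrier V"
    and "\<And>x y z. x \<in> carrier V \<Longrightarrow> y \<in> carrier V \<Longrightarrow> z \<in> carrier V \<Longrightarrow> (x \<oplus> y) \<oplus> z = x \<oplus> (y \<oplus> z)"
    and "\<And>x y. x \<in> carrier V \<Longrightarrow> y \<in> carrier V \<Longrightarrow> x \<oplus> y = y \<oplus> x"
    and "\<And>x. x \<in> carrier V \<Longrightarrow> \<zero> \<oplus> x = x"
    and smul: "\<And>c x. x \<in> carrier V \<Longrightarrow> c \<odot> x \<in> carrier V"
    and left: "\<And>a b x. x \<in> carrier V \<Longrightarrow> (a + b) \<odot> x = a \<odot> x \<oplus> b \<odot> x"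
    and "\<And>a x y. x \<in> carrier V \<Longrightarrow> y \<in> carrier V \<Longrightarrow> a \<odot> (x \<oplus> y) = a \<odot> x \<oplus> a \<odot> y"
    and "\<And>a b x. x \<in> carrier V \<Longrightarrow> a \<odot> (b \<odot> x) = (a * b) \<odot> x"
    and one: "\<And>x. x \<in> carrier V \<Longrightarrow> 1 \<odot> x = x"
    and zero: "\<And>x. x \<in> carrier V \<Longrightarrow> 0 \<odot> x = \<zero>"
  shows "cvec V"
  unfolding cvec_def
proof (rule moduleI)
  have "\<exists>y\<in>carrier V. y \<oplus> x = \<zero>" if "x \<in> carrier V" for x
    using left[OF that, of "-1" 1] one[OF that] zero[OF that] smul[OF that]
    by (intro bexI[of _ "(-1) \<odot> x"]) simp_all
  then show "abelian_group V" by (intro abelian_groupI) (use assms in auto)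
qed (use assms cring_CC in auto)

section \<open>Subspaces and induced topologies\<close>

lemma subobject_simps [simp]:
  "carrier (subobject V S) = S" "mult (subobject V S) = mult V" "one (subobject V S) = one V"
  "zero (subobject V S) = zero V" "add (subobject V S) = add V" "smult (subobject V S) = smult V"
  "topo (subobject V S) = subtopology (topo V) S"
  by (simp_all add: subobject_def)

lemma with_topology_simps [simp]:
  "carrier (with_topology M t) = carrier M" "mult (with_topology M t) = mult M"
  "one (with_topology M t) = one M" "zero (with_topology M t) = zero M"
  "add (with_topology M t) = add M" "smult (with_topology M t) = smult M"
  "topo (with_topology M t) = t"
  by (simp_all add: with_topology_def module.defs lc_alg.defs)

text \<open>Inverses are descriptions in terms of carrier, addition and zero, so records that agree
  there have the same difference, even if their record types differ.\<close>

lemma a_minus_cong: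
  fixes A :: "(complex, 'a, 'm) module_scheme" and B :: "(complex, 'a, 'n) module_scheme"
  assumes "carrier A = carrier B" "add A = add B" "zero A = zero B"
  shows "x \<ominus>\<^bsub>A\<^esub> y = x \<ominus>\<^bsub>B\<^esub> y"
  using assms by (simp add: a_minus_def a_inv_def m_inv_def)

lemma seminorm_topology_cong:
  fixes A :: "(complex, 'a, 'm) module_scheme" and B :: "(complex, 'a, 'n) module_scheme"
  assumes "carrier A = carrier B" "add A = add B" "zero A = zero B"
  shows "seminorm_topology A Q = seminorm_topology B Q"
  unfolding seminorm_topology_def assms(1) a_minus_cong[OF assms] ..

lemma seminorm_on_cong:
  fixes A :: "(complex, 'a, 'm) module_scheme" and B :: "(complex, 'a, 'n) module_scheme"
  assumes "carrier A = carrier B" "add A = add B" "smult A = smult B"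
  shows "seminorm_on A q = seminorm_on B q"
  unfolding seminorm_on_def assms ..

lemma lcs_with_topology:
  assumes "cvec (with_topology M t)" "t = seminorm_topology M Q" "\<And>q. q \<in> Q \<Longrightarrow> seminorm_on M q"
  shows "lcs (with_topology M t)"
proof -
  have "topo (with_topology M t) = seminorm_topology (with_topology M t) Q"
    unfolding with_topology_simps assms(2) by (rule seminorm_topology_cong) simp_all
  moreover have "seminorm_on (with_topology M t) q" if "q \<in> Q" for q
    using assms(3)[OF that] seminorm_on_cong[of "with_topology M t" M q] by simp
  ultimately show ?thesis using assms(1) by (auto simp: lcs_def lcs_axioms_def)
qed

context lcs
begin

lemma subobject_cvec:
  assumes S: "submodule S CC V" shows "cvec (subobject V S)"
  using submoduleD[OF S] in_carrierD[OF S]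
  by (intro cvecI) (simp_all add: a_ac smul_add_left smul_add_right smul_smul)

text \<open>The inverse in the subspace is a description over a smaller carrier; both differences
  equal the sum with the (-1)-multiple.\<close>

lemma subobject_minus:
  assumes S: "submodule S CC V" and "x \<in> S" "y \<in> S"
  shows "x \<ominus>\<^bsub>subobject V S\<^esub> y = x \<ominus> y"
proof -
  interpret S: cvec "subobject V S" by (rule subobject_cvec[OF S])
  show ?thesis using S.minus_eq'[of x y] minus_eq'[of x y] in_carrierD[OF S] assms by simp
qed

lemma subobject_seminorm: "submodule S CC V \<Longrightarrow> seminorm_on V r \<Longrightarrow> seminorm_on (subobject V S) r"
  using submoduleD(1)[of S] by (auto simp: seminorm_on_def subset_iff)

lemma subobject_cs:
  assumes "submodule S CC V" "r \<in> cont_seminorms V" shows "r \<in> cont_seminorms (subobject V S)"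
  using assms by (auto simp: cont_seminorms_def subobject_seminorm continuous_map_from_subtopology)

text \<open>The restrictions of all continuous seminorms of \<open>V\<close> generate the induced
  topology; finite families of them are merged by \<open>cs_sum\<close>.\<close>

lemma subobject_lcs:
  assumes S: "submodule S CC V" shows "lcs (subobject V S)"
proof -
  interpret S: cvec "subobject V S" by (rule subobject_cvec[OF S])
  have "openin (subtopology (topo V) S) U \<longleftrightarrow> openin (seminorm_topology (subobject V S) (cont_seminorms V)) U" for U
  proof
    assume "openin (subtopology (topo V) S) U"
    then obtain T where T: "openin (topo V) T" "U = T \<inter> S" by (auto simp: openin_subtopology)
    show "openin (seminorm_topology (subobject V S) (cont_seminorms V)) U"
    proof (rule S.openin_seminorm_topologyI)
      fix x assume x: "x \<in> U"
      then obtain r e where r: "r\<in>cont_seminorms V" "e>0" "{y \<in> carrier V. r (y \<ominus> x) < e} \<subseteq> T"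
        using T unfolding openin_topo_iff by (metis IntD1)
      have "{y \<in> carrier (subobject V S). \<forall>q\<in>{r}. q (y \<ominus>\<^bsub>subobject V S\<^esub> x) < e} \<subseteq> U"
      proof
        fix y assume "y \<in> {y \<in> carrier (subobject V S). \<forall>q\<in>{r}. q (y \<ominus>\<^bsub>subobject V S\<^esub> x) < e}"
        then have "y \<in> S" "r (y \<ominus> x) < e" using subobject_minus[OF S] x T by auto
        then show "y \<in> U" using r(3) T in_carrierD[OF S] by auto
      qed
      then show "\<exists>F e. finite F \<and> F \<subseteq> cont_seminorms V \<and> 0 < e \<and>
        {y \<in> carrier (subobject V S). \<forall>q\<in>F. q (y \<ominus>\<^bsub>subobject V S\<^esub> x) < e} \<subseteq> U"
        using r(1,2) by (intro exI[of _ "{r}"] exI[of _ e]) auto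
    qed (use T cs_seminorm subobject_seminorm[OF S] in auto)
  next
    assume U: "openin (seminorm_topology (subobject V S) (cont_seminorms V)) U"
    have US: "U \<subseteq> S" using openin_subset[OF U] by simp
    have "\<exists>T. openin (topo V) T \<and> x \<in> T \<and> T \<inter> S \<subseteq> U" if x: "x \<in> U" for x
    proof -
      obtain F e where F: "finite F" "F \<subseteq> cont_seminorms V" "0 < e"
        "{y \<in> carrier (subobject V S). \<forall>q\<in>F. q (y \<ominus>\<^bsub>subobject V S\<^esub> x) < e} \<subseteq> U"
        by (rule S.openin_seminorm_topologyD[OF U x]) (use cs_seminorm subobject_seminorm[OF S] in auto)
      have xc: "x \<in> carrier V" "x \<in> S" using x US in_carrierD[OF S] by auto
      have "(\<lambda>x. \<Sum>q\<in>F. q x) \<in> cont_seminorms V" by (rule cs_sum) (use F in auto)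
      then obtain T where T: "openin (topo V) T" "x \<in> T" "T \<subseteq> {y \<in> carrier V. (\<Sum>q\<in>F. q (y \<ominus> x)) < e}"
        using cs_ball_open[OF _ F(3) xc(1)] by blast
      have "T \<inter> S \<subseteq> U"
      proof
        fix y assume y: "y \<in> T \<inter> S"
        have "q (y \<ominus>\<^bsub>subobject V S\<^esub> x) < e" if q: "q \<in> F" for q
        proof -
          have yc: "y \<in> carrier V" using y in_carrierD[OF S] by auto
          have "q (y \<ominus> x) \<le> (\<Sum>q\<in>F. q (y \<ominus> x))"
            by (rule member_le_sum)
               (use q F xc yc cs_seminorm seminorm_onD(1)[of V _ "y \<ominus> x"] in auto)
          then show ?thesis using y T subobject_minus[OF S, of y x] xc by auto
        qed
        then show "y \<in> U" using y by (intro subsetD[OF F(4)]) simp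
      qed
      then show ?thesis using T by blast
    qed
    then obtain T where T: "\<And>x. x \<in> U \<Longrightarrow> openin (topo V) (T x) \<and> x \<in> T x \<and> T x \<inter> S \<subseteq> U" by metis
    then have "U = (\<Union>x\<in>U. T x) \<inter> S" using US by blast
    moreover have "openin (topo V) (\<Union>x\<in>U. T x)" using T by blast
    ultimately show "openin (subtopology (topo V) S) U" unfolding openin_subtopology by blast
  qed
  then have "topo (subobject V S) = seminorm_topology (subobject V S) (cont_seminorms V)"
    by (simp add: topology_eq)
  then show ?thesis
    using subobject_cvec[OF S] subobject_seminorm[OF S] cs_seminorm by (auto simp: lcs_def lcs_axioms_def)
qed

text \<open>Continuous seminorms of \<open>V\<close> restrict to continuous ones, so a Cauchy filter
  of the subspace is Cauchy in \<open>V\<close>; closedness puts its limit back into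
  \<open>S\<close>.\<close>

lemma complete_subobject:
  assumes S: "submodule S CC V" and cl: "closedin (topo V) S" and co: "complete_lc V"
  shows "complete_lc (subobject V S)"
  unfolding complete_lc_def
proof (intro allI impI)
  fix F assume F: "cauchy_filter_on (subobject V S) F"
  have FS: "F \<le> principal S" "F \<noteq> bot" using F by (auto simp: cauchy_filter_on_def)
  have ev: "eventually (\<lambda>x. x \<in> S) F" using FS by (simp add: le_principal)
  have "cauchy_filter_on V F"
    unfolding cauchy_filter_on_def
  proof (intro conjI ballI allI impI)
    show "F \<le> principal (carrier V)" using FS submoduleD(1)[OF S] by (simp add: le_principal subset_iff eventually_mono)
    fix q e assume q: "q \<in> cont_seminorms V" "(e::real) > 0"
    have "\<forall>\<^sub>F z in F \<times>\<^sub>F F. q (fst z \<ominus>\<^bsub>subobject V S\<^esub> snd z) < e"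
      using F subobject_cs[OF S q(1)] q(2) by (auto simp: cauchy_filter_on_def)
    moreover have "\<forall>\<^sub>F z in F \<times>\<^sub>F F. fst z \<in> S \<and> snd z \<in> S"
      using ev by (auto simp: eventually_prod_same)
    ultimately show "\<forall>\<^sub>F z in F \<times>\<^sub>F F. q (fst z \<ominus> snd z) < e"
      by eventually_elim (use subobject_minus[OF S] in auto)
  qed (use FS in simp)
  then obtain l where l: "limitin (topo V) (\<lambda>x. x) l F" using co by (auto simp: complete_lc_def)
  have "l \<in> S" by (rule limitin_closedin[OF l cl ev FS(2)])
  then have "limitin (topo (subobject V S)) (\<lambda>x. x) l F"
    using l ev by (simp add: limitin_subtopology)
  then show "\<exists>l. limitin (topo (subobject V S)) (\<lambda>x. x) l F" by blast
qed

end

section \<open>Locally convex algebras and closed subalgebras\<close>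

lemma lc_algebraD:
  assumes "lc_algebra X"
  shows "lcs X" "Hausdorff_space (topo X)" "complete_lc X" "assoc_alg X"
    "continuous_map (prod_topology (topo X) (topo X)) (topo X) (\<lambda>z. fst z \<otimes>\<^bsub>X\<^esub> snd z)"
  using assms by (auto simp: lc_algebra_def lcs_iff)

locale lc_algebra_loc = lcs X for X :: "'a lc_alg" (structure) +
  assumes alg: "lc_algebra X"
begin

lemmas lcalg = lc_algebraD[OF alg]

lemma mult_closed': "x \<in> carrier X \<Longrightarrow> y \<in> carrier X \<Longrightarrow> x \<otimes> y \<in> carrier X"
  using lcalg(4) lin_mapD(1)[of X X "\<lambda>y. x \<otimes> y" y] by (simp add: assoc_alg_def)

lemma mult_add_right:
  "x \<in> carrier X \<Longrightarrow> y \<in> carrier X \<Longrightarrow> z \<in> carrier X \<Longrightarrow> x \<otimes> (y \<oplus> z) = x \<otimes> y \<oplus> x \<otimes> z"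
  using lcalg(4) lin_mapD(2)[of X X "\<lambda>y. x \<otimes> y" y z] by (simp add: assoc_alg_def)

lemma mult_add_left:
  "x \<in> carrier X \<Longrightarrow> y \<in> carrier X \<Longrightarrow> z \<in> carrier X \<Longrightarrow> (y \<oplus> z) \<otimes> x = y \<otimes> x \<oplus> z \<otimes> x"
  using lcalg(4) lin_mapD(2)[of X X "\<lambda>y. y \<otimes> x" y z] by (simp add: assoc_alg_def)

lemma mult_smul_right: "x \<in> carrier X \<Longrightarrow> y \<in> carrier X \<Longrightarrow> x \<otimes> (c \<odot> y) = c \<odot> (x \<otimes> y)"
  using lcalg(4) lin_mapD(3)[of X X "\<lambda>y. x \<otimes> y" y c] by (simp add: assoc_alg_def)

lemma mult_smul_left: "x \<in> carrier X \<Longrightarrow> y \<in> carrier X \<Longrightarrow> (c \<odot> y) \<otimes> x = c \<odot> (y \<otimes> x)"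
  using lcalg(4) lin_mapD(3)[of X X "\<lambda>y. y \<otimes> x" y c] by (simp add: assoc_alg_def)

lemma mult_assoc':
  "x \<in> carrier X \<Longrightarrow> y \<in> carrier X \<Longrightarrow> z \<in> carrier X \<Longrightarrow> (x \<otimes> y) \<otimes> z = x \<otimes> (y \<otimes> z)"
  using lcalg(4) by (simp add: assoc_alg_def)

text \<open>Joint continuity sends the closure of \<open>B \<times> C\<close>, which is the product
  of the closures, into the closure of the set of products.\<close>

lemma closure_mult:
  assumes "\<And>b c. b \<in> B \<Longrightarrow> c \<in> C \<Longrightarrow> b \<otimes> c \<in> E"
    and "b \<in> topo X closure_of B" "c \<in> topo X closure_of C"
  shows "b \<otimes> c \<in> topo X closure_of E"
proof -
  have "(\<lambda>z. fst z \<otimes> snd z) ` (prod_topology (topo X) (topo X) closure_of (B \<times> C)) \<subseteq>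
    topo X closure_of ((\<lambda>z. fst z \<otimes> snd z) ` (B \<times> C))"
    by (rule continuous_map_image_closure_subset[OF lcalg(5)])
  moreover have "(b, c) \<in> prod_topology (topo X) (topo X) closure_of (B \<times> C)"
    using assms by (simp add: closure_of_Times)
  ultimately have "b \<otimes> c \<in> topo X closure_of ((\<lambda>z. fst z \<otimes> snd z) ` (B \<times> C))"
    by force
  moreover have "topo X closure_of ((\<lambda>z. fst z \<otimes> snd z) ` (B \<times> C)) \<subseteq> topo X closure_of E"
    by (rule closure_of_mono) (use assms(1) in auto)
  ultimately show ?thesis by blast
qed

lemma mult_continuous_right: "x \<in> carrier X \<Longrightarrow> continuous_map (topo X) (topo X) (\<lambda>y. x \<otimes> y)"
proof -
  assume x: "x \<in> carrier X"
  have "continuous_map (topo X) (prod_topology (topo X) (topo X)) (\<lambda>y. (x, y))"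
    using x by (simp add: continuous_map_pairedI)
  from continuous_map_compose[OF this lcalg(5)] show ?thesis by (simp add: o_def)
qed

lemma mult_continuous_left: "x \<in> carrier X \<Longrightarrow> continuous_map (topo X) (topo X) (\<lambda>y. y \<otimes> x)"
proof -
  assume x: "x \<in> carrier X"
  have "continuous_map (topo X) (prod_topology (topo X) (topo X)) (\<lambda>y. (y, x))"
    using x by (simp add: continuous_map_pairedI)
  from continuous_map_compose[OF this lcalg(5)] show ?thesis by (simp add: o_def)
qed

lemma closed_subalgebra:
  assumes G: "G \<subseteq> carrier X"
  defines "H \<equiv> closed_subalgebra_generated X G"
  shows "submodule H CC X" "\<And>x y. x \<in> H \<Longrightarrow> y \<in> H \<Longrightarrow> x \<otimes> y \<in> H" "closedin (topo X) H" "G \<subseteq> H"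
proof -
  let ?F = "{H. submodule H CC X \<and> (\<forall>x\<in>H. \<forall>y\<in>H. x \<otimes> y \<in> H) \<and> closedin (topo X) H \<and> G \<subseteq> H}"
  have H: "H = \<Inter>?F" by (simp add: H_def closed_subalgebra_generated_def)
  have c: "carrier X \<in> ?F"
    using carrier_is_submodule mult_closed' G closedin_topspace[of "topo X"] by simp
  show "submodule H CC X"
  proof (rule submoduleI')
    show "H \<subseteq> carrier X" using c H by blast
  qed (use submoduleD in \<open>auto simp: H\<close>)
  show "\<And>x y. x \<in> H \<Longrightarrow> y \<in> H \<Longrightarrow> x \<otimes> y \<in> H" by (auto simp: H)
  show "closedin (topo X) H" unfolding H by (rule closedin_Inter) (use c in auto)
  show "G \<subseteq> H" by (auto simp: H)
qed

lemma closed_subalgebra_least: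
  assumes "submodule H CC X" "\<And>x y. x \<in> H \<Longrightarrow> y \<in> H \<Longrightarrow> x \<otimes> y \<in> H" "closedin (topo X) H" "G \<subseteq> H"
  shows "closed_subalgebra_generated X G \<subseteq> H"
  using assms unfolding closed_subalgebra_generated_def by blast

lemma subobject_lc_algebra:
  assumes S: "submodule S CC X" and cl: "closedin (topo X) S"
    and m: "\<And>x y. x \<in> S \<Longrightarrow> y \<in> S \<Longrightarrow> x \<otimes> y \<in> S"
  shows "lc_algebra (subobject X S)"
proof -
  note c = in_carrierD[OF S]
  interpret S: lcs "subobject X S" by (rule subobject_lcs[OF S])
  have "assoc_alg (subobject X S)"
    unfolding assoc_alg_def using S.module_axioms m
    by (auto simp: lin_map_def c mult_add_right mult_add_left mult_smul_right mult_smul_left mult_assoc')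
  moreover have "continuous_map (prod_topology (topo (subobject X S)) (topo (subobject X S)))
     (topo (subobject X S)) (\<lambda>z. fst z \<otimes>\<^bsub>subobject X S\<^esub> snd z)"
    using m lcalg(5)
    by (auto simp: continuous_map_in_subtopology prod_topology_subtopology(1) prod_topology_subtopology(2)
        subtopology_subtopology intro!: continuous_map_from_subtopology)
  ultimately show ?thesis
    using complete_subobject[OF S cl] lcalg S.lcs_axioms
    by (simp add: lc_algebra_def lcs_iff Hausdorff_space_subtopology)
qed

end

section \<open>Continuity of linear maps by seminorm estimates\<close>

context cvec_lin
begin

lemma seminorm_comp: "seminorm_on W q \<Longrightarrow> seminorm_on V (\<lambda>x. q (f x))"
  by (rule seminorm_onI) (simp_all add: linD seminorm_onD)

end

locale lcs_lin = V: lcs V + W: lcs W for V :: "'a lc_alg" and W :: "'b lc_alg" +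
  fixes f assumes lin: "lin_map V W f"
begin

sublocale cvec_lin V W f by unfold_locales (rule lin)

lemma continuousI:
  assumes "\<And>q. q \<in> cont_seminorms W \<Longrightarrow> \<exists>r\<in>cont_seminorms V. \<forall>x\<in>carrier V. q (f x) \<le> r x"
  shows "continuous_map (topo V) (topo W) f"
  unfolding continuous_map_def
proof (intro conjI allI impI)
  show "f \<in> topspace (topo V) \<rightarrow> topspace (topo W)" using linD by auto
  fix U assume U: "openin (topo W) U"
  show "openin (topo V) {x \<in> topspace (topo V). f x \<in> U}"
    unfolding V.openin_topo_iff
  proof (intro conjI ballI)
    fix x assume x: "x \<in> {x \<in> topspace (topo V). f x \<in> U}"
    then obtain q e where q: "q\<in>cont_seminorms W" "e>0" "{y \<in> carrier W. q (y \<ominus>\<^bsub>W\<^esub> f x) < e} \<subseteq> U"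
      using U unfolding W.openin_topo_iff by blast
    obtain r where r: "r\<in>cont_seminorms V" "\<forall>x\<in>carrier V. q (f x) \<le> r x" using assms[OF q(1)] by blast
    have "{y \<in> carrier V. r (y \<ominus>\<^bsub>V\<^esub> x) < e} \<subseteq> {x \<in> topspace (topo V). f x \<in> U}"
    proof
      fix y assume y: "y \<in> {y \<in> carrier V. r (y \<ominus>\<^bsub>V\<^esub> x) < e}"
      then have "q (f y \<ominus>\<^bsub>W\<^esub> f x) < e" using x r(2) map_minus[of y x] V.minus_closed'[of y x] by fastforce
      then show "y \<in> {x \<in> topspace (topo V). f x \<in> U}" using y q(3) linD(1) by auto
    qed
    then show "\<exists>r\<in>cont_seminorms V. \<exists>e>0. {y \<in> carrier V. r (y \<ominus>\<^bsub>V\<^esub> x) < e} \<subseteq> {x \<in> topspace (topo V). f x \<in> U}"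
      using q r by blast
  qed auto
qed

lemma cs_comp:
  assumes "continuous_map (topo V) (topo W) f" "q \<in> cont_seminorms W"
  shows "(\<lambda>x. q (f x)) \<in> cont_seminorms V"
  using assms seminorm_comp continuous_map_compose[of "topo V" "topo W" f euclideanreal q]
  by (auto simp: cont_seminorms_def o_def)

end

section \<open>Weighted l1 seminorms on finitely supported functions\<close>

text \<open>Every seminorm of a space with coordinates is bounded by one of these, with its values
  at the basis vectors as weights; with arbitrary nonnegative weights they therefore describe the
  finest locally convex topology.\<close>

definition wnorm :: "('i \<Rightarrow> real) \<Rightarrow> ('i \<Rightarrow>\<^sub>0 complex) \<Rightarrow> real" where
  "wnorm w c = (\<Sum>i\<in>Poly_Mapping.keys c. w i * cmod (Poly_Mapping.lookup c i))"

lemma wnorm_superset: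
  "finite S \<Longrightarrow> Poly_Mapping.keys c \<subseteq> S \<Longrightarrow> wnorm w c = (\<Sum>i\<in>S. w i * cmod (Poly_Mapping.lookup c i))"
  unfolding wnorm_def by (rule sum.mono_neutral_left) (auto simp: in_keys_iff)

lemma wnorm_nonneg: "(\<And>i. 0 \<le> w i) \<Longrightarrow> 0 \<le> wnorm w c"
  unfolding wnorm_def by (intro sum_nonneg mult_nonneg_nonneg) auto

lemma wnorm_ge_sum:
  assumes "\<And>i. 0 \<le> w i" "finite S"
  shows "(\<Sum>i\<in>S. w i * cmod (Poly_Mapping.lookup c i)) \<le> wnorm w c"
proof -
  have "wnorm w c = (\<Sum>i\<in>S \<union> Poly_Mapping.keys c. w i * cmod (Poly_Mapping.lookup c i))"
    by (rule wnorm_superset) (use assms in auto)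
  then show ?thesis using assms by (auto intro!: sum_mono2)
qed

lemma wnorm_ge:
  assumes "\<And>i. 0 \<le> w i" shows "w i * cmod (Poly_Mapping.lookup c i) \<le> wnorm w c"
  using wnorm_ge_sum[of w "{i}" c] assms by simp

lemma wnorm_scale: "wnorm w (pm_scale k c) = cmod k * wnorm w c"
  by (subst wnorm_superset[of "Poly_Mapping.keys c"])
     (use keys_pm_scale[of k c] in \<open>auto simp: wnorm_def sum_distrib_left norm_mult algebra_simps\<close>)

lemma wnorm_add:
  assumes "\<And>i. 0 \<le> w i" shows "wnorm w (c + d) \<le> wnorm w c + wnorm w d"
proof -
  let ?S = "Poly_Mapping.keys c \<union> Poly_Mapping.keys d"
  have "wnorm w (c + d) = (\<Sum>i\<in>?S. w i * cmod (Poly_Mapping.lookup (c + d) i))"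
    by (rule wnorm_superset) (use Poly_Mapping.keys_add[of c d] in auto)
  also have "\<dots> \<le> (\<Sum>i\<in>?S. w i * cmod (Poly_Mapping.lookup c i) + w i * cmod (Poly_Mapping.lookup d i))"
    using assms
    by (intro sum_mono) (simp add: lookup_add distrib_left[symmetric] mult_left_mono norm_triangle_ineq)
  also have "\<dots> = wnorm w c + wnorm w d"
    by (simp add: sum.distrib wnorm_superset[of ?S c] wnorm_superset[of ?S d])
  finally show ?thesis .
qed

text \<open>Completeness of the finest topology, stated through coordinates \<open>\<kappa>\<close>
  along a filter so that it serves \<open>A\<close> itself as well as subspaces of other spaces.
  Coordinatewise limits exist, and the freedom in the weights forces the limit to have finite
  support.\<close>

lemma fine_complete:
  fixes F :: "'a filter" and \<kappa> :: "'a \<Rightarrow> ('i \<Rightarrow>\<^sub>0 complex)"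
  assumes F: "F \<noteq> bot"
    and cauchy: "\<And>w e. (\<And>i. 0 \<le> w i) \<Longrightarrow> 0 < e \<Longrightarrow> \<forall>\<^sub>F z in F \<times>\<^sub>F F. wnorm w (\<kappa> (fst z) - \<kappa> (snd z)) < e"
  shows "\<exists>\<gamma>. \<forall>w e. (\<forall>i. 0 \<le> w i) \<longrightarrow> 0 < e \<longrightarrow> (\<forall>\<^sub>F x in F. wnorm w (\<kappa> x - \<gamma>) < e)"
proof -
  let ?l = "\<lambda>x i. Poly_Mapping.lookup (\<kappa> x) i"
  have cau: thesis
    if w: "\<And>i. 0 \<le> w i" "0 < e"
      and P: "\<And>P. eventually P F \<Longrightarrow> (\<And>x y. P x \<Longrightarrow> P y \<Longrightarrow> wnorm w (\<kappa> x - \<kappa> y) < e) \<Longrightarrow> thesis"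
    for w e thesis
  proof -
    have "\<forall>\<^sub>F z in F \<times>\<^sub>F F. wnorm w (\<kappa> (fst z) - \<kappa> (snd z)) < e" by (rule cauchy) (rule w)+
    then obtain Q where Q: "eventually Q F" "\<forall>x y. Q x \<longrightarrow> Q y \<longrightarrow> wnorm w (\<kappa> x - \<kappa> y) < e"
      unfolding eventually_prod_same by auto
    show thesis by (rule P[OF Q(1)]) (use Q(2) in simp)
  qed
  have "\<exists>l. ((\<lambda>x. ?l x i) \<longlongrightarrow> l) F" for i
  proof -
    have "cauchy_filter (filtermap (\<lambda>x. ?l x i) F)"
      unfolding cauchy_filter_metric_filtermap
    proof (intro allI impI)
      fix e :: real assume e: "0 < e"
      \<comment> \<open>The weight concentrated at \<open>i\<close> extracts the Cauchy property of
        the single coordinate \<open>i\<close>.\<close>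
      define w where "w j = (if j = i then 1 else 0 :: real)" for j
      have w0: "0 \<le> w j" for j by (simp add: w_def)
      obtain P where P: "eventually P F" "\<And>x y. P x \<Longrightarrow> P y \<Longrightarrow> wnorm w (\<kappa> x - \<kappa> y) < e"
        by (rule cau[of w e, OF w0 e]) (rule that)
      have "dist (?l x i) (?l y i) < e" if xy: "P x \<and> P y" for x y
      proof -
        have "wnorm w (\<kappa> x - \<kappa> y) < e" by (rule P(2)) (use xy in auto)
        moreover have "w i * cmod (?l x i - ?l y i) \<le> wnorm w (\<kappa> x - \<kappa> y)"
          using wnorm_ge[of w i "\<kappa> x - \<kappa> y"] w0 by (simp add: lookup_minus)
        ultimately show ?thesis by (simp add: w_def dist_norm)
      qed
      then show "\<exists>P. eventually P F \<and> (\<forall>x y. P x \<and> P y \<longrightarrow> dist (?l x i) (?l y i) < e)"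
        using P(1) by blast
    qed
    then obtain l where "filtermap (\<lambda>x. ?l x i) F \<le> nhds l"
      using cauchy_filter_complete_converges[of "filtermap (\<lambda>x. ?l x i) F" UNIV]
        complete_UNIV[where 'a=complex] F by (auto simp: filtermap_bot_iff)
    then show ?thesis by (auto simp: filterlim_def)
  qed
  then obtain g where g: "\<And>i. ((\<lambda>x. ?l x i) \<longlongrightarrow> g i) F" by metis
  have fin: "finite {i. g i \<noteq> 0}"
  proof (rule ccontr)
    assume inf: "infinite {i. g i \<noteq> 0}"
    \<comment> \<open>Division by zero gives weight 0 off the support of \<open>g\<close>. At an
      index of the support that is missed by \<open>\<kappa> x0\<close>, the weighted coordinate
      tends to 2 while being bounded by 1.\<close>
    define w where "w i = 2 / cmod (g i)" for i
    obtain P where P: "eventually P F" "\<And>x y. P x \<Longrightarrow> P y \<Longrightarrow> wnorm w (\<kappa> x - \<kappa> y) < 1"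
      by (rule cau[of w 1]) (simp add: w_def, simp, rule that)
    obtain x0 where x0: "P x0" using P(1) F eventually_happens by blast
    have "\<exists>i\<in>{i. g i \<noteq> 0}. i \<notin> Poly_Mapping.keys (\<kappa> x0)"
      using inf finite_subset[of "{i. g i \<noteq> 0}" "Poly_Mapping.keys (\<kappa> x0)"] by auto
    then obtain i where i: "g i \<noteq> 0" "?l x0 i = 0" by (auto simp: in_keys_iff)
    have "\<forall>\<^sub>F x in F. w i * cmod (?l x i) \<le> 1"
    proof (rule eventually_mono[OF P(1)])
      fix x assume "P x"
      then have "wnorm w (\<kappa> x - \<kappa> x0) < 1" using P(2) x0 by blast
      moreover have "w i * cmod (?l x i) \<le> wnorm w (\<kappa> x - \<kappa> x0)"
        using wnorm_ge[of w i "\<kappa> x - \<kappa> x0"] i by (simp add: lookup_minus w_def)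
      ultimately show "w i * cmod (?l x i) \<le> 1" by simp
    qed
    moreover have "((\<lambda>x. w i * cmod (?l x i)) \<longlongrightarrow> w i * cmod (g i)) F"
      by (intro tendsto_intros g)
    ultimately have "w i * cmod (g i) \<le> 1" by (rule tendsto_upperbound[OF _ _ F, rotated])
    then show False using i by (simp add: w_def)
  qed
  define \<gamma> where "\<gamma> = Abs_poly_mapping g"
  have \<gamma>: "Poly_Mapping.lookup \<gamma> = g" unfolding \<gamma>_def by (rule lookup_Abs_poly_mapping[OF fin])
  have "\<forall>\<^sub>F x in F. wnorm w (\<kappa> x - \<gamma>) < e" if w: "\<And>i. 0 \<le> w i" and e: "0 < e" for w e
  proof -
    obtain P where P: "eventually P F" "\<And>x y. P x \<Longrightarrow> P y \<Longrightarrow> wnorm w (\<kappa> x - \<kappa> y) < e/2"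
      by (rule cau[of w "e/2"]) (rule w, simp add: e, rule that)
    show ?thesis
    proof (rule eventually_mono[OF P(1)])
      fix x assume x: "P x"
      \<comment> \<open>This support is finite, so the limit in \<open>y\<close> passes through the
        sum; the bound e/2 compensates for the weak inequality left by the limit.\<close>
      let ?S = "Poly_Mapping.keys (\<kappa> x - \<gamma>)"
      have "\<forall>\<^sub>F y in F. (\<Sum>i\<in>?S. w i * cmod (?l x i - ?l y i)) \<le> e/2"
      proof (rule eventually_mono[OF P(1)])
        fix y assume "P y"
        then have "wnorm w (\<kappa> x - \<kappa> y) < e/2" using P(2) x by blast
        moreover have "(\<Sum>i\<in>?S. w i * cmod (?l x i - ?l y i)) \<le> wnorm w (\<kappa> x - \<kappa> y)"
          using wnorm_ge_sum[of w ?S "\<kappa> x - \<kappa> y"] w by (simp add: lookup_minus)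
        ultimately show "(\<Sum>i\<in>?S. w i * cmod (?l x i - ?l y i)) \<le> e/2" by simp
      qed
      moreover have "((\<lambda>y. \<Sum>i\<in>?S. w i * cmod (?l x i - ?l y i)) \<longlongrightarrow> (\<Sum>i\<in>?S. w i * cmod (?l x i - g i))) F"
        by (intro tendsto_intros g)
      ultimately have "(\<Sum>i\<in>?S. w i * cmod (?l x i - g i)) \<le> e/2" by (rule tendsto_upperbound[OF _ _ F, rotated])
      then show "wnorm w (\<kappa> x - \<gamma>) < e" using e by (simp add: wnorm_def lookup_minus \<gamma>)
    qed
  qed
  then show ?thesis by blast
qed

text \<open>The domination hypothesis says that the span of the \<open>g i\<close> inherits its
  finest topology from \<open>V\<close>. It is then complete in itself, hence closed in the
  Hausdorff space \<open>V\<close>. The Cauchy filter is the trace on the span of the neighbourhoods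
  of a limit point.\<close>

lemma (in lcs) closed_range_lincomb:
  assumes H: "Hausdorff_space (topo V)" and g: "\<And>i. g i \<in> carrier V"
    and dom: "\<And>w. (\<And>i. 0 \<le> w i) \<Longrightarrow> \<exists>r\<in>cont_seminorms V. \<forall>c. wnorm w c \<le> r (lincomb V g c)"
  shows "closedin (topo V) (range (lincomb V g))"
proof -
  let ?L = "lincomb V g"
  have Lc: "?L c \<in> carrier V" for c using g by simp
  have "u \<in> range ?L" if u: "u \<in> topo V closure_of range ?L" for u
  proof -
    have uc: "u \<in> carrier V" using u by (simp add: in_closure_of)
    define F where "F = inf (nhdsin (topo V) u) (principal (range ?L))"
    have evF: "eventually P F" if "openin (topo V) U" "u \<in> U" "\<And>x. x \<in> U \<Longrightarrow> x \<in> range ?L \<Longrightarrow> P x" for P U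
      unfolding F_def eventually_inf_principal eventually_nhdsin using that by blast
    have F: "F \<noteq> bot"
    proof
      assume "F = bot"
      then have "eventually (\<lambda>_. False) F" by simp
      then obtain U where "openin (topo V) U" "u \<in> U" "\<forall>x\<in>U. x \<notin> range ?L"
        unfolding F_def eventually_inf_principal eventually_nhdsin using uc by auto
      moreover from this have "\<exists>y. y \<in> range ?L \<and> y \<in> U" using u unfolding in_closure_of by blast
      ultimately show False by blast
    qed
    define \<kappa> where "\<kappa> x = (SOME c. ?L c = x)" for x
    have \<kappa>: "?L (\<kappa> x) = x" if "x \<in> range ?L" for x
      using that unfolding \<kappa>_def by (metis (mono_tags) rangeE someI)
    have near: "\<forall>\<^sub>F x in F. x \<in> range ?L \<and> r (x \<ominus> u) < e" if re: "r \<in> cont_seminorms V" "e > 0" for r e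
    proof -
      obtain U where U: "openin (topo V) U" "u \<in> U" "U \<subseteq> {y \<in> carrier V. r (y \<ominus> u) < e}"
        using cs_ball_open[OF re uc] by blast
      show ?thesis by (rule evF[OF U(1,2)]) (use U(3) in blast)
    qed
    have "\<forall>\<^sub>F z in F \<times>\<^sub>F F. wnorm w (\<kappa> (fst z) - \<kappa> (snd z)) < e" if w: "\<And>i. 0 \<le> w i" and e: "0 < e" for w e
    proof -
      have "\<exists>r\<in>cont_seminorms V. \<forall>c. wnorm w c \<le> r (?L c)" by (rule dom) (rule w)
      then obtain r where r: "r\<in>cont_seminorms V" "\<And>c. wnorm w c \<le> r (?L c)" by auto
      note sr = cs_seminorm[OF r(1)]
      have "\<forall>\<^sub>F x in F. x \<in> range ?L \<and> r (x \<ominus> u) < e/2" by (rule near[OF r(1)]) (use e in simp)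
      moreover have "wnorm w (\<kappa> x - \<kappa> y) < e"
        if "x \<in> range ?L \<and> r (x \<ominus> u) < e/2" "y \<in> range ?L \<and> r (y \<ominus> u) < e/2" for x y
      proof -
        have c: "x \<in> carrier V" "y \<in> carrier V" using that Lc by auto
        have "wnorm w (\<kappa> x - \<kappa> y) \<le> r (?L (\<kappa> x - \<kappa> y))" by (rule r)
        also have "?L (\<kappa> x - \<kappa> y) = x \<ominus> y" using that g by (simp add: lincomb_diff \<kappa>)
        also have "r (x \<ominus> y) \<le> r (x \<ominus> u) + r (u \<ominus> y)" by (rule seminorm_triangle[OF sr c(1) uc c(2)])
        also have "r (u \<ominus> y) = r (y \<ominus> u)" by (rule seminorm_minus_commute[OF sr uc c(2)])
        finally show ?thesis using that by simp
      qed
      ultimately show ?thesis unfolding eventually_prod_same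
        by (intro exI[of _ "\<lambda>x. x \<in> range ?L \<and> r (x \<ominus> u) < e/2"]) auto
    qed
    from fine_complete[OF F, of \<kappa>, OF this] obtain \<gamma>
      where \<gamma>: "\<And>w e. (\<forall>i. 0 \<le> w i) \<Longrightarrow> 0 < e \<Longrightarrow> \<forall>\<^sub>F x in F. wnorm w (\<kappa> x - \<gamma>) < e"
      by blast
    have "limitin (topo V) (\<lambda>x. x) (?L \<gamma>) F" unfolding limitin_topo_iff
    proof (intro conjI ballI allI impI)
      fix r e assume r: "r \<in> cont_seminorms V" "(e::real) > 0"
      note sr = cs_seminorm[OF r(1)]
      have "\<forall>\<^sub>F x in F. wnorm (\<lambda>i. r (g i)) (\<kappa> x - \<gamma>) < e"
        by (rule \<gamma>) (use r(2) seminorm_onD(1)[OF sr g] in auto)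
      moreover have "\<forall>\<^sub>F x in F. x \<in> range ?L \<and> r (x \<ominus> u) < e" by (rule near[OF r])
      ultimately show "\<forall>\<^sub>F x in F. x \<in> carrier V \<and> r (x \<ominus> ?L \<gamma>) < e"
      proof eventually_elim
        case (elim x)
        have "x \<ominus> ?L \<gamma> = ?L (\<kappa> x - \<gamma>)" using elim g by (simp add: lincomb_diff \<kappa>)
        moreover have "r (?L (\<kappa> x - \<gamma>)) \<le> wnorm (\<lambda>i. r (g i)) (\<kappa> x - \<gamma>)"
          using seminorm_lincomb[OF sr, of "\<kappa> x - \<gamma>" g] g by (simp add: wnorm_def mult.commute)
        ultimately show ?case using elim Lc by auto
      qed
    qed (rule Lc)
    then have "?L \<gamma> = u" if "limitin (topo V) (\<lambda>x. x) u F"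
      by (rule limitin_Hausdorff_unique[OF _ that F H])
    moreover have "limitin (topo V) (\<lambda>x. x) u F"
      unfolding limitin_topo_iff
    proof (intro conjI ballI allI impI)
      fix r e assume r: "r \<in> cont_seminorms V" "(e::real) > 0"
      show "\<forall>\<^sub>F x in F. x \<in> carrier V \<and> r (x \<ominus> u) < e"
        using near[OF r] by (rule eventually_mono) (use Lc in auto)
    qed (rule uc)
    ultimately have "u = ?L \<gamma>" by simp
    then show ?thesis by (rule image_eqI) simp
  qed
  then have "topo V closure_of range ?L \<subseteq> range ?L" by blast
  moreover have "range ?L \<subseteq> topspace (topo V)" using Lc by auto
  ultimately show ?thesis by (simp add: closure_of_subset_eq[symmetric])
qed

section \<open>The projective tensor product\<close>

text \<open>Updating outside the keys is adding a single term, so statements about linear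
  combinations reduce to additivity and one term.\<close>

lemma pm_induct [case_names zero add]:
  assumes "P 0" "\<And>f w c. P f \<Longrightarrow> P (Poly_Mapping.single w c + f)" shows "P f"
proof (induct f rule: Poly_Mapping.update_induct)
  case (update f a b)
  have "Poly_Mapping.update a b f = Poly_Mapping.single a b + f"
    using update by (intro poly_mapping_eqI) (auto simp: lookup_update lookup_add lookup_single when_def in_keys_iff)
  then show ?case using assms(2) update by simp
qed (rule assms)

lemma free_space_simps [simp]:
  "carrier (free_space V W) = {f. Poly_Mapping.keys f \<subseteq> carrier V \<times> carrier W}"
  "zero (free_space V W) = 0" "add (free_space V W) = (+)" "smult (free_space V W) = pm_scale"
  by (simp_all add: free_space_def)

lemma free_space_cvec: "cvec (free_space V W)"
proof (rule cvecI, goal_cases)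
  case (1 x y) then show ?case using Poly_Mapping.keys_add[of x y] by auto
next
  case (6 c x) then show ?case using keys_pm_scale[of c x] by auto
qed (auto intro!: poly_mapping_eqI simp: lookup_add algebra_simps)

lemma keys_single_subset: "Poly_Mapping.keys (Poly_Mapping.single z c) \<subseteq> {z}"
  by simp

lemma keys_diff': "Poly_Mapping.keys (a - b) \<subseteq> Poly_Mapping.keys a \<union> Poly_Mapping.keys b"
  by (auto simp: in_keys_iff lookup_minus)

lemma keys_single_diff:
  "z \<in> S \<Longrightarrow> Poly_Mapping.keys f \<subseteq> S \<Longrightarrow> Poly_Mapping.keys (f - Poly_Mapping.single z a) \<subseteq> S"
  using keys_diff'[of f "Poly_Mapping.single z a"] keys_single_subset[of z a] by blast

lemma tensor_eval_lin:
  assumes "cvec U" "\<And>v w. v \<in> carrier V \<Longrightarrow> w \<in> carrier W \<Longrightarrow> \<beta> v w \<in> carrier U"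
  shows "lin_map (free_space V W) U (tensor_eval U \<beta>)"
proof -
  interpret cvec U by fact
  let ?\<beta> = "\<lambda>z. \<beta> (fst z) (snd z)"
  have c: "?\<beta> z \<in> carrier U" if "f \<in> carrier (free_space V W)" "z \<in> Poly_Mapping.keys f" for f z
    using that assms(2)[of "fst z" "snd z"] by auto
  show ?thesis unfolding tensor_eval_lincomb
  proof (rule lin_mapI)
    fix x y k assume x: "x \<in> carrier (free_space V W)" 
    show "lincomb U ?\<beta> x \<in> carrier U" by (rule lincomb_closed) (rule c[OF x])
    show "lincomb U ?\<beta> (k \<odot>\<^bsub>free_space V W\<^esub> x) = k \<odot>\<^bsub>U\<^esub> lincomb U ?\<beta> x"
      unfolding free_space_simps by (rule lincomb_scale) (rule c[OF x])
    assume y: "y \<in> carrier (free_space V W)"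
    show "lincomb U ?\<beta> (x \<oplus>\<^bsub>free_space V W\<^esub> y) = lincomb U ?\<beta> x \<oplus>\<^bsub>U\<^esub> lincomb U ?\<beta> y"
      unfolding free_space_simps by (rule lincomb_add) (use c[OF x] c[OF y] in blast)
  qed
qed

lemma cvec_tensor_eval_diff:
  fixes V :: "'u lc_alg" (structure)
  assumes V: "cvec V" and \<beta>: "\<And>v w. v \<in> S \<Longrightarrow> w \<in> T \<Longrightarrow> \<beta> v w \<in> carrier V"
    and "Poly_Mapping.keys a \<subseteq> S \<times> T" "Poly_Mapping.keys b \<subseteq> S \<times> T"
  shows "tensor_eval V \<beta> (a - b) = tensor_eval V \<beta> a \<ominus> tensor_eval V \<beta> b"
  unfolding tensor_eval_lincomb
proof (rule cvec.lincomb_diff[OF V])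
  fix i assume "i \<in> Poly_Mapping.keys a \<union> Poly_Mapping.keys b"
  then have "i \<in> S \<times> T" using assms by blast
  then show "\<beta> (fst i) (snd i) \<in> carrier V" by (intro \<beta>) (simp_all add: mem_Times_iff)
qed

locale bilinear_map = V: cvec V + W: cvec W + U: cvec U
  for V :: "'v lc_alg" and W :: "'w lc_alg" and U :: "'u lc_alg" +
  fixes \<beta> assumes closed: "\<And>v w. v \<in> carrier V \<Longrightarrow> w \<in> carrier W \<Longrightarrow> \<beta> v w \<in> carrier U"
    and add_left: "\<And>v v' w. v \<in> carrier V \<Longrightarrow> v' \<in> carrier V \<Longrightarrow> w \<in> carrier W \<Longrightarrow>
      \<beta> (v \<oplus>\<^bsub>V\<^esub> v') w = \<beta> v w \<oplus>\<^bsub>U\<^esub> \<beta> v' w"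
    and add_right: "\<And>v w w'. v \<in> carrier V \<Longrightarrow> w \<in> carrier W \<Longrightarrow> w' \<in> carrier W \<Longrightarrow>
      \<beta> v (w \<oplus>\<^bsub>W\<^esub> w') = \<beta> v w \<oplus>\<^bsub>U\<^esub> \<beta> v w'"
    and smul_left: "\<And>c v w. v \<in> carrier V \<Longrightarrow> w \<in> carrier W \<Longrightarrow> \<beta> (c \<odot>\<^bsub>V\<^esub> v) w = c \<odot>\<^bsub>U\<^esub> \<beta> v w"
    and smul_right: "\<And>c v w. v \<in> carrier V \<Longrightarrow> w \<in> carrier W \<Longrightarrow> \<beta> v (c \<odot>\<^bsub>W\<^esub> w) = c \<odot>\<^bsub>U\<^esub> \<beta> v w"
begin

lemma zero_left: "w \<in> carrier W \<Longrightarrow> \<beta> \<zero>\<^bsub>V\<^esub> w = \<zero>\<^bsub>U\<^esub>"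
  using smul_left[of "\<zero>\<^bsub>V\<^esub>" w 0] closed[of "\<zero>\<^bsub>V\<^esub>" w] by simp

lemma zero_right: "v \<in> carrier V \<Longrightarrow> \<beta> v \<zero>\<^bsub>W\<^esub> = \<zero>\<^bsub>U\<^esub>"
  using smul_right[of v "\<zero>\<^bsub>W\<^esub>" 0] closed[of v "\<zero>\<^bsub>W\<^esub>"] by simp

lemma lin_right: "v \<in> carrier V \<Longrightarrow> lin_map W U (\<beta> v)"
  by (rule lin_mapI) (simp_all add: closed add_right smul_right)

text \<open>The universal property of the algebraic tensor product at the level of formal sums: the
  kernel of \<open>tensor_eval U \<beta>\<close> is a subspace containing the four kinds of
  generating relations.\<close>

lemma relations_vanish:
  assumes "f \<in> bilinear_relations V W" shows "tensor_eval U \<beta> f = \<zero>\<^bsub>U\<^esub>"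
proof -
  interpret FS: cvec "free_space V W" by (rule free_space_cvec)
  interpret cvec_lin "free_space V W" U "tensor_eval U \<beta>"
    by unfold_locales (rule tensor_eval_lin[OF U.cvec_axioms closed])
  have sm: "submodule {f \<in> carrier (free_space V W). tensor_eval U \<beta> f = \<zero>\<^bsub>U\<^esub>} CC (free_space V W)"
  proof (rule FS.submoduleI', goal_cases)
    case (3 a b) then show ?case using linD(2)[of a b] FS.a_closed[of a b] by auto
  next
    case (4 c a) then show ?case using linD(3)[of a c] FS.smul_closed[of a c] by auto
  qed (use map_zero in auto)
  have s: "tensor_eval U \<beta> (Poly_Mapping.single (v, w) c) = c \<odot>\<^bsub>U\<^esub> \<beta> v w"
    if "v \<in> carrier V" "w \<in> carrier W" for v w c
    using that closed by (simp add: tensor_eval_lincomb U.lincomb_single)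
  have d: "tensor_eval U \<beta> (a - b) = tensor_eval U \<beta> a \<ominus>\<^bsub>U\<^esub> tensor_eval U \<beta> b"
    if "Poly_Mapping.keys a \<subseteq> carrier V \<times> carrier W" "Poly_Mapping.keys b \<subseteq> carrier V \<times> carrier W" for a b
    by (rule cvec_tensor_eval_diff[OF U.cvec_axioms closed that])
  have "bilinear_relations V W \<subseteq> {f \<in> carrier (free_space V W). tensor_eval U \<beta> f = \<zero>\<^bsub>U\<^esub>}"
    unfolding bilinear_relations_def
  proof (rule FS.cspan_least[OF sm], intro Un_least subsetI, goal_cases)
    case (1 f)
    then obtain v v' w where f: "f = Poly_Mapping.single (v \<oplus>\<^bsub>V\<^esub> v', w) 1 - Poly_Mapping.single (v, w) 1
         - Poly_Mapping.single (v', w) 1" "v \<in> carrier V" "v' \<in> carrier V" "w \<in> carrier W" by blast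
    have "tensor_eval U \<beta> f = (\<beta> v w \<oplus>\<^bsub>U\<^esub> \<beta> v' w) \<ominus>\<^bsub>U\<^esub> \<beta> v w \<ominus>\<^bsub>U\<^esub> \<beta> v' w"
      unfolding f(1) using f(2-) closed by (simp add: d s add_left keys_single_diff)
    also have "\<dots> = \<zero>\<^bsub>U\<^esub>" using f(2-) closed
      by (simp add: a_minus_def U.a_ac U.r_neg U.r_neg1 U.r_neg2)
    finally show ?case using f(2-) by (simp add: f(1) keys_single_diff)
  next
    case (2 f)
    then obtain v w w' where f: "f = Poly_Mapping.single (v, w \<oplus>\<^bsub>W\<^esub> w') 1 - Poly_Mapping.single (v, w) 1
         - Poly_Mapping.single (v, w') 1" "v \<in> carrier V" "w' \<in> carrier W" "w \<in> carrier W" by blast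
    have "tensor_eval U \<beta> f = (\<beta> v w \<oplus>\<^bsub>U\<^esub> \<beta> v w') \<ominus>\<^bsub>U\<^esub> \<beta> v w \<ominus>\<^bsub>U\<^esub> \<beta> v w'"
      unfolding f(1) using f(2-) closed by (simp add: d s add_right keys_single_diff)
    also have "\<dots> = \<zero>\<^bsub>U\<^esub>" using f(2-) closed
      by (simp add: a_minus_def U.a_ac U.r_neg U.r_neg1 U.r_neg2)
    finally show ?case using f(2-) by (simp add: f(1) keys_single_diff)
  next
    case (3 f)
    then obtain c v w where f: "f = Poly_Mapping.single (c \<odot>\<^bsub>V\<^esub> v, w) 1 - Poly_Mapping.single (v, w) c"
      "v \<in> carrier V" "w \<in> carrier W" by blast
    have "tensor_eval U \<beta> f = \<zero>\<^bsub>U\<^esub>"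
      unfolding f(1) using f(2-) closed
      by (simp add: d s smul_left U.minus_self keys_single_diff)
    then show ?case using f(2-) by (simp add: f(1) keys_single_diff)
  next
    case (4 f)
    then obtain c v w where f: "f = Poly_Mapping.single (v, c \<odot>\<^bsub>W\<^esub> w) 1 - Poly_Mapping.single (v, w) c"
      "v \<in> carrier V" "w \<in> carrier W" by blast
    have "tensor_eval U \<beta> f = \<zero>\<^bsub>U\<^esub>"
      unfolding f(1) using f(2-) closed
      by (simp add: d s smul_right U.minus_self keys_single_diff)
    then show ?case using f(2-) by (simp add: f(1) keys_single_diff)
  qed
  then show ?thesis using assms by blast
qed

end

section \<open>Realizations of the completed tensor product\<close>

locale tensor = V: lcs V + W: lcs W for V :: "'v lc_alg" and W :: "'w lc_alg" +
  fixes X :: "'x lc_alg" and \<tau> :: "'v \<Rightarrow> 'w \<Rightarrow> 'x"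
  assumes tens: "completed_projective_tensor V W X \<tau>"
begin

sublocale X: lcs X
  using tens by (simp add: completed_projective_tensor_def lcs_iff)

lemma tau_closed [simp]: "v \<in> carrier V \<Longrightarrow> w \<in> carrier W \<Longrightarrow> \<tau> v w \<in> carrier X"
  using tens by (simp add: completed_projective_tensor_def)

lemma tau_kernel:
  "f \<in> carrier (free_space V W) \<Longrightarrow> tensor_eval X \<tau> f = \<zero>\<^bsub>X\<^esub> \<longleftrightarrow> f \<in> bilinear_relations V W"
  using tens by (simp add: completed_projective_tensor_def)

sublocale E: cvec_lin "free_space V W" X "tensor_eval X \<tau>"
  by (intro cvec_lin.intro cvec_lin_axioms.intro free_space_cvec X.cvec_axioms tensor_eval_lin tau_closed)

lemma tensor_eval_single:
  "v \<in> carrier V \<Longrightarrow> w \<in> carrier W \<Longrightarrow> tensor_eval X \<tau> (Poly_Mapping.single (v, w) c) = c \<odot>\<^bsub>X\<^esub> \<tau> v w"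
  by (simp add: tensor_eval_lincomb X.lincomb_single)

lemma tensor_eval_diff:
  assumes "Poly_Mapping.keys a \<subseteq> carrier V \<times> carrier W" "Poly_Mapping.keys b \<subseteq> carrier V \<times> carrier W"
  shows "tensor_eval X \<tau> (a - b) = tensor_eval X \<tau> a \<ominus>\<^bsub>X\<^esub> tensor_eval X \<tau> b"
  by (rule cvec_tensor_eval_diff[OF X.cvec_axioms tau_closed assms])

text \<open>Bilinearity of \<tau> is contained in the kernel condition: each defining relation is
  sent to zero.\<close>

sublocale bilinear_map V W X \<tau>
proof (intro bilinear_map.intro bilinear_map_axioms.intro V.cvec_axioms W.cvec_axioms X.cvec_axioms tau_closed)
  have rel: "f \<in> R \<Longrightarrow> f \<in> cspan (free_space V W) R" for f R
    using E.V.cspan_superset by blast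
  fix v v' w w' c assume v: "v \<in> carrier V" and w: "w \<in> carrier W"
  {
    let ?f = "Poly_Mapping.single (c \<odot>\<^bsub>V\<^esub> v, w) 1 - Poly_Mapping.single (v, w) c"
    have "tensor_eval X \<tau> ?f = \<zero>\<^bsub>X\<^esub>"
      using v w by (subst tau_kernel) (simp add: keys_single_diff, unfold bilinear_relations_def, rule rel, blast)
    moreover have "tensor_eval X \<tau> ?f = \<tau> (c \<odot>\<^bsub>V\<^esub> v) w \<ominus>\<^bsub>X\<^esub> c \<odot>\<^bsub>X\<^esub> \<tau> v w"
      using v w by (simp add: tensor_eval_diff tensor_eval_single keys_single_diff)
    ultimately show "\<tau> (c \<odot>\<^bsub>V\<^esub> v) w = c \<odot>\<^bsub>X\<^esub> \<tau> v w"
      using v w by - (rule X.minus_eq_zeroD, simp_all)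
  }
  {
    let ?f = "Poly_Mapping.single (v, c \<odot>\<^bsub>W\<^esub> w) 1 - Poly_Mapping.single (v, w) c"
    have "tensor_eval X \<tau> ?f = \<zero>\<^bsub>X\<^esub>"
      using v w by (subst tau_kernel) (simp add: keys_single_diff, unfold bilinear_relations_def, rule rel, blast)
    moreover have "tensor_eval X \<tau> ?f = \<tau> v (c \<odot>\<^bsub>W\<^esub> w) \<ominus>\<^bsub>X\<^esub> c \<odot>\<^bsub>X\<^esub> \<tau> v w"
      using v w by (simp add: tensor_eval_diff tensor_eval_single keys_single_diff)
    ultimately show "\<tau> v (c \<odot>\<^bsub>W\<^esub> w) = c \<odot>\<^bsub>X\<^esub> \<tau> v w"
      using v w by - (rule X.minus_eq_zeroD, simp_all)
  }
  have swap: "a = b \<oplus>\<^bsub>X\<^esub> c" if "a \<ominus>\<^bsub>X\<^esub> b \<ominus>\<^bsub>X\<^esub> c = \<zero>\<^bsub>X\<^esub>" "a \<in> carrier X" "b \<in> carrier X" "c \<in> carrier X" for a b c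
    using that X.minus_eq_zeroD[of "a \<ominus>\<^bsub>X\<^esub> b" c] X.add_minus_cancel[of a b] by simp
  {
    assume v': "v' \<in> carrier V"
    let ?f = "Poly_Mapping.single (v \<oplus>\<^bsub>V\<^esub> v', w) 1 - Poly_Mapping.single (v, w) 1
         - Poly_Mapping.single (v', w) 1"
    have "tensor_eval X \<tau> ?f = \<zero>\<^bsub>X\<^esub>"
      using v w v' by (subst tau_kernel) (simp add: keys_single_diff, unfold bilinear_relations_def, rule rel, blast)
    moreover have "tensor_eval X \<tau> ?f = \<tau> (v \<oplus>\<^bsub>V\<^esub> v') w \<ominus>\<^bsub>X\<^esub> \<tau> v w \<ominus>\<^bsub>X\<^esub> \<tau> v' w"
      using v w v' by (simp add: tensor_eval_diff tensor_eval_single keys_single_diff)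
    ultimately show "\<tau> (v \<oplus>\<^bsub>V\<^esub> v') w = \<tau> v w \<oplus>\<^bsub>X\<^esub> \<tau> v' w"
      using v w v' by - (rule swap, simp_all)
  }
  {
    assume v': "w' \<in> carrier W"
    let ?f = "Poly_Mapping.single (v, w \<oplus>\<^bsub>W\<^esub> w') 1 - Poly_Mapping.single (v, w) 1
         - Poly_Mapping.single (v, w') 1"
    have "tensor_eval X \<tau> ?f = \<zero>\<^bsub>X\<^esub>"
      using v w v' by (subst tau_kernel) (simp add: keys_single_diff, unfold bilinear_relations_def, rule rel, blast)
    moreover have "tensor_eval X \<tau> ?f = \<tau> v (w \<oplus>\<^bsub>W\<^esub> w') \<ominus>\<^bsub>X\<^esub> \<tau> v w \<ominus>\<^bsub>X\<^esub> \<tau> v w'"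
      using v w v' by (simp add: tensor_eval_diff tensor_eval_single keys_single_diff)
    ultimately show "\<tau> v (w \<oplus>\<^bsub>W\<^esub> w') = \<tau> v w \<oplus>\<^bsub>X\<^esub> \<tau> v w'"
      using v w v' by - (rule swap, simp_all)
  }
qed

section \<open>The algebraic tensor product and lower bounds for its seminorms\<close>

abbreviation "D \<equiv> tensor_eval X \<tau> ` carrier (free_space V W)"

lemma D_submodule: "submodule D CC X"
proof (rule X.submoduleI')
  show "D \<subseteq> carrier X" using E.linD(1) by blast
  show "\<zero>\<^bsub>X\<^esub> \<in> D" using E.map_zero E.V.zero_closed by (metis image_eqI)
next
  fix a b c assume "a \<in> D"
  then obtain f where f: "f \<in> carrier (free_space V W)" "a = tensor_eval X \<tau> f" by blast
  show "c \<odot>\<^bsub>X\<^esub> a \<in> D"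
    using E.linD(3)[OF f(1), of c] E.V.smul_closed[OF f(1), of c] f(2) by (metis image_eqI)
  assume "b \<in> D"
  then obtain g where g: "g \<in> carrier (free_space V W)" "b = tensor_eval X \<tau> g" by blast
  show "a \<oplus>\<^bsub>X\<^esub> b \<in> D"
    using E.linD(2)[OF f(1) g(1)] E.V.a_closed[OF f(1) g(1)] f(2) g(2) by (metis image_eqI)
qed

lemma tau_in_D: "v \<in> carrier V \<Longrightarrow> w \<in> carrier W \<Longrightarrow> \<tau> v w \<in> D"
  by (rule image_eqI[of _ _ "Poly_Mapping.single (v, w) 1"]) (simp_all add: tensor_eval_single)

text \<open>A bilinear map factors through the algebraic tensor product; stating this for two formal
  sums with the same tensor avoids introducing a map on \<open>D\<close>.\<close>

lemma tensor_functional: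
  assumes "bilinear_map V W U \<beta>" and f: "f \<in> carrier (free_space V W)" and g: "g \<in> carrier (free_space V W)"
    and eq: "tensor_eval X \<tau> f = tensor_eval X \<tau> g"
  shows "tensor_eval U \<beta> f = tensor_eval U \<beta> g"
proof -
  interpret B: bilinear_map V W U \<beta> by fact
  interpret EB: cvec_lin "free_space V W" U "tensor_eval U \<beta>"
    by (intro cvec_lin.intro cvec_lin_axioms.intro free_space_cvec B.U.cvec_axioms tensor_eval_lin B.closed)
  have c: "f \<ominus>\<^bsub>free_space V W\<^esub> g \<in> carrier (free_space V W)" using f g by (rule E.V.minus_closed')
  have "tensor_eval X \<tau> (f \<ominus>\<^bsub>free_space V W\<^esub> g) = \<zero>\<^bsub>X\<^esub>"
    using E.map_minus[OF f g] eq E.linD(1)[OF g] by (simp add: X.minus_self)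
  then have "f \<ominus>\<^bsub>free_space V W\<^esub> g \<in> bilinear_relations V W" using tau_kernel[OF c] by simp
  then have "tensor_eval U \<beta> (f \<ominus>\<^bsub>free_space V W\<^esub> g) = \<zero>\<^bsub>U\<^esub>" by (rule B.relations_vanish)
  then show ?thesis
    using EB.map_minus[OF f g] EB.linD(1)[OF f] EB.linD(1)[OF g] by - (rule B.U.minus_eq_zeroD, simp_all)
qed

lemma functional_bilinear:
  fixes \<phi> :: "'v \<Rightarrow> complex"
  assumes "\<And>v v'. v \<in> carrier V \<Longrightarrow> v' \<in> carrier V \<Longrightarrow> \<phi> (v \<oplus>\<^bsub>V\<^esub> v') = \<phi> v + \<phi> v'"
    and "\<And>c v. v \<in> carrier V \<Longrightarrow> \<phi> (c \<odot>\<^bsub>V\<^esub> v) = c * \<phi> v"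
  shows "bilinear_map V W W (\<lambda>v w. \<phi> v \<odot>\<^bsub>W\<^esub> w)"
  by unfold_locales
     (use assms in \<open>simp_all add: W.smul_add_left W.smul_add_right W.smul_smul mult.commute\<close>)

text \<open>Slicing by functionals whose absolute values sum up to at most \<open>p\<close> gives an
  estimate for every representation of the tensor, hence for the infimum. The family is summed,
  rather than treated one functional at a time, because all matrix entries will have to be
  controlled together.\<close>

lemma projective_seminorm_ge:
  fixes \<phi> :: "'k \<Rightarrow> 'v \<Rightarrow> complex"
  assumes S: "finite S"
    and add: "\<And>k v v'. v \<in> carrier V \<Longrightarrow> v' \<in> carrier V \<Longrightarrow> \<phi> k (v \<oplus>\<^bsub>V\<^esub> v') = \<phi> k v + \<phi> k v'"
    and smul: "\<And>k c v. v \<in> carrier V \<Longrightarrow> \<phi> k (c \<odot>\<^bsub>V\<^esub> v) = c * \<phi> k v"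
    and le: "\<And>v. v \<in> carrier V \<Longrightarrow> (\<Sum>k\<in>S. cmod (\<phi> k v)) \<le> p v"
    and q: "seminorm_on W q"
    and f: "f \<in> carrier (free_space V W)"
  shows "(\<Sum>k\<in>S. q (tensor_eval W (\<lambda>v w. \<phi> k v \<odot>\<^bsub>W\<^esub> w) f))
    \<le> projective_seminorm V W X \<tau> p q (tensor_eval X \<tau> f)"
  unfolding projective_seminorm_def
proof (rule cInf_greatest)
  let ?N = "\<lambda>g. \<Sum>z\<in>Poly_Mapping.keys g. cmod (Poly_Mapping.lookup g z) * p (fst z) * q (snd z)"
  show "{?N g |g. g \<in> carrier (free_space V W) \<and> tensor_eval X \<tau> g = tensor_eval X \<tau> f} \<noteq> {}" using f by blast
  fix x assume "x \<in> {?N g |g. g \<in> carrier (free_space V W) \<and> tensor_eval X \<tau> g = tensor_eval X \<tau> f}"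
  then obtain g where x: "x = ?N g" and g: "g \<in> carrier (free_space V W)" "tensor_eval X \<tau> g = tensor_eval X \<tau> f"
    by blast
  have kc: "fst z \<in> carrier V" "snd z \<in> carrier W" if "z \<in> Poly_Mapping.keys g" for z
    using that g(1) by auto
  have "(\<Sum>k\<in>S. q (tensor_eval W (\<lambda>v w. \<phi> k v \<odot>\<^bsub>W\<^esub> w) f))
      = (\<Sum>k\<in>S. q (tensor_eval W (\<lambda>v w. \<phi> k v \<odot>\<^bsub>W\<^esub> w) g))"
  proof (rule sum.cong[OF refl])
    fix k
    have bil: "bilinear_map V W W (\<lambda>v w. \<phi> k v \<odot>\<^bsub>W\<^esub> w)"
      by (rule functional_bilinear) (simp_all add: add smul)
    show "q (tensor_eval W (\<lambda>v w. \<phi> k v \<odot>\<^bsub>W\<^esub> w) f) = q (tensor_eval W (\<lambda>v w. \<phi> k v \<odot>\<^bsub>W\<^esub> w) g)"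
      by (rule arg_cong[OF tensor_functional[OF bil f g(1) g(2)[symmetric]]])
  qed
  also have "\<dots> \<le> (\<Sum>k\<in>S. \<Sum>z\<in>Poly_Mapping.keys g.
      cmod (Poly_Mapping.lookup g z) * (cmod (\<phi> k (fst z)) * q (snd z)))"
  proof (rule sum_mono)
    fix k
    have "q (tensor_eval W (\<lambda>v w. \<phi> k v \<odot>\<^bsub>W\<^esub> w) g) \<le>
      (\<Sum>z\<in>Poly_Mapping.keys g. cmod (Poly_Mapping.lookup g z) * q (\<phi> k (fst z) \<odot>\<^bsub>W\<^esub> snd z))"
      unfolding tensor_eval_lincomb by (rule W.seminorm_lincomb[OF q]) (use kc in simp)
    then show "q (tensor_eval W (\<lambda>v w. \<phi> k v \<odot>\<^bsub>W\<^esub> w) g) \<le> (\<Sum>z\<in>Poly_Mapping.keys g.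
      cmod (Poly_Mapping.lookup g z) * (cmod (\<phi> k (fst z)) * q (snd z)))"
      using kc by (simp add: seminorm_onD(3)[OF q])
  qed
  also have "\<dots> = (\<Sum>z\<in>Poly_Mapping.keys g.
      cmod (Poly_Mapping.lookup g z) * (\<Sum>k\<in>S. cmod (\<phi> k (fst z))) * q (snd z))"
    by (subst sum.swap) (simp add: sum_distrib_left sum_distrib_right mult.assoc)
  also have "\<dots> \<le> x" unfolding x
    by (intro sum_mono mult_right_mono mult_left_mono le) (use kc seminorm_onD(1)[OF q] in auto)
  finally show "(\<Sum>k\<in>S. q (tensor_eval W (\<lambda>v w. \<phi> k v \<odot>\<^bsub>W\<^esub> w) f)) \<le> x" .
qed

text \<open>Projective seminorms live on \<open>D\<close>. The unit ball of one of them is the trace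
  of an open set of \<open>X\<close>, which contains an \<open>e\<close>-ball of some continuous
  seminorm \<open>r\<close> of \<open>X\<close>; homogeneity of \<open>N\<close> turns this
  inclusion into the estimate of \<open>N\<close> by r / e.\<close>

lemma projective_dominated:
  fixes g :: "'i \<Rightarrow> 'x"
  assumes p: "p \<in> cont_seminorms V" and q: "q \<in> cont_seminorms W"
    and gD: "\<And>i. g i \<in> D"
    and hom: "\<And>k c. N (pm_scale k c) = cmod k * N c"
    and le: "\<And>c. N c \<le> projective_seminorm V W X \<tau> p q (lincomb X g c)"
  shows "\<exists>r\<in>cont_seminorms X. \<forall>c. N c \<le> r (lincomb X g c)"
proof -
  let ?L = "lincomb X g"
  define \<pi> where "\<pi> = projective_seminorm V W X \<tau> p q"
  note sp = V.cs_seminorm[OF p] and sq = W.cs_seminorm[OF q]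
  have gX: "g i \<in> carrier X" for i using X.in_carrierD[OF D_submodule gD] .
  have LD: "?L c \<in> D" for c by (rule X.lincomb_in_submodule[OF D_submodule gD])
  have Lc: "?L c \<in> carrier X" for c using gX by simp
  have 0: "\<zero>\<^bsub>X\<^esub> \<in> D" using X.submoduleD(2)[OF D_submodule] .
  have sub: "x \<ominus>\<^bsub>subobject X D\<^esub> \<zero>\<^bsub>X\<^esub> = x" if "x \<in> D" for x
    using X.subobject_minus[OF D_submodule that 0] X.in_carrierD[OF D_submodule that] by (simp add: X.minus_zero)
  let ?B = "{y \<in> carrier (subobject X D). \<pi> (y \<ominus>\<^bsub>subobject X D\<^esub> \<zero>\<^bsub>X\<^esub>) < 1}"
  \<comment> \<open>The empty formal sum represents \<zero> and has the value 0.\<close>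
  have "\<pi> \<zero>\<^bsub>X\<^esub> \<le> 0"
    unfolding \<pi>_def projective_seminorm_def
  proof (rule cInf_lower)
    show "0 \<in> {\<Sum>z\<in>Poly_Mapping.keys f. cmod (Poly_Mapping.lookup f z) * p (fst z) * q (snd z)
          |f. f \<in> carrier (free_space V W) \<and> tensor_eval X \<tau> f = \<zero>\<^bsub>X\<^esub>}"
      using E.map_zero by (intro CollectI exI[of _ 0]) simp
    show "bdd_below {\<Sum>z\<in>Poly_Mapping.keys f. cmod (Poly_Mapping.lookup f z) * p (fst z) * q (snd z)
          |f. f \<in> carrier (free_space V W) \<and> tensor_eval X \<tau> f = \<zero>\<^bsub>X\<^esub>}"
      by (rule bdd_belowI[of _ 0])
         (auto intro!: sum_nonneg mult_nonneg_nonneg seminorm_onD(1)[OF sp] seminorm_onD(1)[OF sq])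
  qed
  then have 0: "\<zero>\<^bsub>X\<^esub> \<in> ?B" using 0 sub by simp
  have "openin (subtopology (topo X) D) ?B"
  proof -
    have "subtopology (topo X) D = seminorm_topology (subobject X D)
          {projective_seminorm V W X \<tau> p q |p q. p \<in> cont_seminorms V \<and> q \<in> cont_seminorms W}"
      using tens by (simp add: completed_projective_tensor_def Let_def)
    moreover have "openin (seminorm_topology (subobject X D)
          {projective_seminorm V W X \<tau> p q |p q. p \<in> cont_seminorms V \<and> q \<in> cont_seminorms W}) ?B"
      unfolding seminorm_topology_def
    proof (rule topology_generated_by_Basis, rule insertI2, rule CollectI,
        rule exI[of _ \<pi>], rule exI[of _ "\<zero>\<^bsub>X\<^esub>"], rule exI[of _ 1], intro conjI)
      show "\<pi> \<in> {projective_seminorm V W X \<tau> p q |p q. p \<in> cont_seminorms V \<and> q \<in> cont_seminorms W}"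
        unfolding \<pi>_def using p q by blast
      show "\<zero>\<^bsub>X\<^esub> \<in> carrier (subobject X D)" using 0 by simp
    qed simp_all
    ultimately show ?thesis by simp
  qed
  then obtain T where T: "openin (topo X) T" "?B = T \<inter> D" by (auto simp: openin_subtopology)
  have "\<zero>\<^bsub>X\<^esub> \<in> T" using 0 T(2) by blast
  then obtain r e where r: "r\<in>cont_seminorms X" "e>0" "{y \<in> carrier X. r (y \<ominus>\<^bsub>X\<^esub> \<zero>\<^bsub>X\<^esub>) < e} \<subseteq> T"
    using T(1) unfolding X.openin_topo_iff by meson
  note sr = X.cs_seminorm[OF r(1)]
  have "N c \<le> 1/e * r (?L c)" for c
  proof (rule ccontr)
    assume "\<not> N c \<le> 1/e * r (?L c)"
    then have lt: "r (?L c) < e * N c" using r(2) by (simp add: field_simps)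
    then have N: "0 < N c" using seminorm_onD(1)[OF sr Lc, of c] r(2) by (smt (verit) zero_less_mult_pos)
    \<comment> \<open>Scaling by 1 / N c produces a vector in the ball of \<open>r\<close> at which
      \<open>N\<close> has the value 1, although \<open>N\<close> is below 1 on the ball of
      \<open>\<pi>\<close>.\<close>
    define k where "k = complex_of_real (1 / N c)"
    have k: "cmod k = 1 / N c" using N by (simp add: k_def norm_divide)
    have "r (?L (pm_scale k c)) = 1 / N c * r (?L c)"
      using X.lincomb_scale[of c g k] gX seminorm_onD(3)[OF sr Lc, of k c] k by simp
    also have "\<dots> < e" using lt N by (simp add: field_simps)
    finally have "?L (pm_scale k c) \<in> T" using Lc by (intro subsetD[OF r(3)]) (simp add: X.minus_zero)
    then have "?L (pm_scale k c) \<in> ?B" using T(2) LD by blast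
    then have "\<pi> (?L (pm_scale k c)) < 1" using sub LD by simp
    then have "N (pm_scale k c) < 1" using le[of "pm_scale k c"] by (simp add: \<pi>_def)
    then show False using N k by (simp add: hom)
  qed
  moreover have "(\<lambda>x. 1/e * r x) \<in> cont_seminorms X" by (rule X.cs_scale) (use r in auto)
  ultimately show ?thesis by (intro bexI[of _ "\<lambda>x. 1/e * r x"] allI)
qed

text \<open>Different indices may give the same pair (v i, b i), so the formal sum is built by
  induction on \<open>c\<close>, where coefficients merge by themselves. One \<open>f\<close> works
  for all \<open>\<beta>\<close>, since it is evaluated under \<tau> and under slices.\<close>

lemma lincomb_tensor_lift:
  fixes v :: "'i \<Rightarrow> 'v" and b :: "'i \<Rightarrow> 'w" and U :: "'u lc_alg"
  assumes "cvec U" and v: "\<And>i. v i \<in> carrier V" and b: "\<And>i. b i \<in> carrier W"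
  shows "\<exists>f\<in>carrier (free_space V W). tensor_eval X \<tau> f = lincomb X (\<lambda>i. \<tau> (v i) (b i)) c \<and>
    (\<forall>\<beta>. (\<forall>v\<in>carrier V. \<forall>w\<in>carrier W. \<beta> v w \<in> carrier U) \<longrightarrow>
      tensor_eval U \<beta> f = lincomb U (\<lambda>i. \<beta> (v i) (b i)) c)"
proof (induct c rule: pm_induct)
  case zero
  interpret U: cvec U by fact
  show ?case by (rule bexI[of _ 0]) (simp_all add: tensor_eval_lincomb)
next
  case (add c i k)
  interpret U: cvec U by fact
  obtain f where f: "f \<in> carrier (free_space V W)" "tensor_eval X \<tau> f = lincomb X (\<lambda>i. \<tau> (v i) (b i)) c"
    "\<And>\<beta>. (\<forall>v\<in>carrier V. \<forall>w\<in>carrier W. \<beta> v w \<in> carrier U) \<Longrightarrow> tensor_eval U \<beta> f = lincomb U (\<lambda>i. \<beta> (v i) (b i)) c"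
    using add by blast
  let ?s = "Poly_Mapping.single (v i, b i) k"
  have s: "?s \<in> carrier (free_space V W)" using v b by auto
  have sum: "?s + f \<in> carrier (free_space V W)" using E.V.a_closed[OF s f(1)] by simp
  show ?case
  proof (rule bexI[OF _ sum], intro conjI allI impI)
    show "tensor_eval X \<tau> (?s + f) = lincomb X (\<lambda>i. \<tau> (v i) (b i)) (Poly_Mapping.single i k + c)"
      using E.linD(2)[OF s f(1)] v b by (simp add: f(2) X.lincomb_add X.lincomb_single tensor_eval_single)
    fix \<beta> assume \<beta>: "\<forall>v\<in>carrier V. \<forall>w\<in>carrier W. \<beta> v w \<in> carrier U"
    have "lin_map (free_space V W) U (tensor_eval U \<beta>)" by (rule tensor_eval_lin) (use assms(1) \<beta> in auto)
    then have "tensor_eval U \<beta> (?s + f) = tensor_eval U \<beta> ?s \<oplus>\<^bsub>U\<^esub> tensor_eval U \<beta> f"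
      using lin_mapD(2)[of "free_space V W" U _ ?s f] s f(1) by simp
    also have "\<dots> = k \<odot>\<^bsub>U\<^esub> \<beta> (v i) (b i) \<oplus>\<^bsub>U\<^esub> lincomb U (\<lambda>i. \<beta> (v i) (b i)) c"
      using f(3)[OF \<beta>] v b \<beta> by (simp add: tensor_eval_lincomb U.lincomb_single)
    also have "\<dots> = lincomb U (\<lambda>i. \<beta> (v i) (b i)) (Poly_Mapping.single i k + c)"
      using v b \<beta> by (simp add: U.lincomb_add U.lincomb_single)
    finally show "tensor_eval U \<beta> (?s + f) = lincomb U (\<lambda>i. \<beta> (v i) (b i)) (Poly_Mapping.single i k + c)" .
  qed
qed

lemma lincomb_functional_zero:
  assumes v: "\<And>i. v i \<in> carrier V" and b: "\<And>i. b i \<in> carrier W"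
    and \<phi>: "\<And>v v'. v \<in> carrier V \<Longrightarrow> v' \<in> carrier V \<Longrightarrow> \<phi> (v \<oplus>\<^bsub>V\<^esub> v') = \<phi> v + \<phi> v'"
      "\<And>c v. v \<in> carrier V \<Longrightarrow> \<phi> (c \<odot>\<^bsub>V\<^esub> v) = c * \<phi> v"
    and zero: "lincomb X (\<lambda>i. \<tau> (v i) (b i)) c = \<zero>\<^bsub>X\<^esub>"
  shows "lincomb W (\<lambda>i. \<phi> (v i) \<odot>\<^bsub>W\<^esub> b i) c = \<zero>\<^bsub>W\<^esub>"
proof -
  obtain f where f: "f \<in> carrier (free_space V W)" "tensor_eval X \<tau> f = lincomb X (\<lambda>i. \<tau> (v i) (b i)) c"
    "\<And>\<beta>. (\<forall>v\<in>carrier V. \<forall>w\<in>carrier W. \<beta> v w \<in> carrier W) \<Longrightarrow> tensor_eval W \<beta> f = lincomb W (\<lambda>i. \<beta> (v i) (b i)) c"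
    using lincomb_tensor_lift[where c=c and v=v and b=b, OF W.cvec_axioms v b] by blast
  have bil: "bilinear_map V W W (\<lambda>v w. \<phi> v \<odot>\<^bsub>W\<^esub> w)" by (rule functional_bilinear) (simp_all add: \<phi>)
  have "f \<in> bilinear_relations V W" using tau_kernel[OF f(1)] f(2) zero by simp
  then have "tensor_eval W (\<lambda>v w. \<phi> v \<odot>\<^bsub>W\<^esub> w) f = \<zero>\<^bsub>W\<^esub>" by (rule bilinear_map.relations_vanish[OF bil])
  then show ?thesis using f(3)[of "\<lambda>v w. \<phi> v \<odot>\<^bsub>W\<^esub> w"] by simp
qed

lemma lincomb_projective_ge:
  fixes \<phi> :: "'k \<Rightarrow> 'v \<Rightarrow> complex"
  assumes v: "\<And>i. v i \<in> carrier V" and b: "\<And>i. b i \<in> carrier W"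
    and S: "finite S"
    and add: "\<And>k v v'. v \<in> carrier V \<Longrightarrow> v' \<in> carrier V \<Longrightarrow> \<phi> k (v \<oplus>\<^bsub>V\<^esub> v') = \<phi> k v + \<phi> k v'"
    and smul: "\<And>k c v. v \<in> carrier V \<Longrightarrow> \<phi> k (c \<odot>\<^bsub>V\<^esub> v) = c * \<phi> k v"
    and le: "\<And>v. v \<in> carrier V \<Longrightarrow> (\<Sum>k\<in>S. cmod (\<phi> k v)) \<le> p v"
    and q: "seminorm_on W q"
  shows "(\<Sum>k\<in>S. q (lincomb W (\<lambda>i. \<phi> k (v i) \<odot>\<^bsub>W\<^esub> b i) c))
    \<le> projective_seminorm V W X \<tau> p q (lincomb X (\<lambda>i. \<tau> (v i) (b i)) c)"
proof -
  obtain f where f: "f \<in> carrier (free_space V W)" "tensor_eval X \<tau> f = lincomb X (\<lambda>i. \<tau> (v i) (b i)) c"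
    "\<And>\<beta>. (\<forall>v\<in>carrier V. \<forall>w\<in>carrier W. \<beta> v w \<in> carrier W) \<Longrightarrow> tensor_eval W \<beta> f = lincomb W (\<lambda>i. \<beta> (v i) (b i)) c"
    using lincomb_tensor_lift[where c=c and v=v and b=b, OF W.cvec_axioms v b] by blast
  have e: "tensor_eval W (\<lambda>v w. \<phi> k v \<odot>\<^bsub>W\<^esub> w) f = lincomb W (\<lambda>i. \<phi> k (v i) \<odot>\<^bsub>W\<^esub> b i) c" for k
    by (rule f(3)) simp
  have "(\<Sum>k\<in>S. q (tensor_eval W (\<lambda>v w. \<phi> k v \<odot>\<^bsub>W\<^esub> w) f)) \<le> projective_seminorm V W X \<tau> p q (tensor_eval X \<tau> f)"
    by (rule projective_seminorm_ge[OF S add smul le q f(1)])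
  then show ?thesis unfolding e f(2) .
qed

end

section \<open>Smooth functions on the circle\<close>

lemma iter_deriv_0 [simp]: "iter_deriv 0 f = f"
  by (simp add: iter_deriv_def)

lemma iter_deriv_Suc: "iter_deriv (Suc n) f = (\<lambda>t. vector_derivative (iter_deriv n f) (at t))"
  by (simp add: iter_deriv_def)

lemma smooth_circle_funsD:
  assumes "f \<in> smooth_circle_funs"
  shows "f (t + 2 * pi) = f t" "iter_deriv n f differentiable (at t)"
  using assms by (auto simp: smooth_circle_funs_def)

lemma smooth_circle_funsI:
  assumes "\<And>t. f (t + 2 * pi) = f t" "\<And>n t. iter_deriv n f differentiable (at t)"
  shows "f \<in> smooth_circle_funs"
  using assms by (auto simp: smooth_circle_funs_def)

lemma iter_deriv_add:
  assumes "\<And>n t. iter_deriv n f differentiable (at t)" "\<And>n t. iter_deriv n g differentiable (at t)"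
  shows "iter_deriv n (\<lambda>t. f t + g t) = (\<lambda>t. iter_deriv n f t + iter_deriv n g t)"
proof (induct n)
  case (Suc n)
  have "vector_derivative (\<lambda>t. iter_deriv n f t + iter_deriv n g t) (at t) =
    vector_derivative (iter_deriv n f) (at t) + vector_derivative (iter_deriv n g) (at t)" for t
    by (rule vector_derivative_at, rule has_vector_derivative_add)
       (use assms in \<open>simp_all add: vector_derivative_works[symmetric]\<close>)
  then show ?case by (simp add: iter_deriv_Suc Suc)
qed simp

lemma iter_deriv_scale:
  assumes "\<And>n t. iter_deriv n f differentiable (at t)"
  shows "iter_deriv n (\<lambda>t. c * f t) = (\<lambda>t. c * iter_deriv n f t)"
proof (induct n)
  case (Suc n)
  have "vector_derivative (\<lambda>t. c * iter_deriv n f t) (at t) =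
    c * vector_derivative (iter_deriv n f) (at t)" for t
    by (rule vector_derivative_at, rule has_vector_derivative_mult_right)
       (use assms in \<open>simp_all add: vector_derivative_works[symmetric]\<close>)
  then show ?case by (simp add: iter_deriv_Suc Suc)
qed simp

lemma smooth_add:
  assumes f: "f \<in> smooth_circle_funs" and g: "g \<in> smooth_circle_funs"
  shows "(\<lambda>t. f t + g t) \<in> smooth_circle_funs"
proof (rule smooth_circle_funsI)
  show "iter_deriv n (\<lambda>t. f t + g t) differentiable (at t)" for n t
    using smooth_circle_funsD(2)[OF f] smooth_circle_funsD(2)[OF g] by (simp add: iter_deriv_add)
qed (simp add: smooth_circle_funsD(1)[OF f] smooth_circle_funsD(1)[OF g])

lemma smooth_scale:
  assumes f: "f \<in> smooth_circle_funs"
  shows "(\<lambda>t. c * f t) \<in> smooth_circle_funs"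
proof (rule smooth_circle_funsI)
  show "iter_deriv n (\<lambda>t. c * f t) differentiable (at t)" for n t
    using smooth_circle_funsD(2)[OF f] by (simp add: iter_deriv_scale)
qed (simp add: smooth_circle_funsD(1)[OF f])

lemma zpow_has_vector_derivative:
  "((\<lambda>t. c * zpow m t) has_vector_derivative (c * (\<i> * of_int m)) * zpow m t) (at t)"
proof -
  have "((\<lambda>z. c * exp (\<i> * of_int m * z)) has_field_derivative
    (c * (\<i> * of_int m)) * exp (\<i> * of_int m * complex_of_real t)) (at (complex_of_real t))"
    by (auto intro!: derivative_eq_intros)
  then have "((\<lambda>t. c * exp (\<i> * of_int m * complex_of_real t)) has_vector_derivative
    (c * (\<i> * of_int m)) * exp (\<i> * of_int m * complex_of_real t)) (at t)"
    by (rule has_vector_derivative_real_field)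
  then show ?thesis by (simp add: zpow_def cis_conv_exp mult.assoc)
qed

lemma iter_deriv_zpow: "iter_deriv n (zpow m) = (\<lambda>t. (\<i> * of_int m) ^ n * zpow m t)"
proof (induct n)
  case (Suc n)
  show ?case
    unfolding iter_deriv_Suc Suc vector_derivative_at[OF zpow_has_vector_derivative] power_Suc2 ..
qed simp

lemma zpow_smooth [simp]: "zpow m \<in> smooth_circle_funs"
proof (rule smooth_circle_funsI)
  show "zpow m (t + 2 * pi) = zpow m t" for t
  proof -
    have "zpow m (t + 2 * pi) = cis (of_int m * t) * cis (2 * pi * of_int m)"
      by (simp add: zpow_def cis_mult algebra_simps)
    also have "cis (2 * pi * of_int m) = 1" by (rule cis_multiple_2pi) simp
    finally show ?thesis by (simp add: zpow_def)
  qed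
  show "iter_deriv n (zpow m) differentiable at t" for n t
    unfolding iter_deriv_zpow using zpow_has_vector_derivative
    by (auto simp: has_vector_derivative_def differentiable_def)
qed

lemma zero_smooth [simp]: "(\<lambda>t. 0) \<in> smooth_circle_funs"
  using smooth_scale[OF zpow_smooth, of 0] by simp

lemma iter_deriv_periodic:
  assumes f: "f \<in> smooth_circle_funs" shows "iter_deriv n f (t + 2 * pi) = iter_deriv n f t"
proof (induct n arbitrary: t)
  case 0 then show ?case using smooth_circle_funsD(1)[OF f] by simp
next
  case (Suc n)
  have "(iter_deriv n f has_vector_derivative iter_deriv (Suc n) f (t + 2 * pi)) (at (t + 2 * pi))"
    using smooth_circle_funsD(2)[OF f] by (simp add: iter_deriv_Suc vector_derivative_works[symmetric])
  then have "((iter_deriv n f \<circ> (\<lambda>t. t + 2 * pi)) has_vector_derivative 1 *\<^sub>R iter_deriv (Suc n) f (t + 2 * pi)) (at t)"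
    by (intro vector_diff_chain_at) (auto intro!: derivative_eq_intros)
  moreover have "iter_deriv n f \<circ> (\<lambda>t. t + 2 * pi) = iter_deriv n f" using Suc by auto
  ultimately show ?case by (simp add: iter_deriv_Suc vector_derivative_at)
qed

lemma periodic_reduce:
  fixes f :: "real \<Rightarrow> 'a"
  assumes "\<And>t. f (t + 2 * pi) = f t"
  shows "\<exists>s\<in>{0..2*pi}. f t = f s"
proof -
  interpret periodic_fun_simple f "2 * pi" by unfold_locales (rule assms)
  let ?n = "\<lfloor>t / (2 * pi)\<rfloor>"
  have "f t = f (t - of_int ?n * (2 * pi))" by (rule minus_of_int[symmetric])
  moreover have "t - of_int ?n * (2 * pi) \<in> {0..2*pi}"
    using floor_divide_lower[of "2*pi" t] floor_divide_upper[of "2*pi" t] by (simp add: algebra_simps)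
  ultimately show ?thesis by blast
qed

lemma smooth_continuous:
  assumes f: "f \<in> smooth_circle_funs" shows "continuous_on S (iter_deriv n f)"
  by (intro continuous_at_imp_continuous_on ballI differentiable_imp_continuous_within
      smooth_circle_funsD(2)[OF f])

lemma periodic_bounded:
  fixes f :: "real \<Rightarrow> complex"
  assumes "\<And>t. f (t + 2 * pi) = f t" "continuous_on {0..2*pi} f"
  shows "bdd_above (range (\<lambda>t. cmod (f t)))"
proof -
  have "compact ((\<lambda>t. cmod (f t)) ` {0..2*pi})"
    by (intro compact_continuous_image continuous_intros assms compact_Icc)
  then obtain B where B: "\<And>s. s \<in> {0..2*pi} \<Longrightarrow> cmod (f s) \<le> B"
    by (metis bdd_above_def bounded_imp_bdd_above compact_imp_bounded imageI)
  show ?thesis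
  proof (rule bdd_aboveI2)
    fix t
    obtain s where s: "s \<in> {0..2*pi}" "f t = f s" using periodic_reduce[of f t] assms(1) by auto
    then show "cmod (f t) \<le> B" using B by simp
  qed
qed

lemma circle_seminorm_bdd:
  "f \<in> smooth_circle_funs \<Longrightarrow> bdd_above (range (\<lambda>t. cmod (iter_deriv n f t)))"
  by (intro periodic_bounded iter_deriv_periodic smooth_continuous)

lemma circle_seminorm_upper: "f \<in> smooth_circle_funs \<Longrightarrow> cmod (iter_deriv n f t) \<le> circle_seminorm n f"
  unfolding circle_seminorm_def by (intro cSUP_upper circle_seminorm_bdd) simp_all

lemma circle_seminorm_add:
  assumes f: "f \<in> smooth_circle_funs" and g: "g \<in> smooth_circle_funs"
  shows "circle_seminorm n (\<lambda>t. f t + g t) \<le> circle_seminorm n f + circle_seminorm n g"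
  unfolding circle_seminorm_def[of n "\<lambda>t. f t + g t"]
proof (rule cSUP_least)
  fix t
  have "cmod (iter_deriv n (\<lambda>t. f t + g t) t) \<le> cmod (iter_deriv n f t) + cmod (iter_deriv n g t)"
    using smooth_circle_funsD(2)[OF f] smooth_circle_funsD(2)[OF g]
    by (simp add: iter_deriv_add norm_triangle_ineq)
  also have "\<dots> \<le> circle_seminorm n f + circle_seminorm n g"
    by (intro add_mono circle_seminorm_upper f g)
  finally show "cmod (iter_deriv n (\<lambda>t. f t + g t) t) \<le> circle_seminorm n f + circle_seminorm n g" .
qed simp

lemma circle_seminorm_nonneg: "f \<in> smooth_circle_funs \<Longrightarrow> 0 \<le> circle_seminorm n f"
  using circle_seminorm_upper[of f n 0] norm_ge_zero[of "iter_deriv n f 0"] by linarith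

text \<open>One inequality, valid for all scalars, gives the other one by scaling back with
  1/c.\<close>

lemma circle_seminorm_scale:
  assumes f: "f \<in> smooth_circle_funs"
  shows "circle_seminorm n (\<lambda>t. c * f t) = cmod c * circle_seminorm n f"
proof -
  have le: "circle_seminorm n (\<lambda>t. c * f t) \<le> cmod c * circle_seminorm n f"
    if f: "f \<in> smooth_circle_funs" for f c
    unfolding circle_seminorm_def[of n "\<lambda>t. c * f t"]
  proof (rule cSUP_least)
    fix t
    show "cmod (iter_deriv n (\<lambda>t. c * f t) t) \<le> cmod c * circle_seminorm n f"
      using smooth_circle_funsD(2)[OF f] circle_seminorm_upper[OF f, of n t]
      by (simp add: iter_deriv_scale norm_mult mult_left_mono)
  qed simp
  show ?thesis
  proof (cases "c = 0")
    case True
    have "0 \<le> circle_seminorm n (\<lambda>t. c * f t)" by (intro circle_seminorm_nonneg smooth_scale f)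
    then show ?thesis using le[OF f, of c] True by simp
  next
    case False
    have "(\<lambda>t. (1/c) * (c * f t)) = f" using False by (auto simp: fun_eq_iff)
    then have "circle_seminorm n f \<le> cmod (1/c) * circle_seminorm n (\<lambda>t. c * f t)"
      using le[OF smooth_scale[OF f, of c], of "1/c"] by simp
    then have "cmod c * circle_seminorm n f \<le> circle_seminorm n (\<lambda>t. c * f t)"
      using False by (simp add: norm_divide field_simps)
    then show ?thesis using le[OF f, of c] by simp
  qed
qed

lemma circle_alg_simps [simp]:
  "carrier circle_alg = smooth_circle_funs" "zero circle_alg = (\<lambda>t. 0)"
  "add circle_alg = (\<lambda>f g t. f t + g t)" "smult circle_alg = (\<lambda>c f t. c * f t)"
  by (simp_all add: circle_alg_def)

lemma smooth_circle_simps [simp]: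
  "carrier smooth_circle = smooth_circle_funs" "zero smooth_circle = (\<lambda>t. 0)"
  "add smooth_circle = (\<lambda>f g t. f t + g t)" "smult smooth_circle = (\<lambda>c f t. c * f t)"
  by (simp_all add: smooth_circle_def)

lemma circle_seminorm_on: "seminorm_on circle_alg (circle_seminorm n)"
  by (rule seminorm_onI)
     (simp_all add: circle_seminorm_nonneg circle_seminorm_add circle_seminorm_scale)

lemma smooth_circle_lcs: "lcs smooth_circle"
  unfolding smooth_circle_def
proof (rule lcs_with_topology)
  show "cvec (with_topology circle_alg (seminorm_topology circle_alg (range circle_seminorm)))"
    by (rule cvecI) (simp_all add: smooth_add smooth_scale algebra_simps)
qed (auto simp: circle_seminorm_on)

lemma circle_seminorm_cont: "circle_seminorm n \<in> cont_seminorms smooth_circle"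
proof -
  interpret lcs smooth_circle by (rule smooth_circle_lcs)
  have eq: "seminorm_topology circle_alg Q = seminorm_topology smooth_circle Q" for Q
    by (rule seminorm_topology_cong) simp_all
  have s: "seminorm_on smooth_circle (circle_seminorm m)" for m
    using circle_seminorm_on seminorm_on_cong[of smooth_circle circle_alg] by simp
  have "topo smooth_circle = seminorm_topology smooth_circle (range circle_seminorm)"
    unfolding eq[symmetric] by (simp add: smooth_circle_def)
  then show ?thesis by (rule cs_generating) (use s in auto)
qed

section \<open>Uniqueness of Fourier coefficients\<close>

lemma fourier_integrable:
  fixes f :: "real \<Rightarrow> complex"
  assumes "continuous_on {0..2*pi} f"
  shows "(\<lambda>t. f t * cis (- of_int k * t)) integrable_on {0..2*pi}"
  by (intro integrable_continuous_interval continuous_intros assms)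

lemma fourier_coeff_add:
  assumes "continuous_on {0..2*pi} f" "continuous_on {0..2*pi} g"
  shows "fourier_coeff (\<lambda>t. f t + g t) k = fourier_coeff f k + fourier_coeff g k"
  unfolding fourier_coeff_def
  by (simp add: distrib_right integral_add[OF fourier_integrable[OF assms(1), of k, simplified] fourier_integrable[OF assms(2), of k, simplified]] add_divide_distrib)

lemma fourier_coeff_scale: "fourier_coeff (\<lambda>t. c * f t) k = c * fourier_coeff f k"
  by (simp add: fourier_coeff_def mult.assoc)

lemma integral_cis_period:
  "integral {0..2*pi} (\<lambda>t. cis (of_int n * t)) = (if n = 0 then complex_of_real (2 * pi) else 0)"
proof (cases "n = 0")
  case False
  have "((\<lambda>t. zpow n t) has_integral (1 / (\<i> * of_int n) * zpow n (2*pi) - 1 / (\<i> * of_int n) * zpow n 0)) {0..2*pi}"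
  proof (rule fundamental_theorem_of_calculus)
    fix x
    show "((\<lambda>t. 1 / (\<i> * of_int n) * zpow n t) has_vector_derivative zpow n x) (at x within {0..2*pi})"
      using zpow_has_vector_derivative[of "1 / (\<i> * of_int n)" n x] False
      by (simp add: has_vector_derivative_at_within)
  qed simp
  moreover have "zpow n (2*pi) = zpow n 0" using smooth_circle_funsD(1)[OF zpow_smooth, of n 0] by simp
  ultimately show ?thesis using False by (simp add: zpow_def integral_unique)
next
  case True
  then show ?thesis by (simp add: integral_const_real scaleR_conv_of_real)
qed

lemma fourier_coeff_zpow: "fourier_coeff (zpow n) k = (if n = k then 1 else 0)"
proof -
  have "zpow n t * cis (- of_int k * t) = cis (of_int (n - k) * t)" for t
    by (simp add: zpow_def cis_mult algebra_simps)
  then show ?thesis unfolding fourier_coeff_def by (simp only: integral_cis_period) auto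
qed

text \<open>\<open>cis\<close> maps a compact interval onto the circle and is therefore a quotient
  map, which reduces continuity of \<open>F\<close> to that of \<open>f\<close>. The function
  \<open>Arg2pi\<close> itself jumps at the point 1.\<close>

lemma circle_descend:
  fixes f :: "real \<Rightarrow> 'a::t2_space"
  assumes per: "\<And>t. f (t + 2 * pi) = f t" and cont: "continuous_on UNIV f"
  obtains F where "continuous_on (sphere 0 1) F" "\<And>t. F (cis t) = f t"
proof -
  define F where "F z = f (Arg2pi z)" for z
  have F: "F (cis t) = f t" for t
  proof -
    interpret periodic_fun_simple f "2 * pi" by unfold_locales (rule per)
    have "cis (Arg2pi (cis t)) = cis t"
      using Arg2pi_eq[of "cis t"] by (simp add: cis_conv_exp)
    then have "exp (\<i> * complex_of_real (Arg2pi (cis t))) = exp (\<i> * complex_of_real t)" by (simp add: cis_conv_exp)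
    then obtain n :: int where "\<i> * complex_of_real (Arg2pi (cis t)) = \<i> * complex_of_real t + (of_int (2 * n) * pi) * \<i>"
      using exp_eq by blast
    then have "Arg2pi (cis t) = t + of_int n * (2 * pi)" by (simp add: complex_eq_iff algebra_simps)
    then show ?thesis using plus_of_int[of t n] by (simp add: F_def)
  qed
  have cc: "continuous_on S cis" for S by (auto simp: cis_conv_exp intro!: continuous_intros)
  have im: "cis ` {0..2*pi} = sphere 0 1"
  proof
    show "sphere 0 1 \<subseteq> cis ` {0..2*pi}"
    proof
      fix z :: complex assume "z \<in> sphere 0 1"
      then have "z = cis (Arg2pi z)" using Arg2pi_eq[of z] by (simp add: cis_conv_exp)
      then show "z \<in> cis ` {0..2*pi}" using Arg2pi[of z] by (intro image_eqI[of _ _ "Arg2pi z"]) auto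
    qed
  qed auto
  have "quotient_map (top_of_set {0..2*pi}) (top_of_set (sphere 0 1)) cis"
    by (rule T1_Spaces.continuous_imp_quotient_map)
       (use im cc in \<open>auto simp: compact_space_subtopology Hausdorff_space_subtopology\<close>)
  moreover have "continuous_map (top_of_set {0..2*pi}) euclidean (F \<circ> cis)"
  proof -
    have "F \<circ> cis = f" using F by auto
    then show ?thesis using cont continuous_on_subset by auto
  qed
  ultimately have "continuous_map (top_of_set (sphere 0 1)) euclidean F"
    by (rule continuous_compose_quotient_map)
  then show ?thesis using F by (intro that[of F]) auto
qed

text \<open>Multiplication by a real function in the ring used for the Stone-Weierstrass theorem
  preserves the vanishing of all Fourier coefficients.\<close>

lemma fourier_unique:
  assumes per: "\<And>t. f (t + 2 * pi) = f t" and cont: "continuous_on UNIV f"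
    and zero: "\<And>k. fourier_coeff f k = 0"
  shows "f = (\<lambda>t. 0)"
proof -
  have cc: "continuous_on S (\<lambda>t. cis (g t))" if "continuous_on S g" for S and g :: "real \<Rightarrow> real"
    using that by (auto simp: cis_conv_exp intro!: continuous_intros)
  define G where "G = {g :: real \<Rightarrow> complex. continuous_on UNIV g \<and> (\<forall>k. fourier_coeff g k = 0)}"
  \<comment> \<open>The continuous real functions that preserve \<open>G\<close> under
    multiplication. Defined as multipliers, they are closed under products without any computation
    of Fourier coefficients.\<close>
  define R where "R = {\<phi> :: complex \<Rightarrow> real. continuous_on (sphere 0 1) \<phi> \<and>
    (\<forall>g\<in>G. (\<lambda>t. complex_of_real (\<phi> (cis t)) * g t) \<in> G)}"
  have Gc: "continuous_on S g" if "g \<in> G" for g S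
    using that continuous_on_subset by (auto simp: G_def)
  have Gadd: "(\<lambda>t. g t + h t) \<in> G" if "g \<in> G" "h \<in> G" for g h
    using that Gc[OF that(1)] Gc[OF that(2)]
    by (auto simp: G_def fourier_coeff_add intro!: continuous_intros)
  have Gscale: "(\<lambda>t. c * g t) \<in> G" if "g \<in> G" for g c
    using that Gc[OF that] by (auto simp: G_def fourier_coeff_scale intro!: continuous_intros)
  have Gcis: "(\<lambda>t. cis (of_int m * t) * g t) \<in> G" if "g \<in> G" for g m
  proof -
    have "fourier_coeff (\<lambda>t. cis (of_int m * t) * g t) k = fourier_coeff g (k - m)" for k
    proof -
      have "cis (of_int m * t) * g t * cis (- of_int k * t) = g t * cis (- of_int (k - m) * t)" for t
        by (simp add: algebra_simps cis_mult mult.left_commute[of _ "g t"])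
      then show ?thesis by (simp only: fourier_coeff_def)
    qed
    then show ?thesis using that Gc[OF that]
      by (auto simp: G_def intro!: continuous_intros cc)
  qed
  have half: "(\<lambda>t. (a * (cis (of_int 1 * t) * g t)) + (b * (cis (of_int (-1) * t) * g t))) \<in> G" if "g \<in> G" for a b g
    by (intro Gadd Gscale Gcis that)
  have Re: "Re \<in> R"
  proof -
    have "complex_of_real (Re (cis t)) * g t = 1/2 * (cis (of_int 1 * t) * g t) + 1/2 * (cis (of_int (-1) * t) * g t)" for t and g :: "real \<Rightarrow> complex"
      by (simp add: complex_eq_iff field_simps)
    then show ?thesis unfolding R_def using half[of _ "1/2" "1/2"] by (auto intro!: continuous_intros)
  qed
  have Im: "Im \<in> R"
  proof -
    have "complex_of_real (Im (cis t)) * g t = (-\<i>/2) * (cis (of_int 1 * t) * g t) + (\<i>/2) * (cis (of_int (-1) * t) * g t)" for t and g :: "real \<Rightarrow> complex"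
      by (simp add: complex_eq_iff field_simps)
    then show ?thesis unfolding R_def using half[of _ "-\<i>/2" "\<i>/2"] by (auto intro!: continuous_intros)
  qed
  interpret function_ring_on R "sphere 0 1"
  proof
    show "continuous_on (sphere 0 1) \<phi>" if "\<phi> \<in> R" for \<phi> using that by (simp add: R_def)
    show "(\<lambda>x. \<phi> x + \<psi> x) \<in> R" if "\<phi> \<in> R" "\<psi> \<in> R" for \<phi> \<psi>
      using that Gadd by (auto simp: R_def distrib_right intro!: continuous_intros)
    show "(\<lambda>x. \<phi> x * \<psi> x) \<in> R" if "\<phi> \<in> R" "\<psi> \<in> R" for \<phi> \<psi>
      using that by (auto simp: R_def mult.assoc intro!: continuous_intros)
    show "(\<lambda>_. c) \<in> R" for c using Gscale by (auto simp: R_def intro!: continuous_intros)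
    show "\<exists>\<phi>\<in>R. \<phi> x \<noteq> \<phi> y" if "x \<noteq> y" for x y
      using that Re Im by (metis complex_eqI)
  qed simp
  have fG: "f \<in> G" using cont zero by (simp add: G_def)
  obtain F where F: "continuous_on (sphere 0 1) F" "\<And>t. F (cis t) = f t" using circle_descend[OF per cont] by blast
  let ?I = "\<lambda>h. integral {0..2*pi} h"
  have fint: "(\<lambda>t. cmod (f t)) integrable_on {0..2*pi}"
    by (intro integrable_continuous_interval continuous_intros Gc[OF fG])
  have "cmod (?I (\<lambda>t. cnj (f t) * f t)) \<le> 2 * e * ?I (\<lambda>t. cmod (f t))" if e: "e > 0" for e
  proof -
    obtain a where a: "a \<in> R" "\<forall>x\<in>sphere 0 1. \<bar>Re (F x) - a x\<bar> < e"
      using Stone_Weierstrass_basic[of "\<lambda>z. Re (F z)" e] F(1) e by (auto intro: continuous_intros)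
    obtain b where b: "b \<in> R" "\<forall>x\<in>sphere 0 1. \<bar>Im (F x) - b x\<bar> < e"
      using Stone_Weierstrass_basic[of "\<lambda>z. Im (F z)" e] F(1) e by (auto intro: continuous_intros)
    \<comment> \<open>With \<open>a\<close> and \<open>b\<close> close to the real and imaginary
      part of \<open>f\<close>, this approximates cnj f * f; as a member of \<open>G\<close> it has
      integral zero.\<close>
    define h where "h t = complex_of_real (a (cis t)) * f t + (-\<i>) * (complex_of_real (b (cis t)) * f t)" for t
    have "h \<in> G" unfolding h_def using a(1) b(1) fG by (intro Gadd Gscale) (auto simp: R_def)
    then have h0: "?I h = 0" "continuous_on {0..2*pi} h"
    proof -
      assume h: "h \<in> G"
      then have "fourier_coeff h 0 = 0" by (simp add: G_def)
      then show "?I h = 0" by (simp add: fourier_coeff_def)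
      show "continuous_on {0..2*pi} h" by (rule Gc[OF h])
    qed
    have ci: "(\<lambda>t. cnj (f t) * f t) integrable_on {0..2*pi}"
      by (intro integrable_continuous_interval continuous_intros Gc[OF fG])
    have hi: "h integrable_on {0..2*pi}" by (intro integrable_continuous_interval h0)
    have "?I (\<lambda>t. cnj (f t) * f t) = ?I (\<lambda>t. cnj (f t) * f t - h t)"
      using ci hi h0 by (simp add: integral_diff)
    also have "cmod \<dots> \<le> ?I (\<lambda>t. 2 * e * cmod (f t))"
    proof (rule integral_norm_bound_integral)
      show "(\<lambda>t. cnj (f t) * f t - h t) integrable_on {0..2*pi}" using ci hi by (rule integrable_diff)
      show "(\<lambda>t. 2 * e * cmod (f t)) integrable_on {0..2*pi}"
        by (intro integrable_continuous_interval continuous_intros Gc[OF fG])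
      fix t
      let ?d = "cnj (f t) - (complex_of_real (a (cis t)) - \<i> * complex_of_real (b (cis t)))"
      have "\<bar>Re (f t) - a (cis t)\<bar> < e" "\<bar>Im (f t) - b (cis t)\<bar> < e"
        using a(2) b(2) F(2)[of t] by (metis norm_cis mem_sphere_0)+
      then have "cmod ?d \<le> 2 * e" using cmod_le[of ?d] by (simp add: abs_minus_commute)
      moreover have "cnj (f t) * f t - h t = ?d * f t" by (simp add: h_def algebra_simps)
      ultimately show "cmod (cnj (f t) * f t - h t) \<le> 2 * e * cmod (f t)"
        by (simp add: norm_mult mult_right_mono)
    qed
    finally show ?thesis by simp
  qed
  then have le: "cmod (?I (\<lambda>t. cnj (f t) * f t)) \<le> e * (2 * ?I (\<lambda>t. cmod (f t)))" if "e > 0" for e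
    using that by (simp add: mult.assoc mult.left_commute)
  have "cmod (?I (\<lambda>t. cnj (f t) * f t)) = 0"
  proof (rule ccontr)
    assume n: "cmod (?I (\<lambda>t. cnj (f t) * f t)) \<noteq> 0"
    let ?M = "2 * ?I (\<lambda>t. cmod (f t))" and ?N = "cmod (?I (\<lambda>t. cnj (f t) * f t))"
    have M: "0 \<le> ?M" by (simp add: integral_nonneg[OF fint])
    have N: "?N > 0" using n by simp
    \<comment> \<open>The choice e = N / (M + 1) makes the bound smaller than N; the 1 allows M =
      0.\<close>
    have "?N \<le> ?N / (?M + 1) * ?M" using M N by (intro le) simp
    then show False using M N by (simp add: field_simps)
  qed
  moreover have "(\<lambda>t. cnj (f t) * f t) = (\<lambda>t. complex_of_real ((cmod (f t))\<^sup>2))"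
    by (simp add: fun_eq_iff complex_norm_square mult.commute del: of_real_power)
  moreover have "?I (\<lambda>t. complex_of_real ((cmod (f t))\<^sup>2)) = complex_of_real (?I (\<lambda>t. (cmod (f t))\<^sup>2))"
    using integral_linear[OF _ bounded_linear_of_real, of "\<lambda>t. (cmod (f t))\<^sup>2" "{0..2*pi}"]
    by (simp add: o_def integrable_continuous_interval continuous_intros Gc[OF fG])
  ultimately have "?I (\<lambda>t. (cmod (f t))\<^sup>2) = 0" by simp
  then have "\<forall>x\<in>{0..2*pi}. (cmod (f x))\<^sup>2 = 0"
    by (subst (asm) integral_eq_0_iff) (auto intro!: continuous_intros Gc[OF fG])
  then have z: "\<And>x. x \<in> {0..2*pi} \<Longrightarrow> f x = 0" by simp
  show ?thesis
  proof
    fix t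
    obtain s where "s \<in> {0..2*pi}" "f t = f s" using periodic_reduce[of f t] per by auto
    then show "f t = 0" using z by simp
  qed
qed

section \<open>The smooth Toeplitz algebra\<close>

lemma K_carrierD: "a \<in> K_carrier \<Longrightarrow> (\<lambda>z. (1 + real (fst z) + real (snd z)) ^ n * cmod (a (fst z) (snd z))) summable_on UNIV"
  by (simp add: K_carrier_def case_prod_unfold)

lemma K_carrierI:
  "(\<And>n. (\<lambda>z. (1 + real (fst z) + real (snd z)) ^ n * cmod (a (fst z) (snd z))) summable_on UNIV) \<Longrightarrow> a \<in> K_carrier"
  by (simp add: K_carrier_def case_prod_unfold)

lemma K_seminorm_eq:
  "K_seminorm n a = (\<Sum>\<^sub>\<infinity>z. (1 + real (fst z) + real (snd z)) ^ n * cmod (a (fst z) (snd z)))"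
  by (simp add: K_seminorm_def case_prod_unfold)

lemma K_add_aux:
  assumes a: "a \<in> K_carrier" and b: "b \<in> K_carrier"
  shows "(\<lambda>z. (1 + real (fst z) + real (snd z)) ^ n * cmod (a (fst z) (snd z)) +
      (1 + real (fst z) + real (snd z)) ^ n * cmod (b (fst z) (snd z))) summable_on UNIV"
    "(\<lambda>z. (1 + real (fst z) + real (snd z)) ^ n * cmod (a (fst z) (snd z) + b (fst z) (snd z))) summable_on UNIV"
proof -
  show s: "(\<lambda>z. (1 + real (fst z) + real (snd z)) ^ n * cmod (a (fst z) (snd z)) +
      (1 + real (fst z) + real (snd z)) ^ n * cmod (b (fst z) (snd z))) summable_on UNIV"
    by (intro summable_on_add K_carrierD a b)
  show "(\<lambda>z. (1 + real (fst z) + real (snd z)) ^ n * cmod (a (fst z) (snd z) + b (fst z) (snd z))) summable_on UNIV"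
    by (rule summable_on_comparison_test[OF s])
       (auto simp: distrib_left[symmetric] intro!: mult_left_mono norm_triangle_ineq)
qed

lemma K_add: "a \<in> K_carrier \<Longrightarrow> b \<in> K_carrier \<Longrightarrow> (\<lambda>i j. a i j + b i j) \<in> K_carrier"
  by (rule K_carrierI) (rule K_add_aux)

lemma K_scale: "a \<in> K_carrier \<Longrightarrow> (\<lambda>i j. c * a i j) \<in> K_carrier"
  by (rule K_carrierI)
     (use summable_on_cmult_right[OF K_carrierD, of a "cmod c"] in \<open>simp add: norm_mult mult.left_commute\<close>)

lemma K_finite_support: "finite {z. a (fst z) (snd z) \<noteq> 0} \<Longrightarrow> a \<in> K_carrier"
  by (rule K_carrierI, rule finite_nonzero_values_imp_summable_on)
     (auto elim!: rev_finite_subset)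

lemma K_zero: "(\<lambda>i j. 0) \<in> K_carrier"
  by (rule K_finite_support) simp

lemma matrix_unit_K [simp]: "matrix_unit i j \<in> K_carrier"
proof (rule K_finite_support)
  have "{z. matrix_unit i j (fst z) (snd z) \<noteq> 0} \<subseteq> {(i, j)}" by (auto simp: matrix_unit_def)
  then show "finite {z. matrix_unit i j (fst z) (snd z) \<noteq> 0}" by (rule finite_subset) simp
qed

lemma K_seminorm_nonneg: "0 \<le> K_seminorm n a"
  unfolding K_seminorm_eq by (rule infsum_nonneg) simp

lemma K_seminorm_scale: "K_seminorm n (\<lambda>i j. c * a i j) = cmod c * K_seminorm n a"
  by (simp add: K_seminorm_eq norm_mult mult.left_commute infsum_cmult_right'[symmetric])

lemma K_seminorm_add:
  assumes a: "a \<in> K_carrier" and b: "b \<in> K_carrier"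
  shows "K_seminorm n (\<lambda>i j. a i j + b i j) \<le> K_seminorm n a + K_seminorm n b"
proof -
  have "K_seminorm n (\<lambda>i j. a i j + b i j) \<le>
    (\<Sum>\<^sub>\<infinity>z. (1 + real (fst z) + real (snd z)) ^ n * cmod (a (fst z) (snd z)) +
      (1 + real (fst z) + real (snd z)) ^ n * cmod (b (fst z) (snd z)))"
    unfolding K_seminorm_eq
    by (rule infsum_mono[OF K_add_aux(2,1)[OF a b]])
       (auto simp: distrib_left[symmetric] intro!: mult_left_mono norm_triangle_ineq)
  also have "\<dots> = K_seminorm n a + K_seminorm n b"
    unfolding K_seminorm_eq by (rule infsum_add[OF K_carrierD[OF a] K_carrierD[OF b]])
  finally show ?thesis .
qed

lemma K_seminorm_ge_sum:
  assumes a: "a \<in> K_carrier" and S: "finite S"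
  shows "(\<Sum>z\<in>S. cmod (a (fst z) (snd z))) \<le> K_seminorm 0 a"
  unfolding K_seminorm_eq
  using finite_sum_le_infsum[OF K_carrierD[OF a, of 0] S] by simp

section \<open>Symbol and compact part of a Toeplitz element\<close>

lemma toeplitz_matrix_add:
  assumes f: "f \<in> smooth_circle_funs" and g: "g \<in> smooth_circle_funs"
  shows "toeplitz_matrix (\<lambda>t. f t + g t) = (\<lambda>i j. toeplitz_matrix f i j + toeplitz_matrix g i j)"
  using smooth_continuous[OF f, of _ 0] smooth_continuous[OF g, of _ 0]
  by (simp add: toeplitz_matrix_def fourier_coeff_add)

lemma toeplitz_matrix_scale: "toeplitz_matrix (\<lambda>t. c * f t) = (\<lambda>i j. c * toeplitz_matrix f i j)"
  by (simp add: toeplitz_matrix_def fourier_coeff_scale)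

text \<open>A Toeplitz matrix is constant along its infinite diagonals.\<close>

lemma toeplitz_in_K:
  assumes f: "f \<in> smooth_circle_funs" and K: "toeplitz_matrix f \<in> K_carrier"
  shows "f = (\<lambda>t. 0)"
proof (rule fourier_unique)
  show "f (t + 2 * pi) = f t" for t by (rule smooth_circle_funsD(1)[OF f])
  show "continuous_on UNIV f" using smooth_continuous[OF f, of UNIV 0] by simp
  fix k
  \<comment> \<open>This runs along the k-th diagonal, where all entries equal
    \<open>fourier_coeff f k\<close>; a summable constant sequence vanishes.\<close>
  define h where "h n = (n + nat k, n + nat (- k))" for n
  have inj: "inj h" by (auto simp: h_def inj_def)
  have "(\<lambda>z. cmod (toeplitz_matrix f (fst z) (snd z))) summable_on range h"
    using summable_on_subset_banach[OF K_carrierD[OF K, of 0], of "range h"] by simp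
  then have "(\<lambda>n. cmod (toeplitz_matrix f (fst (h n)) (snd (h n)))) summable_on UNIV"
    by (subst (asm) summable_on_reindex[OF inj]) (simp add: o_def)
  moreover have "toeplitz_matrix f (fst (h n)) (snd (h n)) = fourier_coeff f k" for n
    by (simp add: toeplitz_matrix_def h_def)
  ultimately have "summable (\<lambda>n::nat. cmod (fourier_coeff f k))"
    by (subst (asm) summable_on_UNIV_nonneg_real_iff) simp_all
  then show "fourier_coeff f k = 0" unfolding summable_const_iff by simp
qed

text \<open>Two decompositions of one matrix differ by the Toeplitz matrix of a smooth function
  lying in \<open>K_carrier\<close>, so the functions agree by \<open>toeplitz_in_K\<close>.\<close>

lemma toeplitz_symbol_eq:
  assumes a: "a \<in> K_carrier" and f: "f \<in> smooth_circle_funs"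
  shows "toeplitz_symbol (\<lambda>i j. a i j + toeplitz_matrix f i j) = f"
  unfolding toeplitz_symbol_def
proof (rule the_equality)
  show "f \<in> smooth_circle_funs \<and>
    (\<lambda>i j. a i j + toeplitz_matrix f i j - toeplitz_matrix f i j) \<in> K_carrier" using a f by simp
  fix g assume g: "g \<in> smooth_circle_funs \<and>
    (\<lambda>i j. a i j + toeplitz_matrix f i j - toeplitz_matrix g i j) \<in> K_carrier"
  let ?d = "\<lambda>t. g t + (-1) * f t"
  have d: "?d \<in> smooth_circle_funs" by (intro smooth_add smooth_scale f) (use g in simp)
  have "(\<lambda>i j. a i j + (-1) * (a i j + toeplitz_matrix f i j - toeplitz_matrix g i j)) \<in> K_carrier"
    by (intro K_add K_scale a) (use g in simp)
  also have "(\<lambda>i j. a i j + (-1) * (a i j + toeplitz_matrix f i j - toeplitz_matrix g i j)) = toeplitz_matrix ?d"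
    using g f by (subst toeplitz_matrix_add) (simp_all add: smooth_scale[of f "-1", simplified] toeplitz_matrix_scale[of "-1", simplified])
  finally have "?d = (\<lambda>t. 0)" by (rule toeplitz_in_K[OF d])
  then show "g = f" by (auto simp: fun_eq_iff)
qed

lemma toeplitz_carrierI:
  "a \<in> K_carrier \<Longrightarrow> f \<in> smooth_circle_funs \<Longrightarrow> (\<lambda>i j. a i j + toeplitz_matrix f i j) \<in> toeplitz_carrier"
  unfolding toeplitz_carrier_def by blast

lemma compact_part_eq:
  assumes a: "a \<in> K_carrier" and f: "f \<in> smooth_circle_funs"
  shows "toeplitz_compact_part (\<lambda>i j. a i j + toeplitz_matrix f i j) = a"
  by (simp add: toeplitz_compact_part_def toeplitz_symbol_eq[OF assms])

lemma toeplitz_decomp: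
  assumes "m \<in> toeplitz_carrier"
  shows "toeplitz_symbol m \<in> smooth_circle_funs" "toeplitz_compact_part m \<in> K_carrier"
    "m = (\<lambda>i j. toeplitz_compact_part m i j + toeplitz_matrix (toeplitz_symbol m) i j)"
proof -
  obtain a f where m: "m = (\<lambda>i j. a i j + toeplitz_matrix f i j)" and a: "a \<in> K_carrier" "f \<in> smooth_circle_funs"
    using assms unfolding toeplitz_carrier_def by blast
  show "toeplitz_symbol m \<in> smooth_circle_funs" "toeplitz_compact_part m \<in> K_carrier"
    "m = (\<lambda>i j. toeplitz_compact_part m i j + toeplitz_matrix (toeplitz_symbol m) i j)"
    using a by (simp_all add: m toeplitz_symbol_eq compact_part_eq)
qed

text \<open>Sums and multiples of decompositions are decompositions; uniqueness identifies their
  parts.\<close>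

lemma toeplitz_linear:
  assumes m: "m \<in> toeplitz_carrier"
  shows "m' \<in> toeplitz_carrier \<Longrightarrow> (\<lambda>i j. m i j + m' i j) \<in> toeplitz_carrier"
    "m' \<in> toeplitz_carrier \<Longrightarrow> toeplitz_symbol (\<lambda>i j. m i j + m' i j) = (\<lambda>t. toeplitz_symbol m t + toeplitz_symbol m' t)"
    "m' \<in> toeplitz_carrier \<Longrightarrow> toeplitz_compact_part (\<lambda>i j. m i j + m' i j) = (\<lambda>i j. toeplitz_compact_part m i j + toeplitz_compact_part m' i j)"
    "(\<lambda>i j. c * m i j) \<in> toeplitz_carrier"
    "toeplitz_symbol (\<lambda>i j. c * m i j) = (\<lambda>t. c * toeplitz_symbol m t)"
    "toeplitz_compact_part (\<lambda>i j. c * m i j) = (\<lambda>i j. c * toeplitz_compact_part m i j)"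
proof -
  note d = toeplitz_decomp[OF m]
  {
    assume m': "m' \<in> toeplitz_carrier"
    note d' = toeplitz_decomp[OF m']
    let ?a = "\<lambda>i j. toeplitz_compact_part m i j + toeplitz_compact_part m' i j"
    let ?f = "\<lambda>t. toeplitz_symbol m t + toeplitz_symbol m' t"
    have a: "?a \<in> K_carrier" and f: "?f \<in> smooth_circle_funs"
      by (intro K_add d d') (intro smooth_add d d')
    have e: "(\<lambda>i j. m i j + m' i j) = (\<lambda>i j. ?a i j + toeplitz_matrix ?f i j)"
      unfolding toeplitz_matrix_add[OF d(1) d'(1)]
      using fun_cong[OF fun_cong[OF d(3)]] fun_cong[OF fun_cong[OF d'(3)]] by (intro ext) simp
    show "(\<lambda>i j. m i j + m' i j) \<in> toeplitz_carrier" unfolding e by (rule toeplitz_carrierI[OF a f])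
    show "toeplitz_symbol (\<lambda>i j. m i j + m' i j) = ?f" unfolding e by (rule toeplitz_symbol_eq[OF a f])
    show "toeplitz_compact_part (\<lambda>i j. m i j + m' i j) = ?a" unfolding e by (rule compact_part_eq[OF a f])
  }
  let ?a = "\<lambda>i j. c * toeplitz_compact_part m i j"
  let ?f = "\<lambda>t. c * toeplitz_symbol m t"
  have a: "?a \<in> K_carrier" and f: "?f \<in> smooth_circle_funs"
    by (intro K_scale d) (intro smooth_scale d)
  have e: "(\<lambda>i j. c * m i j) = (\<lambda>i j. ?a i j + toeplitz_matrix ?f i j)"
    unfolding toeplitz_matrix_scale
    using fun_cong[OF fun_cong[OF d(3)]] by (intro ext) (simp add: distrib_left[symmetric])
  show "(\<lambda>i j. c * m i j) \<in> toeplitz_carrier" unfolding e by (rule toeplitz_carrierI[OF a f])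
  show "toeplitz_symbol (\<lambda>i j. c * m i j) = ?f" unfolding e by (rule toeplitz_symbol_eq[OF a f])
  show "toeplitz_compact_part (\<lambda>i j. c * m i j) = ?a" unfolding e by (rule compact_part_eq[OF a f])
qed

lemma toeplitz_alg_simps [simp]:
  "carrier toeplitz_alg = toeplitz_carrier" "zero toeplitz_alg = (\<lambda>i j. 0)"
  "add toeplitz_alg = (\<lambda>a b i j. a i j + b i j)" "smult toeplitz_alg = (\<lambda>c a i j. c * a i j)"
  by (simp_all add: toeplitz_alg_def)

lemma smooth_toeplitz_simps [simp]:
  "carrier smooth_toeplitz = toeplitz_carrier" "zero smooth_toeplitz = (\<lambda>i j. 0)"
  "add smooth_toeplitz = (\<lambda>a b i j. a i j + b i j)" "smult smooth_toeplitz = (\<lambda>c a i j. c * a i j)"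
  "mult smooth_toeplitz = (\<lambda>a b i j. \<Sum>\<^sub>\<infinity>k. a i k * b k j)"
  "one smooth_toeplitz = (\<lambda>i j. if i = j then 1 else 0)"
  by (simp_all add: smooth_toeplitz_def) (simp_all add: toeplitz_alg_def)

definition toeplitz_seminorms :: "(matrix \<Rightarrow> real) set" where
  "toeplitz_seminorms = range (\<lambda>n m. K_seminorm n (toeplitz_compact_part m)) \<union>
      range (\<lambda>n m. circle_seminorm n (toeplitz_symbol m))"

lemma toeplitz_seminorm_on: "q \<in> toeplitz_seminorms \<Longrightarrow> seminorm_on toeplitz_alg q"
  unfolding toeplitz_seminorms_def
  by (auto intro!: seminorm_onI simp: K_seminorm_nonneg toeplitz_linear K_seminorm_add K_seminorm_scale
      toeplitz_decomp circle_seminorm_nonneg circle_seminorm_add circle_seminorm_scale)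

lemma toeplitz_matrix_carrier [simp]: "f \<in> smooth_circle_funs \<Longrightarrow> toeplitz_matrix f \<in> toeplitz_carrier"
  using toeplitz_carrierI[OF K_zero] by simp

lemma K_subset_toeplitz: "a \<in> K_carrier \<Longrightarrow> a \<in> toeplitz_carrier"
  "a \<in> K_carrier \<Longrightarrow> toeplitz_symbol a = (\<lambda>t. 0)"
  "a \<in> K_carrier \<Longrightarrow> toeplitz_compact_part a = a"
proof -
  have "toeplitz_matrix (\<lambda>t. 0) = (\<lambda>i j. 0)" by (simp add: toeplitz_matrix_def fourier_coeff_def)
  then show "a \<in> K_carrier \<Longrightarrow> a \<in> toeplitz_carrier"
    "a \<in> K_carrier \<Longrightarrow> toeplitz_symbol a = (\<lambda>t. 0)"
    "a \<in> K_carrier \<Longrightarrow> toeplitz_compact_part a = a"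
    using toeplitz_carrierI[OF _ zero_smooth] toeplitz_symbol_eq[OF _ zero_smooth] compact_part_eq[OF _ zero_smooth]
    by (metis (no_types, lifting) add.right_neutral ext)+
qed

lemma toeplitz_symbol_matrix: "f \<in> smooth_circle_funs \<Longrightarrow> toeplitz_symbol (toeplitz_matrix f) = f"
  using toeplitz_symbol_eq[OF K_zero] by simp

lemma smooth_toeplitz_cvec: "cvec smooth_toeplitz"
  by (rule cvecI) (simp_all add: toeplitz_linear K_subset_toeplitz(1)[OF K_zero] algebra_simps)

lemma smooth_toeplitz_lcs: "lcs smooth_toeplitz"
  unfolding smooth_toeplitz_def toeplitz_seminorms_def[symmetric]
  by (rule lcs_with_topology)
     (use smooth_toeplitz_cvec toeplitz_seminorm_on
      in \<open>auto simp: smooth_toeplitz_def toeplitz_seminorms_def[symmetric]\<close>)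

lemma toeplitz_seminorm_cont: "q \<in> toeplitz_seminorms \<Longrightarrow> q \<in> cont_seminorms smooth_toeplitz"
proof -
  assume q: "q \<in> toeplitz_seminorms"
  interpret lcs smooth_toeplitz by (rule smooth_toeplitz_lcs)
  have eq: "seminorm_topology toeplitz_alg Q = seminorm_topology smooth_toeplitz Q" for Q
    by (rule seminorm_topology_cong) simp_all
  have s: "seminorm_on smooth_toeplitz q" if "q \<in> toeplitz_seminorms" for q
    using toeplitz_seminorm_on[OF that] seminorm_on_cong[of smooth_toeplitz toeplitz_alg] by simp
  have "topo smooth_toeplitz = seminorm_topology smooth_toeplitz toeplitz_seminorms"
    unfolding eq[symmetric] by (simp add: smooth_toeplitz_def toeplitz_seminorms_def)
  then show ?thesis by (rule cs_generating) (use s q in auto)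
qed

lemma compact_seminorm_cont: "(\<lambda>m. K_seminorm n (toeplitz_compact_part m)) \<in> cont_seminorms smooth_toeplitz"
  by (rule toeplitz_seminorm_cont) (simp add: toeplitz_seminorms_def)

section \<open>Shifts and matrix units\<close>

abbreviation shift_pow :: "int \<Rightarrow> matrix" where "shift_pow n \<equiv> toeplitz_matrix (zpow n)"

text \<open>For negative \<open>n\<close> this is a power of the backward shift. Hence
  \<open>shift_pow\<close> lifts the powers of z linearly, but it is not multiplicative in
  \<open>n\<close>.\<close>

lemma shift_pow_eq: "shift_pow n = (\<lambda>i j. if int i = int j + n then 1 else 0)"
  by (auto simp: toeplitz_matrix_def fourier_coeff_zpow fun_eq_iff)

lemma one_toeplitz: "one smooth_toeplitz = shift_pow 0"
  by (simp add: shift_pow_eq)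

lemma infsum_supported_at:
  fixes f :: "'a \<Rightarrow> complex"
  assumes "\<And>k. k \<noteq> i \<Longrightarrow> f k = 0" shows "(\<Sum>\<^sub>\<infinity>k. f k) = f i"
proof -
  have "(\<Sum>\<^sub>\<infinity>k. f k) = infsum f {i}" by (rule infsum_cong_neutral) (use assms in auto)
  then show ?thesis by simp
qed

lemma shift_mult: "shift \<otimes>\<^bsub>smooth_toeplitz\<^esub> m = (\<lambda>i j. if i = 0 then 0 else m (i - 1) j)"
proof -
  have "(\<Sum>\<^sub>\<infinity>k. shift i k * m k j) = (if i = 0 then 0 else m (i - 1) j)" for i j
    \<comment> \<open>For i = 0 the truncated difference i - 1 is 0, where \<open>shift 0 0\<close>
      vanishes.\<close>
    by (subst infsum_supported_at[of "i - 1"]) (auto simp: shift_def shift_pow_eq)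
  then show ?thesis by simp
qed

lemma backward_shift_mult: "backward_shift \<otimes>\<^bsub>smooth_toeplitz\<^esub> m = (\<lambda>i j. m (i + 1) j)"
proof -
  have "(\<Sum>\<^sub>\<infinity>k. backward_shift i k * m k j) = m (i + 1) j" for i j
    by (subst infsum_supported_at[of "i + 1"]) (auto simp: backward_shift_def shift_pow_eq)
  then show ?thesis by simp
qed

lemma one_mult_toeplitz: "one smooth_toeplitz \<otimes>\<^bsub>smooth_toeplitz\<^esub> m = m"
proof -
  have "(\<Sum>\<^sub>\<infinity>k. one smooth_toeplitz i k * m k j) = m i j" for i j
    by (subst infsum_supported_at[of i]) auto
  then show ?thesis by simp
qed

text \<open>The second identity is S S* = 1 - e_00 multiplied on the right by a power of S*. The
  matrix unit is the defect of multiplicativity from which the ideal arises.\<close>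

lemma shift_mult_pow:
  "0 \<le> n \<Longrightarrow> shift \<otimes>\<^bsub>smooth_toeplitz\<^esub> shift_pow n = shift_pow (n + 1)"
  "shift_pow (- int j) = shift \<otimes>\<^bsub>smooth_toeplitz\<^esub> shift_pow (- int (Suc j)) \<oplus>\<^bsub>smooth_toeplitz\<^esub> matrix_unit 0 j"
  unfolding shift_mult by (auto simp: shift_pow_eq matrix_unit_def fun_eq_iff)

lemma shift_mult_unit: "shift \<otimes>\<^bsub>smooth_toeplitz\<^esub> matrix_unit i j = matrix_unit (Suc i) j"
  unfolding shift_mult by (auto simp: matrix_unit_def fun_eq_iff)

lemma backward_shift_mult_pow: "backward_shift \<otimes>\<^bsub>smooth_toeplitz\<^esub> shift_pow n = shift_pow (n - 1)"
  unfolding backward_shift_mult by (auto simp: shift_pow_eq fun_eq_iff)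

lemma backward_shift_mult_unit:
  "backward_shift \<otimes>\<^bsub>smooth_toeplitz\<^esub> matrix_unit (Suc i) j = matrix_unit i j"
  "backward_shift \<otimes>\<^bsub>smooth_toeplitz\<^esub> matrix_unit 0 j = (\<lambda>i j. 0)"
  unfolding backward_shift_mult by (auto simp: matrix_unit_def fun_eq_iff)

section \<open>Generalized Weyl algebras\<close>

lemma free_ring_simps [simp]:
  "carrier free_ring = UNIV" "mult free_ring = (*)" "one free_ring = 1" "zero free_ring = 0" "add free_ring = (+)"
  by (simp_all add: free_ring_def)

lemma ring_free_ring: "ring free_ring"
proof -
  have "\<exists>y. y + x = 0 \<and> x + y = 0" for x :: free_alg
    by (rule exI[of _ "- x"]) simp
  then show ?thesis
    by unfold_locales (auto simp: free_ring_def algebra_simps Units_def)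
qed

lemma free_ring_uminus: "\<ominus>\<^bsub>free_ring\<^esub> y = - y"
proof -
  interpret ring free_ring by (rule ring_free_ring)
  show ?thesis using minus_equality[of "- y" y] by simp
qed

section \<open>Polynomials inside the free algebra\<close>

abbreviation gH :: free_alg where "gH \<equiv> Poly_Mapping.single (Word [GH]) 1"

lemma word_plus [simp]: "Word u + Word v = Word (u @ v)"
  by (simp add: plus_word_def)

lemma word_zero: "0 = Word []"
  by (simp add: zero_word_def)

text \<open>Only the words that are powers of h carry coefficients, so identities about
  \<open>gpoly\<close> can be checked word by word.\<close>

lemma lookup_gpoly:
  "Poly_Mapping.lookup (gpoly d) w = (if set (letters w) \<subseteq> {GH} then coeff d (length (letters w)) else 0)"
proof -
  have "Poly_Mapping.lookup (gpoly d) w = (\<Sum>i\<le>degree d. if Word (replicate i GH) = w then coeff d i else 0)"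
    by (simp add: gpoly_def lookup_sum lookup_single when_def)
  also have "\<dots> = (\<Sum>i\<le>degree d. if i = length (letters w) then (if set (letters w) \<subseteq> {GH} then coeff d i else 0) else 0)"
  proof (rule sum.cong[OF refl])
    fix i
    have "Word (replicate i GH) = w \<longleftrightarrow> i = length (letters w) \<and> set (letters w) \<subseteq> {GH}"
      by (cases w) (auto simp: replicate_eqI subset_iff intro!: replicate_eqI[symmetric])
    then show "(if Word (replicate i GH) = w then coeff d i else 0) =
      (if i = length (letters w) then (if set (letters w) \<subseteq> {GH} then coeff d i else 0) else 0)" by auto
  qed
  also have "\<dots> = (if set (letters w) \<subseteq> {GH} then coeff d (length (letters w)) else 0)"
    by (simp add: coeff_eq_0)
  finally show ?thesis .
qed

lemma gpoly_add: "gpoly (d + e) = gpoly d + gpoly e"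
  by (rule poly_mapping_eqI) (simp add: lookup_gpoly lookup_add)

lemma gpoly_smult: "gpoly (Polynomial.smult c d) = Poly_Mapping.single 0 c * gpoly d"
  unfolding mult_map_scale_conv_mult[symmetric]
  by (rule poly_mapping_eqI) (simp add: lookup_gpoly)

lemma gpoly_const: "gpoly [:c:] = Poly_Mapping.single 0 c"
  by (simp add: gpoly_def word_zero)

lemma gpoly_1 [simp]: "gpoly 1 = 1"
  using gpoly_const[of 1] by (simp add: one_pCons)

lemma gpoly_0 [simp]: "gpoly 0 = 0"
  using gpoly_const[of 0] by simp

lemma gpoly_monom: "gpoly (monom c k) = Poly_Mapping.single (Word (replicate k GH)) c"
proof (rule poly_mapping_eqI)
  fix w
  have "Word (replicate k GH) = w \<longleftrightarrow> k = length (letters w) \<and> set (letters w) \<subseteq> {GH}"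
    by (cases w) (auto simp: replicate_eqI subset_iff intro!: replicate_eqI[symmetric])
  then show "Poly_Mapping.lookup (gpoly (monom c k)) w = Poly_Mapping.lookup (Poly_Mapping.single (Word (replicate k GH)) c) w"
    by (auto simp: lookup_gpoly lookup_single when_def)
qed

lemma gpoly_X: "gpoly [:0, 1:] = gH"
  using gpoly_monom[of 1 1] by (simp add: monom_altdef)

text \<open>Left multiplication by h shifts the coefficients by one; this recursion reduces
  multiplicativity of \<open>gpoly\<close> to an induction on the polynomial.\<close>

lemma gpoly_pCons: "gpoly (pCons a d) = Poly_Mapping.single 0 a + gH * gpoly d"
proof (induct d)
  case 0 then show ?case by (simp add: gpoly_const)
next
  case (pCons b d)
  have m: "gH * gpoly d = gpoly (pCons 0 d)" for d
  proof (rule poly_mapping_eqI)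
    fix w :: "gwa_gen word"
    have "gH * gpoly d = (\<Sum>i\<le>degree d. Poly_Mapping.single (Word (replicate (Suc i) GH)) (coeff d i))"
      by (simp add: gpoly_def sum_distrib_left Poly_Mapping.mult_single)
    then have "Poly_Mapping.lookup (gH * gpoly d) w = (\<Sum>i\<le>degree d. if Word (replicate (Suc i) GH) = w then coeff d i else 0)"
      by (simp add: lookup_sum lookup_single when_def)
    also have "\<dots> = (\<Sum>i\<le>degree d. if Suc i = length (letters w) then (if set (letters w) \<subseteq> {GH} then coeff d i else 0) else 0)"
    proof (rule sum.cong[OF refl])
      fix i
      have "Word (replicate (Suc i) GH) = w \<longleftrightarrow> Suc i = length (letters w) \<and> set (letters w) \<subseteq> {GH}"
        by (cases w) (auto simp del: replicate.simps simp: replicate_eqI subset_iff intro!: replicate_eqI[symmetric])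
      then show "(if Word (replicate (Suc i) GH) = w then coeff d i else 0) =
        (if Suc i = length (letters w) then (if set (letters w) \<subseteq> {GH} then coeff d i else 0) else 0)" by auto
    qed
    also have "\<dots> = Poly_Mapping.lookup (gpoly (pCons 0 d)) w"
      by (cases "length (letters w)") (simp_all add: lookup_gpoly coeff_eq_0)
    finally show "Poly_Mapping.lookup (gH * gpoly d) w = Poly_Mapping.lookup (gpoly (pCons 0 d)) w" .
  qed
  have "pCons a (pCons b d) = [:a:] + pCons 0 (pCons b d)" by simp
  then show ?case unfolding m using gpoly_add[of "[:a:]" "pCons 0 (pCons b d)"] by (simp add: gpoly_const)
qed

lemma gpoly_mult: "gpoly (d * e) = gpoly d * gpoly e"
proof (induct d)
  case 0 then show ?case by simp
next
  case (pCons a d)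
  have "gpoly (pCons a d * e) = gpoly (Polynomial.smult a e) + gpoly (pCons 0 (d * e))"
    by (simp add: gpoly_add)
  then show ?case by (simp add: gpoly_pCons[of 0] gpoly_pCons[of a] gpoly_smult pCons distrib_right mult.assoc)
qed

text \<open>Scalars sit at the empty word, which commutes with every word; hence the scalar action
  on the quotient is compatible with products on either side.\<close>

lemma single_scalar_commute: "Poly_Mapping.single 0 c * f = f * Poly_Mapping.single 0 (c::complex)"
  for f :: free_alg
proof (induct f rule: pm_induct)
  case (add f w d)
  then show ?case
    by (cases w) (simp add: distrib_left distrib_right Poly_Mapping.mult_single word_zero mult.commute)
qed simp

section \<open>The quotient algebra and its homogeneous elements\<close>

locale gwa_data =
  fixes \<sigma> :: "complex poly \<Rightarrow> complex poly" and P :: "complex poly"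
  assumes aut: "poly_automorphism \<sigma>"
begin

abbreviation "A \<equiv> gwa \<sigma> P"
abbreviation "cls \<equiv> gwa_class \<sigma> P"
abbreviation "I \<equiv> gwa_ideal \<sigma> P"
abbreviation \<sigma>' where "\<sigma>' \<equiv> inv_into UNIV \<sigma>"

lemma sigma_add: "\<sigma> (f + g) = \<sigma> f + \<sigma> g" and sigma_mult: "\<sigma> (f * g) = \<sigma> f * \<sigma> g"
  and sigma_const: "\<sigma> [:c:] = [:c:]" and sigma_bij: "bij \<sigma>"
  using aut by (auto simp: poly_automorphism_def)

lemma sigma_inv [simp]: "\<sigma> (\<sigma>' f) = f" "\<sigma>' (\<sigma> f) = f"
  using sigma_bij by (simp_all add: bij_is_surj surj_f_inv_f bij_is_inj)

lemma sigma'_add: "\<sigma>' (f + g) = \<sigma>' f + \<sigma>' g" 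
  using sigma_add[of "\<sigma>' f" "\<sigma>' g"] by (metis sigma_inv)

lemma sigma'_mult: "\<sigma>' (f * g) = \<sigma>' f * \<sigma>' g" 
  using sigma_mult[of "\<sigma>' f" "\<sigma>' g"] by (metis sigma_inv)

lemma sigma'_const: "\<sigma>' [:c:] = [:c:]"
  using sigma_const by (metis sigma_inv(2))

lemma sigma_simps [simp]: "\<sigma> 0 = 0" "\<sigma> 1 = 1" "\<sigma>' 0 = 0" "\<sigma>' 1 = 1"
  using sigma_const[of 0] sigma_const[of 1] sigma'_const[of 0] sigma'_const[of 1] by (simp_all add: one_pCons)

lemma sigma_smult: "\<sigma> (Polynomial.smult c f) = Polynomial.smult c (\<sigma> f)"
  "\<sigma>' (Polynomial.smult c f) = Polynomial.smult c (\<sigma>' f)"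
  using sigma_mult[of "[:c:]" f] sigma'_mult[of "[:c:]" f] by (simp_all add: sigma_const sigma'_const)

lemma ideal_I: "ideal I free_ring"
  unfolding gwa_ideal_def by (rule ring.genideal_ideal[OF ring_free_ring]) simp

lemma gwa_simps:
  "carrier A = range cls" "add A = add (free_ring Quot I)" "zero A = I"
  "mult A = mult (free_ring Quot I)" "smult A = (\<lambda>c a. cls (gpoly [:c:]) \<otimes>\<^bsub>free_ring Quot I\<^esub> a)"
  by (auto simp: gwa_def gwa_alg_def Let_def ring.defs module.defs FactRing_def A_RCOSETS_def' gwa_class_def)

lemma cls_hom: "ring_hom_ring free_ring (free_ring Quot I) cls"
  using ideal.rcos_ring_hom_ring[OF ideal_I] by (simp add: gwa_class_def[abs_def])

lemma cls_carrier [simp]: "cls f \<in> carrier A"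
  by (simp add: gwa_simps)

lemma cls_add: "cls (f + g) = cls f \<oplus>\<^bsub>A\<^esub> cls g"
  using ring_hom_ring.homh[OF cls_hom] ring_hom_add[of cls free_ring "free_ring Quot I" f g] by (simp add: gwa_simps)

lemma cls_mult: "cls (f * g) = cls f \<otimes>\<^bsub>A\<^esub> cls g"
  using ring_hom_ring.homh[OF cls_hom] ring_hom_mult[of cls free_ring "free_ring Quot I" f g] by (simp add: gwa_simps)

lemma cls_scale: "cls (Poly_Mapping.single 0 c * f) = c \<odot>\<^bsub>A\<^esub> cls f"
  using cls_mult[of "gpoly [:c:]" f] by (simp add: gwa_simps gpoly_const)

lemma cls_zero: "\<zero>\<^bsub>A\<^esub> = cls 0"
proof -
  interpret ideal I free_ring by (rule ideal_I)
  show ?thesis using a_coset_add_zero[OF a_subset] by (simp add: gwa_simps gwa_class_def)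
qed

lemma cls_eq_iff: "cls f = cls g \<longleftrightarrow> f - g \<in> I"
proof -
  interpret ideal I free_ring by (rule ideal_I)
  have mem: "f \<in> cls g \<longleftrightarrow> f - g \<in> I" for f g
    by (force simp: gwa_class_def a_r_coset_def' image_iff)
  have self: "f \<in> cls f" for f
    using a_rcos_self[of f] by (simp add: gwa_class_def)
  have "cls f = cls g" if "f \<in> cls g"
    using a_repr_independence'[of f g] that by (simp add: gwa_class_def)
  then show ?thesis using mem self by blast
qed

lemma cls_cases: "a \<in> carrier A \<Longrightarrow> (\<And>f. a = cls f \<Longrightarrow> thesis) \<Longrightarrow> thesis"
  by (auto simp: gwa_simps)

lemma cvec_gwa: "cvec A"
proof (rule cvecI)
  show "\<zero>\<^bsub>A\<^esub> \<in> carrier A" by (simp add: cls_zero)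
  show "x \<oplus>\<^bsub>A\<^esub> y \<in> carrier A" if "x \<in> carrier A" "y \<in> carrier A" for x y
    using that by (elim cls_cases) (simp add: cls_add[symmetric])
  show "(x \<oplus>\<^bsub>A\<^esub> y) \<oplus>\<^bsub>A\<^esub> z = x \<oplus>\<^bsub>A\<^esub> (y \<oplus>\<^bsub>A\<^esub> z)" if "x \<in> carrier A" "y \<in> carrier A" "z \<in> carrier A" for x y z
    using that by (elim cls_cases) (simp add: cls_add[symmetric] add.assoc)
  show "x \<oplus>\<^bsub>A\<^esub> y = y \<oplus>\<^bsub>A\<^esub> x" if "x \<in> carrier A" "y \<in> carrier A" for x y
    using that by (elim cls_cases) (simp add: cls_add[symmetric] add.commute)
  show "\<zero>\<^bsub>A\<^esub> \<oplus>\<^bsub>A\<^esub> x = x" if "x \<in> carrier A" for x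
    using that by (elim cls_cases) (simp add: cls_add[symmetric] cls_zero)
  show "c \<odot>\<^bsub>A\<^esub> x \<in> carrier A" if "x \<in> carrier A" for c x
    using that by (elim cls_cases) (simp add: cls_scale[symmetric])
  show "(a + b) \<odot>\<^bsub>A\<^esub> x = a \<odot>\<^bsub>A\<^esub> x \<oplus>\<^bsub>A\<^esub> b \<odot>\<^bsub>A\<^esub> x" if "x \<in> carrier A" for a b x
    using that by (elim cls_cases) (simp add: cls_scale[symmetric] cls_add[symmetric] single_add distrib_right)
  show "a \<odot>\<^bsub>A\<^esub> (x \<oplus>\<^bsub>A\<^esub> y) = a \<odot>\<^bsub>A\<^esub> x \<oplus>\<^bsub>A\<^esub> a \<odot>\<^bsub>A\<^esub> y" if "x \<in> carrier A" "y \<in> carrier A" for a x y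
    using that by (elim cls_cases) (simp add: cls_scale[symmetric] cls_add[symmetric] distrib_left)
  show "a \<odot>\<^bsub>A\<^esub> (b \<odot>\<^bsub>A\<^esub> x) = (a * b) \<odot>\<^bsub>A\<^esub> x" if "x \<in> carrier A" for a b x
    using that by (elim cls_cases) (simp add: cls_scale[symmetric] mult.assoc[symmetric] Poly_Mapping.mult_single)
  show "1 \<odot>\<^bsub>A\<^esub> x = x" if "x \<in> carrier A" for x
    using that by (elim cls_cases) (simp add: cls_scale[symmetric])
  show "0 \<odot>\<^bsub>A\<^esub> x = \<zero>\<^bsub>A\<^esub>" if "x \<in> carrier A" for x
    using that by (elim cls_cases) (simp add: cls_scale[symmetric] cls_zero)
qed

sublocale A: cvec A by (rule cvec_gwa)

lemma assoc_alg_gwa: "assoc_alg A"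
  unfolding assoc_alg_def
proof (intro conjI ballI)
  show "Module.module CC A" by (rule A.module_axioms)
next
  fix x assume x: "x \<in> carrier A"
  then obtain f where f: "x = cls f" by (rule cls_cases)
  show "lin_map A A (\<lambda>y. x \<otimes>\<^bsub>A\<^esub> y)"
  proof (rule lin_mapI)
    fix y z c assume "y \<in> carrier A"
    then obtain g where g: "y = cls g" by (rule cls_cases)
    show "x \<otimes>\<^bsub>A\<^esub> y \<in> carrier A" by (simp add: f g cls_mult[symmetric])
    show "x \<otimes>\<^bsub>A\<^esub> (c \<odot>\<^bsub>A\<^esub> y) = c \<odot>\<^bsub>A\<^esub> (x \<otimes>\<^bsub>A\<^esub> y)"
      by (simp add: f g cls_mult[symmetric] cls_scale[symmetric] mult.assoc[symmetric] single_scalar_commute[of c f])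
    assume "z \<in> carrier A"
    then obtain h where h: "z = cls h" by (rule cls_cases)
    show "x \<otimes>\<^bsub>A\<^esub> (y \<oplus>\<^bsub>A\<^esub> z) = x \<otimes>\<^bsub>A\<^esub> y \<oplus>\<^bsub>A\<^esub> x \<otimes>\<^bsub>A\<^esub> z"
      by (simp add: f g h cls_mult[symmetric] cls_add[symmetric] distrib_left)
  qed
  show "lin_map A A (\<lambda>y. y \<otimes>\<^bsub>A\<^esub> x)"
  proof (rule lin_mapI)
    fix y z c assume "y \<in> carrier A"
    then obtain g where g: "y = cls g" by (rule cls_cases)
    show "y \<otimes>\<^bsub>A\<^esub> x \<in> carrier A" by (simp add: f g cls_mult[symmetric])
    show "(c \<odot>\<^bsub>A\<^esub> y) \<otimes>\<^bsub>A\<^esub> x = c \<odot>\<^bsub>A\<^esub> (y \<otimes>\<^bsub>A\<^esub> x)"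
      by (simp add: f g cls_mult[symmetric] cls_scale[symmetric] mult.assoc)
    assume "z \<in> carrier A"
    then obtain h where h: "z = cls h" by (rule cls_cases)
    show "(y \<oplus>\<^bsub>A\<^esub> z) \<otimes>\<^bsub>A\<^esub> x = y \<otimes>\<^bsub>A\<^esub> x \<oplus>\<^bsub>A\<^esub> z \<otimes>\<^bsub>A\<^esub> x"
      by (simp add: f g h cls_mult[symmetric] cls_add[symmetric] distrib_right)
  qed
next
  fix x y z assume "x \<in> carrier A" "y \<in> carrier A" "z \<in> carrier A"
  then show "x \<otimes>\<^bsub>A\<^esub> y \<otimes>\<^bsub>A\<^esub> z = x \<otimes>\<^bsub>A\<^esub> (y \<otimes>\<^bsub>A\<^esub> z)"
    by (elim cls_cases) (simp add: cls_mult[symmetric] mult.assoc)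
qed

lemma relations:
  "cls (gX * gpoly d) = cls (gpoly (\<sigma> d) * gX)"
  "cls (gY * gpoly d) = cls (gpoly (\<sigma>' d) * gY)"
  "cls (gY * gX) = cls (gpoly P)"
  "cls (gX * gY) = cls (gpoly (\<sigma> P))"
proof -
  have "{gX * gpoly d - gpoly (\<sigma> d) * gX |d. True} \<union>
      {gY * gpoly d - gpoly (\<sigma>' d) * gY |d. True} \<union>
      {gY * gX - gpoly P, gX * gY - gpoly (\<sigma> P)} \<subseteq> I"
    unfolding gwa_ideal_def by (rule ring.genideal_self[OF ring_free_ring]) simp
  then show "cls (gX * gpoly d) = cls (gpoly (\<sigma> d) * gX)"
    "cls (gY * gpoly d) = cls (gpoly (\<sigma>' d) * gY)"
    "cls (gY * gX) = cls (gpoly P)"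
    "cls (gX * gY) = cls (gpoly (\<sigma> P))"
    unfolding cls_eq_iff by blast+
qed

lemma cls_cong: "cls a = cls b \<Longrightarrow> cls (u * a * v) = cls (u * b * v)"
  by (simp add: cls_mult)

text \<open>The typical element of \<open>A\<close> of degree n. With the polynomial kept on the
  left, products of homogeneous elements become computations with polynomials, twisted by \<sigma>
  and its inverse.\<close>

definition hom_elt :: "complex poly \<Rightarrow> int \<Rightarrow> gwa_elt" where
  "hom_elt d n = cls (gpoly d * (if 0 \<le> n then gY ^ nat n else gX ^ nat (- n)))"

lemma hom_elt_carrier [simp]: "hom_elt d n \<in> carrier A"
  by (simp add: hom_elt_def)

lemma gwa_comp_eq: "gwa_comp \<sigma> P n = range (\<lambda>d. hom_elt d n)"
  by (auto simp: gwa_comp_def hom_elt_def)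

lemma hom_elt_add: "hom_elt (d + e) n = hom_elt d n \<oplus>\<^bsub>A\<^esub> hom_elt e n"
  by (simp add: hom_elt_def gpoly_add distrib_right cls_add)

lemma hom_elt_smult: "hom_elt (Polynomial.smult c d) n = c \<odot>\<^bsub>A\<^esub> hom_elt d n"
  by (simp add: hom_elt_def gpoly_smult mult.assoc cls_scale)

lemma hom_elt_zero: "hom_elt 0 n = \<zero>\<^bsub>A\<^esub>"
  by (simp add: hom_elt_def cls_zero)

lemma hom_elt_mult_0: "hom_elt d 0 \<otimes>\<^bsub>A\<^esub> hom_elt e n = hom_elt (d * e) n"
  by (simp add: hom_elt_def cls_mult[symmetric] gpoly_mult mult.assoc)

lemma hom_elt_of_nat: "hom_elt d (int k) = cls (gpoly d * gY ^ k)"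
  "hom_elt d (- int k) = cls (gpoly d * gX ^ k)"
  "hom_elt d 1 = cls (gpoly d * gY)" "hom_elt d (-1) = cls (gpoly d * gX)"
  by (auto simp: hom_elt_def)

text \<open>Moving y past \<open>e\<close> twists it by the inverse of \<sigma>. In negative degree
  y then stands next to an x, and y x = P; as this pair directly follows the polynomial, P itself is
  not twisted.\<close>

lemma hom_elt_mult_1:
  "hom_elt d 1 \<otimes>\<^bsub>A\<^esub> hom_elt e n = hom_elt (d * \<sigma>' e * (if n < 0 then P else 1)) (n + 1)"
proof (cases "0 \<le> n")
  case True
  then obtain k where k: "n = int k" by (metis nonneg_int_cases)
  have "hom_elt d 1 \<otimes>\<^bsub>A\<^esub> hom_elt e n = cls (gpoly d * (gY * gpoly e) * gY ^ k)"
    unfolding k hom_elt_of_nat cls_mult[symmetric] by (simp add: mult.assoc)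
  also have "\<dots> = cls (gpoly d * (gpoly (\<sigma>' e) * gY) * gY ^ k)" by (rule cls_cong[OF relations(2)])
  also have "\<dots> = hom_elt (d * \<sigma>' e) (int (Suc k))"
    unfolding hom_elt_of_nat gpoly_mult by (simp add: mult.assoc)
  finally show ?thesis by (simp add: k add.commute)
next
  case False
  then have "- n - 1 \<ge> 0" by simp
  then obtain k where "- n - 1 = int k" by (metis nonneg_int_cases)
  then have k: "n = - int (Suc k)" by simp
  have "hom_elt d 1 \<otimes>\<^bsub>A\<^esub> hom_elt e n = cls (gpoly d * (gY * gpoly e) * gX ^ Suc k)"
    unfolding k hom_elt_of_nat cls_mult[symmetric] by (simp only: mult.assoc)
  also have "\<dots> = cls (gpoly d * (gpoly (\<sigma>' e) * gY) * gX ^ Suc k)" by (rule cls_cong[OF relations(2)])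
  also have "\<dots> = cls ((gpoly d * gpoly (\<sigma>' e)) * (gY * gX) * gX ^ k)" by (simp add: mult.assoc)
  also have "\<dots> = cls ((gpoly d * gpoly (\<sigma>' e)) * gpoly P * gX ^ k)" by (rule cls_cong[OF relations(3)])
  also have "\<dots> = hom_elt (d * \<sigma>' e * P) (- int k)"
    unfolding hom_elt_of_nat gpoly_mult ..
  finally show ?thesis by (simp add: k)
qed

text \<open>The mirror image: in positive degree x meets a y, and x y = \<sigma> P.\<close>

lemma hom_elt_mult_m1:
  "hom_elt d (-1) \<otimes>\<^bsub>A\<^esub> hom_elt e n = hom_elt (d * \<sigma> e * (if 0 < n then \<sigma> P else 1)) (n - 1)"
proof (cases "0 < n")
  case False
  then have "- n \<ge> 0" by simp
  then obtain k where "- n = int k" by (metis nonneg_int_cases)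
  then have k: "n = - int k" by simp
  have "hom_elt d (-1) \<otimes>\<^bsub>A\<^esub> hom_elt e n = cls (gpoly d * (gX * gpoly e) * gX ^ k)"
    unfolding k hom_elt_of_nat cls_mult[symmetric] by (simp add: mult.assoc)
  also have "\<dots> = cls (gpoly d * (gpoly (\<sigma> e) * gX) * gX ^ k)" by (rule cls_cong[OF relations(1)])
  also have "\<dots> = hom_elt (d * \<sigma> e) (- int (Suc k))"
    unfolding hom_elt_of_nat gpoly_mult by (simp add: mult.assoc)
  also have "- int (Suc k) = n - 1" by (simp add: k)
  finally show ?thesis using False by simp
next
  case True
  then have "n - 1 \<ge> 0" by simp
  then obtain k where "n - 1 = int k" by (metis nonneg_int_cases)
  then have k: "n = int (Suc k)" by simp
  have "hom_elt d (-1) \<otimes>\<^bsub>A\<^esub> hom_elt e n = cls (gpoly d * (gX * gpoly e) * gY ^ Suc k)"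
    unfolding k hom_elt_of_nat cls_mult[symmetric] by (simp only: mult.assoc)
  also have "\<dots> = cls (gpoly d * (gpoly (\<sigma> e) * gX) * gY ^ Suc k)" by (rule cls_cong[OF relations(1)])
  also have "\<dots> = cls ((gpoly d * gpoly (\<sigma> e)) * (gX * gY) * gY ^ k)" by (simp add: mult.assoc)
  also have "\<dots> = cls ((gpoly d * gpoly (\<sigma> e)) * gpoly (\<sigma> P) * gY ^ k)" by (rule cls_cong[OF relations(4)])
  also have "\<dots> = hom_elt (d * \<sigma> e * \<sigma> P) (int k)"
    unfolding hom_elt_of_nat gpoly_mult ..
  finally show ?thesis by (simp add: k)
qed

end

subsection \<open>A faithful representation\<close>

context gwa_data
begin

text \<open>A function \<open>\<phi>\<close> stands for the formal sum of the \<open>\<phi> n * y\<^sup>n\<close> (\<open>n \<ge> 0\<close>) and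
  \<open>\<phi> n * x\<^sup>-\<^sup>n\<close> (\<open>n < 0\<close>), on which the generators act by left multiplication.\<close>

definition act_gen :: "gwa_gen \<Rightarrow> (int \<Rightarrow> complex poly) \<Rightarrow> int \<Rightarrow> complex poly" where
  "act_gen g \<phi> = (case g of GH \<Rightarrow> (\<lambda>n. [:0, 1:] * \<phi> n)
     | GX \<Rightarrow> (\<lambda>n. \<sigma> (\<phi> (n + 1)) * (if 0 < n + 1 then \<sigma> P else 1))
     | GY \<Rightarrow> (\<lambda>n. \<sigma>' (\<phi> (n - 1)) * (if n - 1 < 0 then P else 1)))"

definition act_word :: "gwa_gen word \<Rightarrow> (int \<Rightarrow> complex poly) \<Rightarrow> int \<Rightarrow> complex poly" where
  "act_word w = foldr act_gen (letters w)"

definition act :: "free_alg \<Rightarrow> (int \<Rightarrow> complex poly) \<Rightarrow> int \<Rightarrow> complex poly" where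
  "act f \<phi> = (\<lambda>n. \<Sum>w\<in>Poly_Mapping.keys f. Polynomial.smult (Poly_Mapping.lookup f w) (act_word w \<phi> n))"

lemma act_gen_lin:
  "act_gen g (\<lambda>n. \<phi> n + \<psi> n) = (\<lambda>n. act_gen g \<phi> n + act_gen g \<psi> n)"
  "act_gen g (\<lambda>n. Polynomial.smult c (\<phi> n)) = (\<lambda>n. Polynomial.smult c (act_gen g \<phi> n))"
  by (cases g; simp add: act_gen_def sigma_add sigma'_add sigma_smult algebra_simps)+

lemma act_word_lin:
  "act_word w (\<lambda>n. \<phi> n + \<psi> n) = (\<lambda>n. act_word w \<phi> n + act_word w \<psi> n)"
  "act_word w (\<lambda>n. Polynomial.smult c (\<phi> n)) = (\<lambda>n. Polynomial.smult c (act_word w \<phi> n))"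
proof -
  have "foldr act_gen l (\<lambda>n. \<phi> n + \<psi> n) = (\<lambda>n. foldr act_gen l \<phi> n + foldr act_gen l \<psi> n)" for l
    by (induct l) (simp_all add: act_gen_lin)
  moreover have "foldr act_gen l (\<lambda>n. Polynomial.smult c (\<phi> n)) = (\<lambda>n. Polynomial.smult c (foldr act_gen l \<phi> n))" for l
    by (induct l) (simp_all add: act_gen_lin)
  ultimately show "act_word w (\<lambda>n. \<phi> n + \<psi> n) = (\<lambda>n. act_word w \<phi> n + act_word w \<psi> n)"
    "act_word w (\<lambda>n. Polynomial.smult c (\<phi> n)) = (\<lambda>n. Polynomial.smult c (act_word w \<phi> n))"
    by (simp_all add: act_word_def)
qed

lemma act_word_plus: "act_word (u + v) \<phi> = act_word u (act_word v \<phi>)"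
  by (cases u; cases v) (simp add: act_word_def)

lemma act_superset:
  "finite S \<Longrightarrow> Poly_Mapping.keys f \<subseteq> S \<Longrightarrow>
   act f \<phi> n = (\<Sum>w\<in>S. Polynomial.smult (Poly_Mapping.lookup f w) (act_word w \<phi> n))"
  unfolding act_def by (rule sum.mono_neutral_left) (auto simp: in_keys_iff)

lemma act_0 [simp]: "act 0 \<phi> = (\<lambda>n. 0)"
  by (simp add: act_def)

lemma act_add: "act (f + g) \<phi> = (\<lambda>n. act f \<phi> n + act g \<phi> n)"
proof
  fix n
  let ?S = "Poly_Mapping.keys f \<union> Poly_Mapping.keys g"
  have "act (f + g) \<phi> n = (\<Sum>w\<in>?S. Polynomial.smult (Poly_Mapping.lookup (f + g) w) (act_word w \<phi> n))"
    by (rule act_superset) (use Poly_Mapping.keys_add[of f g] in auto)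
  then show "act (f + g) \<phi> n = act f \<phi> n + act g \<phi> n"
    by (simp add: lookup_add smult_add_left sum.distrib act_superset[of ?S f] act_superset[of ?S g])
qed

lemma act_diff: "act (f - g) \<phi> = (\<lambda>n. act f \<phi> n - act g \<phi> n)"
  using act_add[of "f - g" g \<phi>] by (simp add: fun_eq_iff)

lemma act_single: "act (Poly_Mapping.single w c) \<phi> = (\<lambda>n. Polynomial.smult c (act_word w \<phi> n))"
  by (rule ext, subst act_superset[of "{w}"]) auto

lemma act_zero_right: "act f (\<lambda>n. 0) = (\<lambda>n. 0)"
proof -
  have "act_word w (\<lambda>n. 0) = (\<lambda>n. 0)" for w
    using act_word_lin(2)[of w 0 "\<lambda>n. 0"] by simp
  then show ?thesis by (simp add: act_def)
qed

lemma act_mult: "act (f * g) \<phi> = act f (act g \<phi>)"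
proof (induct f rule: pm_induct)
  case zero then show ?case by simp
next
  case (add f w c)
  have "act (Poly_Mapping.single w c * g) \<phi> = act (Poly_Mapping.single w c) (act g \<phi>)"
  proof (induct g rule: pm_induct)
    case zero then show ?case by (simp add: act_zero_right)
  next
    case (add g v d)
    then show ?case
      by (simp add: distrib_left act_add Poly_Mapping.mult_single act_single act_word_lin act_word_plus
          smult_add_right)
  qed
  then show ?case by (simp add: distrib_right act_add add)
qed

lemma act_gpoly: "act (gpoly d) \<phi> = (\<lambda>n. d * \<phi> n)"
proof (induct d)
  case 0 then show ?case by simp
next
  case (pCons a d)
  have "act gH \<psi> = (\<lambda>n. [:0, 1:] * \<psi> n)" for \<psi>
    by (simp add: act_single act_word_def act_gen_def)
  moreover have "act (Poly_Mapping.single 0 a) \<psi> = (\<lambda>n. Polynomial.smult a (\<psi> n))" for \<psi>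
    by (simp add: act_single act_word_def zero_word_def)
  ultimately show ?case
    using pCons by (simp add: gpoly_pCons act_add act_mult fun_eq_iff algebra_simps)
qed

lemma act_gX: "act gX \<phi> = (\<lambda>n. \<sigma> (\<phi> (n + 1)) * (if 0 < n + 1 then \<sigma> P else 1))"
  and act_gY: "act gY \<phi> = (\<lambda>n. \<sigma>' (\<phi> (n - 1)) * (if n - 1 < 0 then P else 1))"
  by (simp_all add: gX_def gY_def act_single act_word_def act_gen_def)

text \<open>The elements acting as zero form a two-sided ideal, so the defining relations are all
  that has to be verified. The ideal absorbs from the right because vanishing is required on all
  \<phi> at once.\<close>

lemma act_ideal:
  assumes "f \<in> I" shows "act f \<phi> = (\<lambda>n. 0)"
proof -
  let ?J = "{f. \<forall>\<phi>. act f \<phi> = (\<lambda>n. 0)}"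
  have "ideal ?J free_ring"
  proof (rule idealI[OF ring_free_ring])
    have inv: "inv\<^bsub>add_monoid free_ring\<^esub> y = - y" for y using free_ring_uminus[of y] by (simp add: a_inv_def)
    show "subgroup ?J (add_monoid free_ring)"
    proof
      fix x assume "x \<in> ?J"
      then show "inv\<^bsub>add_monoid free_ring\<^esub> x \<in> ?J"
        unfolding inv using act_diff[of 0 x] by simp
    qed (auto simp: act_add)
  qed (auto simp: act_mult act_zero_right)
  moreover have "{gX * gpoly d - gpoly (\<sigma> d) * gX |d. True} \<union>
      {gY * gpoly d - gpoly (\<sigma>' d) * gY |d. True} \<union>
      {gY * gX - gpoly P, gX * gY - gpoly (\<sigma> P)} \<subseteq> ?J"
    by (auto simp: act_diff act_mult act_gpoly act_gX act_gY sigma_mult sigma'_mult fun_eq_iff mult.assoc)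
  ultimately have "I \<subseteq> ?J"
    unfolding gwa_ideal_def by (rule ring.genideal_minimal[OF ring_free_ring])
  then show ?thesis using assms by blast
qed

text \<open>The image of the vector that stands for 1 under a representative;
  \<open>act_ideal\<close> makes the choice of representative irrelevant.\<close>

definition rep :: "gwa_elt \<Rightarrow> int \<Rightarrow> complex poly" where
  "rep a = act (SOME f. cls f = a) (\<lambda>n. if n = 0 then 1 else 0)"

lemma rep_cls: "rep (cls f) = act f (\<lambda>n. if n = 0 then 1 else 0)"
proof -
  have "cls (SOME g. cls g = cls f) = cls f" by (rule someI[of _ f]) simp
  then have "(SOME g. cls g = cls f) - f \<in> I" by (simp add: cls_eq_iff)
  then have "act ((SOME g. cls g = cls f) - f) (\<lambda>n. if n = 0 then 1 else 0) = (\<lambda>n. 0)" by (rule act_ideal)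
  then show ?thesis by (simp add: rep_def act_diff fun_eq_iff)
qed

lemma rep_add: "a \<in> carrier A \<Longrightarrow> b \<in> carrier A \<Longrightarrow> rep (a \<oplus>\<^bsub>A\<^esub> b) n = rep a n + rep b n"
  by (elim cls_cases) (simp add: cls_add[symmetric] rep_cls act_add)

lemma rep_smult: "a \<in> carrier A \<Longrightarrow> rep (c \<odot>\<^bsub>A\<^esub> a) n = Polynomial.smult c (rep a n)"
  by (elim cls_cases) (simp add: cls_scale[symmetric] rep_cls act_mult gpoly_const[symmetric] act_gpoly)

lemma act_power:
  "act (gY ^ k) (\<lambda>n. if n = 0 then 1 else 0) = (\<lambda>n. if n = int k then 1 else 0)"
  "act (gX ^ k) (\<lambda>n. if n = 0 then 1 else 0) = (\<lambda>n. if n = - int k then 1 else 0)"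
proof (induct k)
  case 0
  have "act 1 \<phi> = \<phi>" for \<phi> using act_gpoly[of 1 \<phi>] by simp
  then show "act (gY ^ 0) (\<lambda>n. if n = 0 then 1 else 0) = (\<lambda>n. if n = int 0 then 1 else 0)"
    "act (gX ^ 0) (\<lambda>n. if n = 0 then 1 else 0) = (\<lambda>n. if n = - int 0 then 1 else 0)" by simp_all
next
  case (Suc k)
  show "act (gY ^ Suc k) (\<lambda>n. if n = 0 then 1 else 0) = (\<lambda>n. if n = int (Suc k) then 1 else 0)"
    unfolding power_Suc act_mult Suc act_gY by (auto simp: fun_eq_iff)
  show "act (gX ^ Suc k) (\<lambda>n. if n = 0 then 1 else 0) = (\<lambda>n. if n = - int (Suc k) then 1 else 0)"
    unfolding power_Suc act_mult Suc act_gX by (auto simp: fun_eq_iff)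
qed

text \<open>The polynomial of a homogeneous element can be recovered, so the relations do not make
  the algebra collapse. This is the independence half of the basis property.\<close>

lemma rep_hom_elt: "rep (hom_elt d n) = (\<lambda>m. if m = n then d else 0)"
  by (auto simp: hom_elt_def rep_cls act_mult act_gpoly act_power fun_eq_iff)

section \<open>Basis and coordinates\<close>

definition basis :: "int \<times> nat \<Rightarrow> gwa_elt" where
  "basis z = hom_elt (monom 1 (snd z)) (fst z)"

lemma basis_carrier [simp]: "basis z \<in> carrier A"
  by (simp add: basis_def)

lemma coeff_rep_lincomb: "coeff (rep (lincomb A basis c) n) k = Poly_Mapping.lookup c (n, k)"
proof (induct c rule: pm_induct)
  case zero
  have "rep \<zero>\<^bsub>A\<^esub> n = 0" by (simp add: cls_zero rep_cls)
  then show ?case by simp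
next
  case (add f w c)
  then show ?case
    by (simp add: A.lincomb_add A.lincomb_single rep_add rep_smult lookup_add lookup_single)
       (auto simp: basis_def rep_hom_elt when_def prod_eq_iff)
qed

lemma hom_elt_in_span: "hom_elt d n \<in> range (lincomb A basis)"
proof -
  have sub: "submodule (range (lincomb A basis)) CC A" by (rule A.range_lincomb_submodule) simp
  have "hom_elt (\<Sum>i\<in>S. monom (coeff d i) i) n \<in> range (lincomb A basis)" if "finite S" for S
    using that
  proof induct
    case empty then show ?case using A.submoduleD(2)[OF sub] by (simp add: hom_elt_zero)
  next
    case (insert i S)
    have "hom_elt (monom (coeff d i) i) n = coeff d i \<odot>\<^bsub>A\<^esub> basis (n, i)"
      by (simp add: basis_def hom_elt_smult[symmetric] smult_monom)
    also have "\<dots> = lincomb A basis (Poly_Mapping.single (n, i) (coeff d i))" by (simp add: A.lincomb_single)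
    finally show ?case using insert A.submoduleD(3)[OF sub] by (simp add: hom_elt_add)
  qed
  from this[of "{..degree d}"] show ?thesis by (simp add: poly_as_sum_of_monoms)
qed

lemma hom_elt_gens: "hom_elt [:0, 1:] 0 = cls gH" "hom_elt 1 1 = cls gY" "hom_elt 1 (-1) = cls gX" "hom_elt 1 0 = cls 1"
  by (simp_all add: hom_elt_def gpoly_X)

text \<open>The span of the basis contains 1 and is stable under left multiplication by the three
  generators, hence it contains every word.\<close>

lemma span_all: "a \<in> carrier A \<Longrightarrow> a \<in> range (lincomb A basis)"
proof (elim cls_cases)
  fix f assume a: "a = cls f"
  have sub: "submodule (range (lincomb A basis)) CC A" by (rule A.range_lincomb_submodule) simp
  have lin: "lin_map A A (\<lambda>b. cls g \<otimes>\<^bsub>A\<^esub> b)" for g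
    using assoc_alg_gwa by (simp add: assoc_alg_def)
  have step: "cls (Poly_Mapping.single (Word [g]) 1) \<otimes>\<^bsub>A\<^esub> b \<in> range (lincomb A basis)"
    if b: "b \<in> range (lincomb A basis)" for b g
  proof -
    obtain c where c: "b = lincomb A basis c" using b by auto
    interpret cvec_lin A A "\<lambda>b. cls (Poly_Mapping.single (Word [g]) 1) \<otimes>\<^bsub>A\<^esub> b"
      by unfold_locales (rule lin)
    have "cls (Poly_Mapping.single (Word [g]) 1) \<otimes>\<^bsub>A\<^esub> basis z \<in> range (lincomb A basis)" for z
    proof (cases g)
      case GH
      then show ?thesis using hom_elt_mult_0[of "[:0, 1:]"] hom_elt_in_span
        by (simp add: basis_def hom_elt_gens)
    next
      case GX
      then show ?thesis using hom_elt_mult_m1[of 1] hom_elt_in_span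
        by (simp add: basis_def hom_elt_gens gX_def)
    next
      case GY
      then show ?thesis using hom_elt_mult_1[of 1] hom_elt_in_span
        by (simp add: basis_def hom_elt_gens gY_def)
    qed
    then show ?thesis unfolding c by (subst map_lincomb) (auto intro!: A.lincomb_in_submodule[OF sub])
  qed
  have word: "cls (Poly_Mapping.single (Word l) 1) \<in> range (lincomb A basis)" for l
  proof (induct l)
    case Nil
    then show ?case using hom_elt_in_span[of 1 0] by (simp add: hom_elt_gens word_zero[symmetric])
  next
    case (Cons g l)
    have "Poly_Mapping.single (Word (g # l)) 1 = Poly_Mapping.single (Word [g]) 1 * Poly_Mapping.single (Word l) (1::complex)"
      by (simp add: Poly_Mapping.mult_single)
    then show ?case using step[OF Cons, of g] by (simp add: cls_mult)
  qed
  have "cls f \<in> range (lincomb A basis)"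
  proof (induct f rule: pm_induct)
    case zero then show ?case using A.submoduleD(2)[OF sub] by (simp add: cls_zero)
  next
    case (add f w c)
    have "Poly_Mapping.single w c = Poly_Mapping.single 0 c * Poly_Mapping.single w 1"
      by (simp add: Poly_Mapping.mult_single)
    then have "cls (Poly_Mapping.single w c) = c \<odot>\<^bsub>A\<^esub> cls (Poly_Mapping.single w 1)" by (simp only: cls_scale)
    moreover have "cls (Poly_Mapping.single w 1) \<in> range (lincomb A basis)" using word[of "letters w"] by simp
    ultimately show ?case using add A.submoduleD(3,4)[OF sub] by (simp add: cls_add)
  qed
  then show ?thesis by (simp add: a)
qed

definition coords :: "gwa_elt \<Rightarrow> (int \<times> nat \<Rightarrow>\<^sub>0 complex)" where
  "coords a = (SOME c. lincomb A basis c = a)"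

lemma lincomb_coords: "a \<in> carrier A \<Longrightarrow> lincomb A basis (coords a) = a"
  unfolding coords_def using span_all[of a] by (metis (mono_tags) rangeE someI)

lemma lookup_coords: "a \<in> carrier A \<Longrightarrow> Poly_Mapping.lookup (coords a) (n, k) = coeff (rep a n) k"
  using coeff_rep_lincomb[of "coords a" n k] by (simp add: lincomb_coords)

lemma coords_eqI: "a \<in> carrier A \<Longrightarrow> (\<And>n k. coeff (rep a n) k = Poly_Mapping.lookup c (n, k)) \<Longrightarrow> coords a = c"
  by (rule poly_mapping_eqI) (auto simp: lookup_coords)

lemma coords_lincomb [simp]: "coords (lincomb A basis c) = c"
  by (rule coords_eqI) (simp_all add: coeff_rep_lincomb)

lemma coords_add: "a \<in> carrier A \<Longrightarrow> b \<in> carrier A \<Longrightarrow> coords (a \<oplus>\<^bsub>A\<^esub> b) = coords a + coords b"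
  by (rule coords_eqI) (simp_all add: rep_add lookup_add lookup_coords)

lemma coords_scale: "a \<in> carrier A \<Longrightarrow> coords (c \<odot>\<^bsub>A\<^esub> a) = pm_scale c (coords a)"
  by (rule coords_eqI) (simp_all add: rep_smult lookup_coords)

lemma coords_diff:
  assumes "a \<in> carrier A" "b \<in> carrier A" shows "coords (a \<ominus>\<^bsub>A\<^esub> b) = coords a - coords b"
proof -
  have "coords a - coords b = coords a + pm_scale (-1) (coords b)"
    by (rule poly_mapping_eqI) (simp add: lookup_add lookup_minus)
  then show ?thesis using assms by (simp only: A.minus_eq' coords_add coords_scale A.smul_closed)
qed

lemma lookup_coords_hom_elt: "Poly_Mapping.lookup (coords (hom_elt d n)) (m, k) = (if m = n then coeff d k else 0)"
  by (simp add: lookup_coords rep_hom_elt)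

subsection \<open>The fine topology\<close>

lemma gwa_lcs: "lcs A"
  unfolding gwa_def by (rule lcs_with_topology) (use cvec_gwa in \<open>auto simp: gwa_def\<close>)

sublocale A: lcs A by (rule gwa_lcs)

lemma gwa_cont_seminorms: "cont_seminorms A = {q. seminorm_on A q}"
proof -
  have s: "seminorm_on A q \<longleftrightarrow> seminorm_on (gwa_alg \<sigma> P) q" for q
    by (rule seminorm_on_cong) (simp_all add: gwa_def)
  have "topo A = seminorm_topology (gwa_alg \<sigma> P) {q. seminorm_on (gwa_alg \<sigma> P) q}"
    by (simp add: gwa_def)
  also have "\<dots> = seminorm_topology A {q. seminorm_on A q}"
    unfolding s by (rule seminorm_topology_cong) (simp_all add: gwa_def)
  finally have t: "topo A = seminorm_topology A {q. seminorm_on A q}" .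
  show ?thesis
  proof
    show "{q. seminorm_on A q} \<subseteq> cont_seminorms A"
      using A.cs_generating[OF t] by blast
  qed (auto simp: cont_seminorms_def)
qed

lemma wnorm_coords_seminorm: "(\<And>i. 0 \<le> w i) \<Longrightarrow> seminorm_on A (\<lambda>a. wnorm w (coords a))"
  by (rule seminorm_onI) (simp_all add: wnorm_nonneg coords_add wnorm_add coords_scale wnorm_scale)

lemma seminorm_le_wnorm:
  assumes q: "seminorm_on A q" and a: "a \<in> carrier A"
  shows "q a \<le> wnorm (\<lambda>i. q (basis i)) (coords a)"
  using A.seminorm_lincomb[OF q, of "coords a" basis] a by (simp add: wnorm_def lincomb_coords mult.commute)

text \<open>The pullback of a continuous seminorm of \<open>W\<close> is a seminorm of
  \<open>A\<close>, and all of these are continuous.\<close>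

lemma linear_from_gwa_continuous:
  assumes "lcs W" and f: "lin_map A W f" shows "continuous_map (topo A) (topo W) f"
proof -
  interpret W: lcs W by fact
  interpret lcs_lin A W f by unfold_locales (rule f)
  show ?thesis
    by (rule continuousI) (use seminorm_comp W.cs_seminorm in \<open>auto simp: gwa_cont_seminorms\<close>)
qed

lemma gwa_Hausdorff: "Hausdorff_space (topo A)"
proof (rule A.Hausdorff_I)
  fix a assume a: "a \<in> carrier A" "a \<noteq> \<zero>\<^bsub>A\<^esub>"
  have "coords a \<noteq> 0" using a lincomb_coords[OF a(1)] by (metis A.lincomb_0)
  then obtain i where i: "Poly_Mapping.lookup (coords a) i \<noteq> 0" by (metis lookup_zero poly_mapping_eqI)
  have "0 < cmod (Poly_Mapping.lookup (coords a) i)" using i by simp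
  also have "\<dots> \<le> wnorm (\<lambda>i. 1) (coords a)" using wnorm_ge[of "\<lambda>i. 1" i "coords a"] by simp
  finally show "\<exists>r\<in>cont_seminorms A. r a \<noteq> 0"
    unfolding gwa_cont_seminorms
    by (intro bexI[of _ "\<lambda>a. wnorm (\<lambda>i. 1) (coords a)"]) (auto intro: wnorm_coords_seminorm)
qed

lemma gwa_complete: "complete_lc A"
  unfolding complete_lc_def
proof (intro allI impI)
  fix F assume F: "cauchy_filter_on A F"
  have bot: "F \<noteq> bot" and carr: "\<forall>\<^sub>F x in F. x \<in> carrier A"
    using F by (auto simp: cauchy_filter_on_def le_principal)
  have "\<forall>\<^sub>F z in F \<times>\<^sub>F F. wnorm w (coords (fst z) - coords (snd z)) < e"
    if w: "\<And>i. 0 \<le> w i" and e: "0 < e" for w e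
  proof -
    have "\<forall>\<^sub>F z in F \<times>\<^sub>F F. wnorm w (coords (fst z \<ominus>\<^bsub>A\<^esub> snd z)) < e"
      using F e wnorm_coords_seminorm[of w] w
      by (auto simp: cauchy_filter_on_def gwa_cont_seminorms)
    moreover have "\<forall>\<^sub>F z in F \<times>\<^sub>F F. fst z \<in> carrier A \<and> snd z \<in> carrier A"
      using carr by (auto simp: eventually_prod_same)
    ultimately show ?thesis by eventually_elim (simp add: coords_diff)
  qed
  from fine_complete[OF bot this] obtain \<gamma>
    where \<gamma>: "\<forall>w e. (\<forall>i. 0 \<le> w i) \<longrightarrow> 0 < e \<longrightarrow> (\<forall>\<^sub>F x in F. wnorm w (coords x - \<gamma>) < e)"
    by blast
  have "limitin (topo A) (\<lambda>x. x) (lincomb A basis \<gamma>) F"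
    unfolding A.limitin_topo_iff
  proof (intro conjI ballI allI impI)
    show "lincomb A basis \<gamma> \<in> carrier A" by simp
    fix r e assume r: "r \<in> cont_seminorms A" "(e::real) > 0"
    have sr: "seminorm_on A r" using r by (simp add: gwa_cont_seminorms)
    have "\<forall>\<^sub>F x in F. wnorm (\<lambda>i. r (basis i)) (coords x - \<gamma>) < e"
      using \<gamma> r(2) seminorm_onD(1)[OF sr basis_carrier] by simp
    with carr show "\<forall>\<^sub>F x in F. x \<in> carrier A \<and> r (x \<ominus>\<^bsub>A\<^esub> lincomb A basis \<gamma>) < e"
    proof eventually_elim
      case (elim x)
      have "r (x \<ominus>\<^bsub>A\<^esub> lincomb A basis \<gamma>) \<le> wnorm (\<lambda>i. r (basis i)) (coords (x \<ominus>\<^bsub>A\<^esub> lincomb A basis \<gamma>))"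
        by (rule seminorm_le_wnorm[OF sr]) (use elim in simp)
      then show ?case using elim by (simp add: coords_diff)
    qed
  qed
  then show "\<exists>l. limitin (topo A) (\<lambda>x. x) l F" by blast
qed

text \<open>Countability of the basis enters here: after an enumeration, the weight at an index
  majorizes \<open>q\<close> on all products of basis vectors up to this index. One weighted norm
  then bounds \<open>q\<close> of a product by a product of norms, which gives joint and not just
  separate continuity.\<close>

lemma gwa_mult_bound:
  assumes q: "seminorm_on A q"
  shows "\<exists>W. seminorm_on A W \<and> (\<forall>x\<in>carrier A. \<forall>y\<in>carrier A. q (x \<otimes>\<^bsub>A\<^esub> y) \<le> W x * W y)"
proof -
  let ?b = basis
  have bm: "?b i \<otimes>\<^bsub>A\<^esub> ?b j \<in> carrier A" for i j
    using assoc_alg_gwa lin_mapD(1)[of A A "\<lambda>y. ?b i \<otimes>\<^bsub>A\<^esub> y" "?b j"] by (simp add: assoc_alg_def)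
  let ?J = "\<lambda>N. {i :: int \<times> nat. to_nat i \<le> N}"
  have fin: "finite (?J N)" for N
    using finite_vimageI[of "{..N}" "to_nat :: int \<times> nat \<Rightarrow> nat"] by (simp add: vimage_def)
  \<comment> \<open>The summand 1 gives w i >= 1, so that a bound by the weight of the larger index
    is also a bound by the product of both weights.\<close>
  define w where "w i = 1 + (\<Sum>z\<in>?J (to_nat i) \<times> ?J (to_nat i). q (?b (fst z) \<otimes>\<^bsub>A\<^esub> ?b (snd z)))" for i :: "int \<times> nat"
  have w1: "1 \<le> w i" for i :: "int \<times> nat"
    unfolding w_def using seminorm_onD(1)[OF q bm] by (simp add: sum_nonneg)
  have wq: "q (?b i \<otimes>\<^bsub>A\<^esub> ?b j) \<le> w k" if "to_nat i \<le> to_nat k" "to_nat j \<le> to_nat k" for i j k :: "int \<times> nat"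
  proof -
    have "q (?b (fst (i, j)) \<otimes>\<^bsub>A\<^esub> ?b (snd (i, j))) \<le> (\<Sum>z\<in>?J (to_nat k) \<times> ?J (to_nat k). q (?b (fst z) \<otimes>\<^bsub>A\<^esub> ?b (snd z)))"
      by (rule member_le_sum) (use that fin seminorm_onD(1)[OF q bm] in auto)
    then show ?thesis by (simp add: w_def)
  qed
  have ww: "q (?b i \<otimes>\<^bsub>A\<^esub> ?b j) \<le> w i * w j" for i j
  proof (cases "to_nat i \<le> to_nat j")
    case True
    have "q (?b i \<otimes>\<^bsub>A\<^esub> ?b j) \<le> 1 * w j" using wq[of i j j] True by simp
    also have "\<dots> \<le> w i * w j" using w1[of i] w1[of j] by (intro mult_right_mono) auto
    finally show ?thesis .
  next
    case False
    have "q (?b i \<otimes>\<^bsub>A\<^esub> ?b j) \<le> w i * 1" using wq[of i i j] False by simp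
    also have "\<dots> \<le> w i * w j" using w1[of i] w1[of j] by (intro mult_left_mono) auto
    finally show ?thesis .
  qed
  have w0: "0 \<le> w i" for i using w1[of i] by simp
  have "q (x \<otimes>\<^bsub>A\<^esub> y) \<le> wnorm w (coords x) * wnorm w (coords y)" if x: "x \<in> carrier A" and y: "y \<in> carrier A" for x y
  proof -
    interpret R: cvec_lin A A "\<lambda>x. x \<otimes>\<^bsub>A\<^esub> y"
      by unfold_locales (use assoc_alg_gwa y in \<open>simp add: assoc_alg_def\<close>)
    interpret L: cvec_lin A A "\<lambda>y. ?b i \<otimes>\<^bsub>A\<^esub> y" for i
      by unfold_locales (use assoc_alg_gwa in \<open>simp add: assoc_alg_def\<close>)
    have 1: "q (?b i \<otimes>\<^bsub>A\<^esub> y) \<le> w i * wnorm w (coords y)" for i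
    proof -
      have "?b i \<otimes>\<^bsub>A\<^esub> y = lincomb A (\<lambda>j. ?b i \<otimes>\<^bsub>A\<^esub> ?b j) (coords y)"
        using L.map_lincomb[of "coords y" basis i] by (simp add: lincomb_coords y)
      then have "q (?b i \<otimes>\<^bsub>A\<^esub> y) \<le> (\<Sum>j\<in>Poly_Mapping.keys (coords y). cmod (Poly_Mapping.lookup (coords y) j) * q (?b i \<otimes>\<^bsub>A\<^esub> ?b j))"
        using A.seminorm_lincomb[OF q, of "coords y" "\<lambda>j. ?b i \<otimes>\<^bsub>A\<^esub> ?b j"] bm by simp
      also have "\<dots> \<le> (\<Sum>j\<in>Poly_Mapping.keys (coords y). cmod (Poly_Mapping.lookup (coords y) j) * (w i * w j))"
        by (intro sum_mono mult_left_mono ww) simp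
      also have "\<dots> = w i * wnorm w (coords y)"
        by (simp add: wnorm_def sum_distrib_left mult_ac)
      finally show ?thesis .
    qed
    have "x \<otimes>\<^bsub>A\<^esub> y = lincomb A (\<lambda>i. ?b i \<otimes>\<^bsub>A\<^esub> y) (coords x)"
      using R.map_lincomb[of "coords x" basis] by (simp add: lincomb_coords x)
    then have "q (x \<otimes>\<^bsub>A\<^esub> y) \<le> (\<Sum>i\<in>Poly_Mapping.keys (coords x). cmod (Poly_Mapping.lookup (coords x) i) * q (?b i \<otimes>\<^bsub>A\<^esub> y))"
      using A.seminorm_lincomb[OF q, of "coords x" "\<lambda>i. ?b i \<otimes>\<^bsub>A\<^esub> y"] R.linD(1) by simp
    also have "\<dots> \<le> (\<Sum>i\<in>Poly_Mapping.keys (coords x). cmod (Poly_Mapping.lookup (coords x) i) * (w i * wnorm w (coords y)))"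
      by (intro sum_mono mult_left_mono 1) simp
    also have "\<dots> = wnorm w (coords x) * wnorm w (coords y)"
      by (simp add: wnorm_def[of w "coords x"] sum_distrib_left mult_ac)
    finally show ?thesis .
  qed
  then show ?thesis using wnorm_coords_seminorm[of w, OF w0] by (intro exI[of _ "\<lambda>a. wnorm w (coords a)"]) simp
qed

lemma gwa_mult_continuous:
  "continuous_map (prod_topology (topo A) (topo A)) (topo A) (\<lambda>z. fst z \<otimes>\<^bsub>A\<^esub> snd z)"
  unfolding continuous_map_def
proof (intro conjI allI impI)
  have mc: "x \<otimes>\<^bsub>A\<^esub> y \<in> carrier A" if "x \<in> carrier A" "y \<in> carrier A" for x y
    using assoc_alg_gwa lin_mapD(1)[of A A "\<lambda>y. x \<otimes>\<^bsub>A\<^esub> y" y] that by (simp add: assoc_alg_def)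
  show "(\<lambda>z. fst z \<otimes>\<^bsub>A\<^esub> snd z) \<in> topspace (prod_topology (topo A) (topo A)) \<rightarrow> topspace (topo A)"
    using mc by auto
  fix U assume U: "openin (topo A) U"
  show "openin (prod_topology (topo A) (topo A)) {z \<in> topspace (prod_topology (topo A) (topo A)). fst z \<otimes>\<^bsub>A\<^esub> snd z \<in> U}"
  proof (subst openin_prod_topology_alt, intro allI impI)
    fix x y assume "(x, y) \<in> {z \<in> topspace (prod_topology (topo A) (topo A)). fst z \<otimes>\<^bsub>A\<^esub> snd z \<in> U}"
    then have xy: "x \<in> carrier A" "y \<in> carrier A" "x \<otimes>\<^bsub>A\<^esub> y \<in> U" by auto
    then obtain q e where q: "q \<in> cont_seminorms A" "e > 0" "{z \<in> carrier A. q (z \<ominus>\<^bsub>A\<^esub> x \<otimes>\<^bsub>A\<^esub> y) < e} \<subseteq> U"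
      using U unfolding A.openin_topo_iff by meson
    have sq: "seminorm_on A q" using q by (simp add: gwa_cont_seminorms)
    obtain W where W: "seminorm_on A W" "\<And>x y. x \<in> carrier A \<Longrightarrow> y \<in> carrier A \<Longrightarrow> q (x \<otimes>\<^bsub>A\<^esub> y) \<le> W x * W y"
      using gwa_mult_bound[OF sq] by auto
    have W0: "0 \<le> W x" "0 \<le> W y" using seminorm_onD(1)[OF W(1)] xy by auto
    \<comment> \<open>d \<le> 1 bounds \<open>W t\<close> by W y + 1. The final estimate is d * (1 +
      W x + W y), and the 2 in the denominator makes it strictly smaller than e.\<close>
    define d where "d = min 1 (e / (2 + W x + W y))"
    have d: "0 < d" "d \<le> 1" "d * (1 + W x + W y) < e"
    proof -
      show "0 < d" "d \<le> 1" using q(2) W0 by (auto simp: d_def)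
      have "d * (1 + W x + W y) < d * (2 + W x + W y)" using \<open>0 < d\<close> by simp
      also have "\<dots> \<le> e / (2 + W x + W y) * (2 + W x + W y)"
        using W0 by (intro mult_right_mono) (auto simp: d_def)
      also have "\<dots> = e" using W0 by simp
      finally show "d * (1 + W x + W y) < e" .
    qed
    have Wc: "W \<in> cont_seminorms A" using W by (simp add: gwa_cont_seminorms)
    obtain S where S: "openin (topo A) S" "x \<in> S" "S \<subseteq> {z \<in> carrier A. W (z \<ominus>\<^bsub>A\<^esub> x) < d}"
      using A.cs_ball_open[OF Wc d(1) xy(1)] by blast
    obtain T where T: "openin (topo A) T" "y \<in> T" "T \<subseteq> {z \<in> carrier A. W (z \<ominus>\<^bsub>A\<^esub> y) < d}"
      using A.cs_ball_open[OF Wc d(1) xy(2)] by blast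
    have "S \<times> T \<subseteq> {z \<in> topspace (prod_topology (topo A) (topo A)). fst z \<otimes>\<^bsub>A\<^esub> snd z \<in> U}"
    proof
      fix z assume "z \<in> S \<times> T"
      then obtain s t where z: "z = (s, t)" "s \<in> S" "t \<in> T" by auto
      have st: "s \<in> carrier A" "t \<in> carrier A" "W (s \<ominus>\<^bsub>A\<^esub> x) < d" "W (t \<ominus>\<^bsub>A\<^esub> y) < d" using z S T by auto
      interpret R: cvec_lin A A "\<lambda>x. x \<otimes>\<^bsub>A\<^esub> t"
        by unfold_locales (use assoc_alg_gwa st in \<open>simp add: assoc_alg_def\<close>)
      interpret L: cvec_lin A A "\<lambda>y. x \<otimes>\<^bsub>A\<^esub> y"
        by unfold_locales (use assoc_alg_gwa xy in \<open>simp add: assoc_alg_def\<close>)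
      let ?u = "s \<ominus>\<^bsub>A\<^esub> x" and ?v = "t \<ominus>\<^bsub>A\<^esub> y"
      have uv: "?u \<in> carrier A" "?v \<in> carrier A" using st xy by auto
      have "s \<otimes>\<^bsub>A\<^esub> t \<ominus>\<^bsub>A\<^esub> x \<otimes>\<^bsub>A\<^esub> y = (s \<otimes>\<^bsub>A\<^esub> t \<ominus>\<^bsub>A\<^esub> x \<otimes>\<^bsub>A\<^esub> t) \<oplus>\<^bsub>A\<^esub> (x \<otimes>\<^bsub>A\<^esub> t \<ominus>\<^bsub>A\<^esub> x \<otimes>\<^bsub>A\<^esub> y)"
        using st xy mc by (simp add: A.minus_add_minus)
      also have "\<dots> = ?u \<otimes>\<^bsub>A\<^esub> t \<oplus>\<^bsub>A\<^esub> x \<otimes>\<^bsub>A\<^esub> ?v"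
        using R.map_minus[of s x] L.map_minus[of t y] st xy by simp
      finally have "q (s \<otimes>\<^bsub>A\<^esub> t \<ominus>\<^bsub>A\<^esub> x \<otimes>\<^bsub>A\<^esub> y) \<le> q (?u \<otimes>\<^bsub>A\<^esub> t) + q (x \<otimes>\<^bsub>A\<^esub> ?v)"
        using seminorm_onD(2)[OF sq mc[OF uv(1) st(2)] mc[OF xy(1) uv(2)]] by simp
      also have "\<dots> \<le> W ?u * W t + W x * W ?v" by (intro add_mono W(2) st xy uv)
      also have "\<dots> \<le> d * (W y + 1) + W x * d"
      proof (intro add_mono mult_mono)
        have "W t \<le> W y + W ?v" by (rule A.seminorm_le[OF W(1) st(2) xy(2)])
        then show "W t \<le> W y + 1" using st d by simp
      qed (use st d W0 seminorm_onD(1)[OF W(1)] uv in auto)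
      also have "\<dots> = d * (1 + W x + W y)" by (simp add: algebra_simps)
      also have "\<dots> < e" by (rule d)
      finally have "s \<otimes>\<^bsub>A\<^esub> t \<in> U" using mc[OF st(1,2)] by (intro subsetD[OF q(3)]) simp
      then show "z \<in> {z \<in> topspace (prod_topology (topo A) (topo A)). fst z \<otimes>\<^bsub>A\<^esub> snd z \<in> U}"
        using z st by simp
    qed
    then show "\<exists>S T. openin (topo A) S \<and> openin (topo A) T \<and> x \<in> S \<and> y \<in> T \<and>
      S \<times> T \<subseteq> {z \<in> topspace (prod_topology (topo A) (topo A)). fst z \<otimes>\<^bsub>A\<^esub> snd z \<in> U}"
      using S T by blast
  qed
qed

lemma gwa_lc_algebra: "lc_algebra A"
  using assoc_alg_gwa gwa_lcs gwa_Hausdorff gwa_complete gwa_mult_continuous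
  by (simp add: lc_algebra_def lcs_iff)

end

subsection \<open>The products of graded components\<close>

context gwa_data
begin

text \<open>An automorphism fixing the constants is composition with the image of h. Degrees
  multiply under composition, and \<sigma> composed with its inverse fixes h, so the image of h has
  degree 1.\<close>

lemma sigma_degree: "degree (\<sigma> f) = degree f" "degree (\<sigma>' f) = degree f"
proof -
  have X: "pCons a f = [:a:] + [:0, 1:] * f" for a and f :: "complex poly" by simp
  have s: "\<sigma> f = pcompose f (\<sigma> [:0, 1:])" for f
  proof (induct f)
    case (pCons a f)
    have "\<sigma> (pCons a f) = [:a:] + \<sigma> [:0, 1:] * \<sigma> f" by (subst X) (simp only: sigma_add sigma_mult sigma_const)
    then show ?case using pCons by (simp add: pcompose_pCons)
  qed simp
  have s': "\<sigma>' f = pcompose f (\<sigma>' [:0, 1:])" for f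
  proof (induct f)
    case (pCons a f)
    have "\<sigma>' (pCons a f) = [:a:] + \<sigma>' [:0, 1:] * \<sigma>' f" by (subst X) (simp only: sigma'_add sigma'_mult sigma'_const)
    then show ?case using pCons by (simp add: pcompose_pCons)
  qed simp
  have "degree (\<sigma> (\<sigma>' [:0, 1:])) = degree (\<sigma>' [:0, 1:]) * degree (\<sigma> [:0, 1:])"
    by (subst s) (rule degree_pcompose)
  then have "degree (\<sigma>' [:0, 1:]) * degree (\<sigma> [:0, 1:]) = 1" by simp
  then have "degree (\<sigma>' [:0, 1:]) = 1" "degree (\<sigma> [:0, 1:]) = 1" by simp_all
  then show "degree (\<sigma> f) = degree f" "degree (\<sigma>' f) = degree f"
    using arg_cong[OF s[of f], of degree] arg_cong[OF s'[of f], of degree] by (simp_all add: degree_pcompose)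
qed

lemma sigma'_eq_0: "\<sigma>' f = 0 \<longleftrightarrow> f = 0"
  by (metis sigma_inv(1) sigma_simps(1,3))

text \<open>The polynomial \<open>monomial_factor m n\<close> satisfies \<open>y\<^sup>m v = monomial_factor m n * v'\<close> for the monomials \<open>v\<close> of degree \<open>n\<close>
  and \<open>v'\<close> of degree \<open>m + n\<close>.\<close>

primrec monomial_factor :: "nat \<Rightarrow> int \<Rightarrow> complex poly" where
  "monomial_factor 0 n = 1"
| "monomial_factor (Suc m) n = \<sigma>' (monomial_factor m n) * (if int m + n < 0 then P else 1)"

lemma hom_elt_mult_nat:
  "hom_elt d (int m) \<otimes>\<^bsub>A\<^esub> hom_elt e n = hom_elt (d * (\<sigma>' ^^ m) e * monomial_factor m n) (int m + n)"
proof (induct m arbitrary: d)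
  case 0 then show ?case using hom_elt_mult_0 by simp
next
  case (Suc m)
  have "hom_elt d (int (Suc m)) = hom_elt d 1 \<otimes>\<^bsub>A\<^esub> hom_elt 1 (int m)"
    by (simp add: hom_elt_mult_1 add.commute)
  then have "hom_elt d (int (Suc m)) \<otimes>\<^bsub>A\<^esub> hom_elt e n = hom_elt d 1 \<otimes>\<^bsub>A\<^esub> (hom_elt 1 (int m) \<otimes>\<^bsub>A\<^esub> hom_elt e n)"
    using assoc_alg_gwa by (simp add: assoc_alg_def)
  also have "\<dots> = hom_elt (d * (\<sigma>' ^^ Suc m) e * monomial_factor (Suc m) n) (int (Suc m) + n)"
    by (simp only: Suc hom_elt_mult_1) (simp add: sigma'_mult mult.assoc add.commute add.left_commute)
  finally show ?case .
qed

text \<open>Each y contributes one factor P as long as an x is left for it to meet, min m k times in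
  all, and the twists preserve degrees.\<close>

lemma degree_monomial_factor:
  assumes "P \<noteq> 0" shows "monomial_factor m (- int k) \<noteq> 0 \<and> degree (monomial_factor m (- int k)) = min m k * degree P"
proof (induct m)
  case (Suc m)
  then show ?case using assms
    by (auto simp: degree_mult_eq sigma'_eq_0 sigma_degree min_def)
qed simp

text \<open>The polynomial that A_(i+1) A_(-(j+1)) puts in front of the monomial of degree i - j:
  the product of the two components consists of the C[h]-multiples of \<open>lam i j\<close> times
  this monomial.\<close>

definition lam :: "nat \<Rightarrow> nat \<Rightarrow> complex poly" where
  "lam i j = monomial_factor (Suc i) (- int (Suc j))"

text \<open>The condition int (Suc i) - int (Suc j) < 0 of \<open>monomial_factor\<close> becomes i
  < j; in row 0 the only y always meets an x.\<close>

lemma lam_simps: "lam 0 j = P" "lam (Suc i) j = \<sigma>' (lam i j) * (if i < j then P else 1)"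
  by (simp_all add: lam_def)

lemma degree_lam: "P \<noteq> 0 \<Longrightarrow> lam i j \<noteq> 0 \<and> degree (lam i j) = Suc (min i j) * degree P"
  using degree_monomial_factor[of "Suc i" "Suc j"] by (simp add: lam_def del: monomial_factor.simps)

lemma lam_0:
  assumes P: "P = 0" shows "lam i j = 0"
proof (induct i)
  case 0 show ?case by (rule trans[OF lam_simps(1) P])
next
  case (Suc i) show ?case unfolding lam_simps Suc by simp
qed

definition lam_elt :: "nat \<Rightarrow> nat \<Rightarrow> complex poly \<Rightarrow> gwa_elt" where
  "lam_elt i j d = hom_elt (d * lam i j) (int i - int j)"

lemma lam_elt_carrier [simp]: "lam_elt i j d \<in> carrier A"
  by (simp add: lam_elt_def)

lemma lam_elt_add: "lam_elt i j (d + e) = lam_elt i j d \<oplus>\<^bsub>A\<^esub> lam_elt i j e"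
  by (simp add: lam_elt_def distrib_right hom_elt_add)

lemma lam_elt_smult: "lam_elt i j (Polynomial.smult c d) = c \<odot>\<^bsub>A\<^esub> lam_elt i j d"
  by (simp add: lam_elt_def hom_elt_smult)

lemma lam_elt_zero: "lam_elt i j 0 = \<zero>\<^bsub>A\<^esub>"
  by (simp add: lam_elt_def hom_elt_zero)

text \<open>The products already form a subspace: the polynomial of the second factor moves to the
  left, and taking it to be 1 realizes every multiple of \<open>lam i j\<close>.\<close>

lemma gwa_comp_prod_eq:
  "gwa_comp_prod \<sigma> P (int i + 1) (- (int j + 1)) = range (lam_elt i j)"
proof -
  let ?S = "{a \<otimes>\<^bsub>A\<^esub> b |a b. a \<in> gwa_comp \<sigma> P (int i + 1) \<and> b \<in> gwa_comp \<sigma> P (- (int j + 1))}"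
  have m: "hom_elt d (int i + 1) \<otimes>\<^bsub>A\<^esub> hom_elt e (- (int j + 1)) = lam_elt i j (d * (\<sigma>' ^^ Suc i) e)" for d e
    using hom_elt_mult_nat[of d "Suc i" e "- int (Suc j)"]
    by (simp add: lam_elt_def lam_def add.commute del: monomial_factor.simps funpow.simps)
  have sub: "submodule (range (lam_elt i j)) CC A"
  proof (rule A.submoduleI')
    show "\<zero>\<^bsub>A\<^esub> \<in> range (lam_elt i j)" by (metis lam_elt_zero rangeI)
  qed (auto simp: lam_elt_add[symmetric] lam_elt_smult[symmetric])
  have "?S \<subseteq> range (lam_elt i j)" unfolding gwa_comp_eq by clarify (simp only: m rangeI)
  moreover have "range (lam_elt i j) \<subseteq> ?S"
  proof clarify
    fix d
    have "(\<sigma>' ^^ n) 1 = 1" for n by (induct n) simp_all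
    then have "lam_elt i j d = hom_elt d (int i + 1) \<otimes>\<^bsub>A\<^esub> hom_elt 1 (- (int j + 1))" using m[of d 1] by simp
    then show "\<exists>a b. lam_elt i j d = a \<otimes>\<^bsub>A\<^esub> b \<and> a \<in> gwa_comp \<sigma> P (int i + 1) \<and> b \<in> gwa_comp \<sigma> P (- (int j + 1))"
      unfolding gwa_comp_eq by blast
  qed
  ultimately have S: "?S = range (lam_elt i j)" by blast
  show ?thesis unfolding gwa_comp_prod_def S
    by (rule equalityI[OF A.cspan_least[OF sub order_refl] A.cspan_superset])
qed

text \<open>The coefficient half of the stability of the matrix part under the generators. The last
  identity shows that the defect of S in row 0 has its coefficient in A_1 A_(-(j+1)).\<close>

lemma lam_elt_left:
  "hom_elt e 0 \<otimes>\<^bsub>A\<^esub> lam_elt i j d = lam_elt i j (e * d)"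
  "hom_elt e 1 \<otimes>\<^bsub>A\<^esub> lam_elt i j d = lam_elt (Suc i) j (e * \<sigma>' d)"
  "hom_elt e (-1) \<otimes>\<^bsub>A\<^esub> lam_elt (Suc i) j d = lam_elt i j (e * \<sigma> d * \<sigma> P)"
  "hom_elt e 1 \<otimes>\<^bsub>A\<^esub> hom_elt d (- int (Suc j)) = lam_elt 0 j (e * \<sigma>' d)"
proof -
  show "hom_elt e 0 \<otimes>\<^bsub>A\<^esub> lam_elt i j d = lam_elt i j (e * d)"
    by (simp add: lam_elt_def hom_elt_mult_0 mult.assoc)
  show "hom_elt e 1 \<otimes>\<^bsub>A\<^esub> lam_elt i j d = lam_elt (Suc i) j (e * \<sigma>' d)"
  proof -
    have "int (Suc i) - int j = int i - int j + 1" by simp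
    then show ?thesis by (simp only: lam_elt_def hom_elt_mult_1 lam_simps sigma'_mult) (simp add: mult_ac)
  qed
  show "hom_elt e (-1) \<otimes>\<^bsub>A\<^esub> lam_elt (Suc i) j d = lam_elt i j (e * \<sigma> d * \<sigma> P)"
    by (simp add: lam_elt_def hom_elt_mult_m1 lam_simps sigma_mult mult_ac)
  show "hom_elt e 1 \<otimes>\<^bsub>A\<^esub> hom_elt d (- int (Suc j)) = lam_elt 0 j (e * \<sigma>' d)"
    by (simp add: lam_elt_def hom_elt_mult_1 lam_simps)
qed

end

text \<open>The coefficients of the quotient \<open>C\<close> are controlled by the top coefficients of \<open>C * \<pi>\<close>: the
  weights \<open>v\<close> are chosen recursively to absorb the lower triangular part of the division.\<close>

lemma quotient_coeff_weights:
  fixes \<pi> :: "complex poly" and w :: "nat \<Rightarrow> real"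
  assumes \<pi>: "\<pi> \<noteq> 0" and w: "\<And>k. 0 \<le> w k"
  shows "\<exists>v. (\<forall>k. 0 \<le> v k) \<and> (\<forall>C n. degree C \<le> n \<longrightarrow>
    (\<Sum>k\<le>n. w k * cmod (coeff C k)) \<le> (\<Sum>k\<le>n. v k * cmod (coeff (C * \<pi>) (degree \<pi> + k))))"
proof -
  let ?N = "degree \<pi>"
  define l where "l = cmod (lead_coeff \<pi>)"
  have l: "l > 0" using \<pi> by (simp add: l_def)
  define B where "B = (\<Sum>i\<le>?N. cmod (coeff \<pi> i))"
  have B: "cmod (coeff \<pi> i) \<le> B" for i
  proof (cases "i \<le> ?N")
    case True then show ?thesis unfolding B_def by (intro member_le_sum) auto
  next
    case False then show ?thesis by (simp add: coeff_eq_0 B_def sum_nonneg)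
  qed
  have B0: "0 \<le> B" by (simp add: B_def sum_nonneg)
  \<comment> \<open>\<open>U m\<close> is the sum of the weights \<open>v k\<close> with k < m. The
    recursion solves l * v m - B * U m = w m, so that exactly \<open>w\<close> remains after the
    cross terms are absorbed.\<close>
  define U where "U = rec_nat 0 (\<lambda>m u. u + (w m + B * u) / l)"
  have U: "U 0 = 0" "U (Suc m) = U m + (w m + B * U m) / l" for m by (simp_all add: U_def)
  have U0: "0 \<le> U m" for m by (induct m) (use U w l B0 in auto)
  define v where "v m = (w m + B * U m) / l" for m
  have v0: "0 \<le> v m" for m using U0 w l B0 by (simp add: v_def)
  have Uv: "U m = (\<Sum>k<m. v k)" for m by (induct m) (simp_all add: U v_def)
  have "(\<Sum>k\<le>n. w k * cmod (coeff C k)) \<le> (\<Sum>k\<le>n. v k * cmod (coeff (C * \<pi>) (?N + k)))"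
    if n: "degree C \<le> n" for C n
  proof -
    let ?c = "\<lambda>k. cmod (coeff C k)"
    \<comment> \<open>The coefficient of the product at N + k is the k-th coefficient of C times the
      leading coefficient of \<pi>, plus contributions from higher coefficients of C only.\<close>
    have step: "l * ?c k \<le> cmod (coeff (C * \<pi>) (?N + k)) + B * (\<Sum>m\<in>{k<..n}. ?c m)" if k: "k \<le> n" for k
    proof -
      have "coeff (C * \<pi>) (?N + k) = (\<Sum>m\<le>?N + k. coeff C m * coeff \<pi> (?N + k - m))" by (rule coeff_mult)
      also have "\<dots> = (\<Sum>m\<in>{k..n}. if m \<le> ?N + k then coeff C m * coeff \<pi> (?N + k - m) else 0)"
      proof -
        have "(\<Sum>m\<le>?N + k. coeff C m * coeff \<pi> (?N + k - m)) = (\<Sum>m\<in>{k..n} \<inter> {..?N + k}. coeff C m * coeff \<pi> (?N + k - m))"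
        proof (rule sum.mono_neutral_right)
          show "\<forall>m\<in>{..?N + k} - {k..n} \<inter> {..?N + k}. coeff C m * coeff \<pi> (?N + k - m) = 0"
          proof
            fix m assume m: "m \<in> {..?N + k} - {k..n} \<inter> {..?N + k}"
            show "coeff C m * coeff \<pi> (?N + k - m) = 0"
            proof (cases "m < k")
              case True then show ?thesis by (simp add: coeff_eq_0)
            next
              case False
              then have "n < m" using m by auto
              then show ?thesis using n by (simp add: coeff_eq_0)
            qed
          qed
        qed auto
        also have "\<dots> = (\<Sum>m\<in>{k..n}. if m \<le> ?N + k then coeff C m * coeff \<pi> (?N + k - m) else 0)"
          by (subst sum.inter_restrict) (auto intro!: sum.cong)
        finally show ?thesis .
      qed
      also have "{k..n} = insert k {k<..n}" using k by auto
      also have "(\<Sum>m\<in>insert k {k<..n}. if m \<le> ?N + k then coeff C m * coeff \<pi> (?N + k - m) else 0) =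
          coeff C k * lead_coeff \<pi> + (\<Sum>m\<in>{k<..n}. if m \<le> ?N + k then coeff C m * coeff \<pi> (?N + k - m) else 0)"
        by (subst sum.insert) auto
      finally have "coeff C k * lead_coeff \<pi> = coeff (C * \<pi>) (?N + k)
          - (\<Sum>m\<in>{k<..n}. if m \<le> ?N + k then coeff C m * coeff \<pi> (?N + k - m) else 0)" by simp
      then have "cmod (coeff C k * lead_coeff \<pi>) \<le> cmod (coeff (C * \<pi>) (?N + k))
          + cmod (\<Sum>m\<in>{k<..n}. if m \<le> ?N + k then coeff C m * coeff \<pi> (?N + k - m) else 0)"
        using norm_triangle_ineq4 by metis
      also have "cmod (\<Sum>m\<in>{k<..n}. if m \<le> ?N + k then coeff C m * coeff \<pi> (?N + k - m) else 0)
          \<le> (\<Sum>m\<in>{k<..n}. ?c m * B)"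
        by (rule sum_norm_le) (auto simp: norm_mult B B0 intro!: mult_left_mono)
      finally show ?thesis by (simp add: norm_mult l_def mult.commute sum_distrib_left)
    qed
    have "(\<Sum>k\<le>n. v k * (l * ?c k)) \<le> (\<Sum>k\<le>n. v k * (cmod (coeff (C * \<pi>) (?N + k)) + B * (\<Sum>m\<in>{k<..n}. ?c m)))"
      by (intro sum_mono mult_left_mono step v0) simp
    also have "\<dots> = (\<Sum>k\<le>n. v k * cmod (coeff (C * \<pi>) (?N + k))) + (\<Sum>k\<le>n. \<Sum>m\<in>{k<..n}. v k * B * ?c m)"
      by (simp add: distrib_left sum.distrib sum_distrib_left mult.assoc)
    also have "(\<Sum>k\<le>n. \<Sum>m\<in>{k<..n}. v k * B * ?c m) = (\<Sum>m\<le>n. \<Sum>k<m. v k * B * ?c m)"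
    proof -
      have "(\<Sum>k\<le>n. \<Sum>m\<in>{k<..n}. v k * B * ?c m) = (\<Sum>k\<le>n. \<Sum>m\<le>n. if k < m then v k * B * ?c m else 0)"
        by (intro sum.cong refl sum.mono_neutral_cong_left) auto
      also have "\<dots> = (\<Sum>m\<le>n. \<Sum>k\<le>n. if k < m then v k * B * ?c m else 0)" by (rule sum.swap)
      also have "\<dots> = (\<Sum>m\<le>n. \<Sum>k<m. v k * B * ?c m)"
        by (intro sum.cong refl sum.mono_neutral_cong_right) auto
      finally show ?thesis .
    qed
    also have "\<dots> = (\<Sum>m\<le>n. B * U m * ?c m)"
      by (simp add: Uv sum_distrib_left sum_distrib_right mult_ac)
    finally have "(\<Sum>k\<le>n. v k * (l * ?c k)) - (\<Sum>m\<le>n. B * U m * ?c m) \<le> (\<Sum>k\<le>n. v k * cmod (coeff (C * \<pi>) (?N + k)))"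
      by simp
    moreover have "(\<Sum>k\<le>n. v k * (l * ?c k)) - (\<Sum>m\<le>n. B * U m * ?c m) = (\<Sum>k\<le>n. w k * ?c k)"
      unfolding sum_subtractf[symmetric]
    proof (rule sum.cong[OF refl])
      fix k
      have "v k * l = w k + B * U k" using l by (simp add: v_def)
      then have "v k * (l * ?c k) = (w k + B * U k) * ?c k" by (simp add: mult.assoc[symmetric])
      then show "v k * (l * ?c k) - B * U k * ?c k = w k * ?c k" by (simp add: distrib_right)
    qed
    ultimately show ?thesis by simp
  qed
  then show ?thesis using v0 by blast
qed

section \<open>Linear maps out of the algebra\<close>

context gwa_data
begin

text \<open>The coordinates of a homogeneous element lie in a single degree, where the family
  \<open>v\<close> is constant; linearity in the second argument reassembles the element.\<close>

lemma lincomb_hom_elt: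
  assumes "bilinear_map V A U \<beta>" and v: "\<And>n. v n \<in> carrier V"
  shows "lincomb U (\<lambda>z. \<beta> (v (fst z)) (basis z)) (coords (hom_elt d n)) = \<beta> (v n) (hom_elt d n)"
proof -
  interpret B: bilinear_map V A U \<beta> by fact
  interpret R: cvec_lin A U "\<beta> (v n)" by unfold_locales (rule B.lin_right[OF v])
  have "lincomb U (\<lambda>z. \<beta> (v (fst z)) (basis z)) (coords (hom_elt d n)) = lincomb U (\<lambda>z. \<beta> (v n) (basis z)) (coords (hom_elt d n))"
  proof (rule B.U.lincomb_cong)
    fix z assume "z \<in> Poly_Mapping.keys (coords (hom_elt d n))"
    then have "fst z = n" by (cases z) (auto simp: in_keys_iff lookup_coords_hom_elt split: if_splits)
    then show "\<beta> (v (fst z)) (basis z) = \<beta> (v n) (basis z)" by simp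
  qed (simp add: B.closed v)
  also have "\<dots> = \<beta> (v n) (lincomb A basis (coords (hom_elt d n)))"
    by (rule R.map_lincomb[symmetric]) simp
  finally show ?thesis by (simp add: lincomb_coords)
qed

lemma lincomb_coords_lin:
  assumes "cvec U" and g: "\<And>z. g z \<in> carrier U"
  shows "lin_map A U (\<lambda>a. lincomb U g (coords a))"
proof -
  interpret U: cvec U by fact
  show ?thesis by (rule lin_mapI) (simp_all add: g coords_add coords_scale U.lincomb_add U.lincomb_scale)
qed

lemma lin_map_basis:
  assumes "cvec U" "lin_map A U f" and H: "submodule H CC U" and f: "\<And>d n. f (hom_elt d n) \<in> H" and a: "a \<in> carrier A"
  shows "f a \<in> H"
proof -
  interpret cvec_lin A U f using assms(1,2) A.cvec_axioms by (intro cvec_lin.intro cvec_lin_axioms.intro)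
  have "f (lincomb A basis (coords a)) = lincomb U (\<lambda>z. f (basis z)) (coords a)" by (rule map_lincomb) simp
  moreover have "\<dots> \<in> H" by (rule W.lincomb_in_submodule[OF H]) (simp add: basis_def f)
  ultimately show ?thesis using a by (simp add: lincomb_coords)
qed

text \<open>The components form a total family that vanishes off \<open>F\<close>; the induction can
  then change one component without asking whether its degree has occurred before.\<close>

lemma homogeneous_decomposition:
  "\<exists>F u. finite F \<and> (\<forall>n. u n \<in> gwa_comp \<sigma> P n) \<and> (\<forall>n. n \<notin> F \<longrightarrow> u n = \<zero>\<^bsub>A\<^esub>) \<and> lincomb A basis c = finsum A u F"
proof (induct c rule: pm_induct)
  case zero
  show ?case
    by (rule exI[of _ "{}"], rule exI[of _ "\<lambda>n. hom_elt 0 n"]) (simp add: gwa_comp_eq, simp add: hom_elt_zero)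
next
  case (add c z k)
  then obtain F u where u: "finite F" "\<And>n. u n \<in> gwa_comp \<sigma> P n" "\<And>n. n \<notin> F \<Longrightarrow> u n = \<zero>\<^bsub>A\<^esub>"
    "lincomb A basis c = finsum A u F" by blast
  have uc: "u n \<in> carrier A" for n using u(2)[of n] by (auto simp: gwa_comp_eq)
  let ?n = "fst z" and ?x = "k \<odot>\<^bsub>A\<^esub> basis z"
  let ?u = "u(?n := ?x \<oplus>\<^bsub>A\<^esub> u ?n)" and ?R = "F - {?n}"
  have "finsum A u F = finsum A u (insert ?n ?R)"
  proof (rule A.add.finprod_mono_neutral_cong_left)
    show "F \<subseteq> insert ?n ?R" by auto
  qed (use u uc in auto)
  also have "\<dots> = u ?n \<oplus>\<^bsub>A\<^esub> finsum A u ?R" using u(1) uc by (subst A.finsum_insert) auto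
  finally have F: "finsum A u F = u ?n \<oplus>\<^bsub>A\<^esub> finsum A u ?R" .
  have Rc: "finsum A u ?R \<in> carrier A" using uc by (intro A.finsum_closed) auto
  have eq: "finsum A ?u ?R = finsum A u ?R" using uc by (intro A.finsum_cong') auto
  have "finsum A ?u (insert ?n ?R) = (?x \<oplus>\<^bsub>A\<^esub> u ?n) \<oplus>\<^bsub>A\<^esub> finsum A u ?R"
    using u(1) uc eq by (subst A.finsum_insert) auto
  also have "\<dots> = ?x \<oplus>\<^bsub>A\<^esub> finsum A u F" unfolding F using uc Rc by (simp add: A.a_assoc)
  also have "\<dots> = lincomb A basis (Poly_Mapping.single z k + c)"
    by (simp add: A.lincomb_add A.lincomb_single u(4))
  finally have e: "lincomb A basis (Poly_Mapping.single z k + c) = finsum A ?u (insert ?n ?R)" by simp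
  have m: "?u n \<in> gwa_comp \<sigma> P n" for n
    using u(2)[of n] by (auto simp: gwa_comp_eq basis_def hom_elt_smult[symmetric] hom_elt_add[symmetric])
  have z: "n \<notin> insert ?n ?R \<longrightarrow> ?u n = \<zero>\<^bsub>A\<^esub>" for n using u(3) by auto
  show ?case
    by (rule exI[of _ "insert ?n ?R"], rule exI[of _ ?u], intro conjI allI)
       (use u(1) m z e in blast)+
qed

end

section \<open>The Toeplitz extension\<close>

locale toeplitz_setup = gwa_data \<sigma> P for \<sigma> P +
  fixes X :: "'x lc_alg" and \<tau> :: "matrix \<Rightarrow> gwa_elt \<Rightarrow> 'x"
    and Y :: "'y lc_alg" and \<tau>' :: "(real \<Rightarrow> complex) \<Rightarrow> gwa_elt \<Rightarrow> 'y"
    and p :: "'x \<Rightarrow> 'y"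
  assumes X: "completed_projective_tensor_algebra smooth_toeplitz (gwa \<sigma> P) X \<tau>"
    and Y: "completed_projective_tensor_algebra smooth_circle (gwa \<sigma> P) Y \<tau>'"
    and p: "is_tensor_id smooth_toeplitz (gwa \<sigma> P) X \<tau> Y \<tau>' toeplitz_symbol p"
begin

sublocale T: lcs smooth_toeplitz by (rule smooth_toeplitz_lcs)
sublocale C: lcs smooth_circle by (rule smooth_circle_lcs)

sublocale X: lc_algebra_loc X
proof -
  have "lc_algebra X" using X by (simp add: completed_projective_tensor_algebra_def)
  then show "lc_algebra_loc X" by (intro lc_algebra_loc.intro lc_algebra_loc_axioms.intro lc_algebraD(1))
qed

sublocale Y: lcs Y
  using Y by (simp add: completed_projective_tensor_algebra_def lc_algebraD(1))

sublocale TX: tensor smooth_toeplitz A X \<tau>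
  using X by unfold_locales (simp add: completed_projective_tensor_algebra_def)

sublocale TY: tensor smooth_circle A Y \<tau>'
  using Y by unfold_locales (simp add: completed_projective_tensor_algebra_def)

lemma Y_Hausdorff: "Hausdorff_space (topo Y)"
  using Y by (simp add: completed_projective_tensor_algebra_def lc_algebra_def)

sublocale p: lcs_lin X Y p
  using p by unfold_locales (simp add: is_tensor_id_def)

lemma p_continuous: "continuous_map (topo X) (topo Y) p"
  using p by (simp add: is_tensor_id_def)

lemma p_tau: "m \<in> toeplitz_carrier \<Longrightarrow> a \<in> carrier A \<Longrightarrow> p (\<tau> m a) = \<tau>' (toeplitz_symbol m) a"
  using p by (simp add: is_tensor_id_def)

lemma tau_mult:
  "m \<in> toeplitz_carrier \<Longrightarrow> m' \<in> toeplitz_carrier \<Longrightarrow> a \<in> carrier A \<Longrightarrow> a' \<in> carrier A \<Longrightarrow>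
   \<tau> m a \<otimes>\<^bsub>X\<^esub> \<tau> m' a' = \<tau> (m \<otimes>\<^bsub>smooth_toeplitz\<^esub> m') (a \<otimes>\<^bsub>A\<^esub> a')"
  using X by (simp add: completed_projective_tensor_algebra_def del: smooth_toeplitz_simps(5))

lemma tau_carrier [simp]: "m \<in> toeplitz_carrier \<Longrightarrow> a \<in> carrier A \<Longrightarrow> \<tau> m a \<in> carrier X"
  using TX.tau_closed by simp

lemma tau'_carrier [simp]: "f \<in> smooth_circle_funs \<Longrightarrow> a \<in> carrier A \<Longrightarrow> \<tau>' f a \<in> carrier Y"
  using TY.tau_closed by simp

section \<open>The section and the subspace of loops\<close>

definition sec :: "gwa_elt \<Rightarrow> 'x" where
  "sec a = lincomb X (\<lambda>z. \<tau> (shift_pow (fst z)) (basis z)) (coords a)"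

text \<open>The inverse of the identification of z^n \<otimes> a_n with a_n.\<close>

definition loop :: "gwa_elt \<Rightarrow> 'y" where
  "loop a = lincomb Y (\<lambda>z. \<tau>' (zpow (fst z)) (basis z)) (coords a)"

lemma sec_lin: "lin_map A X sec"
  unfolding sec_def[abs_def] by (rule lincomb_coords_lin) (simp_all add: X.cvec_axioms)

lemma loop_lin: "lin_map A Y loop"
  unfolding loop_def[abs_def] by (rule lincomb_coords_lin) (simp_all add: Y.cvec_axioms)

sublocale sec: lcs_lin A X sec by unfold_locales (rule sec_lin)
sublocale loop: lcs_lin A Y loop by unfold_locales (rule loop_lin)

lemma sec_hom_elt: "sec (hom_elt d n) = \<tau> (shift_pow n) (hom_elt d n)"
  unfolding sec_def by (rule lincomb_hom_elt[OF TX.bilinear_map_axioms]) simp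

lemma loop_hom_elt: "loop (hom_elt d n) = \<tau>' (zpow n) (hom_elt d n)"
  unfolding loop_def by (rule lincomb_hom_elt[OF TY.bilinear_map_axioms]) simp

lemma p_sec: "a \<in> carrier A \<Longrightarrow> p (sec a) = loop a"
  unfolding sec_def loop_def
  by (subst p.map_lincomb) (auto intro!: Y.lincomb_cong simp: p_tau toeplitz_symbol_matrix)

text \<open>Evaluation at \<open>1\<close> on the circle is continuous and inverts \<open>loop\<close>.\<close>

lemma loop_dominates:
  fixes w :: "int \<times> nat \<Rightarrow> real"
  assumes w: "\<And>i. 0 \<le> w i"
  shows "\<exists>r\<in>cont_seminorms Y. \<forall>c. wnorm w c \<le> r (lincomb Y (\<lambda>z. \<tau>' (zpow (fst z)) (basis z)) c)"
proof (rule TY.projective_dominated[OF circle_seminorm_cont[of 0]])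
  have sq: "seminorm_on A (\<lambda>a. wnorm w (coords a))" by (rule wnorm_coords_seminorm[OF w])
  then show "(\<lambda>a. wnorm w (coords a)) \<in> cont_seminorms A" by (simp add: gwa_cont_seminorms)
  show "\<tau>' (zpow (fst z)) (basis z) \<in> TY.D" for z :: "int \<times> nat" by (rule TY.tau_in_D) simp_all
  show "wnorm w (pm_scale k c) = cmod k * wnorm w c" for k c by (rule wnorm_scale)
  fix c
  \<comment> \<open>The index set has one element: the single functional is evaluation at the
    parameter 0, where all powers of z are 1, so that the slice of the combination is the element of
    \<open>A\<close> itself.\<close>
  have "(\<Sum>k\<in>{()}. wnorm w (coords (lincomb A (\<lambda>z. (\<lambda>_ f. f 0) k (zpow (fst z)) \<odot>\<^bsub>A\<^esub> basis z) c)))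
    \<le> projective_seminorm smooth_circle A Y \<tau>' (circle_seminorm 0) (\<lambda>a. wnorm w (coords a))
      (lincomb Y (\<lambda>z. \<tau>' (zpow (fst z)) (basis z)) c)"
  proof (rule TY.lincomb_projective_ge[OF _ _ _ _ _ _ sq])
    show "(\<Sum>k\<in>{()}. cmod ((\<lambda>_ f. f 0) k v)) \<le> circle_seminorm 0 v" if "v \<in> carrier smooth_circle" for v
      using circle_seminorm_upper[of v 0 0] that by simp
  qed simp_all
  moreover have "lincomb A (\<lambda>z. zpow (fst z) 0 \<odot>\<^bsub>A\<^esub> basis z) c = lincomb A basis c"
    by (rule A.lincomb_cong) (simp_all add: zpow_def)
  ultimately show "wnorm w c \<le> projective_seminorm smooth_circle A Y \<tau>' (circle_seminorm 0) (\<lambda>a. wnorm w (coords a))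
      (lincomb Y (\<lambda>z. \<tau>' (zpow (fst z)) (basis z)) c)" by simp
qed

lemma loop_range: "loop ` carrier A = range (lincomb Y (\<lambda>z. \<tau>' (zpow (fst z)) (basis z)))"
proof
  show "range (lincomb Y (\<lambda>z. \<tau>' (zpow (fst z)) (basis z))) \<subseteq> loop ` carrier A"
  proof clarify
    fix c
    have "lincomb Y (\<lambda>z. \<tau>' (zpow (fst z)) (basis z)) c = loop (lincomb A basis c)" by (simp add: loop_def)
    then show "lincomb Y (\<lambda>z. \<tau>' (zpow (fst z)) (basis z)) c \<in> loop ` carrier A" by simp
  qed
qed (auto simp: loop_def)

lemma loop_closed: "closedin (topo Y) (loop ` carrier A)"
  unfolding loop_range
proof (rule Y.closed_range_lincomb[OF Y_Hausdorff])
  show "\<tau>' (zpow (fst z)) (basis z) \<in> carrier Y" for z :: "int \<times> nat" by simp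
qed (rule loop_dominates)

text \<open>Continuity of the inverse of \<open>loop\<close>, in terms of seminorms; injectivity of
  \<open>loop\<close> and continuity of the quotient map both rest on it.\<close>

lemma loop_seminorm:
  assumes q: "seminorm_on A q"
  shows "\<exists>r\<in>cont_seminorms Y. \<forall>a\<in>carrier A. q a \<le> r (loop a)"
proof -
  have "\<exists>r\<in>cont_seminorms Y. \<forall>c. wnorm (\<lambda>i. q (basis i)) c \<le> r (lincomb Y (\<lambda>z. \<tau>' (zpow (fst z)) (basis z)) c)"
    by (rule loop_dominates) (rule seminorm_onD(1)[OF q basis_carrier])
  then obtain r where r: "r \<in> cont_seminorms Y"
    "\<And>c. wnorm (\<lambda>i. q (basis i)) c \<le> r (lincomb Y (\<lambda>z. \<tau>' (zpow (fst z)) (basis z)) c)" by auto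
  have "q a \<le> r (loop a)" if "a \<in> carrier A" for a
    using order_trans[OF seminorm_le_wnorm[OF q that] r(2)] by (simp add: loop_def)
  then show ?thesis using r(1) by blast
qed

lemma loop_zero:
  assumes a: "a \<in> carrier A" "loop a = \<zero>\<^bsub>Y\<^esub>" shows "a = \<zero>\<^bsub>A\<^esub>"
proof (rule A.Hausdorff_sep[OF gwa_Hausdorff a(1)])
  fix q assume "q \<in> cont_seminorms A"
  then have q: "seminorm_on A q" by (simp add: gwa_cont_seminorms)
  obtain r where r: "r \<in> cont_seminorms Y" "\<forall>a\<in>carrier A. q a \<le> r (loop a)" using loop_seminorm[OF q] by blast
  have "q a \<le> r \<zero>\<^bsub>Y\<^esub>" using r(2) a by metis
  also have "\<dots> = 0" by (rule Y.seminorm_zero[OF Y.cs_seminorm[OF r(1)]])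
  finally show "q a = 0" using seminorm_onD(1)[OF q a(1)] by simp
qed

lemma loop_inject:
  assumes "a \<in> carrier A" "b \<in> carrier A" "loop a = loop b" shows "a = b"
proof -
  have "loop (a \<ominus>\<^bsub>A\<^esub> b) = \<zero>\<^bsub>Y\<^esub>"
    using assms loop.map_minus[of a b] loop.linD(1)[of b] by (simp add: Y.minus_self)
  then have "a \<ominus>\<^bsub>A\<^esub> b = \<zero>\<^bsub>A\<^esub>" using assms by (intro loop_zero) simp_all
  then show ?thesis using assms A.minus_eq_zeroD by blast
qed

text \<open>Translates the relational identification into a linear map, for which existence is
  membership in the range and uniqueness is injectivity.\<close>

lemma loop_identified_iff: "loop_identified \<sigma> P Y \<tau>' y a \<longleftrightarrow> a \<in> carrier A \<and> y = loop a"
proof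
  assume "loop_identified \<sigma> P Y \<tau>' y a"
  then obtain F c where F: "finite F" "\<forall>n\<in>F. c n \<in> gwa_comp \<sigma> P n"
    "y = finsum Y (\<lambda>n. \<tau>' (zpow n) (c n)) F" "a = finsum A c F"
    unfolding loop_identified_def by blast
  have c: "c n \<in> carrier A" "loop (c n) = \<tau>' (zpow n) (c n)" if "n \<in> F" for n
    using F(2) that by (auto simp: gwa_comp_eq loop_hom_elt)
  have "loop a = finsum Y (\<lambda>n. loop (c n)) F" unfolding F(4) by (rule loop.map_finsum[OF F(1) c(1)])
  also have "\<dots> = y" unfolding F(3) by (rule Y.finsum_cong') (use c in auto)
  finally show "a \<in> carrier A \<and> y = loop a" using c F by (auto intro: A.finsum_closed)
next
  assume a: "a \<in> carrier A \<and> y = loop a"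
  obtain F u where u: "finite F" "\<forall>n. u n \<in> gwa_comp \<sigma> P n" "lincomb A basis (coords a) = finsum A u F"
    using homogeneous_decomposition[of "coords a"] by blast
  have c: "u n \<in> carrier A" "loop (u n) = \<tau>' (zpow n) (u n)" for n
  proof -
    have "u n \<in> gwa_comp \<sigma> P n" using u(2) by blast
    then show "u n \<in> carrier A" "loop (u n) = \<tau>' (zpow n) (u n)" by (auto simp: gwa_comp_eq loop_hom_elt)
  qed
  have e: "a = finsum A u F" using u(3) a by (simp add: lincomb_coords)
  have "loop a = finsum Y (\<lambda>n. loop (u n)) F" unfolding e by (rule loop.map_finsum[OF u(1) c(1)])
  then have "y = finsum Y (\<lambda>n. \<tau>' (zpow n) (u n)) F" using a by (simp add: c(2))
  then show "loop_identified \<sigma> P Y \<tau>' y a" unfolding loop_identified_def using u e by blast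
qed

abbreviation "\<Lambda>\<^sub>0 \<equiv> Lambda_algebraic \<sigma> P X \<tau>"
abbreviation "\<Lambda> \<equiv> Lambda_gwa \<sigma> P X \<tau>"
abbreviation "TA \<equiv> toeplitz_gwa \<sigma> P X \<tau>"

section \<open>The matrix part and left multiplication by the generators\<close>

definition unit_elt :: "nat \<Rightarrow> nat \<Rightarrow> complex poly \<Rightarrow> 'x" where
  "unit_elt i j d = \<tau> (matrix_unit i j) (lam_elt i j d)"

lemma matrix_unit_carrier [simp]: "matrix_unit i j \<in> toeplitz_carrier"
  by (simp add: K_subset_toeplitz(1))

lemma unit_elt_carrier [simp]: "unit_elt i j d \<in> carrier X"
  by (simp add: unit_elt_def)

lemma Lambda_summand_eq: "Lambda_summand \<sigma> P \<tau> k = range (unit_elt (fst k) (snd k))"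
  unfolding Lambda_summand_def gwa_comp_prod_eq by (auto simp: unit_elt_def)

lemma Lambda_0_eq: "\<Lambda>\<^sub>0 = cspan X (\<Union>k. range (unit_elt (fst k) (snd k)))"
  by (simp add: Lambda_algebraic_def Lambda_summand_eq)

lemma Lambda_0_submodule: "submodule \<Lambda>\<^sub>0 CC X"
  unfolding Lambda_0_eq by (rule X.cspan_submodule) auto

lemma unit_elt_in: "unit_elt i j d \<in> \<Lambda>\<^sub>0"
  unfolding Lambda_0_eq by (rule subsetD[OF X.cspan_superset], rule UN_I[of "(i, j)"]) simp_all

lemma Lambda_0_image:
  assumes "cvec U" "lin_map X U f" "submodule H CC U" "\<And>i j d. f (unit_elt i j d) \<in> H" "u \<in> \<Lambda>\<^sub>0"
  shows "f u \<in> H"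
proof -
  interpret cvec_lin X U f using assms(1,2) X.cvec_axioms by (intro cvec_lin.intro cvec_lin_axioms.intro)
  show ?thesis
    by (rule image_cspan[OF _ assms(3) _ assms(5)[unfolded Lambda_0_eq]]) (use assms(4) in auto)
qed

lemma shift_carrier [simp]: "shift \<in> toeplitz_carrier" "backward_shift \<in> toeplitz_carrier"
  by (simp_all add: shift_def backward_shift_def)

text \<open>Read off from S S*^(j+1) = S*^j - e_0j, a difference of two known elements.\<close>

lemma shift_mult_carrier: "shift \<otimes>\<^bsub>smooth_toeplitz\<^esub> shift_pow (- int (Suc j)) \<in> toeplitz_carrier"
proof -
  have "shift \<otimes>\<^bsub>smooth_toeplitz\<^esub> shift_pow (- int (Suc j)) =
    shift_pow (- int j) \<oplus>\<^bsub>smooth_toeplitz\<^esub> (-1) \<odot>\<^bsub>smooth_toeplitz\<^esub> matrix_unit 0 j"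
    unfolding shift_mult_pow(2)[of j] by (simp add: fun_eq_iff)
  then show ?thesis using T.a_closed[of "shift_pow (- int j)"] T.smul_closed[of "matrix_unit 0 j"]
    by (simp only: smooth_toeplitz_simps(1) toeplitz_matrix_carrier zpow_smooth matrix_unit_carrier)
qed

lemma shift_eqs: "shift_pow 0 = one smooth_toeplitz" "shift_pow 1 = shift" "shift_pow (-1) = backward_shift"
  unfolding one_toeplitz by (simp_all add: shift_def backward_shift_def)

lemma mult_lin: "x \<in> carrier X \<Longrightarrow> lin_map X X (\<lambda>y. x \<otimes>\<^bsub>X\<^esub> y)"
  using X.lcalg(4) by (simp add: assoc_alg_def)

text \<open>Left multiplication by the generators, modulo the ideal, is the one of \<open>A\<close>. The only defect
  comes from \<open>shift * shift_pow (- Suc j) = shift_pow (- j) - matrix_unit 0 j\<close>.\<close>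

lemma generator_mult_hom_elt:
  assumes \<delta>: "\<delta> \<in> {-1, 0, 1}"
  shows "\<tau> (shift_pow \<delta>) (hom_elt e \<delta>) \<otimes>\<^bsub>X\<^esub> sec (hom_elt d n) \<ominus>\<^bsub>X\<^esub> sec (hom_elt e \<delta> \<otimes>\<^bsub>A\<^esub> hom_elt d n) \<in> \<Lambda>\<^sub>0"
proof -
  let ?b = "hom_elt e \<delta> \<otimes>\<^bsub>A\<^esub> hom_elt d n"
  \<comment> \<open>Only the degree of the product matters, as it selects the power of the shift in
    \<open>sec\<close>.\<close>
  obtain d' where b: "?b = hom_elt d' (\<delta> + n)"
    using \<delta> hom_elt_mult_0[of e d n] hom_elt_mult_1[of e d n] hom_elt_mult_m1[of e d n]
    by (auto simp: add.commute)
  have l: "\<tau> (shift_pow \<delta>) (hom_elt e \<delta>) \<otimes>\<^bsub>X\<^esub> sec (hom_elt d n) = \<tau> (shift_pow \<delta> \<otimes>\<^bsub>smooth_toeplitz\<^esub> shift_pow n) ?b"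
    unfolding sec_hom_elt by (rule tau_mult) simp_all
  have r: "sec ?b = \<tau> (shift_pow (\<delta> + n)) ?b" unfolding b by (rule sec_hom_elt)
  show ?thesis
  proof (cases "\<delta> = 1 \<and> n < 0")
    case False
    have "shift_pow \<delta> \<otimes>\<^bsub>smooth_toeplitz\<^esub> shift_pow n = shift_pow (\<delta> + n)"
    proof -
      consider "\<delta> = 0" | "\<delta> = -1" | "\<delta> = 1" "0 \<le> n" using False \<delta> by fastforce
      then show ?thesis
      proof cases
        case 1
        show ?thesis unfolding 1 shift_eqs(1) by (simp only: one_mult_toeplitz add_0)
      next
        case 2
        show ?thesis unfolding 2 shift_eqs(3) by (simp only: backward_shift_mult_pow) simp
      next
        case 3
        show ?thesis unfolding 3(1) shift_eqs(2) by (simp only: shift_mult_pow(1)[OF 3(2)] add.commute)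
      qed
    qed
    then have "\<tau> (shift_pow \<delta>) (hom_elt e \<delta>) \<otimes>\<^bsub>X\<^esub> sec (hom_elt d n) = sec ?b" using l r by simp
    moreover have "sec ?b \<in> carrier X" unfolding b by (rule sec.linD(1)) simp
    ultimately show ?thesis using X.submoduleD(2)[OF Lambda_0_submodule] by (simp add: X.minus_self)
  next
    case True
    then have "- n - 1 \<ge> 0" by simp
    then obtain j where "- n - 1 = int j" by (metis nonneg_int_cases)
    then have n: "n = - int (Suc j)" by simp
    have \<delta>1: "\<delta> = 1" using True by simp
    \<comment> \<open>The product of y with x^(j+1) has picked up the factor P =
      \<open>lam 0 j\<close>, so the correction by e_0j lies in the summand at position (0,
      j).\<close>
    have bl: "?b = lam_elt 0 j (e * \<sigma>' d)" unfolding n \<delta>1 by (rule lam_elt_left)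
    have bc: "?b \<in> carrier A" unfolding bl by simp
    have sm: "shift \<otimes>\<^bsub>smooth_toeplitz\<^esub> shift_pow n \<in> toeplitz_carrier" unfolding n by (rule shift_mult_carrier)
    have "\<tau> (shift_pow (- int j)) ?b = \<tau> (shift \<otimes>\<^bsub>smooth_toeplitz\<^esub> shift_pow n) ?b \<oplus>\<^bsub>X\<^esub> \<tau> (matrix_unit 0 j) ?b"
      unfolding n shift_mult_pow(2)[of j]
      by (rule TX.add_left) (use sm bc n in \<open>simp_all only: smooth_toeplitz_simps(1) matrix_unit_carrier\<close>)
    moreover have "\<delta> + n = - int j" using n \<delta>1 by simp
    moreover have "\<tau> (matrix_unit 0 j) ?b = unit_elt 0 j (e * \<sigma>' d)" by (simp only: bl unit_elt_def)
    ultimately have "sec ?b = \<tau> (shift \<otimes>\<^bsub>smooth_toeplitz\<^esub> shift_pow n) ?b \<oplus>\<^bsub>X\<^esub> unit_elt 0 j (e * \<sigma>' d)"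
      using r by simp
    moreover have "\<tau> (shift_pow \<delta>) (hom_elt e \<delta>) \<otimes>\<^bsub>X\<^esub> sec (hom_elt d n) = \<tau> (shift \<otimes>\<^bsub>smooth_toeplitz\<^esub> shift_pow n) ?b"
      using l unfolding \<delta>1 shift_eqs(2) .
    moreover have tc: "\<tau> (shift \<otimes>\<^bsub>smooth_toeplitz\<^esub> shift_pow n) ?b \<in> carrier X" by (rule tau_carrier[OF sm bc])
    ultimately have "\<tau> (shift_pow \<delta>) (hom_elt e \<delta>) \<otimes>\<^bsub>X\<^esub> sec (hom_elt d n) \<ominus>\<^bsub>X\<^esub> sec ?b
        = (-1) \<odot>\<^bsub>X\<^esub> unit_elt 0 j (e * \<sigma>' d)"
      by (simp only: X.minus_add_self(1)[OF tc unit_elt_carrier])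
    then show ?thesis using X.submoduleD(4)[OF Lambda_0_submodule unit_elt_in] by simp
  qed
qed

text \<open>S raises the row, S* lowers it and kills row 0; the coefficients follow by
  \<open>lam_elt_left\<close>, and the column stays fixed.\<close>

lemma generator_mult_unit_elt:
  assumes \<delta>: "\<delta> \<in> {-1, 0, 1}"
  shows "\<tau> (shift_pow \<delta>) (hom_elt e \<delta>) \<otimes>\<^bsub>X\<^esub> unit_elt i j d \<in> \<Lambda>\<^sub>0"
proof -
  let ?b = "hom_elt e \<delta> \<otimes>\<^bsub>A\<^esub> lam_elt i j d"
  have l: "\<tau> (shift_pow \<delta>) (hom_elt e \<delta>) \<otimes>\<^bsub>X\<^esub> unit_elt i j d = \<tau> (shift_pow \<delta> \<otimes>\<^bsub>smooth_toeplitz\<^esub> matrix_unit i j) ?b"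
    unfolding unit_elt_def by (rule tau_mult) simp_all
  consider "\<delta> = 0" | "\<delta> = 1" | "\<delta> = -1" using \<delta> by fastforce
  then show ?thesis
  proof cases
    case 1
    have "\<tau> (shift_pow \<delta>) (hom_elt e \<delta>) \<otimes>\<^bsub>X\<^esub> unit_elt i j d = unit_elt i j (e * d)"
      unfolding l unfolding 1 shift_eqs(1) lam_elt_left(1) one_mult_toeplitz unit_elt_def ..
    then show ?thesis by (simp add: unit_elt_in)
  next
    case 2
    have "\<tau> (shift_pow \<delta>) (hom_elt e \<delta>) \<otimes>\<^bsub>X\<^esub> unit_elt i j d = unit_elt (Suc i) j (e * \<sigma>' d)"
      unfolding l unfolding 2 shift_eqs(2) lam_elt_left(2) shift_mult_unit unit_elt_def ..
    then show ?thesis by (simp add: unit_elt_in)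
  next
    case 3
    show ?thesis
    proof (cases i)
      case 0
      have bc: "?b \<in> carrier A"
        unfolding 3 lam_elt_def hom_elt_mult_m1 by simp
      have "\<tau> (shift_pow \<delta>) (hom_elt e \<delta>) \<otimes>\<^bsub>X\<^esub> unit_elt i j d = \<tau> \<zero>\<^bsub>smooth_toeplitz\<^esub> ?b"
        unfolding l unfolding 3 0 shift_eqs(3) backward_shift_mult_unit(2) by simp
      also have "\<dots> = \<zero>\<^bsub>X\<^esub>" by (rule TX.zero_left[OF bc])
      finally show ?thesis using X.submoduleD(2)[OF Lambda_0_submodule] by simp
    next
      case (Suc i')
      have "\<tau> (shift_pow \<delta>) (hom_elt e \<delta>) \<otimes>\<^bsub>X\<^esub> unit_elt i j d = unit_elt i' j (e * \<sigma> d * \<sigma> P)"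
        unfolding l unfolding 3 Suc shift_eqs(3) lam_elt_left(3) backward_shift_mult_unit(1) unit_elt_def ..
      then show ?thesis by (simp add: unit_elt_in)
    qed
  qed
qed

lemma A_mult_lin: "b \<in> carrier A \<Longrightarrow> lin_map A A (\<lambda>a. b \<otimes>\<^bsub>A\<^esub> a)"
  using assoc_alg_gwa by (simp add: assoc_alg_def)

lemma A_mult_closed: "a \<in> carrier A \<Longrightarrow> b \<in> carrier A \<Longrightarrow> a \<otimes>\<^bsub>A\<^esub> b \<in> carrier A"
  using lin_mapD(1)[OF A_mult_lin] by blast

lemma generator_mult_sec:
  assumes \<delta>: "\<delta> \<in> {-1, 0, 1}" and a: "a \<in> carrier A"
  shows "\<tau> (shift_pow \<delta>) (hom_elt e \<delta>) \<otimes>\<^bsub>X\<^esub> sec a \<ominus>\<^bsub>X\<^esub> sec (hom_elt e \<delta> \<otimes>\<^bsub>A\<^esub> a) \<in> \<Lambda>\<^sub>0"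
proof (rule lin_map_basis[where f="\<lambda>a. \<tau> (shift_pow \<delta>) (hom_elt e \<delta>) \<otimes>\<^bsub>X\<^esub> sec a
      \<ominus>\<^bsub>X\<^esub> sec (hom_elt e \<delta> \<otimes>\<^bsub>A\<^esub> a)", OF X.cvec_axioms _ Lambda_0_submodule _ a])
  let ?g = "\<tau> (shift_pow \<delta>) (hom_elt e \<delta>)" and ?b = "hom_elt e \<delta>"
  interpret L: cvec_lin X X "\<lambda>y. ?g \<otimes>\<^bsub>X\<^esub> y" by unfold_locales (rule mult_lin, simp)
  interpret LA: cvec_lin A A "\<lambda>y. ?b \<otimes>\<^bsub>A\<^esub> y" by unfold_locales (rule A_mult_lin, simp)
  show "lin_map A X (\<lambda>a. ?g \<otimes>\<^bsub>X\<^esub> sec a \<ominus>\<^bsub>X\<^esub> sec (?b \<otimes>\<^bsub>A\<^esub> a))"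
    by (rule lin_mapI) (simp_all add: sec.linD L.linD LA.linD X.add_diff_add X.smul_diff)
qed (rule generator_mult_hom_elt[OF \<delta>])

lemma generator_mult_Lambda_0:
  assumes \<delta>: "\<delta> \<in> {-1, 0, 1}" and u: "u \<in> \<Lambda>\<^sub>0"
  shows "\<tau> (shift_pow \<delta>) (hom_elt e \<delta>) \<otimes>\<^bsub>X\<^esub> u \<in> \<Lambda>\<^sub>0"
  by (rule Lambda_0_image[OF X.cvec_axioms mult_lin Lambda_0_submodule generator_mult_unit_elt[OF \<delta>] u]) simp

section \<open>The Toeplitz algebra as the closure of W\<close>

definition gens :: "'x set" where
  "gens = {\<tau> (shift_pow \<delta>) (hom_elt e \<delta>) |\<delta> e. \<delta> \<in> {-1, 0, 1}}"

lemma TA_eq: "TA = closed_subalgebra_generated X gens"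
proof -
  have "gens = \<tau> \<one>\<^bsub>smooth_toeplitz\<^esub> ` gwa_comp \<sigma> P 0 \<union> \<tau> shift ` gwa_comp \<sigma> P 1 \<union>
      \<tau> backward_shift ` gwa_comp \<sigma> P (- 1)"
    unfolding gens_def gwa_comp_eq shift_eqs[symmetric] by auto
  then show ?thesis by (simp add: toeplitz_gwa_def)
qed

lemma gens_carrier: "gens \<subseteq> carrier X"
  by (auto simp: gens_def)

lemmas TA_props = X.closed_subalgebra[OF gens_carrier, folded TA_eq]

definition W :: "'x set" where
  "W = {sec a \<oplus>\<^bsub>X\<^esub> l |a l. a \<in> carrier A \<and> l \<in> \<Lambda>\<^sub>0}"

lemma W_submodule: "submodule W CC X"
proof (rule X.submoduleI')
  note L = X.submoduleD[OF Lambda_0_submodule] and Lc = X.in_carrierD[OF Lambda_0_submodule]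
  show "W \<subseteq> carrier X" using Lc sec.linD(1) by (auto simp: W_def)
  show "\<zero>\<^bsub>X\<^esub> \<in> W" unfolding W_def using L(2) sec.map_zero A.zero_closed X.l_zero[OF X.zero_closed] by force
next
  note L = X.submoduleD[OF Lambda_0_submodule] and Lc = X.in_carrierD[OF Lambda_0_submodule]
  fix x y c assume "x \<in> W"
  then obtain a l where x: "x = sec a \<oplus>\<^bsub>X\<^esub> l" "a \<in> carrier A" "l \<in> \<Lambda>\<^sub>0" by (auto simp: W_def)
  have "c \<odot>\<^bsub>X\<^esub> x = sec (c \<odot>\<^bsub>A\<^esub> a) \<oplus>\<^bsub>X\<^esub> c \<odot>\<^bsub>X\<^esub> l"
    using x Lc sec.linD by (simp add: X.smul_add_right)
  then show "c \<odot>\<^bsub>X\<^esub> x \<in> W" unfolding W_def using x L(4) A.smul_closed by blast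
  assume "y \<in> W"
  then obtain b m where y: "y = sec b \<oplus>\<^bsub>X\<^esub> m" "b \<in> carrier A" "m \<in> \<Lambda>\<^sub>0" by (auto simp: W_def)
  have "x \<oplus>\<^bsub>X\<^esub> y = sec (a \<oplus>\<^bsub>A\<^esub> b) \<oplus>\<^bsub>X\<^esub> (l \<oplus>\<^bsub>X\<^esub> m)"
    using x y Lc sec.linD by (simp add: X.a_ac)
  then show "x \<oplus>\<^bsub>X\<^esub> y \<in> W" unfolding W_def using x y L(3) A.a_closed by blast
qed

lemma W_carrier: "W \<subseteq> carrier X" by (rule X.submoduleD(1)[OF W_submodule])

lemma sec_in_W: "a \<in> carrier A \<Longrightarrow> sec a \<in> W"
  unfolding W_def using X.submoduleD(2)[OF Lambda_0_submodule] sec.linD(1) X.r_zero by force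

lemma Lambda_0_in_W: "\<Lambda>\<^sub>0 \<subseteq> W"
proof
  fix l assume l: "l \<in> \<Lambda>\<^sub>0"
  have "l = sec \<zero>\<^bsub>A\<^esub> \<oplus>\<^bsub>X\<^esub> l" using l X.in_carrierD[OF Lambda_0_submodule] by (simp add: sec.map_zero)
  then show "l \<in> W" unfolding W_def using l A.zero_closed by blast
qed

text \<open>Besides the stability of \<open>W\<close> this records the \<open>A\<close>-component of
  the product, from which multiplicativity of the quotient map will follow.\<close>

lemma generator_mult_W:
  assumes \<delta>: "\<delta> \<in> {-1, 0, 1}" and a: "a \<in> carrier A" and l: "l \<in> \<Lambda>\<^sub>0"
  shows "\<exists>m\<in>\<Lambda>\<^sub>0. \<tau> (shift_pow \<delta>) (hom_elt e \<delta>) \<otimes>\<^bsub>X\<^esub> (sec a \<oplus>\<^bsub>X\<^esub> l) = sec (hom_elt e \<delta> \<otimes>\<^bsub>A\<^esub> a) \<oplus>\<^bsub>X\<^esub> m"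
proof -
  let ?g = "\<tau> (shift_pow \<delta>) (hom_elt e \<delta>)" and ?b = "hom_elt e \<delta> \<otimes>\<^bsub>A\<^esub> a"
  note L = X.submoduleD[OF Lambda_0_submodule] and Lc = X.in_carrierD[OF Lambda_0_submodule]
  let ?m = "(?g \<otimes>\<^bsub>X\<^esub> sec a \<ominus>\<^bsub>X\<^esub> sec ?b) \<oplus>\<^bsub>X\<^esub> ?g \<otimes>\<^bsub>X\<^esub> l"
  have g: "?g \<in> carrier X" by simp
  have b: "?b \<in> carrier A" using a by (simp add: A_mult_closed)
  have c: "?g \<otimes>\<^bsub>X\<^esub> sec a \<in> carrier X" "?g \<otimes>\<^bsub>X\<^esub> l \<in> carrier X" "sec ?b \<in> carrier X"
    using g a b Lc[OF l] sec.linD(1) by (simp_all add: X.mult_closed')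
  have m: "?m \<in> \<Lambda>\<^sub>0" by (intro L(3) generator_mult_sec generator_mult_Lambda_0 \<delta> a l)
  have "?g \<otimes>\<^bsub>X\<^esub> (sec a \<oplus>\<^bsub>X\<^esub> l) = ?g \<otimes>\<^bsub>X\<^esub> sec a \<oplus>\<^bsub>X\<^esub> ?g \<otimes>\<^bsub>X\<^esub> l"
    using g a Lc[OF l] sec.linD(1) by (simp add: X.mult_add_right)
  also have "\<dots> = (sec ?b \<oplus>\<^bsub>X\<^esub> (?g \<otimes>\<^bsub>X\<^esub> sec a \<ominus>\<^bsub>X\<^esub> sec ?b)) \<oplus>\<^bsub>X\<^esub> ?g \<otimes>\<^bsub>X\<^esub> l"
    using c by (simp add: X.add_minus_cancel)
  also have "\<dots> = sec ?b \<oplus>\<^bsub>X\<^esub> ?m" using c by (simp add: X.a_assoc)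
  finally show ?thesis using m by blast
qed

lemma gens_mult_W: "g \<in> gens \<Longrightarrow> w \<in> W \<Longrightarrow> g \<otimes>\<^bsub>X\<^esub> w \<in> W"
proof -
  assume "g \<in> gens" "w \<in> W"
  then obtain \<delta> e a l where g: "g = \<tau> (shift_pow \<delta>) (hom_elt e \<delta>)" "\<delta> \<in> {-1, 0, 1}"
    and w: "w = sec a \<oplus>\<^bsub>X\<^esub> l" "a \<in> carrier A" "l \<in> \<Lambda>\<^sub>0" unfolding gens_def W_def by blast
  obtain m where "m \<in> \<Lambda>\<^sub>0" "g \<otimes>\<^bsub>X\<^esub> w = sec (hom_elt e \<delta> \<otimes>\<^bsub>A\<^esub> a) \<oplus>\<^bsub>X\<^esub> m"
    using generator_mult_W[OF g(2) w(2,3)] unfolding g(1) w(1) by blast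
  moreover have "hom_elt e \<delta> \<otimes>\<^bsub>A\<^esub> a \<in> carrier A" using w by (simp add: A_mult_closed)
  ultimately show ?thesis unfolding W_def by blast
qed

lemma gens_subset_W: "gens \<subseteq> W"
proof
  fix g assume "g \<in> gens"
  then obtain \<delta> e where g: "g = \<tau> (shift_pow \<delta>) (hom_elt e \<delta>)" unfolding gens_def by blast
  show "g \<in> W" unfolding g sec_hom_elt[symmetric] by (rule sec_in_W) simp
qed

lemma W_subset_closure: "W \<subseteq> topo X closure_of W"
  using W_carrier by (intro closure_of_subset) simp

text \<open>What is known is that left multiplication by the generators preserves \<open>W\<close>.
  The elements of the closure that multiply the closure into itself from the left form a closed
  subalgebra containing the generators, so they exhaust \<open>TA\<close>.\<close>

lemma TA_subset_closure: "TA \<subseteq> topo X closure_of W"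
proof -
  let ?c = "topo X closure_of W"
  let ?B = "{u \<in> ?c. \<forall>v\<in>?c. u \<otimes>\<^bsub>X\<^esub> v \<in> ?c}"
  note cl = X.submoduleD[OF X.closure_submodule[OF W_submodule]] and clc = X.in_carrierD[OF X.closure_submodule[OF W_submodule]]
  have "TA \<subseteq> ?B" unfolding TA_eq
  proof (rule X.closed_subalgebra_least)
    show "submodule ?B CC X"
    proof (rule X.submoduleI')
      show "?B \<subseteq> carrier X" using clc by blast
      show "\<zero>\<^bsub>X\<^esub> \<in> ?B"
      proof (intro CollectI conjI ballI cl(2))
        fix v assume v: "v \<in> ?c"
        have "\<zero>\<^bsub>X\<^esub> \<otimes>\<^bsub>X\<^esub> v = \<zero>\<^bsub>X\<^esub>"
          using X.mult_smul_left[of v "\<zero>\<^bsub>X\<^esub>" 0] X.mult_closed'[of "\<zero>\<^bsub>X\<^esub>" v] clc[OF v] by simp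
        then show "\<zero>\<^bsub>X\<^esub> \<otimes>\<^bsub>X\<^esub> v \<in> ?c" using cl(2) by simp
      qed
    next
      fix a b assume "a \<in> ?B" "b \<in> ?B"
      then show "a \<oplus>\<^bsub>X\<^esub> b \<in> ?B" using cl(3) clc by (simp add: X.mult_add_left)
    next
      fix k a assume "a \<in> ?B"
      then show "k \<odot>\<^bsub>X\<^esub> a \<in> ?B" using cl(4) clc by (simp add: X.mult_smul_left)
    qed
    show "x \<otimes>\<^bsub>X\<^esub> y \<in> ?B" if "x \<in> ?B" "y \<in> ?B" for x y
      using that clc by (simp add: X.mult_assoc')
    have "topo X closure_of ?B \<subseteq> ?B"
    proof
      fix u assume u: "u \<in> topo X closure_of ?B"
      have 1: "u \<in> ?c"
      proof -
        have "topo X closure_of ?B \<subseteq> topo X closure_of ?c" by (rule closure_of_mono) blast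
        then show ?thesis using u by auto
      qed
      have "u \<otimes>\<^bsub>X\<^esub> v \<in> ?c" if v: "v \<in> ?c" for v
      proof -
        have v': "v \<in> topo X closure_of ?c" using v by simp
        have "u \<otimes>\<^bsub>X\<^esub> v \<in> topo X closure_of ?c" by (rule X.closure_mult[OF _ u v']) blast
        then show ?thesis by simp
      qed
      then show "u \<in> ?B" using 1 by blast
    qed
    moreover have "?B \<subseteq> topspace (topo X)" using clc by auto
    ultimately show "closedin (topo X) ?B" by (simp only: closure_of_subset_eq[symmetric])
    show "gens \<subseteq> ?B"
    proof
      fix g assume g: "g \<in> gens"
      have "g \<otimes>\<^bsub>X\<^esub> v \<in> ?c" if "v \<in> ?c" for v
      proof (rule X.closure_mult[of "{g}" W W])
        show "g \<in> topo X closure_of {g}" using closure_of_subset[of "{g}" "topo X"] g gens_carrier by auto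
      qed (use g that gens_mult_W in auto)
      then show "g \<in> ?B" using g gens_subset_W W_subset_closure by blast
    qed
  qed
  then show ?thesis by blast
qed

text \<open>Positive powers arise by repeated left multiplication with S \<otimes> y, negative ones
  with S* and x; the twist is cancelled by starting from \<sigma> d or from its preimage.\<close>

lemma sec_in_TA: "a \<in> carrier A \<Longrightarrow> sec a \<in> TA"
proof (rule lin_map_basis[OF X.cvec_axioms sec_lin TA_props(1)])
  have g: "\<tau> (shift_pow \<delta>) (hom_elt e \<delta>) \<in> TA" if "\<delta> \<in> {-1, 0, 1}" for \<delta> e
    using TA_props(4) that unfolding gens_def by blast
  have pos: "\<tau> (shift_pow (int k)) (hom_elt d (int k)) \<in> TA" for k d
  proof (induct k arbitrary: d)
    case 0 then show ?case using g[of 0 d] by simp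
  next
    case (Suc k)
    have "\<tau> (shift_pow 1) (hom_elt 1 1) \<otimes>\<^bsub>X\<^esub> \<tau> (shift_pow (int k)) (hom_elt (\<sigma> d) (int k))
        = \<tau> (shift_pow 1 \<otimes>\<^bsub>smooth_toeplitz\<^esub> shift_pow (int k)) (hom_elt 1 1 \<otimes>\<^bsub>A\<^esub> hom_elt (\<sigma> d) (int k))"
      by (rule tau_mult) simp_all
    also have "shift_pow 1 \<otimes>\<^bsub>smooth_toeplitz\<^esub> shift_pow (int k) = shift_pow (int (Suc k))"
      unfolding shift_eqs(2) using shift_mult_pow(1)[of "int k"] by (simp add: add.commute del: smooth_toeplitz_simps)
    also have "hom_elt 1 1 \<otimes>\<^bsub>A\<^esub> hom_elt (\<sigma> d) (int k) = hom_elt d (int (Suc k))"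
      by (simp add: hom_elt_mult_1 add.commute)
    finally show ?case using TA_props(2)[OF g[of 1 1] Suc[of "\<sigma> d"]] by simp
  qed
  have neg: "\<tau> (shift_pow (- int k)) (hom_elt d (- int k)) \<in> TA" for k d
  proof (induct k arbitrary: d)
    case 0 then show ?case using g[of 0 d] by simp
  next
    case (Suc k)
    have e: "- int k - 1 = - int (Suc k)" by simp
    have "\<tau> (shift_pow (-1)) (hom_elt 1 (-1)) \<otimes>\<^bsub>X\<^esub> \<tau> (shift_pow (- int k)) (hom_elt (\<sigma>' d) (- int k))
        = \<tau> (shift_pow (-1) \<otimes>\<^bsub>smooth_toeplitz\<^esub> shift_pow (- int k)) (hom_elt 1 (-1) \<otimes>\<^bsub>A\<^esub> hom_elt (\<sigma>' d) (- int k))"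
      by (rule tau_mult) simp_all
    also have "shift_pow (-1) \<otimes>\<^bsub>smooth_toeplitz\<^esub> shift_pow (- int k) = shift_pow (- int (Suc k))"
      unfolding shift_eqs(3) backward_shift_mult_pow e ..
    also have "hom_elt 1 (-1) \<otimes>\<^bsub>A\<^esub> hom_elt (\<sigma>' d) (- int k) = hom_elt d (- int (Suc k))"
      unfolding hom_elt_mult_m1 e by simp
    finally show ?case using TA_props(2)[OF g[of "-1" 1] Suc[of "\<sigma>' d"]] by simp
  qed
  show "sec (hom_elt d n) \<in> TA" for d n
    unfolding sec_hom_elt using pos[of "nat n" d] neg[of "nat (- n)" d] by (cases "0 \<le> n") simp_all
qed

text \<open>Row 0 is a difference of two elements of \<open>TA\<close> by the defect formula for S.
  Multiplication with S \<otimes> y raises the row, and \<sigma> d in place of \<open>d\<close>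
  cancels the twist.\<close>

lemma unit_elt_in_TA: "unit_elt i j d \<in> TA"
proof (induct i arbitrary: d)
  case 0
  let ?g = "\<tau> (shift_pow 1) (hom_elt 1 1)" and ?n = "- int (Suc j)"
  have b: "hom_elt 1 1 \<otimes>\<^bsub>A\<^esub> hom_elt (\<sigma> d) ?n = lam_elt 0 j d" using lam_elt_left(4)[of 1 "\<sigma> d" j] by simp
  have bh: "lam_elt 0 j d = hom_elt (d * P) (- int j)" by (simp add: lam_elt_def lam_simps)
  have g: "?g \<in> TA" using TA_props(4) unfolding gens_def by blast
  have s: "sec (hom_elt (\<sigma> d) ?n) \<in> TA" "sec (lam_elt 0 j d) \<in> TA" by (simp_all add: sec_in_TA)
  have l: "?g \<otimes>\<^bsub>X\<^esub> sec (hom_elt (\<sigma> d) ?n) = \<tau> (shift \<otimes>\<^bsub>smooth_toeplitz\<^esub> shift_pow ?n) (lam_elt 0 j d)"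
    unfolding sec_hom_elt b[symmetric] shift_eqs(2)[symmetric] by (rule tau_mult) simp_all
  note sm = shift_mult_carrier[of j]
  have "sec (lam_elt 0 j d) = \<tau> (shift_pow (- int j)) (lam_elt 0 j d)" unfolding bh by (rule sec_hom_elt)
  also have "\<dots> = ?g \<otimes>\<^bsub>X\<^esub> sec (hom_elt (\<sigma> d) ?n) \<oplus>\<^bsub>X\<^esub> unit_elt 0 j d"
    unfolding l unit_elt_def unfolding shift_mult_pow(2)[of j]
    by (rule TX.add_left) (use sm in \<open>simp_all only: smooth_toeplitz_simps(1) matrix_unit_carrier lam_elt_carrier\<close>)
  finally have "sec (lam_elt 0 j d) = ?g \<otimes>\<^bsub>X\<^esub> sec (hom_elt (\<sigma> d) ?n) \<oplus>\<^bsub>X\<^esub> unit_elt 0 j d" .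
  moreover have gs: "?g \<otimes>\<^bsub>X\<^esub> sec (hom_elt (\<sigma> d) ?n) \<in> TA" by (rule TA_props(2)[OF g s(1)])
  ultimately have "unit_elt 0 j d = sec (lam_elt 0 j d) \<ominus>\<^bsub>X\<^esub> ?g \<otimes>\<^bsub>X\<^esub> sec (hom_elt (\<sigma> d) ?n)"
    by (simp only: X.minus_add_self(2)[OF X.in_carrierD[OF TA_props(1) gs] unit_elt_carrier])
  then show ?case using X.submoduleD(5)[OF TA_props(1) s(2) gs] by simp
next
  case (Suc i)
  let ?g = "\<tau> (shift_pow 1) (hom_elt 1 1)"
  have g: "?g \<in> TA" using TA_props(4) unfolding gens_def by blast
  have "?g \<otimes>\<^bsub>X\<^esub> unit_elt i j (\<sigma> d) = \<tau> (shift \<otimes>\<^bsub>smooth_toeplitz\<^esub> matrix_unit i j) (hom_elt 1 1 \<otimes>\<^bsub>A\<^esub> lam_elt i j (\<sigma> d))"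
    unfolding unit_elt_def shift_eqs(2) by (rule tau_mult) simp_all
  also have "\<dots> = unit_elt (Suc i) j d" unfolding shift_mult_unit lam_elt_left(2) unit_elt_def by simp
  finally show ?case using TA_props(2)[OF g Suc[of "\<sigma> d"]] by simp
qed

lemma W_subset_TA: "W \<subseteq> TA"
proof -
  have "\<Lambda>\<^sub>0 \<subseteq> TA" unfolding Lambda_0_eq by (rule X.cspan_least[OF TA_props(1)]) (use unit_elt_in_TA in auto)
  then show ?thesis unfolding W_def using sec_in_TA X.submoduleD(3)[OF TA_props(1)] by blast
qed

lemma TA_eq_closure: "TA = topo X closure_of W"
  using TA_subset_closure closure_of_minimal[OF W_subset_TA TA_props(3)] by blast

section \<open>The quotient map\<close>

lemma p_Lambda_0: "u \<in> \<Lambda>\<^sub>0 \<Longrightarrow> p u = \<zero>\<^bsub>Y\<^esub>"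
proof -
  assume u: "u \<in> \<Lambda>\<^sub>0"
  have "p u \<in> {\<zero>\<^bsub>Y\<^esub>}"
  proof (rule Lambda_0_image[OF Y.cvec_axioms p.lin _ _ u])
    show "submodule {\<zero>\<^bsub>Y\<^esub>} CC Y" by (rule Y.submoduleI') auto
    show "p (unit_elt i j d) \<in> {\<zero>\<^bsub>Y\<^esub>}" for i j d
      using TY.zero_left[of "lam_elt i j d"] by (simp add: unit_elt_def p_tau K_subset_toeplitz(2))
  qed
  then show "p u = \<zero>\<^bsub>Y\<^esub>" by simp
qed

lemma p_W: "a \<in> carrier A \<Longrightarrow> l \<in> \<Lambda>\<^sub>0 \<Longrightarrow> p (sec a \<oplus>\<^bsub>X\<^esub> l) = loop a"
  using p.linD(2)[of "sec a" l] sec.linD(1)[of a] loop.linD(1)[of a] X.in_carrierD[OF Lambda_0_submodule, of l]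
  by (simp add: p_sec p_Lambda_0)

text \<open>Here the closed range of \<open>loop\<close> is used: a priori \<open>p\<close> takes
  limits of elements of \<open>W\<close> to limits of loops.\<close>

lemma p_TA: "u \<in> TA \<Longrightarrow> p u \<in> loop ` carrier A"
proof -
  assume u: "u \<in> TA"
  have "p ` (topo X closure_of W) \<subseteq> topo Y closure_of (p ` W)"
    by (rule continuous_map_image_closure_subset[OF p_continuous])
  moreover have "topo Y closure_of (p ` W) \<subseteq> loop ` carrier A"
    by (rule closure_of_minimal[OF _ loop_closed]) (auto simp: W_def p_W)
  ultimately show "p u \<in> loop ` carrier A" using u unfolding TA_eq_closure by blast
qed

abbreviation "pb \<equiv> p_bar \<sigma> P Y \<tau>' p"

lemma pb_eqI: "a \<in> carrier A \<Longrightarrow> p u = loop a \<Longrightarrow> pb u = a"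
  unfolding p_bar_def by (rule the_equality) (auto simp: loop_identified_iff dest: loop_inject)

lemma pb: assumes "u \<in> TA" shows "pb u \<in> carrier A" "loop (pb u) = p u"
proof -
  obtain a where a: "a \<in> carrier A" "p u = loop a" using p_TA[OF assms] by blast
  then show "pb u \<in> carrier A" "loop (pb u) = p u" using pb_eqI[OF a] by simp_all
qed

lemma pb_unique: "u \<in> TA \<Longrightarrow> \<exists>!a. loop_identified \<sigma> P Y \<tau>' (p u) a"
  using pb[of u] loop_inject by (intro ex1I[of _ "pb u"]) (auto simp: loop_identified_iff)

lemma pb_W: "a \<in> carrier A \<Longrightarrow> l \<in> \<Lambda>\<^sub>0 \<Longrightarrow> pb (sec a \<oplus>\<^bsub>X\<^esub> l) = a"
  by (rule pb_eqI) (simp_all add: p_W)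

lemma pb_sec: "a \<in> carrier A \<Longrightarrow> pb (sec a) = a"
  by (rule pb_eqI) (simp_all add: p_sec)

abbreviation "E \<equiv> subobject X TA"

sublocale E: lc_algebra_loc E
proof -
  have "lc_algebra E" by (rule X.subobject_lc_algebra[OF TA_props(1,3,2)])
  then show "lc_algebra_loc E" by (intro lc_algebra_loc.intro lc_algebra_loc_axioms.intro lc_algebraD(1))
qed

lemma TA_carrier: "u \<in> TA \<Longrightarrow> u \<in> carrier X"
  by (rule X.in_carrierD[OF TA_props(1)])

lemma pb_lin: "lin_map E A pb"
proof (rule lin_mapI, unfold subobject_simps)
  fix x y c assume x: "x \<in> TA"
  show "pb x \<in> carrier A" by (rule pb[OF x])
  show "pb (c \<odot>\<^bsub>X\<^esub> x) = c \<odot>\<^bsub>A\<^esub> pb x"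
    using pb[OF x] TA_carrier[OF x] by (intro pb_eqI) (simp_all add: p.linD loop.linD)
  assume y: "y \<in> TA"
  show "pb (x \<oplus>\<^bsub>X\<^esub> y) = pb x \<oplus>\<^bsub>A\<^esub> pb y"
    using pb[OF x] TA_carrier[OF x] pb[OF y] TA_carrier[OF y] by (intro pb_eqI) (simp_all add: p.linD loop.linD)
qed

sublocale pb: lcs_lin E A pb by unfold_locales (rule pb_lin)

text \<open>\<open>pb\<close> is \<open>p\<close> followed by the inverse of \<open>loop\<close>,
  whose continuity is \<open>loop_seminorm\<close>.\<close>

lemma pb_continuous: "continuous_map (topo E) (topo A) pb"
proof (rule pb.continuousI)
  fix q assume "q \<in> cont_seminorms A"
  then have q: "seminorm_on A q" by (simp add: gwa_cont_seminorms)
  obtain r where r: "r \<in> cont_seminorms Y" "\<forall>a\<in>carrier A. q a \<le> r (loop a)" using loop_seminorm[OF q] by blast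
  have "(\<lambda>u. r (p u)) \<in> cont_seminorms E"
    by (rule X.subobject_cs[OF TA_props(1) p.cs_comp[OF p_continuous r(1)]])
  moreover have "q (pb u) \<le> r (p u)" if "u \<in> carrier E" for u
  proof -
    have u: "u \<in> TA" using that by simp
    have "q (pb u) \<le> r (loop (pb u))" using r(2) pb(1)[OF u] by blast
    then show ?thesis using pb(2)[OF u] by simp
  qed
  ultimately show "\<exists>r\<in>cont_seminorms E. \<forall>x\<in>carrier E. q (pb x) \<le> r x"
    by (intro bexI[of _ "\<lambda>u. r (p u)"] ballI)
qed

lemma sec_continuous: "continuous_map (topo A) (topo X) sec"
  by (rule linear_from_gwa_continuous[OF X.lcs_axioms sec_lin])

lemma sec_continuous_E: "continuous_map (topo A) (topo E) sec"
  using sec_continuous sec_in_TA by (auto simp: continuous_map_in_subtopology)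

lemma W_dense: "topo E closure_of W = TA"
  using W_subset_TA by (simp add: closure_of_subtopology Int_absorb1 TA_eq_closure[symmetric])

lemma A_continuous_mult:
  assumes "continuous_map S (topo A) f" "continuous_map S (topo A) g"
  shows "continuous_map S (topo A) (\<lambda>x. f x \<otimes>\<^bsub>A\<^esub> g x)"
  using continuous_map_compose[OF continuous_map_pairedI[OF assms] gwa_mult_continuous] by (simp add: o_def)

lemma E_mult_left: "u \<in> TA \<Longrightarrow> continuous_map (topo E) (topo E) (\<lambda>v. u \<otimes>\<^bsub>X\<^esub> v)"
  using E.mult_continuous_right[of u] by simp

lemma E_mult_right: "u \<in> TA \<Longrightarrow> continuous_map (topo E) (topo E) (\<lambda>v. v \<otimes>\<^bsub>X\<^esub> u)"
  using E.mult_continuous_left[of u] by simp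

lemma pb_comp_continuous:
  "continuous_map (topo E) (topo E) f \<Longrightarrow> continuous_map (topo E) (topo A) (\<lambda>v. pb (f v))"
  using continuous_map_compose[OF _ pb_continuous, of "topo E" f] by (simp add: o_def)

lemma pb_const_continuous: "u \<in> TA \<Longrightarrow> continuous_map (topo E) (topo A) (\<lambda>v. pb u)"
  using pb(1) by simp

text \<open>Both sides are continuous in \<open>v\<close> and agree on the dense subspace
  \<open>W\<close>.\<close>

lemma pb_mult_gen:
  assumes g: "g \<in> gens" and v: "v \<in> TA"
  shows "pb (g \<otimes>\<^bsub>X\<^esub> v) = pb g \<otimes>\<^bsub>A\<^esub> pb v"
proof -
  have gT: "g \<in> TA" using g TA_props(4) by blast
  have "v \<in> topo E closure_of W" unfolding W_dense by (rule v)
  then show ?thesis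
  proof (rule forall_in_closure_of_eq[OF _ gwa_Hausdorff])
    show "continuous_map (topo E) (topo A) (\<lambda>v. pb (g \<otimes>\<^bsub>X\<^esub> v))"
      by (rule pb_comp_continuous[OF E_mult_left[OF gT]])
    show "continuous_map (topo E) (topo A) (\<lambda>v. pb g \<otimes>\<^bsub>A\<^esub> pb v)"
      by (rule A_continuous_mult[OF pb_const_continuous[OF gT] pb_continuous])
    fix w assume "w \<in> W"
    then obtain a l where w: "w = sec a \<oplus>\<^bsub>X\<^esub> l" "a \<in> carrier A" "l \<in> \<Lambda>\<^sub>0" by (auto simp: W_def)
    obtain \<delta> e where g: "g = \<tau> (shift_pow \<delta>) (hom_elt e \<delta>)" "\<delta> \<in> {-1, 0, 1}" using g unfolding gens_def by blast
    obtain m where "m \<in> \<Lambda>\<^sub>0" "g \<otimes>\<^bsub>X\<^esub> w = sec (hom_elt e \<delta> \<otimes>\<^bsub>A\<^esub> a) \<oplus>\<^bsub>X\<^esub> m"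
      using generator_mult_W[OF g(2) w(2,3)] unfolding g(1) w(1) by blast
    then have "pb (g \<otimes>\<^bsub>X\<^esub> w) = hom_elt e \<delta> \<otimes>\<^bsub>A\<^esub> a" using w by (simp add: pb_W A_mult_closed)
    moreover have "pb g = hom_elt e \<delta>" unfolding g(1) sec_hom_elt[symmetric] by (rule pb_sec) simp
    moreover have "pb w = a" unfolding w(1) by (rule pb_W[OF w(2,3)])
    ultimately show "pb (g \<otimes>\<^bsub>X\<^esub> w) = pb g \<otimes>\<^bsub>A\<^esub> pb w" by simp
  qed
qed

lemma A_mult_lin_right: "b \<in> carrier A \<Longrightarrow> lin_map A A (\<lambda>a. a \<otimes>\<^bsub>A\<^esub> b)"
  using assoc_alg_gwa by (simp add: assoc_alg_def)

text \<open>The left factors that are multiplicative against all of \<open>TA\<close> form a closed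
  subalgebra containing the generators; quantifying over all \<open>v\<close> is what makes this set
  stable under products.\<close>

lemma pb_mult:
  assumes u: "u \<in> TA" and v: "v \<in> TA" shows "pb (u \<otimes>\<^bsub>X\<^esub> v) = pb u \<otimes>\<^bsub>A\<^esub> pb v"
proof -
  let ?B = "{u \<in> TA. \<forall>v\<in>TA. pb (u \<otimes>\<^bsub>X\<^esub> v) = pb u \<otimes>\<^bsub>A\<^esub> pb v}"
  note sub = X.submoduleD[OF TA_props(1)] and c = TA_carrier
  note RL = lin_mapD[OF A_mult_lin_right[OF pb(1)]]
  note pbl = lin_mapD[OF pb_lin, unfolded subobject_simps]
  have "TA \<subseteq> ?B" 
  proof (subst (1) TA_eq, rule X.closed_subalgebra_least)
    show "submodule ?B CC X"
    proof (rule X.submoduleI')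
      show "?B \<subseteq> carrier X" using c by blast
    next
      have "pb (\<zero>\<^bsub>X\<^esub> \<otimes>\<^bsub>X\<^esub> v) = pb \<zero>\<^bsub>X\<^esub> \<otimes>\<^bsub>A\<^esub> pb v" if v: "v \<in> TA" for v
      proof -
        have z: "\<zero>\<^bsub>X\<^esub> = 0 \<odot>\<^bsub>X\<^esub> \<zero>\<^bsub>X\<^esub>" by simp
        have "\<zero>\<^bsub>X\<^esub> \<otimes>\<^bsub>X\<^esub> v = 0 \<odot>\<^bsub>X\<^esub> (\<zero>\<^bsub>X\<^esub> \<otimes>\<^bsub>X\<^esub> v)" by (subst z) (rule X.mult_smul_left, use c[OF v] in simp_all)
        then have "\<zero>\<^bsub>X\<^esub> \<otimes>\<^bsub>X\<^esub> v = \<zero>\<^bsub>X\<^esub>" using X.mult_closed'[of "\<zero>\<^bsub>X\<^esub>" v] c[OF v] by simp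
        moreover have "pb \<zero>\<^bsub>X\<^esub> = \<zero>\<^bsub>A\<^esub>" using pb.map_zero by simp
        moreover have "\<zero>\<^bsub>A\<^esub> \<otimes>\<^bsub>A\<^esub> pb v = \<zero>\<^bsub>A\<^esub>"
          using RL(3)[OF v, of "\<zero>\<^bsub>A\<^esub>" 0] RL(1)[OF v, of "\<zero>\<^bsub>A\<^esub>"] by simp
        ultimately show ?thesis by simp
      qed
      then show "\<zero>\<^bsub>X\<^esub> \<in> ?B" using sub(2) by blast
    next
      fix a b assume ab: "a \<in> ?B" "b \<in> ?B"
      have "pb ((a \<oplus>\<^bsub>X\<^esub> b) \<otimes>\<^bsub>X\<^esub> v) = pb (a \<oplus>\<^bsub>X\<^esub> b) \<otimes>\<^bsub>A\<^esub> pb v" if v: "v \<in> TA" for v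
      proof -
        have "pb ((a \<oplus>\<^bsub>X\<^esub> b) \<otimes>\<^bsub>X\<^esub> v) = pb (a \<otimes>\<^bsub>X\<^esub> v \<oplus>\<^bsub>X\<^esub> b \<otimes>\<^bsub>X\<^esub> v)" using ab v c by (simp add: X.mult_add_left)
        also have "\<dots> = pb (a \<otimes>\<^bsub>X\<^esub> v) \<oplus>\<^bsub>A\<^esub> pb (b \<otimes>\<^bsub>X\<^esub> v)" using ab v TA_props(2) by (intro pbl(2)) auto
        also have "\<dots> = pb a \<otimes>\<^bsub>A\<^esub> pb v \<oplus>\<^bsub>A\<^esub> pb b \<otimes>\<^bsub>A\<^esub> pb v" using ab v by simp
        also have "\<dots> = (pb a \<oplus>\<^bsub>A\<^esub> pb b) \<otimes>\<^bsub>A\<^esub> pb v" using ab pb(1) by (simp add: RL(2)[OF v])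
        also have "pb a \<oplus>\<^bsub>A\<^esub> pb b = pb (a \<oplus>\<^bsub>X\<^esub> b)" using ab by (intro pbl(2)[symmetric]) auto
        finally show ?thesis .
      qed
      then show "a \<oplus>\<^bsub>X\<^esub> b \<in> ?B" using ab sub(3) by blast
    next
      fix k a assume a: "a \<in> ?B"
      have "pb ((k \<odot>\<^bsub>X\<^esub> a) \<otimes>\<^bsub>X\<^esub> v) = pb (k \<odot>\<^bsub>X\<^esub> a) \<otimes>\<^bsub>A\<^esub> pb v" if v: "v \<in> TA" for v
      proof -
        have "pb ((k \<odot>\<^bsub>X\<^esub> a) \<otimes>\<^bsub>X\<^esub> v) = pb (k \<odot>\<^bsub>X\<^esub> (a \<otimes>\<^bsub>X\<^esub> v))" using a v c by (simp add: X.mult_smul_left)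
        also have "\<dots> = k \<odot>\<^bsub>A\<^esub> pb (a \<otimes>\<^bsub>X\<^esub> v)" using a v TA_props(2) by (intro pbl(3)) auto
        also have "\<dots> = k \<odot>\<^bsub>A\<^esub> (pb a \<otimes>\<^bsub>A\<^esub> pb v)" using a v by simp
        also have "\<dots> = (k \<odot>\<^bsub>A\<^esub> pb a) \<otimes>\<^bsub>A\<^esub> pb v" using a pb(1) by (simp add: RL(3)[OF v])
        also have "k \<odot>\<^bsub>A\<^esub> pb a = pb (k \<odot>\<^bsub>X\<^esub> a)" using a by (intro pbl(3)[symmetric]) auto
        finally show ?thesis .
      qed
      then show "k \<odot>\<^bsub>X\<^esub> a \<in> ?B" using a sub(4) by blast
    qed
    show "x \<otimes>\<^bsub>X\<^esub> y \<in> ?B" if x: "x \<in> ?B" and y: "y \<in> ?B" for x y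
    proof -
      have "pb ((x \<otimes>\<^bsub>X\<^esub> y) \<otimes>\<^bsub>X\<^esub> v) = pb (x \<otimes>\<^bsub>X\<^esub> y) \<otimes>\<^bsub>A\<^esub> pb v" if v: "v \<in> TA" for v
      proof -
        have "pb ((x \<otimes>\<^bsub>X\<^esub> y) \<otimes>\<^bsub>X\<^esub> v) = pb (x \<otimes>\<^bsub>X\<^esub> (y \<otimes>\<^bsub>X\<^esub> v))" using x y v c by (simp add: X.mult_assoc')
        also have "\<dots> = pb x \<otimes>\<^bsub>A\<^esub> (pb y \<otimes>\<^bsub>A\<^esub> pb v)" using x y v TA_props(2) by simp
        also have "\<dots> = (pb x \<otimes>\<^bsub>A\<^esub> pb y) \<otimes>\<^bsub>A\<^esub> pb v"
          using x y v pb(1) assoc_alg_gwa by (simp add: assoc_alg_def)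
        finally show ?thesis using x y by simp
      qed
      then show ?thesis using x y TA_props(2) by blast
    qed
    have "topo X closure_of ?B \<subseteq> ?B"
    proof
      fix u assume u: "u \<in> topo X closure_of ?B"
      have "topo X closure_of ?B \<subseteq> TA" by (rule closure_of_minimal[OF _ TA_props(3)]) blast
      then have uT: "u \<in> TA" using u by blast
      have uE: "u \<in> topo E closure_of ?B"
      proof -
        have "TA \<inter> ?B = ?B" by blast
        then show ?thesis using u uT by (simp add: closure_of_subtopology)
      qed
      have "pb (u \<otimes>\<^bsub>X\<^esub> v) = pb u \<otimes>\<^bsub>A\<^esub> pb v" if v: "v \<in> TA" for v
      proof (rule forall_in_closure_of_eq[OF uE gwa_Hausdorff])
        show "continuous_map (topo E) (topo A) (\<lambda>u. pb (u \<otimes>\<^bsub>X\<^esub> v))"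
          by (rule pb_comp_continuous[OF E_mult_right[OF v]])
        show "continuous_map (topo E) (topo A) (\<lambda>u. pb u \<otimes>\<^bsub>A\<^esub> pb v)"
          by (rule A_continuous_mult[OF pb_continuous pb_const_continuous[OF v]])
      qed (use v in blast)
      then show "u \<in> ?B" using uT by blast
    qed
    moreover have "?B \<subseteq> topspace (topo X)" using c by auto
    ultimately show "closedin (topo X) ?B" by (simp only: closure_of_subset_eq[symmetric])
    show "gens \<subseteq> ?B" using pb_mult_gen TA_props(4) by blast
  qed
  then show ?thesis using u v by blast
qed

section \<open>The kernel and the extension\<close>

lemma Lambda_eq: "\<Lambda> = topo X closure_of \<Lambda>\<^sub>0"
  by (simp add: Lambda_gwa_def)

lemma Lambda_submodule: "submodule \<Lambda> CC X"
  unfolding Lambda_eq by (rule X.closure_submodule[OF Lambda_0_submodule])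

lemma Lambda_closed: "closedin (topo X) \<Lambda>"
  unfolding Lambda_eq by simp

lemma Lambda_subset_TA: "\<Lambda> \<subseteq> TA"
  unfolding Lambda_eq by (rule closure_of_minimal[OF _ TA_props(3)]) (use Lambda_0_in_W W_subset_TA in blast)

text \<open>The map taking \<open>u\<close> to u - sec (pb u) is continuous, sends \<open>W\<close>
  into the algebraic sum and is the identity on the kernel; density of \<open>W\<close> then puts
  the kernel into the closure of that sum.\<close>

lemma pb_zero_iff:
  assumes u: "u \<in> TA" shows "pb u = \<zero>\<^bsub>A\<^esub> \<longleftrightarrow> u \<in> \<Lambda>"
proof
  assume "u \<in> \<Lambda>"
  then have u': "u \<in> topo X closure_of \<Lambda>\<^sub>0" by (simp add: Lambda_eq)
  have "p u = \<zero>\<^bsub>Y\<^esub>"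
    by (rule forall_in_closure_of_eq[OF u' Y_Hausdorff p_continuous]) (simp_all add: p_Lambda_0)
  then show "pb u = \<zero>\<^bsub>A\<^esub>" by (intro pb_eqI) (simp_all add: loop.map_zero)
next
  assume z: "pb u = \<zero>\<^bsub>A\<^esub>"
  let ?F = "\<lambda>u. u \<ominus>\<^bsub>X\<^esub> sec (pb u)"
  have Flin: "lin_map E X ?F"
    by (rule lin_mapI)
       (simp_all add: pb.linD[unfolded subobject_simps] pb TA_carrier sec.linD X.add_diff_add X.smul_diff)
  interpret F: lcs_lin E X ?F by unfold_locales (rule Flin)
  have "continuous_map (topo E) (topo X) ?F"
  proof (rule F.continuousI)
    fix q assume q: "q \<in> cont_seminorms X"
    note sq = X.cs_seminorm[OF q]
    have "continuous_map (topo E) (topo X) (\<lambda>u. sec (pb u))"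
      using continuous_map_compose[OF pb_continuous sec_continuous] by (simp add: o_def)
    then have "continuous_map (topo E) euclideanreal (\<lambda>u. q (sec (pb u)))"
      using continuous_map_compose[of "topo E" "topo X" "\<lambda>u. sec (pb u)" euclideanreal q] q
      by (simp add: o_def cont_seminorms_def)
    moreover have "seminorm_on E (\<lambda>u. q (sec (pb u)))"
      using pb.seminorm_comp[OF sec.seminorm_comp[OF sq]] .
    ultimately have 1: "(\<lambda>u. q (sec (pb u))) \<in> cont_seminorms E" by (simp add: cont_seminorms_def)
    have 2: "q \<in> cont_seminorms E" by (rule X.subobject_cs[OF TA_props(1) q])
    have "q (?F x) \<le> q x + q (sec (pb x))" if "x \<in> carrier E" for x
    proof -
      have x: "x \<in> carrier X" "sec (pb x) \<in> carrier X" using that TA_carrier pb(1) sec.linD(1) by auto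
      have "q (?F x) \<le> q x + q ((-1) \<odot>\<^bsub>X\<^esub> sec (pb x))"
        using x seminorm_onD(2)[OF sq, of x "(-1) \<odot>\<^bsub>X\<^esub> sec (pb x)"] by (simp add: X.minus_eq')
      then show ?thesis using x by (simp add: seminorm_onD(3)[OF sq])
    qed
    then show "\<exists>r\<in>cont_seminorms E. \<forall>x\<in>carrier E. q (?F x) \<le> r x"
      using E.cs_add[OF 2 1] by (intro bexI[of _ "\<lambda>x. q x + q (sec (pb x))"] ballI)
  qed
  then have "?F ` (topo E closure_of W) \<subseteq> topo X closure_of (?F ` W)"
    by (rule continuous_map_image_closure_subset)
  moreover have "?F ` W \<subseteq> \<Lambda>\<^sub>0"
  proof clarify
    fix w assume "w \<in> W"
    then obtain a l where w: "w = sec a \<oplus>\<^bsub>X\<^esub> l" "a \<in> carrier A" "l \<in> \<Lambda>\<^sub>0" by (auto simp: W_def)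
    have "?F w = l"
      unfolding w(1) pb_W[OF w(2,3)]
      by (rule X.minus_add_self(2)) (use w sec.linD(1) X.in_carrierD[OF Lambda_0_submodule] in auto)
    then show "?F w \<in> \<Lambda>\<^sub>0" using w by simp
  qed
  then have "topo X closure_of (?F ` W) \<subseteq> \<Lambda>" unfolding Lambda_eq by (rule closure_of_mono)
  moreover have "?F u = u" using z TA_carrier[OF u] by (simp add: sec.map_zero X.minus_zero)
  ultimately show "u \<in> \<Lambda>" using u unfolding W_dense by force
qed

lemma A_zero_mult: "a \<in> carrier A \<Longrightarrow> \<zero>\<^bsub>A\<^esub> \<otimes>\<^bsub>A\<^esub> a = \<zero>\<^bsub>A\<^esub>" "a \<in> carrier A \<Longrightarrow> a \<otimes>\<^bsub>A\<^esub> \<zero>\<^bsub>A\<^esub> = \<zero>\<^bsub>A\<^esub>"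
proof -
  assume a: "a \<in> carrier A"
  interpret R: cvec_lin A A "\<lambda>b. b \<otimes>\<^bsub>A\<^esub> a" by unfold_locales (rule A_mult_lin_right[OF a])
  interpret L: cvec_lin A A "\<lambda>b. a \<otimes>\<^bsub>A\<^esub> b" by unfold_locales (rule A_mult_lin[OF a])
  show "\<zero>\<^bsub>A\<^esub> \<otimes>\<^bsub>A\<^esub> a = \<zero>\<^bsub>A\<^esub>" "a \<otimes>\<^bsub>A\<^esub> \<zero>\<^bsub>A\<^esub> = \<zero>\<^bsub>A\<^esub>" by (rule R.map_zero, rule L.map_zero)
qed

text \<open>The kernel of the multiplicative map \<open>pb\<close> absorbs products, so right
  multiplication of matrix units never has to be computed.\<close>

lemma Lambda_mult:
  assumes "x \<in> \<Lambda>" "y \<in> TA" shows "x \<otimes>\<^bsub>X\<^esub> y \<in> \<Lambda>" "y \<otimes>\<^bsub>X\<^esub> x \<in> \<Lambda>"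
proof -
  have x: "x \<in> TA" "pb x = \<zero>\<^bsub>A\<^esub>" using assms(1) Lambda_subset_TA pb_zero_iff by auto
  show "x \<otimes>\<^bsub>X\<^esub> y \<in> \<Lambda>" "y \<otimes>\<^bsub>X\<^esub> x \<in> \<Lambda>"
    using pb_zero_iff[OF TA_props(2)[OF x(1) assms(2)]] pb_zero_iff[OF TA_props(2)[OF assms(2) x(1)]]
    using x assms(2) pb(1) by (simp_all add: pb_mult A_zero_mult)
qed

lemma Lambda_ideal: "two_sided_ideal \<Lambda> E"
proof -
  have "submodule \<Lambda> CC E"
    by (rule E.submoduleI') (use X.submoduleD[OF Lambda_submodule] Lambda_subset_TA in auto)
  then show ?thesis using Lambda_mult by (simp add: two_sided_ideal_def)
qed

lemma Lambda_lc_algebra: "lc_algebra (subobject X \<Lambda>)"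
  by (rule X.subobject_lc_algebra[OF Lambda_submodule Lambda_closed])
     (use Lambda_mult Lambda_subset_TA in blast)

text \<open>The continuous section makes \<open>pb\<close> a retraction, which yields surjectivity
  and the quotient topology.\<close>

lemma extension: "linearly_split_extension (subobject X \<Lambda>) E A (\<lambda>u. u) pb"
proof -
  have "alg_hom (subobject X \<Lambda>) E (\<lambda>u. u)"
    using Lambda_subset_TA by (auto simp: alg_hom_def lin_map_def)
  moreover have "embedding_map (topo (subobject X \<Lambda>)) (topo E) (\<lambda>u. u)"
  proof -
    have "topspace (subtopology (topo X) \<Lambda>) = \<Lambda>" using X.submoduleD(1)[OF Lambda_submodule] by auto
    moreover have "subtopology (subtopology (topo X) TA) \<Lambda> = subtopology (topo X) \<Lambda>"
      using Lambda_subset_TA by (simp add: subtopology_subtopology Int_absorb1)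
    ultimately show ?thesis by (simp add: embedding_map_def homeomorphic_map_id[unfolded id_def])
  qed
  moreover have "alg_hom E A pb"
    using pb_lin pb_mult by (simp add: alg_hom_def)
  moreover have "quotient_map (topo E) (topo A) pb"
  proof (rule retraction_imp_quotient_map)
    show "retraction_map (topo E) (topo A) pb"
      unfolding retraction_map_def retraction_maps_def
      using pb_continuous sec_continuous_E pb_sec by auto
  qed
  moreover have "(\<lambda>u. u) ` carrier (subobject X \<Lambda>) = {x \<in> carrier E. pb x = \<zero>\<^bsub>A\<^esub>}"
    using pb_zero_iff Lambda_subset_TA by auto
  moreover have "lin_map A E sec" using sec.linD sec_in_TA by (auto simp: lin_map_def)
  ultimately show ?thesis
    using Lambda_lc_algebra E.alg gwa_lc_algebra sec_continuous_E pb_sec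
    unfolding linearly_split_extension_def lc_extension_def by blast
qed

section \<open>Independence of the summands\<close>

lemma compact_part_matrix_unit:
  "toeplitz_compact_part (matrix_unit i j) k l = (if k = i \<and> l = j then 1 else 0)"
  by (simp add: K_subset_toeplitz(3)) (simp add: matrix_unit_def)

text \<open>Slicing with the entry \<open>k\<close> of the compact part isolates the coefficient at
  position \<open>k\<close>.\<close>

lemma independent: "independent_subspaces X (Lambda_summand \<sigma> P \<tau>)"
  unfolding independent_subspaces_def
proof (intro allI impI ballI)
  fix F :: "(nat \<times> nat) set" and u k
  assume F: "finite F" and u: "\<forall>k\<in>F. u k \<in> Lambda_summand \<sigma> P \<tau> k" and z: "finsum X u F = \<zero>\<^bsub>X\<^esub>" and k: "k \<in> F"
  have "\<forall>k. \<exists>a\<in>carrier A. k \<in> F \<longrightarrow> u k = \<tau> (matrix_unit (fst k) (snd k)) a"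
  proof
    fix k
    show "\<exists>a\<in>carrier A. k \<in> F \<longrightarrow> u k = \<tau> (matrix_unit (fst k) (snd k)) a"
    proof (cases "k \<in> F")
      case True
      then obtain d where "u k = unit_elt (fst k) (snd k) d" using u by (auto simp: Lambda_summand_eq)
      then show ?thesis by (intro bexI[of _ "lam_elt (fst k) (snd k) d"]) (simp_all add: unit_elt_def)
    qed (use A.zero_closed in blast)
  qed
  then obtain a where a: "\<And>k. a k \<in> carrier A" "\<And>k. k \<in> F \<Longrightarrow> u k = \<tau> (matrix_unit (fst k) (snd k)) (a k)" by metis
  \<comment> \<open>The indicator function of \<open>F\<close> turns the finite sum into a
    \<open>lincomb\<close>, to which the slice lemma applies.\<close>
  define c :: "nat \<times> nat \<Rightarrow>\<^sub>0 complex" where "c = Abs_poly_mapping (\<lambda>k. if k \<in> F then 1 else 0)"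
  have lc: "Poly_Mapping.lookup c = (\<lambda>k. if k \<in> F then 1 else 0)"
    unfolding c_def by (rule lookup_Abs_poly_mapping) (use F in simp)
  have kc: "Poly_Mapping.keys c \<subseteq> F" by (auto simp: in_keys_iff lc split: if_splits)
  have "lincomb X (\<lambda>k. \<tau> (matrix_unit (fst k) (snd k)) (a k)) c = finsum X u F"
  proof -
    have "lincomb X (\<lambda>k. \<tau> (matrix_unit (fst k) (snd k)) (a k)) c
        = finsum X (\<lambda>k. Poly_Mapping.lookup c k \<odot>\<^bsub>X\<^esub> \<tau> (matrix_unit (fst k) (snd k)) (a k)) F"
      by (rule X.lincomb_superset[OF F kc]) (simp add: a)
    also have "\<dots> = finsum X u F" by (rule X.finsum_cong') (auto simp: lc a)
    finally show ?thesis .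
  qed
  then have "lincomb A (\<lambda>l. toeplitz_compact_part (matrix_unit (fst l) (snd l)) (fst k) (snd k) \<odot>\<^bsub>A\<^esub> a l) c = \<zero>\<^bsub>A\<^esub>"
    using z by (intro TX.lincomb_functional_zero[where \<phi>="\<lambda>m. toeplitz_compact_part m (fst k) (snd k)"])
      (simp_all add: a toeplitz_linear)
  moreover have "lincomb A (\<lambda>l. toeplitz_compact_part (matrix_unit (fst l) (snd l)) (fst k) (snd k) \<odot>\<^bsub>A\<^esub> a l) c = a k"
  proof -
    have "lincomb A (\<lambda>l. toeplitz_compact_part (matrix_unit (fst l) (snd l)) (fst k) (snd k) \<odot>\<^bsub>A\<^esub> a l) c
      = lincomb A (\<lambda>l. if l = k then a k else \<zero>\<^bsub>A\<^esub>) c"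
      by (rule A.lincomb_cong) (auto simp: compact_part_matrix_unit a prod_eq_iff)
    also have "\<dots> = finsum A (\<lambda>l. Poly_Mapping.lookup c l \<odot>\<^bsub>A\<^esub> (if l = k then a k else \<zero>\<^bsub>A\<^esub>)) F"
      by (rule A.lincomb_superset[OF F kc]) (simp add: a)
    also have "\<dots> = finsum A (\<lambda>l. if k = l then a l else \<zero>\<^bsub>A\<^esub>) F"
      by (rule A.finsum_cong') (auto simp: lc a)
    also have "\<dots> = a k" by (rule A.finsum_singleton[OF k F]) (simp add: a)
    finally show ?thesis .
  qed
  ultimately have "a k = \<zero>\<^bsub>A\<^esub>" by simp
  then show "u k = \<zero>\<^bsub>X\<^esub>" using a(2)[OF k] TX.zero_right[of "matrix_unit (fst k) (snd k)"] by simp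
qed

section \<open>Closedness of the algebraic sum\<close>

definition unit_basis :: "(nat \<times> nat) \<times> nat \<Rightarrow> 'x" where
  "unit_basis z = unit_elt (fst (fst z)) (snd (fst z)) (monom 1 (snd z))"

lemma unit_basis_carrier [simp]: "unit_basis z \<in> carrier X"
  by (simp add: unit_basis_def)

lemma Lambda_0_range: "\<Lambda>\<^sub>0 = range (lincomb X unit_basis)"
proof
  have sub: "submodule (range (lincomb X unit_basis)) CC X" by (rule X.range_lincomb_submodule) simp
  have one: "unit_basis z \<in> range (lincomb X unit_basis)" for z
    using X.lincomb_single[of unit_basis z 1] by (metis X.smul_one rangeI unit_basis_carrier)
  have "unit_elt i j (\<Sum>k\<in>S. monom (coeff d k) k) \<in> range (lincomb X unit_basis)" if "finite S" for i j d S
    using that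
  proof induct
    case empty
    then show ?case using X.submoduleD(2)[OF sub] TX.zero_right[of "matrix_unit i j"]
      by (simp add: unit_elt_def lam_elt_zero)
  next
    case (insert k S)
    have "unit_elt i j (monom (coeff d k) k) = coeff d k \<odot>\<^bsub>X\<^esub> unit_basis ((i, j), k)"
      using TX.smul_right[of "matrix_unit i j" "lam_elt i j (monom 1 k)" "coeff d k"]
      by (simp add: unit_basis_def unit_elt_def lam_elt_smult[symmetric] smult_monom)
    moreover have "unit_elt i j (monom (coeff d k) k + (\<Sum>k\<in>S. monom (coeff d k) k)) =
      unit_elt i j (monom (coeff d k) k) \<oplus>\<^bsub>X\<^esub> unit_elt i j (\<Sum>k\<in>S. monom (coeff d k) k)"
      by (simp add: unit_elt_def lam_elt_add TX.add_right)
    ultimately show ?case using insert X.submoduleD(3,4)[OF sub] one by simp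
  qed
  then have "unit_elt i j d \<in> range (lincomb X unit_basis)" for i j d
    using poly_as_sum_of_monoms[of d] by (metis finite_atMost)
  then show "\<Lambda>\<^sub>0 \<subseteq> range (lincomb X unit_basis)"
    unfolding Lambda_0_eq by (intro X.cspan_least[OF sub]) auto
  have "unit_basis z \<in> \<Lambda>\<^sub>0" for z by (simp add: unit_basis_def unit_elt_in)
  then show "range (lincomb X unit_basis) \<subseteq> \<Lambda>\<^sub>0"
    by (auto intro: X.lincomb_in_submodule[OF Lambda_0_submodule])
qed

text \<open>The polynomial that stands in front of \<open>lam\<close> in the slice of the
  combination at position \<open>k\<close>.\<close>

definition entry_poly :: "((nat \<times> nat) \<times> nat \<Rightarrow>\<^sub>0 complex) \<Rightarrow> nat \<times> nat \<Rightarrow> complex poly" where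
  "entry_poly c k = (\<Sum>z\<in>Poly_Mapping.keys c. if fst z = k then monom (Poly_Mapping.lookup c z) (snd z) else 0)"

lemma coeff_entry_poly: "coeff (entry_poly c k) n = Poly_Mapping.lookup c (k, n)"
proof -
  have "coeff (entry_poly c k) n = (\<Sum>z\<in>Poly_Mapping.keys c. if z = (k, n) then Poly_Mapping.lookup c z else 0)"
    unfolding entry_poly_def coeff_sum by (rule sum.cong) (auto simp: prod_eq_iff)
  then show ?thesis by (simp add: in_keys_iff)
qed

lemma entry_lincomb:
  "lincomb A (\<lambda>z. toeplitz_compact_part (matrix_unit (fst (fst z)) (snd (fst z))) (fst k) (snd k)
      \<odot>\<^bsub>A\<^esub> lam_elt (fst (fst z)) (snd (fst z)) (monom 1 (snd z))) c = lam_elt (fst k) (snd k) (entry_poly c k)"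
proof -
  have l: "lam_elt (fst k) (snd k) (\<Sum>z\<in>S. f z) = finsum A (\<lambda>z. lam_elt (fst k) (snd k) (f z)) S" if "finite S" for S and f :: "'b \<Rightarrow> complex poly"
    using that by induct (simp_all add: lam_elt_zero lam_elt_add)
  have "lincomb A (\<lambda>z. toeplitz_compact_part (matrix_unit (fst (fst z)) (snd (fst z))) (fst k) (snd k)
      \<odot>\<^bsub>A\<^esub> lam_elt (fst (fst z)) (snd (fst z)) (monom 1 (snd z))) c =
    finsum A (\<lambda>z. lam_elt (fst k) (snd k) (if fst z = k then monom (Poly_Mapping.lookup c z) (snd z) else 0)) (Poly_Mapping.keys c)"
    unfolding lincomb_def
  proof (rule A.finsum_cong', goal_cases)
    case (3 z)
    show ?case
    proof (cases "fst z = k")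
      case True
      then show ?thesis
        by (simp add: compact_part_matrix_unit lam_elt_smult[symmetric] smult_monom)
    next
      case False
      then have "toeplitz_compact_part (matrix_unit (fst (fst z)) (snd (fst z))) (fst k) (snd k) = 0"
        by (auto simp: compact_part_matrix_unit prod_eq_iff)
      then show ?thesis using False by (simp add: lam_elt_zero)
    qed
  qed auto
  then show ?thesis by (simp add: l entry_poly_def)
qed

text \<open>Division by \<open>lam i j\<close> asks for weights on the coefficients of C * lam i j
  in degree i - j of \<open>A\<close>, at exponents from the degree of \<open>lam i j\<close> on,
  which exceeds min i j. So a given basis vector of \<open>A\<close> receives requests from finitely
  many positions, and a single \<open>W\<close> can meet them all.\<close>

lemma entry_weights:
  fixes w :: "(nat \<times> nat) \<times> nat \<Rightarrow> real"
  assumes P: "degree P > 0" and w: "\<And>z. 0 \<le> w z"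
  shows "\<exists>W. (\<forall>i. 0 \<le> W i) \<and> (\<forall>k C n. degree C \<le> n \<longrightarrow>
    (\<Sum>m\<le>n. w (k, m) * cmod (coeff C m)) \<le> wnorm W (coords (lam_elt (fst k) (snd k) C)))"
proof -
  have P0: "P \<noteq> 0" using P by auto
  let ?l = "\<lambda>k. lam (fst k) (snd k)" and ?N = "\<lambda>k. degree (lam (fst k) (snd k))"
  have N: "Suc (min (fst k) (snd k)) \<le> ?N k" for k
  proof -
    have "Suc (min (fst k) (snd k)) * 1 \<le> Suc (min (fst k) (snd k)) * degree P" using P by (intro mult_le_mono) auto
    then show ?thesis using degree_lam[OF P0, of "fst k" "snd k"] by simp
  qed
  have "\<forall>k. \<exists>v. (\<forall>m. 0 \<le> v m) \<and> (\<forall>C n. degree C \<le> n \<longrightarrow>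
      (\<Sum>m\<le>n. w (k, m) * cmod (coeff C m)) \<le> (\<Sum>m\<le>n. v m * cmod (coeff (C * ?l k) (?N k + m))))"
    using quotient_coeff_weights[OF conjunct1[OF degree_lam[OF P0]] w] by blast
  from choice[OF this] obtain v where v': "\<forall>k. (\<forall>m. 0 \<le> v k m) \<and> (\<forall>C n. degree C \<le> n \<longrightarrow>
      (\<Sum>m\<le>n. w (k, m) * cmod (coeff C m)) \<le> (\<Sum>m\<le>n. v k m * cmod (coeff (C * ?l k) (?N k + m))))" ..
  have v0: "0 \<le> v k m" for k m using v' by blast
  have v: "(\<Sum>m\<le>n. w (k, m) * cmod (coeff C m)) \<le> (\<Sum>m\<le>n. v k m * cmod (coeff (C * ?l k) (?N k + m)))"
    if "degree C \<le> n" for k C n using v' that by blast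
  \<comment> \<open>A request at degree n and exponent e comes from a position with |i - j| = |n|
    and min i j < e, so both indices are at most e + |n|.\<close>
  define J where "J i = {..snd i + nat \<bar>fst i\<bar>} \<times> {..snd i + nat \<bar>fst i\<bar>}" for i :: "int \<times> nat"
  define W where "W i = (\<Sum>k\<in>J i. if int (fst k) - int (snd k) = fst i \<and> ?N k \<le> snd i then v k (snd i - ?N k) else 0)" for i
  have W0: "0 \<le> W i" for i unfolding W_def by (rule sum_nonneg) (simp add: v0)
  have Wv: "v k m \<le> W (int (fst k) - int (snd k), ?N k + m)" for k m
  proof -
    let ?i = "(int (fst k) - int (snd k), ?N k + m)"
    have "k \<in> J ?i" using N[of k] by (cases k) (auto simp: J_def)
    moreover have "finite (J ?i)" by (simp add: J_def)
    ultimately have "(if int (fst k) - int (snd k) = fst ?i \<and> ?N k \<le> snd ?i then v k (snd ?i - ?N k) else 0) \<le> W ?i"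
      unfolding W_def by (intro member_le_sum) (auto simp: v0)
    then show ?thesis by simp
  qed
  have "(\<Sum>m\<le>n. w (k, m) * cmod (coeff C m)) \<le> wnorm W (coords (lam_elt (fst k) (snd k) C))"
    if C: "degree C \<le> n" for k C n
  proof -
    let ?i = "\<lambda>m. (int (fst k) - int (snd k), ?N k + m)" and ?c = "coords (lam_elt (fst k) (snd k) C)"
    have l: "Poly_Mapping.lookup ?c (?i m) = coeff (C * ?l k) (?N k + m)" for m
      by (simp add: lam_elt_def lookup_coords_hom_elt)
    have "(\<Sum>m\<le>n. w (k, m) * cmod (coeff C m)) \<le> (\<Sum>m\<le>n. v k m * cmod (coeff (C * ?l k) (?N k + m)))"
      by (rule v[OF C])
    also have "\<dots> \<le> (\<Sum>m\<le>n. W (?i m) * cmod (Poly_Mapping.lookup ?c (?i m)))"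
      unfolding l by (intro sum_mono mult_right_mono Wv) simp
    also have "\<dots> = (\<Sum>i\<in>?i ` {..n}. W i * cmod (Poly_Mapping.lookup ?c i))"
      by (subst sum.reindex) (auto simp: inj_on_def)
    also have "\<dots> \<le> wnorm W ?c" by (rule wnorm_ge_sum) (simp_all add: W0)
    finally show ?thesis .
  qed
  then show ?thesis using W0 by blast
qed

text \<open>The entries of the compact part, whose absolute values sum up to at most
  \<open>K_seminorm 0\<close>, slice out all entry polynomials at once; \<open>entry_weights\<close>
  converts the norms of these slices into arbitrary weights on the coefficients.\<close>

lemma Lambda_0_closed:
  assumes P: "degree P > 0" shows "closedin (topo X) \<Lambda>\<^sub>0"
  unfolding Lambda_0_range
proof (rule X.closed_range_lincomb[OF X.lcalg(2)])
  fix w :: "(nat \<times> nat) \<times> nat \<Rightarrow> real" assume w: "\<And>z. 0 \<le> w z"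
  obtain V where V: "\<And>i. 0 \<le> V i" "\<And>k C n. degree C \<le> n \<Longrightarrow>
    (\<Sum>m\<le>n. w (k, m) * cmod (coeff C m)) \<le> wnorm V (coords (lam_elt (fst k) (snd k) C))"
    using entry_weights[OF P, of w, OF w] by blast
  have sq: "seminorm_on A (\<lambda>a. wnorm V (coords a))" by (rule wnorm_coords_seminorm[OF V(1)])
  show "\<exists>r\<in>cont_seminorms X. \<forall>c. wnorm w c \<le> r (lincomb X unit_basis c)"
  proof (rule TX.projective_dominated[OF compact_seminorm_cont[of 0]])
    show "(\<lambda>a. wnorm V (coords a)) \<in> cont_seminorms A" using sq by (simp add: gwa_cont_seminorms)
    show "unit_basis z \<in> TX.D" for z unfolding unit_basis_def unit_elt_def by (rule TX.tau_in_D) simp_all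
    show "wnorm w (pm_scale k c) = cmod k * wnorm w c" for k c by (rule wnorm_scale)
    fix c :: "(nat \<times> nat) \<times> nat \<Rightarrow>\<^sub>0 complex"
    define S where "S = fst ` Poly_Mapping.keys c"
    \<comment> \<open>The inserted 0 keeps the maximum defined for c = 0.\<close>
    define n where "n = Max (insert 0 (snd ` Poly_Mapping.keys c))"
    have S: "finite S" by (simp add: S_def)
    have keys: "Poly_Mapping.keys c \<subseteq> S \<times> {..n}"
    proof
      fix z assume z: "z \<in> Poly_Mapping.keys c"
      then have "snd z \<le> n" unfolding n_def by (intro Max_ge) auto
      then show "z \<in> S \<times> {..n}" using z by (cases z) (force simp: S_def)
    qed
    have deg: "degree (entry_poly c k) \<le> n" for k
    proof (rule degree_le, intro allI impI)
      fix m assume m: "n < m"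
      have "(k, m) \<notin> Poly_Mapping.keys c" using keys m by auto
      then show "coeff (entry_poly c k) m = 0" by (simp add: coeff_entry_poly in_keys_iff)
    qed
    have "wnorm w c = (\<Sum>z\<in>S \<times> {..n}. w z * cmod (Poly_Mapping.lookup c z))"
      by (rule wnorm_superset[OF _ keys]) (simp add: S)
    also have "\<dots> = (\<Sum>k\<in>S. \<Sum>m\<le>n. w (k, m) * cmod (coeff (entry_poly c k) m))"
      by (simp add: sum.cartesian_product' coeff_entry_poly)
    also have "\<dots> \<le> (\<Sum>k\<in>S. wnorm V (coords (lam_elt (fst k) (snd k) (entry_poly c k))))"
      by (intro sum_mono V(2) deg)
    also have "\<dots> = (\<Sum>k\<in>S. wnorm V (coords (lincomb A
        (\<lambda>z. toeplitz_compact_part (matrix_unit (fst (fst z)) (snd (fst z))) (fst k) (snd k)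
          \<odot>\<^bsub>A\<^esub> lam_elt (fst (fst z)) (snd (fst z)) (monom 1 (snd z))) c)))"
      unfolding entry_lincomb ..
    also have "\<dots> \<le> projective_seminorm smooth_toeplitz A X \<tau> (\<lambda>m. K_seminorm 0 (toeplitz_compact_part m))
        (\<lambda>a. wnorm V (coords a)) (lincomb X (\<lambda>z. \<tau> (matrix_unit (fst (fst z)) (snd (fst z)))
          (lam_elt (fst (fst z)) (snd (fst z)) (monom 1 (snd z)))) c)"
    proof (rule TX.lincomb_projective_ge[where \<phi>="\<lambda>k m. toeplitz_compact_part m (fst k) (snd k)", OF _ _ S _ _ _ sq])
      show "(\<Sum>k\<in>S. cmod (toeplitz_compact_part m (fst k) (snd k))) \<le> K_seminorm 0 (toeplitz_compact_part m)"
        if "m \<in> carrier smooth_toeplitz" for m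
        using that by (intro K_seminorm_ge_sum[OF toeplitz_decomp(2) S]) simp
    qed (simp_all add: toeplitz_linear)
    finally show "wnorm w c \<le> projective_seminorm smooth_toeplitz A X \<tau> (\<lambda>m. K_seminorm 0 (toeplitz_compact_part m))
        (\<lambda>a. wnorm V (coords a)) (lincomb X unit_basis c)"
      by (simp add: unit_basis_def[abs_def] unit_elt_def)
  qed
qed simp

text \<open>For P = 0 every \<open>lam i j\<close> vanishes, so the sum is zero and closed by the
  Hausdorff property; otherwise P is not constant.\<close>

lemma Lambda_eq_algebraic:
  assumes "degree P > 0 \<or> P = 0" shows "\<Lambda> = \<Lambda>\<^sub>0"
proof -
  have "closedin (topo X) \<Lambda>\<^sub>0"
  proof (cases "P = 0")
    case True
    have "unit_elt i j d = \<zero>\<^bsub>X\<^esub>" for i j d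
      using TX.zero_right[of "matrix_unit i j"] by (simp add: unit_elt_def lam_elt_def lam_0[OF True] hom_elt_zero)
    then have "\<Lambda>\<^sub>0 \<subseteq> {\<zero>\<^bsub>X\<^esub>}"
      unfolding Lambda_0_eq by (intro X.cspan_least X.submoduleI') auto
    then have "\<Lambda>\<^sub>0 = {\<zero>\<^bsub>X\<^esub>}" using X.submoduleD(2)[OF Lambda_0_submodule] by blast
    then show ?thesis using closedin_Hausdorff_singleton[OF X.lcalg(2)] by simp
  next
    case False
    then show ?thesis using assms Lambda_0_closed by blast
  qed
  then show ?thesis unfolding Lambda_eq by (simp add: closure_of_closedin)
qed

end

text \<open>The exact sequence is accompanied by the facts that give its notation a meaning:
  independence makes the sum direct, the third part tells for which P it is purely algebraic, and
  unique existence of \<open>a\<close> justifies the description in \<open>p_bar\<close>.\<close>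

theorem proposition4p5:
  fixes \<sigma> :: "complex poly \<Rightarrow> complex poly" and P :: "complex poly"
    and X :: "'x lc_alg" and \<tau> :: "matrix \<Rightarrow> gwa_elt \<Rightarrow> 'x"
    and Y :: "'y lc_alg" and \<tau>' :: "(real \<Rightarrow> complex) \<Rightarrow> gwa_elt \<Rightarrow> 'y"
    and p :: "'x \<Rightarrow> 'y"
  assumes "poly_automorphism \<sigma>"
    and "completed_projective_tensor_algebra smooth_toeplitz (gwa \<sigma> P) X \<tau>"
    and "completed_projective_tensor_algebra smooth_circle (gwa \<sigma> P) Y \<tau>'"
    and "is_tensor_id smooth_toeplitz (gwa \<sigma> P) X \<tau> Y \<tau>' toeplitz_symbol p"
  shows "two_sided_ideal (Lambda_gwa \<sigma> P X \<tau>) (subobject X (toeplitz_gwa \<sigma> P X \<tau>)) \<and>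
    independent_subspaces X (Lambda_summand \<sigma> P \<tau>) \<and>
    (degree P > 0 \<or> P = 0 \<longrightarrow> Lambda_gwa \<sigma> P X \<tau> = Lambda_algebraic \<sigma> P X \<tau>) \<and>
    (\<forall>u\<in>toeplitz_gwa \<sigma> P X \<tau>. \<exists>!a. loop_identified \<sigma> P Y \<tau>' (p u) a) \<and>
    linearly_split_extension
      (subobject X (Lambda_gwa \<sigma> P X \<tau>)) (subobject X (toeplitz_gwa \<sigma> P X \<tau>)) (gwa \<sigma> P)
      (\<lambda>u. u) (p_bar \<sigma> P Y \<tau>' p)"
proof -
  interpret toeplitz_setup \<sigma> P X \<tau> Y \<tau>' p
    by (intro toeplitz_setup.intro gwa_data.intro toeplitz_setup_axioms.intro assms)
  show ?thesis
    using Lambda_ideal independent Lambda_eq_algebraic pb_unique extension by blast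
qed

end
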